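(* Let $\mu$ be a Borel measure on $\mathbb{R}$ with finite moments whose recurrence coefficients satisfy, for some $a>0$, $b\in\mathbb{R}$ and $0<\beta<1$, $a_n=a+O(n^{-\beta})$ and $b_n=b+O(n^{-\beta})$ as $n\to\infty$. Then for every $f\in C^1_c(\mathbb{R})$, every $x_0\in(b-2a,b+2a)$ and every $0<\alpha<\beta$, for the OPE associated with $\mu$, $$X^{(n)}_{f,\alpha,x_0}-\mathbb{E}X^{(n)}_{f,\alpha,x_0}\to N(0,\sigma_f^2)$$ in distribution as $n\to\infty$, where $\sigma_f^2=\frac{1}{4\pi^2}\iint_{\mathbb{R}^2}\left(\frac{f(x)-f(y)}{x-y}\right)^2{\rm d}x\,{\rm d}y$.
   Context: Recurrence coefficients: for a measure $\mu$ with finite moments and orthonormal polynomials $p_n$, $xp_n(x)=a_{n+1}p_{n+1}(x)+b_{n+1}p_n(x)+a_np_{n-1}(x)$, $a_n\ge0$, $b_n\in\mathbb{R}$, $a_0=0$. The OPE of size $n$ is the probability measure on $\mathbb{R}^n$ proportional to $\prod_{i<j}(x_i-x_j)^2\,{\rm d}\mu(x_1)\cdots{\rm d}\mu(x_n)$, and $X^{(n)}_{f,\alpha,x_0}=\sum_{j=1}^n f(n^\alpha(x_j-x_0))$ with expectation $\mathbb{E}$ under the OPE. *)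

theory Defs
  imports "HOL-Probability.Probability" "HOL-Computational_Algebra.Polynomial"
          "HOL-Library.Landau_Symbols"
begin

definition finite_moments :: "real measure \<Rightarrow> bool" where
  "finite_moments \<mu> \<longleftrightarrow> sets \<mu> = sets borel \<and> (\<forall>k::nat. integrable \<mu> (\<lambda>x. x ^ k))"

definition orthonormal_polys :: "real measure \<Rightarrow> (nat \<Rightarrow> real poly) \<Rightarrow> bool" where
  "orthonormal_polys \<mu> p \<longleftrightarrow>
     (\<forall>n. degree (p n) = n \<and> lead_coeff (p n) > 0) \<and>
     (\<forall>m n. (\<integral>x. poly (p m) x * poly (p n) x \<partial>\<mu>) = (if m = n then 1 else 0))"

(* recurrence coefficients, from  x p_n = a_{n+1} p_{n+1} + b_{n+1} p_n + a_n p_{n-1}, a_0 = 0 *)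
definition rec_a :: "real measure \<Rightarrow> (nat \<Rightarrow> real poly) \<Rightarrow> nat \<Rightarrow> real" where
  "rec_a \<mu> p n = (if n = 0 then 0
      else \<integral>x. x * poly (p (n - 1)) x * poly (p n) x \<partial>\<mu>)"

definition rec_b :: "real measure \<Rightarrow> (nat \<Rightarrow> real poly) \<Rightarrow> nat \<Rightarrow> real" where
  "rec_b \<mu> p n = (\<integral>x. x * (poly (p (n - 1)) x)\<^sup>2 \<partial>\<mu>)"

definition vandermonde :: "nat \<Rightarrow> (nat \<Rightarrow> real) \<Rightarrow> real" where
  "vandermonde n x = (\<Prod>j<n. \<Prod>i<j. (x i - x j))"

definition OPE :: "real measure \<Rightarrow> nat \<Rightarrow> (nat \<Rightarrow> real) measure" where
  "OPE \<mu> n =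
     (let Z = (\<integral>x. (vandermonde n x)\<^sup>2 \<partial>(PiM {..<n} (\<lambda>_. \<mu>)))
      in density (PiM {..<n} (\<lambda>_. \<mu>)) (\<lambda>x. ennreal ((vandermonde n x)\<^sup>2 / Z)))"

definition lin_stat :: "(real \<Rightarrow> real) \<Rightarrow> real \<Rightarrow> real \<Rightarrow> nat \<Rightarrow> (nat \<Rightarrow> real) \<Rightarrow> real" where
  "lin_stat f \<alpha> x0 n x = (\<Sum>j<n. f (real n powr \<alpha> * (x j - x0)))"

definition gaussian :: "real \<Rightarrow> real measure" where
  "gaussian v = (if v = 0 then return borel 0 else density lborel (normal_density 0 (sqrt v)))"

definition sigma_sq :: "(real \<Rightarrow> real) \<Rightarrow> real" where
  "sigma_sq f = 1 / (4 * pi\<^sup>2) *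
     (\<integral>x. (\<integral>y. ((f x - f y) / (x - y))\<^sup>2 \<partial>lborel) \<partial>lborel)"

end

theory Submission
  imports Defs "HOL-Complex_Analysis.Complex_Analysis" "Jordan_Normal_Form.Determinant"
    "HOL-Probability.Sinc_Integral" "HOL-Real_Asymp.Real_Asymp"
begin

text \<open>
  For statistics of the form \<open>\<phi>(x) = 2 \<Sum>\<^sub>r Im (Ln (x - w\<^sub>r) - Ln (x - z\<^sub>r))\<close> with poles in the upper half plane,
  \<open>exp (i \<Sum>\<^sub>j \<phi>(x\<^sub>j))\<close> is a product of rational functions of the particles, and its expectation is a ratio of
  finite determinants built from \<open>p\<^sub>n\<close>, the functions \<open>Q\<^sub>n(z) = \<integral> p\<^sub>n(x) / (z - x) d\<mu>(x)\<close> of the second kind and the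
  Cauchy kernel. At \<open>z = x\<^sub>0 + \<omega> n\<^bsup>-\<alpha>\<^esup>\<close>, \<open>\<alpha> < \<beta>\<close>, both \<open>p\<^sub>n / p\<^sub>n\<^sub>-\<^sub>1\<close> and \<open>Q\<^sub>n / Q\<^sub>n\<^sub>-\<^sub>1\<close> solve a slowly perturbed
  constant-coefficient recurrence whose growing and decaying solutions separate by a factor
  \<open>1 + c n\<^bsup>-\<alpha>\<^esup>\<close> per step; this beats the \<open>O(n\<^bsup>-\<beta>\<^esup>)\<close> error, so the ratios converge to the two roots \<open>\<tau>\<close>, \<open>cnj \<tau>\<close> of the limiting
  recurrence. Then the determinants collapse to Cauchy determinants, and the characteristic function of the centred statistic
  converges to an explicit product over pairs of poles.

  The variance of any linear statistic is bounded, uniformly in \<open>n\<close>, by the square of the Lipschitz norm of the test function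
  with respect to \<open>|x - y| / (sqrt (1 + x\<^sup>2) sqrt (1 + y\<^sup>2))\<close>. A \<open>C\<^sup>1\<close> function \<open>f\<close> of compact support is approximated in
  this norm by statistics \<open>\<phi>\<close> as above: smoothen \<open>f\<close> with a Poisson kernel, discretise it, and replace the poles of
  the resulting sum by short dipoles \<open>(z\<^sub>r, w\<^sub>r)\<close>. In this limit the product over pairs becomes
  \<open>exp (- \<sigma>\<^sub>f\<^sup>2 / 2)\<close>, and Levy's continuity theorem concludes.
\<close>

subsection \<open>Orthonormal polynomials and functions of the second kind\<close>

hide_const (open) Module.smult

text \<open>Only ratios of consecutive \<open>P\<close> and \<open>Q\<close> are under control; the
  size and phase of \<open>P (n - 1)\<close> itself at a mesoscopic point are not. Such values
  factor out of the determinants, and what is left of them is a product of quotients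
  \<open>X / cnj X\<close>. The mean of the statistic produces the same phase through
  \<open>log_trace\<close>, so it is the centring that makes a limit exist.

  The exponential of a statistic is rational only if the logarithms enter with integer weights, so a
  real amplitude cannot be a coefficient. It is encoded as the displacement \<open>w r - z r\<close>
  of a zero from a pole: of the order of \<open>1 / h\<close> dipoles of length \<open>O(h)\<close>,
  whose pairs each contribute a factor \<open>1 + O(h^2)\<close>.

  The weight in the Lipschitz norm factorises in \<open>x\<close> and \<open>y\<close>. Hence the
  squared Christoffel-Darboux kernel splits into two integrals against a Poisson kernel at height
  \<open>n powr -\<alpha>\<close>, which the ratio asymptotics evaluate, and the double integral for
  the limiting variance converges absolutely.\<close>

definition cpoly :: "real poly \<Rightarrow> complex \<Rightarrow> complex" where
  "cpoly q z = poly (map_poly complex_of_real q) z"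

lemma cpoly_add: "cpoly (q + r) z = cpoly q z + cpoly r z"
proof -
  have "map_poly complex_of_real (q + r) = map_poly complex_of_real q + map_poly complex_of_real r"
    by (intro poly_eqI) (simp add: coeff_map_poly)
  then show ?thesis by (simp add: cpoly_def)
qed

lemma cpoly_smult: "cpoly (smult c q) z = of_real c * cpoly q z"
proof -
  have "map_poly complex_of_real (smult c q) = smult (of_real c) (map_poly complex_of_real q)"
    by (intro poly_eqI) (simp add: coeff_map_poly)
  then show ?thesis by (simp add: cpoly_def)
qed

lemma cpoly_pCons: "cpoly (pCons c q) z = of_real c + z * cpoly q z"
  by (simp add: cpoly_def map_poly_pCons)

lemma cpoly_0 [simp]: "cpoly 0 z = 0"
  by (simp add: cpoly_def)

lemma cpoly_of_real: "cpoly q (of_real x) = of_real (poly q x)"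
  by (induction q) (simp_all add: cpoly_pCons)

lemma cpoly_cnj: "cpoly q (cnj z) = cnj (cpoly q z)"
  by (induction q) (simp_all add: cpoly_pCons)

lemma holomorphic_cpoly [holomorphic_intros]: "cpoly q holomorphic_on S"
  unfolding cpoly_def by (intro holomorphic_intros)

locale orthonormal_system =
  fixes \<mu> :: "real measure" and p :: "nat \<Rightarrow> real poly"
  assumes fm: "finite_moments \<mu>" and op: "orthonormal_polys \<mu> p"
begin

abbreviation "ra \<equiv> rec_a \<mu> p"
abbreviation "rb \<equiv> rec_b \<mu> p"

lemma sets_mu [measurable_cong, simp]: "sets \<mu> = sets borel"
  using fm by (simp add: finite_moments_def)

lemma space_mu [simp]: "space \<mu> = UNIV"
  using sets_eq_imp_space_eq[OF sets_mu] by simp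

lemma finite_measure_mu: "finite_measure \<mu>"
proof -
  have "integrable \<mu> (\<lambda>x. x ^ 0)" using fm unfolding finite_moments_def by blast
  then have "integrable \<mu> (\<lambda>x. 1::real)" by simp
  from has_bochner_integral_integrable[OF this]
  have "emeasure \<mu> (space \<mu>) < \<infinity>"
    using integrableD(2)[OF \<open>integrable \<mu> (\<lambda>x. 1::real)\<close>] by (simp add: less_top)
  then show ?thesis by (intro finite_measureI) auto
qed

sublocale finite_measure \<mu> by (rule finite_measure_mu)

lemma degree_p [simp]: "degree (p n) = n"
  and lead_p: "coeff (p n) n > 0"
  using op unfolding orthonormal_polys_def by (auto, metis)

lemma orthonormal: "(\<integral>x. poly (p m) x * poly (p n) x \<partial>\<mu>) = (if m = n then 1 else 0)"
  using op unfolding orthonormal_polys_def by auto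

lemma integrable_poly: "integrable \<mu> (poly q)"
proof -
  have "poly q = (\<lambda>x. \<Sum>i\<le>degree q. coeff q i * x ^ i)"
    by (rule ext) (simp add: poly_altdef)
  moreover have "integrable \<mu> (\<lambda>x. \<Sum>i\<le>degree q. coeff q i * x ^ i)"
    using fm unfolding finite_moments_def by (intro Bochner_Integration.integrable_sum integrable_mult_right) auto
  ultimately show ?thesis by simp
qed

lemma integrable_poly_mult [simp]: "integrable \<mu> (\<lambda>x. poly q x * poly r x)"
  using integrable_poly[of "q * r"] by (simp add: poly_mult[abs_def])

lemma integrable_bounded_poly:
  fixes f :: "real \<Rightarrow> 'b::{banach, second_countable_topology, real_normed_algebra_1}"
  assumes [measurable]: "f \<in> borel_measurable borel" and "\<And>x. norm (f x) \<le> C"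
  shows "integrable \<mu> (\<lambda>x. f x * of_real (poly q x))"
proof (rule Bochner_Integration.integrable_bound)
  show "integrable \<mu> (\<lambda>x. C * poly q x)" by (intro integrable_mult_right integrable_poly)
  have [measurable]: "poly q \<in> borel_measurable borel"
    by (intro borel_measurable_continuous_onI continuous_intros)
  show "(\<lambda>x. f x * of_real (poly q x)) \<in> borel_measurable \<mu>" by measurable
  show "AE x in \<mu>. norm (f x * of_real (poly q x)) \<le> norm (C * poly q x)"
  proof (intro AE_I2)
    fix x
    have "norm (f x) \<le> \<bar>C\<bar>" using assms(2)[of x] by linarith
    then have "norm (f x) * \<bar>poly q x\<bar> \<le> \<bar>C\<bar> * \<bar>poly q x\<bar>" by (intro mult_right_mono) auto
    then show "norm (f x * of_real (poly q x)) \<le> norm (C * poly q x)"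
      using norm_mult_ineq[of "f x" "of_real (poly q x)"] by (simp add: abs_mult)
  qed
qed

section \<open>Expansion in orthonormal polynomials and the three-term recurrence\<close>

lemma expansion_exists: "degree q \<le> n \<Longrightarrow> \<exists>c. q = (\<Sum>k\<le>n. smult (c k) (p k))"
proof (induction n arbitrary: q)
  case 0
  obtain u where u: "q = [:u:]" using 0 degree_0_id[of q] by (metis le_zero_eq)
  obtain v where v: "p 0 = [:v:]" using degree_p[of 0] degree_0_id[of "p 0"] by metis
  have "v > 0" using lead_p[of 0] v by simp
  then have "q = smult (u / v) (p 0)" by (simp add: u v)
  then show ?case by (intro exI[of _ "\<lambda>_. u / v"]) simp
next
  case (Suc n)
  define d where "d = coeff q (Suc n) / coeff (p (Suc n)) (Suc n)"
  have "degree (q - smult d (p (Suc n))) \<le> n"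
  proof (rule degree_le, intro allI impI)
    fix i assume "i > n"
    show "coeff (q - smult d (p (Suc n))) i = 0"
    proof (cases "i = Suc n")
      case True
      then show ?thesis using lead_p[of "Suc n"] by (simp add: d_def)
    next
      case False
      then have "i > Suc n" using \<open>i > n\<close> by simp
      then have "coeff q i = 0" "coeff (p (Suc n)) i = 0"
        using Suc.prems by (auto intro!: coeff_eq_0)
      then show ?thesis by simp
    qed
  qed
  from Suc.IH[OF this] obtain c where c: "q - smult d (p (Suc n)) = (\<Sum>k\<le>n. smult (c k) (p k))" by auto
  have "q = (\<Sum>k\<le>Suc n. smult (if k = Suc n then d else c k) (p k))"
  proof -
    have "(\<Sum>k\<le>n. smult (if k = Suc n then d else c k) (p k)) = (\<Sum>k\<le>n. smult (c k) (p k))"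
      by (intro sum.cong) auto
    then show ?thesis using c by (simp add: algebra_simps)
  qed
  then show ?case by (intro exI)
qed

lemma expansion:
  assumes "degree q \<le> n"
  shows "q = (\<Sum>k\<le>n. smult (\<integral>x. poly q x * poly (p k) x \<partial>\<mu>) (p k))"
proof -
  obtain c where c: "q = (\<Sum>k\<le>n. smult (c k) (p k))" using expansion_exists[OF assms] by auto
  have "(\<integral>x. poly q x * poly (p k) x \<partial>\<mu>) = c k" if "k \<le> n" for k
  proof -
    have "(\<integral>x. poly q x * poly (p k) x \<partial>\<mu>) = (\<integral>x. (\<Sum>j\<le>n. c j * (poly (p j) x * poly (p k) x)) \<partial>\<mu>)"
      by (subst c) (simp add: poly_sum sum_distrib_right mult.assoc)
    also have "\<dots> = (\<Sum>j\<le>n. c j * (\<integral>x. poly (p j) x * poly (p k) x \<partial>\<mu>))"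
      by (subst Bochner_Integration.integral_sum) auto
    also have "\<dots> = (\<Sum>j\<le>n. if j = k then c k else 0)"
      by (intro sum.cong) (auto simp: orthonormal)
    also have "\<dots> = c k" using that by simp
    finally show ?thesis .
  qed
  then show ?thesis using c by (metis (no_types, lifting) atMost_iff sum.cong)
qed

lemma orthogonal_lower_degree:
  assumes "degree q < n"
  shows "(\<integral>x. poly q x * poly (p n) x \<partial>\<mu>) = 0"
proof -
  define c where "c = (\<lambda>k. \<integral>x. poly q x * poly (p k) x \<partial>\<mu>)"
  have q: "q = (\<Sum>k\<le>degree q. smult (c k) (p k))" using expansion[of q "degree q"] by (simp add: c_def)
  have "(\<integral>x. poly q x * poly (p n) x \<partial>\<mu>) = (\<integral>x. (\<Sum>j\<le>degree q. c j * (poly (p j) x * poly (p n) x)) \<partial>\<mu>)"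
    by (subst q) (simp add: poly_sum sum_distrib_right mult.assoc)
  also have "\<dots> = (\<Sum>j\<le>degree q. c j * (\<integral>x. poly (p j) x * poly (p n) x \<partial>\<mu>))"
    by (subst Bochner_Integration.integral_sum) auto
  also have "\<dots> = 0" using assms by (intro sum.neutral) (auto simp: orthonormal)
  finally show ?thesis .
qed

text \<open>Natural subtraction would turn the predecessor of \<open>p 0\<close> into
  \<open>p 0\<close> again; here it is the zero polynomial.\<close>

definition pv :: "nat \<Rightarrow> real poly" where "pv n = (if n = 0 then 0 else p (n - 1))"

text \<open>Multiplication by \<open>x\<close> is symmetric, so the coefficient of
  \<open>x * p n\<close> along \<open>p k\<close> is also that of \<open>x * p k\<close> along
  \<open>p n\<close>. It vanishes by degree when \<open>Suc k < n\<close>, and the three that remain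
  are recurrence coefficients by definition.\<close>

lemma recurrence_poly:
  "pCons 0 (p n) = smult (ra (Suc n)) (p (Suc n)) + smult (rb (Suc n)) (p n) + smult (ra n) (pv n)"
proof -
  define c where "c = (\<lambda>k. \<integral>x. poly (pCons 0 (p n)) x * poly (p k) x \<partial>\<mu>)"
  have nz: "p n \<noteq> 0" using lead_p[of n] by auto
  have e: "pCons 0 (p n) = (\<Sum>k\<le>Suc n. smult (c k) (p k))"
    unfolding c_def by (rule expansion) (simp add: degree_pCons_le nz)
  have c1: "c (Suc n) = ra (Suc n)" by (simp add: c_def rec_a_def)
  have c2: "c n = rb (Suc n)" by (simp add: c_def rec_b_def power2_eq_square mult.assoc)
  have c3: "c k = 0" if "Suc k < n" for k
  proof -
    have "c k = (\<integral>x. poly (pCons 0 (p k)) x * poly (p n) x \<partial>\<mu>)"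
      unfolding c_def by (intro Bochner_Integration.integral_cong) (auto simp: algebra_simps)
    also have "\<dots> = 0"
      using degree_pCons_le[of 0 "p k"] that by (intro orthogonal_lower_degree) auto
    finally show ?thesis .
  qed
  show ?thesis
  proof (cases n)
    case 0
    then show ?thesis using e c1 c2 by (simp add: pv_def)
  next
    case (Suc m)
    have c4: "c m = ra n"
      unfolding c_def rec_a_def Suc by (simp, intro Bochner_Integration.integral_cong) (auto simp: algebra_simps)
    have "(\<Sum>k\<le>Suc n. smult (c k) (p k)) = (\<Sum>k<m. smult (c k) (p k)) + smult (c m) (p m) + smult (c n) (p n) + smult (c (Suc n)) (p (Suc n))"
      unfolding Suc by (simp add: lessThan_Suc_atMost[symmetric])
    also have "(\<Sum>k<m. smult (c k) (p k)) = 0" using c3 Suc by (intro sum.neutral) auto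
    finally show ?thesis using e c1 c2 c4 Suc by (simp add: pv_def add_ac)
  qed
qed

text \<open>Comparison of leading coefficients in the recurrence makes \<open>ra (Suc m)\<close> a
  quotient of two positive numbers.\<close>

lemma ra_pos: "n > 0 \<Longrightarrow> ra n > 0"
proof -
  assume "n > 0"
  then obtain m where n: "n = Suc m" by (cases n) auto
  have "coeff (pCons 0 (p m)) (Suc m) = ra (Suc m) * coeff (p (Suc m)) (Suc m)"
    by (subst recurrence_poly) (auto simp: pv_def coeff_eq_0)
  then have "coeff (p m) m = ra (Suc m) * coeff (p (Suc m)) (Suc m)" by simp
  then show ?thesis using lead_p[of m] lead_p[of "Suc m"] n by (metis zero_less_mult_pos2)
qed

lemma ra_0 [simp]: "ra 0 = 0" by (simp add: rec_a_def)

section \<open>Polynomials and functions of the second kind off the real line\<close>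

definition P :: "nat \<Rightarrow> complex \<Rightarrow> complex" where "P n = cpoly (p n)"

definition Q :: "nat \<Rightarrow> complex \<Rightarrow> complex" where
  "Q n z = (\<integral>x. (1 / (z - of_real x)) * of_real (poly (p n) x) \<partial>\<mu>)"

lemma P_cnj: "P n (cnj z) = cnj (P n z)" by (simp add: P_def cpoly_cnj)

lemma P_0: "P 0 z = of_real (coeff (p 0) 0)"
proof -
  obtain v where "p 0 = [:v:]" using degree_p[of 0] degree_0_id[of "p 0"] by metis
  then show ?thesis by (simp add: P_def cpoly_pCons)
qed

text \<open>At \<open>n = 0\<close> the term \<open>P (n - 1)\<close> is really \<open>P 0\<close>,
  and \<open>ra 0 = 0\<close> removes it. The same convention is in force in
  \<open>real_recurrence\<close> and \<open>Q_Suc\<close>.\<close>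

lemma P_Suc: "of_real (ra (Suc n)) * P (Suc n) z = (z - of_real (rb (Suc n))) * P n z - of_real (ra n) * P (n - 1) z"
proof -
  have "cpoly (pCons 0 (p n)) z = cpoly (smult (ra (Suc n)) (p (Suc n)) + smult (rb (Suc n)) (p n) + smult (ra n) (pv n)) z"
    by (simp add: recurrence_poly)
  then show ?thesis
    by (cases n) (simp_all add: cpoly_pCons cpoly_add cpoly_smult P_def pv_def algebra_simps)
qed

lemma real_recurrence:
  "x * poly (p n) x = ra (Suc n) * poly (p (Suc n)) x + rb (Suc n) * poly (p n) x + ra n * poly (p (n - 1)) x"
proof -
  have "poly (pCons 0 (p n)) x = poly (smult (ra (Suc n)) (p (Suc n)) + smult (rb (Suc n)) (p n) + smult (ra n) (pv n)) x"
    by (simp add: recurrence_poly)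
  then show ?thesis by (cases n) (simp_all add: pv_def)
qed

lemma resolvent_bound: "Im z \<noteq> 0 \<Longrightarrow> norm (1 / (z - complex_of_real x)) \<le> 1 / \<bar>Im z\<bar>"
  using abs_Im_le_cmod[of "z - of_real x"] by (auto simp: norm_divide intro!: divide_left_mono mult_pos_pos)

lemma integrable_resolvent:
  assumes "Im z \<noteq> 0" shows "integrable \<mu> (\<lambda>x. (1 / (z - complex_of_real x)) * of_real (poly q x))"
  by (rule integrable_bounded_poly[where C = "1 / \<bar>Im z\<bar>"]) (use resolvent_bound[OF assms] in auto)

lemma Q_cnj: assumes z: "Im z \<noteq> 0" shows "Q n (cnj z) = cnj (Q n z)"
proof -
  have "cnj (Q n z) = (\<integral>x. cnj ((1 / (z - of_real x)) * of_real (poly (p n) x)) \<partial>\<mu>)"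
    unfolding Q_def by (rule integral_bounded_linear[OF bounded_linear_cnj integrable_resolvent[OF z], symmetric])
  also have "\<dots> = Q n (cnj z)" unfolding Q_def by (intro Bochner_Integration.integral_cong) auto
  finally show ?thesis by simp
qed

lemma p0_const: "poly (p 0) x = coeff (p 0) 0"
proof -
  obtain v where "p 0 = [:v:]" using degree_p[of 0] degree_0_id[of "p 0"] by metis
  then show ?thesis by simp
qed

lemma integral_p: "(\<integral>x. poly (p n) x \<partial>\<mu>) = (if n = 0 then 1 / coeff (p 0) 0 else 0)"
proof -
  have c: "coeff (p 0) 0 > 0" using lead_p[of 0] by simp
  have "(\<integral>x. poly (p 0) x * poly (p n) x \<partial>\<mu>) = coeff (p 0) 0 * (\<integral>x. poly (p n) x \<partial>\<mu>)"
    by (simp add: p0_const)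
  then show ?thesis using orthonormal[of 0 n] c by (auto simp: field_simps)
qed

text \<open>The matrix entries of the resolvent of multiplication by \<open>x\<close> in the basis
  \<open>p\<close>.\<close>

definition G :: "nat \<Rightarrow> nat \<Rightarrow> complex \<Rightarrow> complex" where
  "G j k z = (\<integral>x. (1 / (z - of_real x)) * of_real (poly (p j * p k) x) \<partial>\<mu>)"

lemma integral_linear_combination4:
  fixes f1 :: "real \<Rightarrow> complex"
  assumes "integrable M f1" "integrable M f2" "integrable M f3" "integrable M f4"
  shows "(\<integral>x. f1 x + c2 * f2 x + c3 * f3 x + c4 * f4 x \<partial>M) =
    integral\<^sup>L M f1 + c2 * integral\<^sup>L M f2 + c3 * integral\<^sup>L M f3 + c4 * integral\<^sup>L M f4"
  using assms by simp

text \<open>Insert \<open>z / (z - x) = 1 + x / (z - x)\<close> and the recurrence for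
  \<open>x * p n\<close>. The free factor \<open>q\<close> makes the identity serve for
  \<open>Q\<close> (with \<open>q = 1\<close>) and for \<open>G\<close> (with
  \<open>q = p k\<close>).\<close>

lemma resolvent_recurrence:
  assumes z: "Im z \<noteq> 0"
  shows "z * (\<integral>x. (1 / (z - of_real x)) * of_real (poly (p n * q) x) \<partial>\<mu>) =
    of_real (\<integral>x. poly (p n * q) x \<partial>\<mu>) +
    of_real (ra (Suc n)) * (\<integral>x. (1 / (z - of_real x)) * of_real (poly (p (Suc n) * q) x) \<partial>\<mu>) +
    of_real (rb (Suc n)) * (\<integral>x. (1 / (z - of_real x)) * of_real (poly (p n * q) x) \<partial>\<mu>) +
    of_real (ra n) * (\<integral>x. (1 / (z - of_real x)) * of_real (poly (p (n - 1) * q) x) \<partial>\<mu>)" (is "?L = ?R")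
proof -
  let ?r = "\<lambda>x::real. 1 / (z - complex_of_real x)"
  note I = integrable_resolvent[OF z]
  have "?L = (\<integral>x. z * (?r x * of_real (poly (p n * q) x)) \<partial>\<mu>)" by (rule integral_mult_right_zero[symmetric])
  also have "\<dots> = (\<integral>x. of_real (poly (p n * q) x) + of_real (ra (Suc n)) * (?r x * of_real (poly (p (Suc n) * q) x))
     + of_real (rb (Suc n)) * (?r x * of_real (poly (p n * q) x))
     + of_real (ra n) * (?r x * of_real (poly (p (n - 1) * q) x)) \<partial>\<mu>)"
  proof (intro Bochner_Integration.integral_cong refl)
    fix x
    have nz: "z - complex_of_real x \<noteq> 0" using z by (auto simp: complex_eq_iff)
    have "z * ?r x = 1 + of_real x * ?r x" using nz by (simp add: field_simps)
    then have "z * (?r x * of_real (poly (p n * q) x)) = (1 + of_real x * ?r x) * of_real (poly (p n * q) x)"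
      by (metis mult.assoc)
    also have "\<dots> = of_real (poly (p n * q) x) + ?r x * of_real ((x * poly (p n) x) * poly q x)"
      unfolding poly_mult of_real_mult by (simp only: algebra_simps mult_1_left)
    finally have "z * (?r x * of_real (poly (p n * q) x)) = of_real (poly (p n * q) x) + ?r x * of_real ((x * poly (p n) x) * poly q x)" .
    also have "?r x * of_real ((x * poly (p n) x) * poly q x) = of_real (ra (Suc n)) * (?r x * of_real (poly (p (Suc n) * q) x))
     + of_real (rb (Suc n)) * (?r x * of_real (poly (p n * q) x))
     + of_real (ra n) * (?r x * of_real (poly (p (n - 1) * q) x))"
      by (subst real_recurrence) (simp add: algebra_simps)
    finally show "z * (?r x * of_real (poly (p n * q) x)) = of_real (poly (p n * q) x) + of_real (ra (Suc n)) * (?r x * of_real (poly (p (Suc n) * q) x))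
     + of_real (rb (Suc n)) * (?r x * of_real (poly (p n * q) x))
     + of_real (ra n) * (?r x * of_real (poly (p (n - 1) * q) x))" by (simp add: algebra_simps)
  qed
  also have "\<dots> = ?R"
    by (subst integral_linear_combination4[OF _ I I I]) (auto simp: integrable_poly simp del: poly_mult)
  finally show ?thesis .
qed

lemma Q_Suc:
  assumes z: "Im z \<noteq> 0"
  shows "of_real (ra (Suc n)) * Q (Suc n) z = (z - of_real (rb (Suc n))) * Q n z - of_real (ra n) * Q (n - 1) z
     - of_real (if n = 0 then 1 / coeff (p 0) 0 else 0)"
  using resolvent_recurrence[OF z, of n 1] integral_p[of n] unfolding Q_def by (auto simp: algebra_simps)

text \<open>As functions of \<open>j\<close> both sides solve the same recurrence with the same
  start: the inhomogeneous term in the step from \<open>i\<close> is the integral of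
  \<open>p i * p k\<close>, which is zero as long as \<open>i < k\<close>.\<close>

lemma G_eq_PQ:
  assumes z: "Im z \<noteq> 0" and "j \<le> k"
  shows "G j k z = P j z * Q k z"
  using assms(2)
proof (induction j rule: less_induct)
  case (less j)
  show ?case
  proof (cases j)
    case 0
    have "G 0 k z = (\<integral>x. of_real (coeff (p 0) 0) * ((1 / (z - of_real x)) * of_real (poly (p k) x)) \<partial>\<mu>)"
      unfolding G_def by (intro Bochner_Integration.integral_cong) (auto simp: p0_const)
    also have "\<dots> = of_real (coeff (p 0) 0) * Q k z" unfolding Q_def by (rule integral_mult_right_zero)
    finally show ?thesis using 0 by (simp add: P_0)
  next
    case (Suc i)
    have o: "(\<integral>x. poly (p i * p k) x \<partial>\<mu>) = 0" using less.prems Suc by (simp add: orthonormal)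
    have "of_real (ra (Suc i)) * G (Suc i) k z = (z - of_real (rb (Suc i))) * G i k z - of_real (ra i) * G (i - 1) k z"
      using resolvent_recurrence[OF z, of i "p k"] o unfolding G_def by (simp add: algebra_simps)
    also have "G i k z = P i z * Q k z" using less Suc by auto
    also have "G (i - 1) k z = P (i - 1) z * Q k z" using less Suc by auto
    also have "(z - of_real (rb (Suc i))) * (P i z * Q k z) - of_real (ra i) * (P (i - 1) z * Q k z) = of_real (ra (Suc i)) * (P (Suc i) z * Q k z)"
      using P_Suc[of i z] by (metis (no_types, lifting) left_diff_distrib mult.assoc)
    finally show ?thesis using ra_pos[of "Suc i"] Suc by simp
  qed
qed

section \<open>Casoratians and Christoffel-Darboux formulas\<close>

definition FF :: "nat \<Rightarrow> complex \<Rightarrow> complex \<Rightarrow> complex" where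
  "FF n w z = of_real (ra n) * (P n w * Q (n - 1) z - P (n - 1) w * Q n z)"

text \<open>\<open>FF n w z\<close> is the Casoratian of \<open>P\<close> at \<open>w\<close> and
  \<open>Q\<close> at \<open>z\<close>; it changes by \<open>(w - z) * (P n w * Q n z)\<close> from
  \<open>n\<close> to \<open>Suc n\<close>, so the sum telescopes. The constant 1 comes from the
  source term \<open>1 / coeff (p 0) 0\<close> in the recurrence for \<open>Q\<close> at index 0,
  multiplied by \<open>P 0\<close>.\<close>

lemma mixed_Christoffel_Darboux:
  assumes z: "Im z \<noteq> 0" and "n > 0"
  shows "(z - w) * (\<Sum>k<n. P k w * Q k z) = 1 - FF n w z"
  using \<open>n > 0\<close>
proof (induction n rule: nat_induct_non_zero)
  case 1
  have c: "coeff (p 0) 0 \<noteq> 0" using lead_p[of 0] by simp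
  have "FF 1 w z = (of_real (ra 1) * P 1 w) * Q 0 z - P 0 w * (of_real (ra 1) * Q 1 z)"
    by (simp add: FF_def algebra_simps)
  also have "\<dots> = ((w - of_real (rb 1)) * P 0 w) * Q 0 z - P 0 w * ((z - of_real (rb 1)) * Q 0 z - of_real (1 / coeff (p 0) 0))"
    using P_Suc[of 0 w] Q_Suc[OF z, of 0] by simp
  also have "\<dots> = (w - z) * (P 0 w * Q 0 z) + 1" using c by (simp add: P_0 algebra_simps)
  finally show ?case by (simp add: algebra_simps)
next
  case (Suc n)
  have "FF (Suc n) w z = (of_real (ra (Suc n)) * P (Suc n) w) * Q n z - P n w * (of_real (ra (Suc n)) * Q (Suc n) z)"
    by (simp add: FF_def algebra_simps)
  also have "\<dots> = (w - z) * (P n w * Q n z) + FF n w z"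
    using Suc(1) by (subst P_Suc, subst Q_Suc[OF z]) (simp add: FF_def algebra_simps)
  finally have "FF (Suc n) w z = (w - z) * (P n w * Q n z) + (1 - (z - w) * (\<Sum>k<n. P k w * Q k z))"
    using Suc by simp
  then show ?case by (simp add: algebra_simps)
qed

lemma FF_diag: "Im z \<noteq> 0 \<Longrightarrow> n > 0 \<Longrightarrow> FF n z z = 1"
  using mixed_Christoffel_Darboux[of z n z] by simp

text \<open>Differentiate the mixed formula in \<open>w\<close> at \<open>w = z\<close>: the factor
  \<open>z - w\<close> removes the derivative of the sum.\<close>

lemma kernel_diag_derivative:
  assumes z: "Im z \<noteq> 0" and "n > 0"
  shows "(\<Sum>k<n. P k z * Q k z) = of_real (ra n) * (deriv (P n) z * Q (n - 1) z - deriv (P (n - 1)) z * Q n z)"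
proof -
  have d: "(P k has_field_derivative deriv (P k) z) (at z)" for k
    unfolding P_def by (rule holomorphic_derivI[OF holomorphic_cpoly open_UNIV]) auto
  have "((\<lambda>w. (z - w) * (\<Sum>k<n. P k w * Q k z)) has_field_derivative
     (0 - 1) * (\<Sum>k<n. P k z * Q k z) + (\<Sum>k<n. deriv (P k) z * Q k z) * (z - z)) (at z)"
    by (intro DERIV_mult DERIV_sum DERIV_cmult_right d DERIV_diff DERIV_const DERIV_ident)
  moreover have "((\<lambda>w. 1 - FF n w z) has_field_derivative
     0 - of_real (ra n) * (deriv (P n) z * Q (n - 1) z - deriv (P (n - 1)) z * Q n z)) (at z)"
    unfolding FF_def by (intro DERIV_mult DERIV_cmult_right DERIV_cmult d DERIV_diff DERIV_const)
  moreover have "(\<lambda>w. (z - w) * (\<Sum>k<n. P k w * Q k z)) = (\<lambda>w. 1 - FF n w z)"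
    using mixed_Christoffel_Darboux[OF assms] by auto
  ultimately show ?thesis using DERIV_unique by fastforce
qed

lemma Christoffel_Darboux:
  assumes "n > 0"
  shows "(x - y) * (\<Sum>k<n. poly (p k) x * poly (p k) y) =
    ra n * (poly (p n) x * poly (p (n - 1)) y - poly (p (n - 1)) x * poly (p n) y)"
proof -
  have st: "ra (Suc n) * (poly (p (Suc n)) x * poly (p n) y - poly (p n) x * poly (p (Suc n)) y) =
     (x - y) * (poly (p n) x * poly (p n) y) + ra n * (poly (p n) x * poly (p (n - 1)) y - poly (p (n - 1)) x * poly (p n) y)" for n
  proof -
    have "ra (Suc n) * poly (p (Suc n)) x = x * poly (p n) x - rb (Suc n) * poly (p n) x - ra n * poly (p (n - 1)) x"
      "ra (Suc n) * poly (p (Suc n)) y = y * poly (p n) y - rb (Suc n) * poly (p n) y - ra n * poly (p (n - 1)) y"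
      using real_recurrence[of x n] real_recurrence[of y n] by auto
    moreover have "ra (Suc n) * (poly (p (Suc n)) x * poly (p n) y - poly (p n) x * poly (p (Suc n)) y) =
       (ra (Suc n) * poly (p (Suc n)) x) * poly (p n) y - poly (p n) x * (ra (Suc n) * poly (p (Suc n)) y)"
      by (simp add: algebra_simps)
    ultimately show ?thesis by (simp only:) (simp add: algebra_simps)
  qed
  show ?thesis using assms
  proof (induction n rule: nat_induct_non_zero)
    case 1
    show ?case using st[of 0] by simp
  next
    case (Suc n)
    then show ?case using st[of n] by (simp add: distrib_left)
  qed
qed

text \<open>Christoffel-Darboux at \<open>z\<close> and its conjugate. It places
  \<open>P n z / P (n - 1) z\<close> in the same half-plane as \<open>z\<close>, which later
  supplies the sign condition on the initial values in \<open>ratio_asymptotics\<close>.\<close>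

lemma Im_P_ratio:
  "ra n * Im (P n z * cnj (P (n - 1) z)) = Im z * (\<Sum>k<n. (cmod (P k z))\<^sup>2)"
proof (induction n)
  case 0 show ?case by simp
next
  case (Suc n)
  have "of_real (ra (Suc n)) * P (Suc n) z * cnj (P n z) = (z - of_real (rb (Suc n))) * (P n z * cnj (P n z)) - of_real (ra n) * (P (n - 1) z * cnj (P n z))"
    by (subst P_Suc) (simp add: algebra_simps)
  then have "Im (of_real (ra (Suc n)) * (P (Suc n) z * cnj (P n z))) = Im ((z - of_real (rb (Suc n))) * of_real ((cmod (P n z))\<^sup>2) - of_real (ra n) * (P (n - 1) z * cnj (P n z)))"
    by (simp only: complex_norm_square mult.assoc)
  then have "ra (Suc n) * Im (P (Suc n) z * cnj (P n z)) = Im z * (cmod (P n z))\<^sup>2 - ra n * Im (P (n - 1) z * cnj (P n z))"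
    by simp
  moreover have "Im (P (n - 1) z * cnj (P n z)) = - Im (P n z * cnj (P (n - 1) z))" by simp
  ultimately show ?case using Suc by (simp add: algebra_simps)
qed

text \<open>A zero of \<open>P n\<close> off the real line would annihilate the left side of
  \<open>Im_P_ratio\<close> at index \<open>Suc n\<close>, while the right side contains the nonzero
  constant \<open>P 0\<close>.\<close>

lemma P_nonzero: assumes "Im z \<noteq> 0" shows "P n z \<noteq> 0"
proof
  assume 0: "P n z = 0"
  have "ra (Suc n) * Im (P (Suc n) z * cnj (P n z)) = Im z * (\<Sum>k<Suc n. (cmod (P k z))\<^sup>2)"
    using Im_P_ratio[of "Suc n" z] by simp
  then have "(\<Sum>k<Suc n. (cmod (P k z))\<^sup>2) = 0" using 0 assms by simp
  moreover have "(\<Sum>k<Suc n. (cmod (P k z))\<^sup>2) \<ge> (cmod (P 0 z))\<^sup>2"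
    by (rule member_le_sum) auto
  ultimately show False using lead_p[of 0] by (simp add: P_0)
qed

text \<open>The Fourier coefficients of \<open>g\<close> in \<open>L^2(\<mu>)\<close> are square
  summable. Applied to the resolvent this gives the decay of \<open>Q k z\<close> in
  \<open>k\<close>, without a rate.\<close>

lemma Bessel:
  fixes g :: "real \<Rightarrow> real"
  assumes [measurable]: "g \<in> borel_measurable borel" and b: "\<And>x. \<bar>g x\<bar> \<le> C"
  shows "(\<lambda>k. \<integral>x. g x * poly (p k) x \<partial>\<mu>) \<longlonglongrightarrow> 0"
proof -
  define c where "c = (\<lambda>k. \<integral>x. g x * poly (p k) x \<partial>\<mu>)"
  have I: "integrable \<mu> (\<lambda>x. g x * poly q x)" for q
    using integrable_bounded_poly[of g C q] b by simp
  have Ig: "integrable \<mu> (\<lambda>x. (g x)\<^sup>2)"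
    by (rule integrable_const_bound[where B = "C\<^sup>2"]) (use b in \<open>auto simp: abs_le_square_iff[symmetric] intro!: AE_I2 order_trans[OF b]\<close>)
  have le: "(\<Sum>k<N. (c k)\<^sup>2) \<le> (\<integral>x. (g x)\<^sup>2 \<partial>\<mu>)" for N
  proof -
    define q where "q = (\<Sum>k<N. smult (c k) (p k))"
    have gq: "(\<integral>x. g x * poly q x \<partial>\<mu>) = (\<Sum>k<N. (c k)\<^sup>2)"
    proof -
      have "(\<integral>x. g x * poly q x \<partial>\<mu>) = (\<integral>x. (\<Sum>k<N. c k * (g x * poly (p k) x)) \<partial>\<mu>)"
        by (simp add: q_def poly_sum sum_distrib_left algebra_simps)
      also have "\<dots> = (\<Sum>k<N. c k * c k)"
        by (subst Bochner_Integration.integral_sum) (auto simp: I c_def)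
      finally show ?thesis by (simp add: power2_eq_square)
    qed
    have qq: "(\<integral>x. poly q x * poly q x \<partial>\<mu>) = (\<Sum>k<N. (c k)\<^sup>2)"
    proof -
      have "(\<integral>x. poly q x * poly q x \<partial>\<mu>) = (\<integral>x. (\<Sum>k<N. c k * (poly q x * poly (p k) x)) \<partial>\<mu>)"
        by (subst (2) q_def) (simp add: poly_sum sum_distrib_left algebra_simps)
      also have "\<dots> = (\<Sum>k<N. c k * (\<integral>x. poly q x * poly (p k) x \<partial>\<mu>))"
        by (subst Bochner_Integration.integral_sum) auto
      also have "\<dots> = (\<Sum>k<N. c k * c k)"
      proof (intro sum.cong refl arg_cong2[of _ _ _ _ "(*)"])
        fix k assume k: "k \<in> {..<N}"
        have "(\<integral>x. poly q x * poly (p k) x \<partial>\<mu>) = (\<integral>x. (\<Sum>j<N. c j * (poly (p j) x * poly (p k) x)) \<partial>\<mu>)"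
          unfolding q_def poly_sum poly_smult sum_distrib_right mult.assoc ..
        also have "\<dots> = (\<Sum>j<N. c j * (if j = k then 1 else 0))"
          by (subst Bochner_Integration.integral_sum) (auto simp: orthonormal)
        also have "\<dots> = (\<Sum>j<N. if j = k then c j else 0)" by (intro sum.cong) auto
        also have "\<dots> = c k" using k by simp
        finally show "(\<integral>x. poly q x * poly (p k) x \<partial>\<mu>) = c k" .
      qed
      finally show ?thesis by (simp add: power2_eq_square)
    qed
    have "0 \<le> (\<integral>x. (g x - poly q x)\<^sup>2 \<partial>\<mu>)" by (intro integral_nonneg_AE AE_I2) simp
    also have "\<dots> = (\<integral>x. (g x)\<^sup>2 - 2 * (g x * poly q x) + poly q x * poly q x \<partial>\<mu>)"
      by (intro Bochner_Integration.integral_cong) (auto simp: power2_eq_square algebra_simps)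
    also have "\<dots> = (\<integral>x. (g x)\<^sup>2 \<partial>\<mu>) - 2 * (\<integral>x. g x * poly q x \<partial>\<mu>) + (\<integral>x. poly q x * poly q x \<partial>\<mu>)"
      using Ig I[of q] by simp
    finally show ?thesis using gq qq by simp
  qed
  have "summable (\<lambda>k. (c k)\<^sup>2)"
    by (rule summableI_nonneg_bounded[of _ "\<integral>x. (g x)\<^sup>2 \<partial>\<mu>"]) (use le in auto)
  then have "(\<lambda>k. (c k)\<^sup>2) \<longlonglongrightarrow> 0" by (rule summable_LIMSEQ_zero)
  then have "(\<lambda>k. sqrt ((c k)\<^sup>2)) \<longlonglongrightarrow> sqrt 0" by (intro tendsto_intros)
  then have "(\<lambda>k. \<bar>c k\<bar>) \<longlonglongrightarrow> 0" by simp
  then show ?thesis unfolding c_def by (simp add: tendsto_rabs_zero_iff)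
qed

lemma Q_tendsto_0:
  assumes z: "Im z \<noteq> 0" shows "(\<lambda>k. Q k z) \<longlonglongrightarrow> 0"
proof -
  let ?r = "\<lambda>x::real. 1 / (z - complex_of_real x)"
  have b: "norm (?r x) \<le> 1 / \<bar>Im z\<bar>" for x using resolvent_bound[OF z] .
  have re: "(\<lambda>k. \<integral>x. Re (?r x) * poly (p k) x \<partial>\<mu>) \<longlonglongrightarrow> 0"
    by (rule Bessel[where C = "1 / \<bar>Im z\<bar>"]) (measurable, rule order_trans[OF abs_Re_le_cmod b])
  have im: "(\<lambda>k. \<integral>x. Im (?r x) * poly (p k) x \<partial>\<mu>) \<longlonglongrightarrow> 0"
    by (rule Bessel[where C = "1 / \<bar>Im z\<bar>"]) (measurable, rule order_trans[OF abs_Im_le_cmod b])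
  have e: "Q k z = Complex (\<integral>x. Re (?r x) * poly (p k) x \<partial>\<mu>) (\<integral>x. Im (?r x) * poly (p k) x \<partial>\<mu>)" for k
  proof (rule complex_eqI)
    have *: "Re (?r x * of_real (poly (p k) x)) = Re (?r x) * poly (p k) x" for x
      by (simp only: Re_complex_of_real Im_complex_of_real times_complex.sel mult_zero_right diff_zero)
    show "Re (Q k z) = Re (Complex (\<integral>x. Re (?r x) * poly (p k) x \<partial>\<mu>) (\<integral>x. Im (?r x) * poly (p k) x \<partial>\<mu>))"
      unfolding Q_def using integral_Re[OF integrable_resolvent[OF z, of "p k"]] unfolding * by simp
    have *: "Im (?r x * of_real (poly (p k) x)) = Im (?r x) * poly (p k) x" for x
      by (simp only: Re_complex_of_real Im_complex_of_real times_complex.sel mult_zero_right add_0_left)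
    show "Im (Q k z) = Im (Complex (\<integral>x. Re (?r x) * poly (p k) x \<partial>\<mu>) (\<integral>x. Im (?r x) * poly (p k) x \<partial>\<mu>))"
      unfolding Q_def using integral_Im[OF integrable_resolvent[OF z, of "p k"]] unfolding * by simp
  qed
  have "(\<lambda>k. Complex (\<integral>x. Re (?r x) * poly (p k) x \<partial>\<mu>) (\<integral>x. Im (?r x) * poly (p k) x \<partial>\<mu>)) \<longlonglongrightarrow> Complex 0 0"
    by (intro tendsto_Complex re im)
  then show ?thesis unfolding e by (simp only: zero_complex.code)
qed

text \<open>The counterpart of \<open>Im_P_ratio\<close> for a decaying solution: the start at index
  0 is replaced by a condition at infinity. The sequence \<open>T\<close> increases and tends to 0,
  hence is never positive; boundedness of \<open>ra\<close> enters through \<open>T\<close> tending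
  to 0.\<close>

lemma Im_Q_ratio:
  assumes z: "Im z > 0" and b: "bounded (range ra)" and n: "n > 0"
  shows "Im (Q (n - 1) z * cnj (Q n z)) \<ge> 0"
proof -
  have z': "Im z \<noteq> 0" using z by simp
  define T where "T = (\<lambda>k. ra (Suc k) * Im (Q (Suc k) z * cnj (Q k z)))"
  have step: "T (Suc k) = T k + Im z * (cmod (Q (Suc k) z))\<^sup>2" for k
  proof -
    let ?n = "Suc k"
    have "of_real (ra (Suc ?n)) * Q (Suc ?n) z * cnj (Q ?n z) = (z - of_real (rb (Suc ?n))) * (Q ?n z * cnj (Q ?n z)) - of_real (ra ?n) * (Q k z * cnj (Q ?n z))"
      by (subst Q_Suc[OF z']) (simp add: algebra_simps)
    then have "Im (of_real (ra (Suc ?n)) * (Q (Suc ?n) z * cnj (Q ?n z))) = Im ((z - of_real (rb (Suc ?n))) * of_real ((cmod (Q ?n z))\<^sup>2) - of_real (ra ?n) * (Q k z * cnj (Q ?n z)))"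
      by (simp only: complex_norm_square mult.assoc)
    then have "ra (Suc ?n) * Im (Q (Suc ?n) z * cnj (Q ?n z)) = Im z * (cmod (Q ?n z))\<^sup>2 - ra ?n * Im (Q k z * cnj (Q ?n z))"
      by simp
    moreover have "Im (Q k z * cnj (Q ?n z)) = - Im (Q ?n z * cnj (Q k z))" by simp
    ultimately show ?thesis by (simp add: T_def algebra_simps)
  qed
  have "incseq T" by (rule incseq_SucI) (use z in \<open>simp add: step\<close>)
  moreover have "T \<longlonglongrightarrow> 0"
  proof -
    obtain C where C: "\<And>k. \<bar>ra k\<bar> \<le> C" using b unfolding bounded_iff by auto
    have q: "(\<lambda>k. Q k z) \<longlonglongrightarrow> 0" by (rule Q_tendsto_0[OF z'])
    have "(\<lambda>k. Im (Q (Suc k) z * cnj (Q k z))) \<longlonglongrightarrow> Im (0 * cnj 0)"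
      by (intro tendsto_intros q filterlim_compose[OF q filterlim_Suc])
    then have l: "(\<lambda>k. Im (Q (Suc k) z * cnj (Q k z))) \<longlonglongrightarrow> 0" by simp
    have l': "(\<lambda>k. C * \<bar>Im (Q (Suc k) z * cnj (Q k z))\<bar>) \<longlonglongrightarrow> 0"
      by (intro tendsto_mult_right_zero tendsto_rabs_zero l)
    show ?thesis unfolding T_def
      by (rule Lim_null_comparison[of _ "\<lambda>k. C * \<bar>Im (Q (Suc k) z * cnj (Q k z))\<bar>"])
        (use C l' in \<open>auto intro!: always_eventually mult_right_mono simp: abs_mult\<close>)
  qed
  ultimately have "T (n - 1) \<le> 0" by (rule incseq_le)
  then have "ra n * Im (Q n z * cnj (Q (n - 1) z)) \<le> 0" using n by (simp add: T_def)
  then have "Im (Q n z * cnj (Q (n - 1) z)) \<le> 0" using ra_pos[OF n] by (simp add: mult_le_0_iff)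
  then show ?thesis by (simp add: mult.commute)
qed

end

subsection \<open>Ratio asymptotics for perturbed recurrences\<close>

text \<open>\<open>y\<^sub>j\<^sub>+\<^sub>1 - \<xi> y\<^sub>j\<close> and \<open>y\<^sub>j\<^sub>+\<^sub>1 - y\<^sub>j / \<xi>\<close> are the coordinates of \<open>(y\<^sub>j\<^sub>+\<^sub>1, y\<^sub>j)\<close> along the growing and the decaying
  solution; the second becomes negligible against the first.\<close>

lemma ratio_contraction:
  fixes y :: "nat \<Rightarrow> complex"
  assumes rec: "\<And>j. j < N \<Longrightarrow> cmod (y (Suc (Suc j)) - (\<xi> + 1 / \<xi>) * y (Suc j) + y j) \<le> \<delta> * (cmod (y (Suc j)) + cmod (y j))"
    and r: "1 / 2 \<le> cmod \<xi>" "cmod \<xi> \<le> 1" and g: "0 < g" "1 / (cmod \<xi>)\<^sup>2 \<ge> 1 + g"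
    and d: "0 < d" "d \<le> cmod (1 / \<xi> - \<xi>)" and K: "0 \<le> K" "cmod (y 1 - y 0 / \<xi>) \<le> K * cmod (y 1 - \<xi> * y 0)"
    and \<delta>: "0 \<le> \<delta>" "\<delta>' = \<delta> * (1 + 2 / d) * (K + 2)" "4 * \<delta>' \<le> g"
  shows "cmod (y (Suc N) - y N / \<xi>) \<le> (K / (1 + g / 2) ^ N + 4 * \<delta>' / g) * cmod (y (Suc N) - \<xi> * y N)"
proof -
  define A where "A = (\<lambda>j. y (Suc j) - \<xi> * y j)"
  define B where "B = (\<lambda>j. y (Suc j) - y j / \<xi>)"
  \<comment> \<open>\<open>C\<close> solves
    \<open>C (Suc j) * (1 + g / 2) = C j + 2 * \<delta>'\<close>, whose fixed point is
    \<open>4 * \<delta>' / g\<close>: a step gains the factor \<open>1 + g / 2\<close> and adds the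
    perturbation.\<close>
  define C where "C = (\<lambda>j::nat. K / (1 + g / 2) ^ j + 4 * \<delta>' / g)"
  have \<xi>0: "\<xi> \<noteq> 0" using r by auto
  have \<delta>'0: "\<delta>' \<ge> 0" using \<delta> d K by (auto intro!: mult_nonneg_nonneg add_nonneg_nonneg divide_nonneg_nonneg)
  have C0: "C j \<ge> 0" for j using K g \<delta>'0 by (auto simp: C_def intro!: add_nonneg_nonneg divide_nonneg_nonneg)
  have C1: "C j \<le> K + 1" for j
  proof -
    have "K / (1 + g / 2) ^ j \<le> K / 1" using K g by (intro divide_left_mono one_le_power) auto
    moreover have "4 * \<delta>' / g \<le> 1" using \<delta> g by simp
    ultimately show ?thesis by (simp add: C_def)
  qed
  have "cmod (B j) \<le> C j * cmod (A j)" if "j \<le> N" for j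
    using that
  proof (induction j)
    case 0
    have "cmod (B 0) \<le> K * cmod (A 0)" using K(2) by (simp add: A_def B_def)
    also have "\<dots> \<le> C 0 * cmod (A 0)" using \<delta>'0 g by (intro mult_right_mono) (auto simp: C_def)
    finally show ?case .
  next
    case (Suc j)
    then have IH: "cmod (B j) \<le> C j * cmod (A j)" and j: "j < N" by auto
    define e where "e = y (Suc (Suc j)) - (\<xi> + 1 / \<xi>) * y (Suc j) + y j"
    have As: "A (Suc j) = A j / \<xi> + e" using \<xi>0 by (simp add: A_def e_def field_simps)
    have Bs: "B (Suc j) = \<xi> * B j + e" using \<xi>0 by (simp add: B_def e_def field_simps)
    have BK: "cmod (B j) \<le> (K + 1) * cmod (A j)"
      using IH mult_right_mono[OF C1[of j], of "cmod (A j)"] by simp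
    \<comment> \<open>The difference of the two coordinates returns \<open>y j\<close> times the
      difference of the roots, which \<open>d\<close> bounds away from 0.\<close>
    have yj: "cmod (y j) \<le> (cmod (A j) + cmod (B j)) / d"
    proof -
      have "A j - B j = (1 / \<xi> - \<xi>) * y j" by (simp add: A_def B_def algebra_simps)
      then have "cmod (1 / \<xi> - \<xi>) * cmod (y j) \<le> cmod (A j) + cmod (B j)"
        by (metis norm_mult norm_triangle_ineq4)
      moreover have "d * cmod (y j) \<le> cmod (1 / \<xi> - \<xi>) * cmod (y j)" using d by (intro mult_right_mono) auto
      ultimately show ?thesis using d(1) by (simp add: field_simps)
    qed
    have "y (Suc j) = A j + \<xi> * y j" by (simp add: A_def)
    then have "cmod (y (Suc j)) \<le> cmod (A j) + cmod \<xi> * cmod (y j)" by (metis norm_mult norm_triangle_ineq)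
    also have "\<dots> \<le> cmod (A j) + 1 * cmod (y j)" using r by (intro add_left_mono mult_right_mono) auto
    finally have "cmod (y (Suc j)) + cmod (y j) \<le> cmod (A j) + 2 * ((cmod (A j) + cmod (B j)) / d)" using yj by linarith
    also have "\<dots> \<le> (cmod (A j) + cmod (B j)) + 2 * ((cmod (A j) + cmod (B j)) / d)" by simp
    also have "\<dots> = (1 + 2 / d) * (cmod (A j) + cmod (B j))" by (simp add: algebra_simps add_divide_distrib)
    also have "\<dots> \<le> (1 + 2 / d) * ((K + 2) * cmod (A j))" using d BK by (intro mult_left_mono) (auto simp: algebra_simps)
    finally have yy: "cmod (y (Suc j)) + cmod (y j) \<le> (1 + 2 / d) * ((K + 2) * cmod (A j))" .
    have "cmod e \<le> \<delta> * (cmod (y (Suc j)) + cmod (y j))" using rec[OF j] by (simp add: e_def)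
    also have "\<dots> \<le> \<delta> * ((1 + 2 / d) * ((K + 2) * cmod (A j)))" using \<delta> yy by (intro mult_left_mono) auto
    finally have e: "cmod e \<le> \<delta>' * cmod (A j)" by (simp add: \<delta>(2) mult.assoc)
    have rr: "cmod \<xi> > 0" using r by linarith
    have "(1 + g) * cmod \<xi> \<le> 1 / (cmod \<xi>)\<^sup>2 * cmod \<xi>" using g rr by (intro mult_right_mono) auto
    then have r1: "(1 + g) * cmod \<xi> \<le> 1 / cmod \<xi>" using rr by (simp add: power2_eq_square)
    have r2: "\<delta>' \<le> cmod \<xi> * g / 2" using mult_right_mono[OF r(1), of g] \<delta>(3) g by linarith
    have "cmod (A j) / cmod \<xi> - cmod e \<le> cmod (A (Suc j))"
      unfolding As using norm_diff_ineq[of "A j / \<xi>" e] by (simp add: norm_divide)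
    then have "cmod (A (Suc j)) \<ge> (1 / cmod \<xi> - \<delta>') * cmod (A j)" using e by (simp add: algebra_simps)
    \<comment> \<open>Half of the gap \<open>g\<close> absorbs the perturbation, since
      \<open>\<delta>'\<close> is at most \<open>cmod \<xi> * g / 2\<close>; the other half remains
      as growth.\<close>
    moreover have "(1 / cmod \<xi> - \<delta>') * cmod (A j) \<ge> (cmod \<xi> * (1 + g / 2)) * cmod (A j)"
      using r1 r2 by (intro mult_right_mono) (auto simp: algebra_simps)
    ultimately have A': "cmod (A (Suc j)) \<ge> cmod \<xi> * (1 + g / 2) * cmod (A j)" by linarith
    have "cmod (B (Suc j)) \<le> cmod \<xi> * cmod (B j) + cmod e" unfolding Bs by (metis norm_mult norm_triangle_ineq)
    also have "\<dots> \<le> cmod \<xi> * (C j * cmod (A j)) + \<delta>' * cmod (A j)" using IH e r by (intro add_mono mult_left_mono) auto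
    also have "\<dots> \<le> cmod \<xi> * (C j * cmod (A j)) + (cmod \<xi> * 2 * \<delta>') * cmod (A j)"
      using mult_right_mono[OF r(1), of \<delta>'] \<delta>'0 by (intro add_left_mono mult_right_mono) auto
    also have "\<dots> = (C j + 2 * \<delta>') * (cmod \<xi> * cmod (A j))" by (simp add: algebra_simps)
    also have "C j + 2 * \<delta>' = C (Suc j) * (1 + g / 2)"
    proof -
      have "K / (1 + g / 2) ^ Suc j * (1 + g / 2) = K / (1 + g / 2) ^ j" using g by simp
      moreover have "4 * \<delta>' / g * (1 + g / 2) = 4 * \<delta>' / g + 2 * \<delta>'" using g by (simp add: field_simps)
      ultimately show ?thesis unfolding C_def distrib_right by simp
    qed
    also have "C (Suc j) * (1 + g / 2) * (cmod \<xi> * cmod (A j)) = C (Suc j) * (cmod \<xi> * (1 + g / 2) * cmod (A j))" by simp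
    also have "\<dots> \<le> C (Suc j) * cmod (A (Suc j))" using C0 A' by (intro mult_left_mono) auto
    finally show ?case .
  qed
  from this[of N] show ?thesis by (simp add: A_def B_def C_def)
qed

text \<open>The two solutions of \<open>\<xi> + 1 / \<xi> = s\<close> have product 1, and \<xi> is
  the one in the closed unit disc. Taking imaginary parts gives
  \<open>Im \<sigma> = - Im \<xi> * (1 / (cmod \<xi>)\<^sup>2 - 1)\<close>, which yields both the
  sign of \<open>Im \<xi>\<close> and the gap. For the distance to \<open>cnj \<tau>\<close>, use
  \<open>(\<xi> - \<tau>) * (\<xi> - cnj \<tau>) = \<sigma> * \<xi>\<close>, where the first factor
  is at least \<open>Im \<tau>\<close> because \<xi> lies below the real axis.\<close>

lemma small_root:
  fixes \<tau> \<sigma> :: complex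
  assumes \<tau>: "cmod \<tau> = 1" "Im \<tau> > 0" and \<sigma>: "Im \<sigma> > 0"
  obtains \<xi> where "\<xi> \<noteq> 0" "\<xi> + 1 / \<xi> = \<tau> + cnj \<tau> + \<sigma>" "cmod \<xi> \<le> 1" "Im \<xi> < 0"
    "1 / (cmod \<xi>)\<^sup>2 \<ge> 1 + Im \<sigma>" "cmod (\<xi> - cnj \<tau>) \<le> cmod \<sigma> / Im \<tau>"
proof -
  define s where "s = \<tau> + cnj \<tau> + \<sigma>"
  have ims: "Im s = Im \<sigma>" by (simp add: s_def)
  have \<tau>\<tau>: "\<tau> * cnj \<tau> = 1" using \<tau> by (simp add: complex_norm_square[symmetric])
  define D where "D = csqrt (s\<^sup>2 - 4)"
  define x1 where "x1 = (s + D) / 2"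
  define x2 where "x2 = (s - D) / 2"
  have D2: "D\<^sup>2 = s\<^sup>2 - 4" by (simp add: D_def)
  have "x1 * x2 = (s\<^sup>2 - D\<^sup>2) / 4" by (simp add: x1_def x2_def power2_eq_square algebra_simps)
  then have prod: "x1 * x2 = 1" by (simp add: D2)
  have sum: "x1 + x2 = s" by (simp add: x1_def x2_def add_divide_distrib[symmetric])
  obtain \<xi> where \<xi>: "\<xi> * (s - \<xi>) = 1" "cmod \<xi> \<le> 1"
  proof (cases "cmod x1 \<le> 1")
    case True
    have "s - x1 = x2" using sum by auto
    then show ?thesis using that[of x1] prod True by simp
  next
    case False
    have "s - x2 = x1" using sum by auto
    moreover have "cmod x1 * cmod x2 = 1" using prod by (metis norm_mult norm_one)
    then have "cmod x2 \<le> 1" using False by (smt (verit) mult_le_cancel_right1 norm_ge_zero)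
    ultimately show ?thesis using that[of x2] prod by (simp add: mult.commute)
  qed
  have \<xi>0: "\<xi> \<noteq> 0" using \<xi> by auto
  have inv: "1 / \<xi> = s - \<xi>" using \<xi>(1) \<xi>0 by (simp add: field_simps)
  have c2: "cnj \<xi> / (of_real ((cmod \<xi>)\<^sup>2)) = 1 / \<xi>" using \<xi>0 by (simp add: complex_norm_square field_simps del: of_real_power)
  have im: "Im (1 / \<xi>) = - Im \<xi> / (cmod \<xi>)\<^sup>2" unfolding c2[symmetric] by simp
  have n0: "(cmod \<xi>)\<^sup>2 > 0" using \<xi>0 by simp
  have ims': "Im \<sigma> = Im \<xi> - Im \<xi> / (cmod \<xi>)\<^sup>2"
  proof -
    have "Im s = Im \<xi> + Im (1 / \<xi>)" by (simp add: inv)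
    then show ?thesis using ims im by simp
  qed
  have n1: "1 / (cmod \<xi>)\<^sup>2 \<ge> 1" using n0 \<xi>(2) by (simp add: abs_square_le_1)
  have e: "Im \<sigma> = (- Im \<xi>) * (1 / (cmod \<xi>)\<^sup>2 - 1)" using ims' by (simp add: algebra_simps)
  have neg: "Im \<xi> < 0"
  proof (rule ccontr)
    assume "\<not> Im \<xi> < 0"
    then have "Im \<sigma> \<le> 0" unfolding e using n1 by (intro mult_nonpos_nonneg) auto
    then show False using \<sigma> by simp
  qed
  have "- Im \<xi> \<le> 1" using abs_Im_le_cmod[of \<xi>] \<xi>(2) by linarith
  then have "Im \<sigma> \<le> 1 * (1 / (cmod \<xi>)\<^sup>2 - 1)" unfolding e using n1 by (intro mult_right_mono) auto
  then have big: "1 / (cmod \<xi>)\<^sup>2 \<ge> 1 + Im \<sigma>" by simp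
  have "(\<xi> - \<tau>) * (\<xi> - cnj \<tau>) = \<sigma> * \<xi>"
  proof -
    have "(\<xi> - \<tau>) * (\<xi> - cnj \<tau>) = \<xi> * \<xi> - (\<tau> + cnj \<tau>) * \<xi> + \<tau> * cnj \<tau>" by (simp add: algebra_simps)
    also have "\<dots> = \<sigma> * \<xi> - (\<xi> * (s - \<xi>)) + 1" using \<tau>\<tau> by (simp add: s_def algebra_simps)
    finally show ?thesis using \<xi> by simp
  qed
  then have "cmod (\<xi> - \<tau>) * cmod (\<xi> - cnj \<tau>) = cmod \<sigma> * cmod \<xi>" by (metis norm_mult)
  also have "\<dots> \<le> cmod \<sigma>" using \<xi>(2) by (simp add: mult_left_le)
  finally have "cmod (\<xi> - \<tau>) * cmod (\<xi> - cnj \<tau>) \<le> cmod \<sigma>" .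
  moreover have "Im \<tau> \<le> cmod (\<xi> - \<tau>)" using abs_Im_le_cmod[of "\<xi> - \<tau>"] neg \<tau> by simp
  ultimately have "Im \<tau> * cmod (\<xi> - cnj \<tau>) \<le> cmod \<sigma>"
    by (meson mult_right_mono norm_ge_zero order_trans)
  then have "cmod (\<xi> - cnj \<tau>) \<le> cmod \<sigma> / Im \<tau>" using \<tau> by (simp add: field_simps)
  then show ?thesis using that[of \<xi>] \<xi>0 \<xi> inv neg big by (simp add: s_def)
qed

text \<open>The two solutions separate at a rate of order \<open>n powr -\<alpha>\<close> per step
  and the error is of order \<open>n powr -\<beta>\<close>, so their quotient is small as \<alpha> <
  \<beta>; over at least \<open>n / 4\<close> steps the gap accumulates to the order
  \<open>n powr (1 - \<alpha>)\<close>. The sign condition on \<open>y 1 * cnj (y 0)\<close> keeps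
  the start away from the decaying solution, whose ratio lies in the lower half-plane. Quantifying
  \<sigma>, \<open>y\<close> and \<open>N\<close> inside \<open>eventually\<close> makes the
  convergence uniform.\<close>

lemma ratio_asymptotics:
  fixes \<tau> :: complex and c R C \<alpha> \<beta> e :: real
  assumes \<tau>: "cmod \<tau> = 1" "Im \<tau> > 0" and c: "c > 0" and \<alpha>: "0 < \<alpha>" "\<alpha> < \<beta>" "\<beta> < 1" and C: "C \<ge> 0" and e: "e > 0"
  shows "\<forall>\<^sub>F n in sequentially. \<forall>\<sigma> y N. cmod \<sigma> \<le> R * real n powr (-\<alpha>) \<and> Im \<sigma> \<ge> c * real n powr (-\<alpha>) \<and>
     Im (y 1 * cnj (y 0)) \<ge> 0 \<and> real n / 4 \<le> real N \<and> (y N \<noteq> 0 \<or> y (Suc N) \<noteq> 0) \<and>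
     (\<forall>j<N. cmod (y (Suc (Suc j)) - (\<tau> + cnj \<tau> + \<sigma>) * y (Suc j) + y j) \<le> C * real n powr (-\<beta>) * (cmod (y (Suc j)) + cmod (y j)))
     \<longrightarrow> y N \<noteq> 0 \<and> cmod (y (Suc N) / y N - \<tau>) < e"
proof -
  define h where "h = Im \<tau> / 2"
  \<comment> \<open>The constant for the initial values: 3 bounds
    \<open>cmod (1 / \<xi> - \<xi>)\<close> from above, and \<open>h\<close> bounds
    \<open>cmod (u - \<xi>)\<close> from below for the initial ratio \<open>u\<close>.\<close>
  define K where "K = 1 + 3 / h"
  define D where "D = C * (1 + 2 / h) * (K + 2)"
  have h: "h > 0" "h \<le> 1 / 2" using \<tau> abs_Im_le_cmod[of \<tau>] by (auto simp: h_def)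
  have K: "K \<ge> 1" using h by (simp add: K_def)
  have D: "D \<ge> 0" using h K C by (simp add: D_def)
  \<comment> \<open>A bound for the factor returned by \<open>ratio_contraction\<close>: the initial
    term, by Bernoulli's inequality with at least \<open>n / 4\<close> steps of gain
    \<open>g / 2\<close>, and the accumulated error \<open>4 * \<delta>' / g\<close>.\<close>
  define \<eta> where "\<eta> = (\<lambda>n::nat. K * (8 / c) * real n powr (-(1 - \<alpha>)) + 4 * D / c * real n powr (- (\<beta> - \<alpha>)))"
  have np: "(\<lambda>n::nat. real n powr (-s)) \<longlonglongrightarrow> 0" if "s > 0" for s
    using that by (intro tendsto_neg_powr filterlim_real_sequentially) auto
  have l1: "(\<lambda>n. R * real n powr (-\<alpha>)) \<longlonglongrightarrow> 0" using np[of \<alpha>] \<alpha> by (intro tendsto_mult_right_zero) auto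
  have l2: "\<eta> \<longlonglongrightarrow> 0"
    unfolding \<eta>_def using \<alpha> by (intro tendsto_add_zero tendsto_mult_right_zero np) auto
  have l3: "(\<lambda>n. 4 * D / c * real n powr (- (\<beta> - \<alpha>))) \<longlonglongrightarrow> 0"
    using \<alpha> by (intro tendsto_mult_right_zero np) auto
  \<comment> \<open>\<open>h * h\<close> forces \<xi> to within \<open>h / 2\<close> of
    \<open>cnj \<tau>\<close>, as \<open>Im \<tau> = 2 * h\<close>; \<open>e * h / 8\<close> forces
    \<open>1 / \<xi>\<close> to within \<open>e / 8\<close> of \<tau>.\<close>
  define q where "q = min (h * h) (e * h / 8)"
  have q: "q > 0" using h e by (simp add: q_def)
  have E1: "\<forall>\<^sub>F n in sequentially. R * real n powr (-\<alpha>) < q" using order_tendstoD(2)[OF l1 q] .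
  have E2: "\<forall>\<^sub>F n in sequentially. \<eta> n < min (1/2) (e / 12)" using order_tendstoD(2)[OF l2, of "min (1/2) (e / 12)"] e by linarith
  have E3: "\<forall>\<^sub>F n in sequentially. 4 * D / c * real n powr (- (\<beta> - \<alpha>)) < 1" using order_tendstoD(2)[OF l3] by auto
  show ?thesis
    using E1 E2 E3 eventually_gt_at_top[of 0]
  proof eventually_elim
    case (elim n)
    show ?case
    proof (intro allI impI, elim conjE)
      fix \<sigma> y N
      assume s1: "cmod \<sigma> \<le> R * real n powr (-\<alpha>)" and s2: "Im \<sigma> \<ge> c * real n powr (-\<alpha>)"
        and im: "Im (y 1 * cnj (y 0)) \<ge> 0" and N: "real n / 4 \<le> real N" and ne: "y N \<noteq> 0 \<or> y (Suc N) \<noteq> 0"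
        and rec: "\<forall>j<N. cmod (y (Suc (Suc j)) - (\<tau> + cnj \<tau> + \<sigma>) * y (Suc j) + y j) \<le> C * real n powr (-\<beta>) * (cmod (y (Suc j)) + cmod (y j))"
      define g where "g = c * real n powr (-\<alpha>)"
      have n0: "real n > 0" using elim by simp
      have g: "g > 0" using c n0 by (simp add: g_def)
      have \<sigma>0: "Im \<sigma> > 0" using s2 g by (simp add: g_def)
      obtain \<xi> where \<xi>: "\<xi> \<noteq> 0" "\<xi> + 1 / \<xi> = \<tau> + cnj \<tau> + \<sigma>" "cmod \<xi> \<le> 1" "Im \<xi> < 0"
        "1 / (cmod \<xi>)\<^sup>2 \<ge> 1 + Im \<sigma>" "cmod (\<xi> - cnj \<tau>) \<le> cmod \<sigma> / Im \<tau>"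
        using small_root[OF \<tau> \<sigma>0] by blast
      have sq: "cmod \<sigma> < q" using s1 elim by linarith
      have "cmod \<sigma> / Im \<tau> \<le> (h * h) / Im \<tau>" using sq \<tau> by (intro divide_right_mono) (auto simp: q_def)
      also have "\<dots> = h / 2" using \<tau> by (simp add: h_def field_simps)
      finally have d1: "cmod (\<xi> - cnj \<tau>) \<le> h / 2" using \<xi>(6) by linarith
      have imx: "Im \<xi> \<le> - h"
        using d1 abs_Im_le_cmod[of "\<xi> - cnj \<tau>"] h by (simp add: h_def)
      have r1: "cmod \<xi> \<ge> 1 / 2"
        using norm_triangle_ineq2[of "cnj \<tau>" "cnj \<tau> - \<xi>"] d1 \<tau> h by (simp add: norm_minus_commute)
      have imi: "Im (1 / \<xi>) \<ge> 0" using \<xi>(4) by (simp add: Im_divide divide_nonpos_nonneg)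
      have dd: "h \<le> cmod (1 / \<xi> - \<xi>)" using abs_Im_le_cmod[of "1 / \<xi> - \<xi>"] imx imi by simp
      have inv2: "cmod (1 / \<xi>) \<le> 2" using r1 \<xi>(1) by (simp add: norm_divide field_simps)
      have b3: "cmod (1 / \<xi> - \<xi>) \<le> 3" using norm_triangle_ineq4[of "1/\<xi>" \<xi>] inv2 \<xi>(3) by linarith
      have K0: "cmod (y 1 - y 0 / \<xi>) \<le> K * cmod (y 1 - \<xi> * y 0)"
      proof (cases "y 0 = 0")
        case True
        then show ?thesis using K by (simp add: mult_le_cancel_right1)
      next
        case False
        define u where "u = y 1 / y 0"
        have yu: "y 1 = u * y 0" using False by (simp add: u_def)
        have "y 1 * cnj (y 0) = u * of_real ((cmod (y 0))\<^sup>2)" by (simp only: yu complex_norm_square mult.assoc)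
        then have "Im u * (cmod (y 0))\<^sup>2 \<ge> 0" using im by simp
        then have "Im u \<ge> 0" using False by (simp add: zero_le_mult_iff)
        then have uh: "h \<le> cmod (u - \<xi>)" using abs_Im_le_cmod[of "u - \<xi>"] imx by simp
        have "cmod (u - 1 / \<xi>) \<le> cmod (u - \<xi>) + cmod (1 / \<xi> - \<xi>)"
          using norm_triangle_ineq4[of "u - \<xi>" "1/\<xi> - \<xi>"] by simp
        also have "\<dots> \<le> cmod (u - \<xi>) + 3 / h * h" using b3 h by simp
        also have "\<dots> \<le> cmod (u - \<xi>) + 3 / h * cmod (u - \<xi>)" using uh h by (intro add_left_mono mult_left_mono) auto
        finally have *: "cmod (u - 1 / \<xi>) \<le> K * cmod (u - \<xi>)" by (simp add: K_def algebra_simps)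
        have "y 1 - y 0 / \<xi> = (u - 1 / \<xi>) * y 0" "y 1 - \<xi> * y 0 = (u - \<xi>) * y 0" unfolding yu by (simp_all add: algebra_simps)
        then show ?thesis using mult_right_mono[OF *, of "cmod (y 0)"] by (simp add: norm_mult mult.assoc)
      qed
      define \<delta> where "\<delta> = C * real n powr (-\<beta>)"
      define \<delta>' where "\<delta>' = \<delta> * (1 + 2 / h) * (K + 2)"
      have \<delta>'D: "\<delta>' = D * real n powr (-\<beta>)" by (simp add: \<delta>'_def \<delta>_def D_def)
      have \<delta>g: "4 * \<delta>' / g = 4 * D / c * real n powr (- (\<beta> - \<alpha>))"
        using n0 c by (simp add: \<delta>'D g_def powr_diff powr_minus field_simps)
      have "4 * \<delta>' / g < 1" using elim \<delta>g by simp
      then have 4: "4 * \<delta>' \<le> g" using g by (simp add: field_simps)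
      have main: "cmod (y (Suc N) - y N / \<xi>) \<le> (K / (1 + g / 2) ^ N + 4 * \<delta>' / g) * cmod (y (Suc N) - \<xi> * y N)"
      proof (rule ratio_contraction[where \<delta> = \<delta> and d = h])
        show "1 / (cmod \<xi>)\<^sup>2 \<ge> 1 + g" using \<xi>(5) s2 by (simp add: g_def)
        show "0 \<le> \<delta>" using C by (simp add: \<delta>_def)
      qed (use rec \<xi> r1 g h dd K K0 4 \<delta>'_def in \<open>auto simp: \<delta>_def\<close>)
      have "K / (1 + g / 2) ^ N \<le> K * (8 / c) * real n powr (-(1 - \<alpha>))"
      proof -
        have "1 + real N * (g / 2) \<le> (1 + g / 2) ^ N" using g by (intro Bernoulli_inequality) auto
        moreover have "real n * g / 8 \<le> real N * (g / 2)" using N g by (simp add: field_simps)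
        ultimately have "real n * g / 8 \<le> (1 + g / 2) ^ N" by linarith
        then have "K / (1 + g / 2) ^ N \<le> K / (real n * g / 8)" using K g n0 by (intro divide_left_mono) auto
        also have "\<dots> = K * (8 / c) * real n powr (-(1 - \<alpha>))"
          using n0 c by (simp add: g_def powr_diff powr_minus field_simps)
        finally show ?thesis .
      qed
      then have "K / (1 + g / 2) ^ N + 4 * \<delta>' / g \<le> \<eta> n" using \<delta>g by (simp add: \<eta>_def)
      then have B: "cmod (y (Suc N) - y N / \<xi>) \<le> \<eta> n * cmod (y (Suc N) - \<xi> * y N)"
        using main by (meson mult_right_mono norm_ge_zero order_trans)
      have yN: "y N \<noteq> 0"
      proof
        assume 0: "y N = 0"
        then have "cmod (y (Suc N)) \<le> \<eta> n * cmod (y (Suc N))" using B by simp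
        moreover have "y (Suc N) \<noteq> 0" using ne 0 by simp
        ultimately have "1 \<le> \<eta> n" by (simp add: mult_le_cancel_right1)
        then show False using elim by simp
      qed
      define u where "u = y (Suc N) / y N"
      have "y (Suc N) - y N / \<xi> = (u - 1 / \<xi>) * y N" "y (Suc N) - \<xi> * y N = (u - \<xi>) * y N"
        using yN by (simp_all add: u_def field_simps)
      then have "cmod (u - 1 / \<xi>) * cmod (y N) \<le> (\<eta> n * cmod (u - \<xi>)) * cmod (y N)" using B by (simp add: norm_mult)
      then have u1: "cmod (u - 1 / \<xi>) \<le> \<eta> n * cmod (u - \<xi>)" using yN by simp
      have eta0: "\<eta> n \<ge> 0" using K D c by (simp add: \<eta>_def)
      have "cmod (u - \<xi>) \<le> cmod (u - 1 / \<xi>) + 3"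
        using norm_triangle_ineq[of "u - 1/\<xi>" "1/\<xi> - \<xi>"] b3 by simp
      then have "cmod (u - 1 / \<xi>) \<le> \<eta> n * (cmod (u - 1 / \<xi>) + 3)" using u1 eta0 by (meson mult_left_mono order_trans)
      also have "\<dots> = \<eta> n * cmod (u - 1 / \<xi>) + 3 * \<eta> n" by (simp add: algebra_simps)
      \<comment> \<open>As \<open>\<eta> n < 1 / 2\<close>, the unknown distance on the right is
        absorbed on the left.\<close>
      also have "\<dots> \<le> 1 / 2 * cmod (u - 1 / \<xi>) + 3 * \<eta> n" using elim by (intro add_right_mono mult_right_mono) auto
      finally have u2: "cmod (u - 1 / \<xi>) \<le> 6 * \<eta> n" by simp
      have "1 / \<xi> = \<tau> + cnj \<tau> + \<sigma> - \<xi>" using \<xi>(2) by (simp add: algebra_simps)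
      then have "1 / \<xi> - \<tau> = \<sigma> - (\<xi> - cnj \<tau>)" by simp
      then have "cmod (1 / \<xi> - \<tau>) \<le> cmod \<sigma> + cmod (\<xi> - cnj \<tau>)" by (simp add: norm_triangle_ineq4)
      also have "\<dots> \<le> cmod \<sigma> + cmod \<sigma> / Im \<tau>" using \<xi>(6) by simp
      also have "\<dots> \<le> cmod \<sigma> / Im \<tau> + cmod \<sigma> / Im \<tau>" using h \<tau> by (intro add_right_mono) (auto simp: field_simps h_def mult_left_le_one_le)
      also have "\<dots> = cmod \<sigma> / h" by (simp add: h_def)
      also have "\<dots> \<le> (e * h / 8) / h" using sq h by (intro divide_right_mono) (auto simp: q_def)
      also have "\<dots> = e / 8" using h by simp
      finally have "cmod (1 / \<xi> - \<tau>) \<le> e / 8" .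
      then have "cmod (u - \<tau>) < e" using u2 elim e norm_triangle_ineq[of "u - 1/\<xi>" "1/\<xi> - \<tau>"] by simp
      then show "y N \<noteq> 0 \<and> cmod (y (Suc N) / y N - \<tau>) < e" using yN by (simp add: u_def)
    qed
  qed
qed

subsection \<open>Mesoscopic asymptotics\<close>

text \<open>Freezing the coefficients at their limits costs an error linear in \<rho>, because
  \<open>a2 \<ge> a / 2\<close> keeps the division harmless. The hypotheses on \<open>a1\<close> and
  \<open>a2\<close> are the same, so the statement also covers a recurrence read backwards.\<close>

lemma perturbed_recurrence:
  fixes y0 y1 y2 z :: complex and a a1 a2 b b' \<rho> B :: real
  assumes a: "a > 0" and \<rho>: "\<bar>a1 - a\<bar> \<le> \<rho>" "\<bar>a2 - a\<bar> \<le> \<rho>" "\<bar>b' - b\<bar> \<le> \<rho>" "\<rho> \<le> a / 2"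
    and B: "cmod (z - of_real b) \<le> B"
    and rec: "of_real a2 * y2 = (z - of_real b') * y1 - of_real a1 * y0"
  shows "cmod (y2 - ((z - of_real b) / of_real a) * y1 + y0) \<le> (2 * B / a\<^sup>2 + 4 / a) * \<rho> * (cmod y1 + cmod y0)"
proof -
  have a2: "a2 \<ge> a / 2" "a2 > 0" using \<rho> a by linarith+
  have \<rho>0: "\<rho> \<ge> 0" using \<rho> by linarith
  have B0: "B \<ge> 0" using B norm_ge_zero order_trans by blast
  define c1 where "c1 = ((z - of_real b) * of_real (a - a2) / of_real a + of_real (b - b')) / of_real a2"
  define c0 :: complex where "c0 = of_real ((a2 - a1) / a2)"
  have y2: "y2 = ((z - of_real b') * y1 - of_real a1 * y0) / of_real a2" using rec a2 by (simp add: field_simps)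
  have "y2 - ((z - of_real b) / of_real a) * y1 + y0 = c1 * y1 + c0 * (y0 :: complex)"
    unfolding y2 c1_def c0_def using a a2 by (simp add: field_simps)
  then have "cmod (y2 - ((z - of_real b) / of_real a) * y1 + y0) \<le> cmod c1 * cmod y1 + cmod c0 * cmod y0"
    by (metis norm_mult norm_triangle_ineq)
  also have "\<dots> \<le> (2 * B / a\<^sup>2 + 4 / a) * \<rho> * cmod y1 + (2 * B / a\<^sup>2 + 4 / a) * \<rho> * cmod y0"
  proof (intro add_mono mult_right_mono)
    have "cmod ((z - of_real b) * of_real (a - a2) / of_real a + of_real (b - b')) \<le> cmod ((z - of_real b) * of_real (a - a2) / of_real a) + \<bar>b - b'\<bar>"
      using norm_triangle_ineq[of "(z - of_real b) * of_real (a - a2) / of_real a" "of_real (b - b')"] by (simp only: norm_of_real)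
    also have "\<dots> = cmod (z - of_real b) * \<bar>a - a2\<bar> / a + \<bar>b - b'\<bar>"
      using a by (simp only: norm_mult norm_divide norm_of_real abs_of_pos)
    also have "\<dots> \<le> B * \<rho> / a + \<rho>"
      using \<rho> B B0 a by (intro add_mono divide_right_mono mult_mono) auto
    finally have "cmod c1 \<le> (B * \<rho> / a + \<rho>) / a2" using a2 by (simp add: c1_def norm_divide divide_right_mono)
    also have "\<dots> \<le> (B * \<rho> / a + \<rho>) / (a / 2)" using a a2 B0 \<rho>0 by (intro divide_left_mono) auto
    also have "\<dots> = (2 * B / a\<^sup>2 + 2 / a) * \<rho>" using a by (simp add: field_simps power2_eq_square)
    also have "\<dots> \<le> (2 * B / a\<^sup>2 + 4 / a) * \<rho>" using a \<rho>0 by (intro mult_right_mono) (auto simp: divide_right_mono)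
    finally show "cmod c1 \<le> (2 * B / a\<^sup>2 + 4 / a) * \<rho>" .
    have "cmod c0 = \<bar>a2 - a1\<bar> / a2" using a2 by (simp add: c0_def abs_divide del: of_real_divide of_real_diff)
    also have "\<dots> \<le> (2 * \<rho>) / a2" using \<rho> a2 by (intro divide_right_mono) auto
    also have "\<dots> \<le> (2 * \<rho>) / (a / 2)" using a a2 \<rho>0 by (intro divide_left_mono) auto
    also have "\<dots> = 4 / a * \<rho>" by simp
    also have "\<dots> \<le> (2 * B / a\<^sup>2 + 4 / a) * \<rho>" using \<rho>0 B0 by (intro mult_right_mono) auto
    finally show "cmod c0 \<le> (2 * B / a\<^sup>2 + 4 / a) * \<rho>" .
  qed auto
  finally show ?thesis by (simp only: distrib_left)
qed

section \<open>Logarithms of \<open>x - z\<close> and the logarithmic trace\<close>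

lemma Ln_shift_derivative:
  fixes x :: real
  assumes "Im z > 0"
  shows "((\<lambda>z. Ln (of_real x - z)) has_field_derivative 1 / (z - of_real x)) (at z within S)"
proof -
  have "of_real x - z \<notin> \<real>\<^sub>\<le>\<^sub>0" using assms by (auto simp: complex_nonpos_Reals_iff)
  then have "((\<lambda>z. Ln (of_real x - z)) has_field_derivative inverse (of_real x - z) * (0 - 1)) (at z within S)"
    by (intro DERIV_chain2[where f = Ln] has_field_derivative_Ln DERIV_diff DERIV_const DERIV_ident)
  moreover have "inverse (of_real x - z) * (0 - 1) = 1 / (z - of_real x)"
    using inverse_minus_eq[of "z - of_real x"] by (simp add: divide_inverse)
  ultimately show ?thesis by simp
qed

lemma resolvent_bound_pos: "h > 0 \<Longrightarrow> Im z \<ge> h \<Longrightarrow> cmod (1 / (z - complex_of_real x)) \<le> 1 / h"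
  using abs_Im_le_cmod[of "z - of_real x"] by (auto simp: norm_divide intro!: divide_left_mono mult_pos_pos)

lemma convex_Im_ge: "convex {z. Im z \<ge> h}"
  by (simp add: convex_halfspace_Im_ge)

lemma Ln_shift_lipschitz:
  fixes x :: real
  assumes "h > 0" "Im z \<ge> h" "Im w \<ge> h"
  shows "cmod (Ln (of_real x - w) - Ln (of_real x - z)) \<le> cmod (w - z) / h"
proof -
  have "cmod (Ln (of_real x - w) - Ln (of_real x - z)) \<le> (1 / h) * cmod (w - z)"
    by (rule field_differentiable_bound[OF convex_Im_ge[of h], where f' = "\<lambda>z. 1 / (z - of_real x)"])
      (use assms in \<open>auto intro!: Ln_shift_derivative resolvent_bound_pos simp del: norm_divide\<close>)
  then show ?thesis by simp
qed

text \<open>After subtraction of the linear term the derivative on the segment is of size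
  \<open>cmod (w - z) / h\<^sup>2\<close>. The bound is uniform in \<open>x\<close>, which permits
  differentiation under the integral in \<open>log_mean_derivative\<close>.\<close>

lemma Ln_shift_taylor:
  fixes x :: real
  assumes h: "h > 0" "Im z \<ge> h" "Im w \<ge> h"
  shows "cmod (Ln (of_real x - w) - Ln (of_real x - z) - (w - z) * (1 / (z - of_real x))) \<le> (cmod (w - z))\<^sup>2 / h\<^sup>2"
proof -
  let ?f = "\<lambda>u. Ln (of_real x - u) - u * (1 / (z - of_real x))"
  have d: "(?f has_field_derivative 1 / (u - of_real x) - 1 / (z - of_real x)) (at u within closed_segment z w)"
    if "u \<in> closed_segment z w" for u
  proof -
    have "Im u \<ge> h" using convex_Im_ge[of h] that h by (metis (mono_tags, lifting) closed_segment_subset mem_Collect_eq subsetD)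
    then show ?thesis using h
      by (intro DERIV_diff Ln_shift_derivative) (auto intro!: derivative_eq_intros)
  qed
  have b: "cmod (1 / (u - of_real x) - 1 / (z - of_real x)) \<le> cmod (w - z) / h\<^sup>2"
    if "u \<in> closed_segment z w" for u
  proof -
    have u: "Im u \<ge> h" using convex_Im_ge[of h] that h by (metis (mono_tags, lifting) closed_segment_subset mem_Collect_eq subsetD)
    have nz: "u - of_real x \<noteq> 0" "z - of_real x \<noteq> 0" using u h by (auto simp: complex_eq_iff)
    have "1 / (u - of_real x) - 1 / (z - of_real x) = (z - u) * (1 / (u - of_real x)) * (1 / (z - of_real x))"
      using nz by (simp add: field_simps)
    then have "cmod (1 / (u - of_real x) - 1 / (z - of_real x)) = cmod (z - u) * cmod (1 / (u - of_real x)) * cmod (1 / (z - of_real x))"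
      by (metis norm_mult)
    also have "\<dots> \<le> cmod (w - z) * (1 / h) * (1 / h)"
      using segment_bound1[OF that] resolvent_bound_pos[OF h(1) u, of x] resolvent_bound_pos[OF h(1) h(2), of x] h
      by (intro mult_mono) (auto simp: norm_minus_commute)
    finally show ?thesis by (simp add: power2_eq_square)
  qed
  have "cmod (?f w - ?f z) \<le> cmod (w - z) / h\<^sup>2 * cmod (w - z)"
    by (rule field_differentiable_bound[OF convex_closed_segment[of z w] d b]) auto
  moreover have "?f w - ?f z = Ln (of_real x - w) - Ln (of_real x - z) - (w - z) * (1 / (z - of_real x))"
    by (simp only: left_diff_distrib) simp
  ultimately show ?thesis by (simp only: power2_eq_square times_divide_eq_left)
qed

context orthonormal_system
begin

lemma integral_linear_combination3:
  fixes f1 :: "real \<Rightarrow> complex"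
  assumes "integrable M f1" "integrable M f2" "integrable M f3"
  shows "(\<integral>x. f1 x - f2 x - c * f3 x \<partial>M) = integral\<^sup>L M f1 - integral\<^sup>L M f2 - c * integral\<^sup>L M f3"
  using assms by simp

text \<open>A single logarithm is unbounded in \<open>x\<close>, whereas the difference of two is
  bounded by \<open>Ln_shift_lipschitz\<close> and hence integrable against any polynomial. As a
  function of \<open>w\<close>, the reference point \<open>z\<close> only fixes an additive
  constant.\<close>

definition log_mean :: "real poly \<Rightarrow> complex \<Rightarrow> complex \<Rightarrow> complex" where
  "log_mean q w z = (\<integral>x. (Ln (of_real x - w) - Ln (of_real x - z)) * of_real (poly q x) \<partial>\<mu>)"

lemma Ln_shift_measurable [measurable]:
  assumes "Im z > 0"
  shows "(\<lambda>x::real. Ln (of_real x - z)) \<in> borel_measurable borel"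
  by (intro borel_measurable_continuous_onI continuous_intros)
    (use assms in \<open>auto simp: complex_nonpos_Reals_iff\<close>)

lemma integrable_log_mean:
  assumes "Im z > 0" "Im w > 0"
  shows "integrable \<mu> (\<lambda>x. (Ln (of_real x - w) - Ln (of_real x - z)) * of_real (poly q x))"
proof (rule integrable_bounded_poly)
  show "(\<lambda>x. Ln (of_real x - w) - Ln (of_real x - z)) \<in> borel_measurable borel"
    using assms by measurable
  show "norm (Ln (of_real x - w) - Ln (of_real x - z)) \<le> cmod (w - z) / min (Im z) (Im w)" for x :: real
    using assms by (intro Ln_shift_lipschitz) auto
qed

lemma log_mean_derivative:
  assumes z: "Im z > 0" and w: "Im w > 0"
  shows "((\<lambda>w. log_mean q w z) has_field_derivative (\<integral>x. (1 / (w - of_real x)) * of_real (poly q x) \<partial>\<mu>)) (at w)"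
proof -
  define g where "g = (\<integral>x. (1 / (w - of_real x)) * of_real (poly q x) \<partial>\<mu>)"
  define h where "h = Im w / 2"
  define M where "M = (\<integral>x. \<bar>poly q x\<bar> \<partial>\<mu>) / h\<^sup>2"
  have h: "h > 0" using w by (simp add: h_def)
  have b: "cmod ((log_mean q (w + d) z - log_mean q w z) / d - g) \<le> M * cmod d" if d: "d \<noteq> 0" "cmod d < h" for d
  proof -
    have wd: "Im (w + d) \<ge> h" "Im w \<ge> h" using d abs_Im_le_cmod[of d] w by (auto simp: h_def)
    then have wd': "Im (w + d) > 0" "Im w > 0" using h by linarith+
    have w0: "Im w \<noteq> 0" using w by simp
    have "log_mean q (w + d) z - log_mean q w z - d * g =
      (\<integral>x. (Ln (of_real x - (w + d)) - Ln (of_real x - z)) * of_real (poly q x)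
          - (Ln (of_real x - w) - Ln (of_real x - z)) * of_real (poly q x)
          - d * ((1 / (w - of_real x)) * of_real (poly q x)) \<partial>\<mu>)"
      unfolding log_mean_def g_def
      using integrable_log_mean[OF z wd'(1), of q] integrable_log_mean[OF z w, of q] integrable_resolvent[OF w0, of q]
      by (subst integral_linear_combination3) auto
    also have "\<dots> = (\<integral>x. (Ln (of_real x - (w + d)) - Ln (of_real x - w) - ((w + d) - w) * (1 / (w - of_real x))) * of_real (poly q x) \<partial>\<mu>)"
      by (intro Bochner_Integration.integral_cong) (auto simp: algebra_simps)
    also have "cmod \<dots> \<le> (\<integral>x. (cmod d)\<^sup>2 / h\<^sup>2 * \<bar>poly q x\<bar> \<partial>\<mu>)"
    proof (rule Bochner_Integration.integral_norm_bound_integral)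
      show "integrable \<mu> (\<lambda>x. (cmod d)\<^sup>2 / h\<^sup>2 * \<bar>poly q x\<bar>)"
        using integrable_poly[of q] by (intro integrable_mult_right integrable_abs)
      have "integrable \<mu> (\<lambda>x. (Ln (of_real x - (w + d)) - Ln (of_real x - w)) * of_real (poly q x) - d * ((1 / (w - of_real x)) * of_real (poly q x)))"
        using integrable_log_mean[OF w wd'(1), of q] integrable_resolvent[OF w0, of q]
        by (intro Bochner_Integration.integrable_diff integrable_mult_right)
      then show "integrable \<mu> (\<lambda>x. (Ln (of_real x - (w + d)) - Ln (of_real x - w) - ((w + d) - w) * (1 / (w - of_real x))) * of_real (poly q x))"
        by (rule Bochner_Integration.integrable_cong[THEN iffD1, rotated -1]) (auto simp: algebra_simps)
      show "norm ((Ln (of_real x - (w + d)) - Ln (of_real x - w) - ((w + d) - w) * (1 / (w - of_real x))) * of_real (poly q x))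
         \<le> (cmod d)\<^sup>2 / h\<^sup>2 * \<bar>poly q x\<bar>" for x
        using mult_right_mono[OF Ln_shift_taylor[OF h wd(2) wd(1), of x], of "\<bar>poly q x\<bar>"] by (simp add: norm_mult)
    qed
    also have "\<dots> = M * cmod d * cmod d" by (simp add: M_def power2_eq_square)
    finally have "cmod (log_mean q (w + d) z - log_mean q w z - d * g) \<le> M * cmod d * cmod d" .
    moreover have "(log_mean q (w + d) z - log_mean q w z) / d - g = (log_mean q (w + d) z - log_mean q w z - d * g) / d"
      using d by (simp add: field_simps)
    ultimately show ?thesis using d by (simp add: norm_divide field_simps)
  qed
  have "((\<lambda>d. (log_mean q (w + d) z - log_mean q w z) / d - g) \<longlongrightarrow> 0) (at 0)"
  proof (rule Lim_null_comparison)
    show "\<forall>\<^sub>F d in at 0. norm ((log_mean q (w + d) z - log_mean q w z) / d - g) \<le> M * cmod d"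
      unfolding eventually_at using h b by (intro exI[of _ h]) auto
    show "((\<lambda>d. M * cmod d) \<longlongrightarrow> 0) (at 0)" by (intro tendsto_eq_intros) auto
  qed
  then show ?thesis unfolding DERIV_def g_def by (rule LIM_zero_cancel)
qed

text \<open>The mean under the ensemble of the sum over the particles of
  \<open>Ln (x - w) - Ln (x - z)\<close>: the mean of a linear statistic is the trace of its matrix
  in the first \<open>n\<close> polynomials, as in
  \<open>expectation_linear_statistic\<close>.\<close>

definition log_trace :: "nat \<Rightarrow> complex \<Rightarrow> complex \<Rightarrow> complex" where
  "log_trace n w z = (\<Sum>k<n. log_mean (p k * p k) w z)"

lemma log_trace_derivative:
  assumes z: "Im z > 0" and w: "Im w > 0" and n: "n > 0"
  shows "((\<lambda>w. log_trace n w z) has_field_derivative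
    of_real (ra n) * (deriv (P n) w * Q (n - 1) w - deriv (P (n - 1)) w * Q n w)) (at w)"
proof -
  have w0: "Im w \<noteq> 0" using w by simp
  have "((\<lambda>w. log_trace n w z) has_field_derivative (\<Sum>k<n. G k k w)) (at w)"
    unfolding log_trace_def G_def by (intro DERIV_sum log_mean_derivative z w)
  then show ?thesis using kernel_diag_derivative[OF w0 n] G_eq_PQ[OF w0] by simp
qed

lemma P_derivative: "(P k has_field_derivative deriv (P k) z) (at z within S)"
  unfolding P_def by (rule has_field_derivative_at_within, rule holomorphic_derivI[OF holomorphic_cpoly open_UNIV]) auto

text \<open>The Casoratian identity \<open>FF n w w = 1\<close> eliminates \<open>ra n\<close>. What
  remains contains only ratios of consecutive \<open>P\<close> and of consecutive \<open>Q\<close>,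
  whose limits are accessible.\<close>

lemma log_trace_minus_log_P:
  assumes w: "Im w > 0" and n: "n > 0" and Qz: "Q (n - 1) w \<noteq> 0"
  shows "of_real (ra n) * (deriv (P n) w * Q (n - 1) w - deriv (P (n - 1)) w * Q n w) - deriv (P (n - 1)) w / P (n - 1) w
    = deriv (\<lambda>w. P n w / P (n - 1) w) w / (P n w / P (n - 1) w - Q n w / Q (n - 1) w)"
proof -
  have w0: "Im w \<noteq> 0" using w by simp
  have p0: "P (n - 1) w \<noteq> 0" using P_nonzero[OF w0] .
  have W: "of_real (ra n) * (P n w * Q (n - 1) w - P (n - 1) w * Q n w) = 1"
    using FF_diag[OF w0 n] by (simp add: FF_def)
  have du: "deriv (\<lambda>w. P n w / P (n - 1) w) w = (deriv (P n) w * P (n - 1) w - P n w * deriv (P (n - 1)) w) / (P (n - 1) w * P (n - 1) w)"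
    by (intro DERIV_imp_deriv DERIV_divide P_derivative p0)
  have df: "P n w / P (n - 1) w - Q n w / Q (n - 1) w = (P n w * Q (n - 1) w - P (n - 1) w * Q n w) / (P (n - 1) w * Q (n - 1) w)"
    using p0 Qz by (simp add: field_simps)
  have W0: "P n w * Q (n - 1) w - P (n - 1) w * Q n w \<noteq> 0" using W by auto
  have alg: "1 / (U * q - V * s) * (U' * q - V' * s) - V' / V =
    (U' * V - U * V') / (V * V) / ((U * q - V * s) / (V * q))"
    if "V \<noteq> 0" "q \<noteq> 0" "U * q - V * s \<noteq> 0" for U V U' V' q s :: complex
  proof -
    have "1 / (U * q - V * s) * (U' * q - V' * s) - V' / V = ((U' * q - V' * s) * V - V' * (U * q - V * s)) / ((U * q - V * s) * V)"
      by (subst diff_frac_eq[symmetric]) (use that in \<open>auto simp: mult.commute\<close>)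
    also have "(U' * q - V' * s) * V - V' * (U * q - V * s) = q * (U' * V - U * V')" by (simp add: algebra_simps)
    also have "q * (U' * V - U * V') / ((U * q - V * s) * V) = (U' * V - U * V') / (V * V) / ((U * q - V * s) / (V * q))"
      using that by (simp add: mult.commute)
    finally show ?thesis .
  qed
  have r: "of_real (ra n) = 1 / (P n w * Q (n - 1) w - P (n - 1) w * Q n w)" using W W0 by (simp add: field_simps)
  show ?thesis unfolding du df r by (rule alg[OF p0 Qz W0])
qed

end

section \<open>Convergence of the ratios at the mesoscopic scale\<close>

locale mesoscopic = orthonormal_system +
  fixes a b \<beta> \<alpha> x0 :: real
  assumes a: "a > 0" and \<alpha>: "0 < \<alpha>" "\<alpha> < \<beta>" "\<beta> < 1"
    and ra_O: "(\<lambda>n. rec_a \<mu> p n - a) \<in> O(\<lambda>n. real n powr (-\<beta>))"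
    and rb_O: "(\<lambda>n. rec_b \<mu> p n - b) \<in> O(\<lambda>n. real n powr (-\<beta>))"
    and x0: "x0 \<in> {b - 2 * a <..< b + 2 * a}"
begin

text \<open>The root in the upper half-plane of \<open>\<xi> + 1 / \<xi> = (x0 - b) / a\<close>,
  that is \<open>exp (\<i> * \<theta>)\<close> with \<open>x0 = b + 2 * a * cos \<theta>\<close>. It
  is not real because \<open>x0\<close> lies in the open interval.\<close>

definition \<tau> :: complex where
  "\<tau> = Complex ((x0 - b) / (2 * a)) (sqrt (1 - ((x0 - b) / (2 * a))\<^sup>2))"

lemma \<tau>_bound: "((x0 - b) / (2 * a))\<^sup>2 < 1"
proof -
  have "\<bar>(x0 - b) / (2 * a)\<bar> < 1" using x0 a by (auto simp: abs_less_iff field_simps)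
  then show ?thesis by (simp only: abs_square_less_1)
qed

lemma Im_\<tau>: "Im \<tau> > 0" using \<tau>_bound by (simp add: \<tau>_def)

lemma cmod_\<tau>: "cmod \<tau> = 1" using \<tau>_bound by (simp add: \<tau>_def cmod_def)

lemma \<tau>_sum: "\<tau> + cnj \<tau> = of_real ((x0 - b) / a)"
  using a by (simp add: complex_add_cnj) (simp add: \<tau>_def field_simps)

lemma cnj_\<tau>: "1 / \<tau> = cnj \<tau>"
proof -
  have "\<tau> * cnj \<tau> = 1" using cmod_\<tau> by (simp add: complex_norm_square[symmetric])
  moreover have "\<tau> \<noteq> 0" using Im_\<tau> by auto
  ultimately show ?thesis by (simp add: field_simps)
qed

definition zz :: "nat \<Rightarrow> complex \<Rightarrow> complex" where
  "zz n \<omega> = of_real x0 + \<omega> * of_real (real n powr (-\<alpha>))"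

lemma Im_zz: "Im (zz n \<omega>) = Im \<omega> * real n powr (-\<alpha>)" by (simp add: zz_def)

lemma zz_cnj: "zz n (cnj \<omega>) = cnj (zz n \<omega>)" by (simp add: zz_def)

text \<open>An index \<open>k \<ge> n / 2\<close> costs only the factor
  \<open>2 powr \<beta>\<close>, so one rate in \<open>n\<close> serves all indices from
  \<open>n / 2\<close> upwards, including those between \<open>n\<close> and \<open>2 * n\<close>.
  The last conjunct is the smallness condition in \<open>perturbed_recurrence\<close>.\<close>

lemma coefficient_bounds:
  obtains C where "C \<ge> 0" "\<forall>\<^sub>F n in sequentially. \<forall>k. real n / 2 \<le> real k \<longrightarrow>
     \<bar>ra k - a\<bar> \<le> C * real n powr (-\<beta>) \<and> \<bar>rb k - b\<bar> \<le> C * real n powr (-\<beta>) \<and> C * real n powr (-\<beta>) \<le> a / 2"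
proof -
  obtain c1 where c1: "c1 > 0" "\<forall>\<^sub>F n in sequentially. norm (ra n - a) \<le> c1 * norm (real n powr (-\<beta>))"
    using ra_O by (rule landau_o.bigE)
  obtain c2 where c2: "c2 > 0" "\<forall>\<^sub>F n in sequentially. norm (rb n - b) \<le> c2 * norm (real n powr (-\<beta>))"
    using rb_O by (rule landau_o.bigE)
  obtain N where N: "\<And>k. k \<ge> N \<Longrightarrow> \<bar>ra k - a\<bar> \<le> c1 * real k powr (-\<beta>)" "\<And>k. k \<ge> N \<Longrightarrow> \<bar>rb k - b\<bar> \<le> c2 * real k powr (-\<beta>)"
    using eventually_conj[OF c1(2) c2(2)] unfolding eventually_sequentially by auto
  define C where "C = (c1 + c2) * 2 powr \<beta>"
  have C: "C \<ge> 0" using c1 c2 by (simp add: C_def)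
  have "(\<lambda>n. C * real n powr (-\<beta>)) \<longlonglongrightarrow> 0"
    using \<alpha> by (intro tendsto_mult_right_zero tendsto_neg_powr filterlim_real_sequentially) auto
  then have "\<forall>\<^sub>F n in sequentially. C * real n powr (-\<beta>) < a / 2" using a by (intro order_tendstoD(2)) auto
  then have "\<forall>\<^sub>F n in sequentially. \<forall>k. real n / 2 \<le> real k \<longrightarrow>
     \<bar>ra k - a\<bar> \<le> C * real n powr (-\<beta>) \<and> \<bar>rb k - b\<bar> \<le> C * real n powr (-\<beta>) \<and> C * real n powr (-\<beta>) \<le> a / 2"
    using eventually_ge_at_top[of "2 * N + 1"]
  proof eventually_elim
    case (elim n)
    show ?case
    proof (intro allI impI)
      fix k assume k: "real n / 2 \<le> real k"
      have n: "n \<ge> 1" using elim by simp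
      have kN: "k \<ge> N" using k elim by linarith
      have "real k powr (-\<beta>) \<le> (real n / 2) powr (-\<beta>)" using k n \<alpha> by (intro powr_mono2') auto
      also have "\<dots> = 2 powr \<beta> * real n powr (-\<beta>)" using n by (simp add: powr_divide powr_minus field_simps)
      finally have kp: "real k powr (-\<beta>) \<le> 2 powr \<beta> * real n powr (-\<beta>)" .
      have "c1 * real k powr (-\<beta>) \<le> (c1 + c2) * (2 powr \<beta> * real n powr (-\<beta>))"
        "c2 * real k powr (-\<beta>) \<le> (c1 + c2) * (2 powr \<beta> * real n powr (-\<beta>))"
        using c1 c2 kp by (intro mult_mono; simp)+
      then show "\<bar>ra k - a\<bar> \<le> C * real n powr (-\<beta>) \<and> \<bar>rb k - b\<bar> \<le> C * real n powr (-\<beta>) \<and> C * real n powr (-\<beta>) \<le> a / 2"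
        using N[OF kN] elim by (auto simp: C_def)
    qed
  qed
  then show ?thesis using that C by blast
qed

lemma bounded_ra: "bounded (range ra)"
proof -
  obtain C where "C \<ge> 0" and C: "\<forall>\<^sub>F n in sequentially. \<forall>k. real n / 2 \<le> real k \<longrightarrow>
     \<bar>ra k - a\<bar> \<le> C * real n powr (-\<beta>) \<and> \<bar>rb k - b\<bar> \<le> C * real n powr (-\<beta>) \<and> C * real n powr (-\<beta>) \<le> a / 2"
    by (rule coefficient_bounds)
  have "\<forall>\<^sub>F n in sequentially. norm (ra n) \<le> 2 * a"
    using C
  proof eventually_elim
    case (elim n)
    have "real n / 2 \<le> real n" by simp
    with elim have "\<bar>ra n - a\<bar> \<le> a / 2" using order_trans by blast
    then have "\<bar>ra n\<bar> \<le> 2 * a" using a by linarith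
    then show ?case by simp
  qed
  then have "Bseq ra" by (rule BfunI)
  then show ?thesis by (simp add: Bseq_eq_bounded)
qed

end

context mesoscopic
begin

definition UU :: "nat \<Rightarrow> complex \<Rightarrow> complex" where
  "UU n \<omega> = P n (zz n \<omega>) / P (n - 1) (zz n \<omega>)"

definition SS :: "nat \<Rightarrow> complex \<Rightarrow> complex" where
  "SS n \<omega> = Q n (zz n \<omega>) / Q (n - 1) (zz n \<omega>)"

lemma Im_zz_pos: "n > 0 \<Longrightarrow> Im \<omega> > 0 \<Longrightarrow> Im (zz n \<omega>) > 0"
  by (simp add: Im_zz)

lemma scaled_spectral_parameter:
  "(zz n \<omega> - of_real b) / of_real a = \<tau> + cnj \<tau> + \<omega> * of_real (real n powr (-\<alpha>)) / of_real a"
  unfolding \<tau>_sum zz_def by (simp add: add_divide_distrib diff_divide_distrib)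

lemma zz_bound:
  assumes "n > 0" "cmod \<omega> \<le> R"
  shows "cmod (zz n \<omega> - of_real b) \<le> \<bar>x0 - b\<bar> + R"
proof -
  have p: "real n powr (-\<alpha>) \<le> 1" using assms \<alpha> powr_mono[of "-\<alpha>" 0 "real n"] by simp
  have "zz n \<omega> - of_real b = of_real (x0 - b) + \<omega> * of_real (real n powr (-\<alpha>))" by (simp add: zz_def)
  then have "cmod (zz n \<omega> - of_real b) \<le> \<bar>x0 - b\<bar> + cmod (\<omega> * of_real (real n powr (-\<alpha>)))"
    by (metis norm_of_real norm_triangle_ineq)
  also have "cmod (\<omega> * of_real (real n powr (-\<alpha>))) = cmod \<omega> * real n powr (-\<alpha>)" by (simp add: norm_mult)
  also have "\<dots> \<le> R * 1" using assms p by (intro mult_mono) (auto intro: order_trans[OF norm_ge_zero])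
  finally show ?thesis by simp
qed

text \<open>The growing solution is run forward. Uniformity in \<omega> over a truncated half-plane
  is kept for the Cauchy estimate in \<open>UU_derivative_tendsto\<close>.\<close>

lemma UU_tendsto:
  assumes e: "e > 0" and h: "h > 0"
  shows "\<forall>\<^sub>F n in sequentially. \<forall>\<omega>. cmod \<omega> \<le> R \<and> Im \<omega> \<ge> h \<longrightarrow> cmod (UU n \<omega> - \<tau>) < e"
proof -
  obtain C where C: "C \<ge> 0" "\<forall>\<^sub>F n in sequentially. \<forall>k. real n / 2 \<le> real k \<longrightarrow>
     \<bar>ra k - a\<bar> \<le> C * real n powr (-\<beta>) \<and> \<bar>rb k - b\<bar> \<le> C * real n powr (-\<beta>) \<and> C * real n powr (-\<beta>) \<le> a / 2"
    by (rule coefficient_bounds)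
  define B where "B = \<bar>x0 - b\<bar> + \<bar>R\<bar>"
  define C' where "C' = (2 * B / a\<^sup>2 + 4 / a) * C"
  have C': "C' \<ge> 0" using a C by (simp add: C'_def B_def)
  have "h / a > 0" using h a by simp
  note rat = ratio_asymptotics[OF cmod_\<tau> Im_\<tau> this \<alpha> C' e, of "\<bar>R\<bar> / a"]
  show ?thesis
    using rat C(2) eventually_ge_at_top[of 4]
  proof eventually_elim
    case (elim n)
    show ?case
    proof (intro allI impI, elim conjE)
      fix \<omega> assume \<omega>: "cmod \<omega> \<le> R" "Im \<omega> \<ge> h"
      have n4: "n \<ge> 4" using elim by simp
      define z where "z = zz n \<omega>"
      define \<sigma> where "\<sigma> = \<omega> * of_real (real n powr (-\<alpha>)) / of_real a"
      \<comment> \<open>Starting half way keeps every coefficient index at or above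
        \<open>n / 2\<close>, where the error is \<open>O(n powr -\<beta>)\<close>, and leaves at
        least \<open>n / 4\<close> steps once \<open>n \<ge> 4\<close>.\<close>
      define m where "m = n div 2"
      define N where "N = n - 1 - m"
      define y where "y = (\<lambda>j. P (m + j) z)"
      have zI: "Im z > 0" using \<omega> h n4 unfolding z_def by (intro Im_zz_pos) auto
      have N1: "Suc (m + N) = n" using n4 unfolding m_def N_def by simp
      have N2: "real n / 4 \<le> real N"
      proof -
        have "n \<le> 4 * N" using n4 unfolding N_def m_def by presburger
        then have "real n \<le> real (4 * N)" by (rule of_nat_mono)
        then show ?thesis by simp
      qed
      have m2: "real n / 2 \<le> real (m + 1)"
      proof -
        have "n \<le> 2 * (m + 1)" unfolding m_def by presburger
        then have "real n \<le> real (2 * (m + 1))" by (rule of_nat_mono)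
        then show ?thesis by simp
      qed
      have im: "Im (y 1 * cnj (y 0)) \<ge> 0"
      proof -
        have "ra (m + 1) * Im (y 1 * cnj (y 0)) = Im z * (\<Sum>k<m + 1. (cmod (P k z))\<^sup>2)"
          using Im_P_ratio[of "m + 1" z] by (simp add: y_def)
        moreover have "\<dots> \<ge> 0" using zI by (intro mult_nonneg_nonneg sum_nonneg) auto
        ultimately show ?thesis using ra_pos[of "m + 1"] by (metis add_gr_0 less_numeral_extra(1) not_le zero_le_mult_iff)
      qed
      have s1: "cmod \<sigma> \<le> \<bar>R\<bar> / a * real n powr (-\<alpha>)"
      proof -
        have "cmod \<sigma> = cmod \<omega> * real n powr (-\<alpha>) / a" using a by (simp add: \<sigma>_def norm_mult norm_divide)
        also have "\<dots> \<le> \<bar>R\<bar> * real n powr (-\<alpha>) / a" using \<omega> a by (intro divide_right_mono mult_right_mono) auto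
        finally show ?thesis by simp
      qed
      have s2: "Im \<sigma> \<ge> h / a * real n powr (-\<alpha>)"
      proof -
        have "Im \<sigma> = Im \<omega> / a * real n powr (-\<alpha>)" by (simp add: \<sigma>_def Im_divide_of_real)
        also have "\<dots> \<ge> h / a * real n powr (-\<alpha>)" using \<omega> a by (intro mult_right_mono divide_right_mono) auto
        finally show ?thesis .
      qed
      have zB: "cmod (z - of_real b) \<le> B" unfolding z_def B_def using n4 \<omega> by (intro zz_bound) auto
      have rec: "cmod (y (Suc (Suc j)) - (\<tau> + cnj \<tau> + \<sigma>) * y (Suc j) + y j) \<le> C' * real n powr (-\<beta>) * (cmod (y (Suc j)) + cmod (y j))"
        if "j < N" for j
      proof -
        define k where "k = m + 1 + j"
        have k: "real n / 2 \<le> real k" "real n / 2 \<le> real (Suc k)" using m2 unfolding k_def by auto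
        have "cmod (P (Suc k) z - ((z - of_real b) / of_real a) * P k z + P (k - 1) z) \<le> (2 * B / a\<^sup>2 + 4 / a) * (C * real n powr (-\<beta>)) * (cmod (P k z) + cmod (P (k - 1) z))"
          by (rule perturbed_recurrence[OF a _ _ _ _ zB P_Suc[of k z]]) (use elim(2) k in blast)+
        then show ?thesis unfolding z_def scaled_spectral_parameter \<sigma>_def[symmetric] y_def C'_def k_def by (simp add: mult.assoc)
      qed
      have ne: "y N \<noteq> 0 \<or> y (Suc N) \<noteq> 0" using P_nonzero[of z] zI by (simp add: y_def)
      have "y N \<noteq> 0 \<and> cmod (y (Suc N) / y N - \<tau>) < e"
        using elim(1) s1 s2 im N2 ne rec by blast
      moreover have "y (Suc N) / y N = UU n \<omega>"
        unfolding y_def UU_def z_def[symmetric] using N1 by (metis add_Suc_right diff_Suc_1)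
      ultimately show "cmod (UU n \<omega> - \<tau>) < e" by simp
    qed
  qed
qed

text \<open>The functions of the second kind decay, so their recurrence is read backwards
  from index \<open>2n\<close>.\<close>

lemma SS_inverse_tendsto:
  assumes e: "e > 0" and h: "h > 0"
  shows "\<forall>\<^sub>F n in sequentially. \<forall>\<omega>. cmod \<omega> \<le> R \<and> Im \<omega> \<ge> h \<longrightarrow>
    Q n (zz n \<omega>) \<noteq> 0 \<and> cmod (Q (n - 1) (zz n \<omega>) / Q n (zz n \<omega>) - \<tau>) < e"
proof -
  obtain C where C: "C \<ge> 0" "\<forall>\<^sub>F n in sequentially. \<forall>k. real n / 2 \<le> real k \<longrightarrow>
     \<bar>ra k - a\<bar> \<le> C * real n powr (-\<beta>) \<and> \<bar>rb k - b\<bar> \<le> C * real n powr (-\<beta>) \<and> C * real n powr (-\<beta>) \<le> a / 2"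
    by (rule coefficient_bounds)
  define B where "B = \<bar>x0 - b\<bar> + \<bar>R\<bar>"
  define C' where "C' = (2 * B / a\<^sup>2 + 4 / a) * C"
  have C': "C' \<ge> 0" using a C by (simp add: C'_def B_def)
  have "h / a > 0" using h a by simp
  note rat = ratio_asymptotics[OF cmod_\<tau> Im_\<tau> this \<alpha> C' e, of "\<bar>R\<bar> / a"]
  show ?thesis
    using rat C(2) eventually_ge_at_top[of 1]
  proof eventually_elim
    case (elim n)
    show ?case
    proof (intro allI impI, elim conjE)
      fix \<omega> assume \<omega>: "cmod \<omega> \<le> R" "Im \<omega> \<ge> h"
      have n1: "n \<ge> 1" using elim by simp
      define z where "z = zz n \<omega>"
      define \<sigma> where "\<sigma> = \<omega> * of_real (real n powr (-\<alpha>)) / of_real a"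
      \<comment> \<open>The index runs down from \<open>2 * n\<close>, so that \<open>n\<close>
        steps lead to \<open>Q n\<close> and \<open>Q (n - 1)\<close>. In this direction
        \<open>Q\<close> is the growing solution, and \<open>Im_Q_ratio\<close> provides the sign
        condition.\<close>
      define y where "y = (\<lambda>j. Q (2 * n - j) z)"
      have zI: "Im z > 0" using \<omega> h n1 unfolding z_def by (intro Im_zz_pos) auto
      then have z0: "Im z \<noteq> 0" by simp
      have im: "Im (y 1 * cnj (y 0)) \<ge> 0"
        unfolding y_def using Im_Q_ratio[OF zI bounded_ra, of "2 * n"] n1 by simp
      have s1: "cmod \<sigma> \<le> \<bar>R\<bar> / a * real n powr (-\<alpha>)"
      proof -
        have "cmod \<sigma> = cmod \<omega> * real n powr (-\<alpha>) / a" using a by (simp add: \<sigma>_def norm_mult norm_divide)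
        also have "\<dots> \<le> \<bar>R\<bar> * real n powr (-\<alpha>) / a" using \<omega> a by (intro divide_right_mono mult_right_mono) auto
        finally show ?thesis by simp
      qed
      have s2: "Im \<sigma> \<ge> h / a * real n powr (-\<alpha>)"
      proof -
        have "Im \<sigma> = Im \<omega> / a * real n powr (-\<alpha>)" by (simp add: \<sigma>_def Im_divide_of_real)
        also have "\<dots> \<ge> h / a * real n powr (-\<alpha>)" using \<omega> a by (intro mult_right_mono divide_right_mono) auto
        finally show ?thesis .
      qed
      have zB: "cmod (z - of_real b) \<le> B" unfolding z_def B_def using n1 \<omega> by (intro zz_bound) auto
      have rec: "cmod (y (Suc (Suc j)) - (\<tau> + cnj \<tau> + \<sigma>) * y (Suc j) + y j) \<le> C' * real n powr (-\<beta>) * (cmod (y (Suc j)) + cmod (y j))"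
        if "j < n" for j
      proof -
        define k where "k = 2 * n - Suc j"
        have k: "real n / 2 \<le> real k" "real n / 2 \<le> real (Suc k)" "k > 0" using that n1 unfolding k_def by auto
        have kk: "2 * n - j = Suc k" "2 * n - Suc (Suc j) = k - 1" "2 * n - Suc j = k" using that k_def by auto
        have rec': "of_real (ra k) * Q (k - 1) z = (z - of_real (rb (Suc k))) * Q k z - of_real (ra (Suc k)) * Q (Suc k) z"
          using Q_Suc[OF z0, of k] k by simp
        have "cmod (Q (k - 1) z - ((z - of_real b) / of_real a) * Q k z + Q (Suc k) z) \<le> (2 * B / a\<^sup>2 + 4 / a) * (C * real n powr (-\<beta>)) * (cmod (Q k z) + cmod (Q (Suc k) z))"
          by (rule perturbed_recurrence[OF a _ _ _ _ zB rec']) (use elim(2) k in blast)+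
        then show ?thesis unfolding z_def scaled_spectral_parameter \<sigma>_def[symmetric] y_def C'_def kk by (simp add: mult.assoc)
      qed
      \<comment> \<open>The two values cannot both vanish, as the Casoratian \<open>FF n z z\<close>
        equals 1.\<close>
      have ne: "y n \<noteq> 0 \<or> y (Suc n) \<noteq> 0"
      proof (rule ccontr)
        assume "\<not> ?thesis"
        then have "Q n z = 0" "Q (n - 1) z = 0" using n1 by (auto simp: y_def mult_2)
        then have "FF n z z = 0" by (simp add: FF_def)
        then show False using FF_diag[OF z0, of n] n1 by simp
      qed
      have "real n / 4 \<le> real n" by simp
      then have "y n \<noteq> 0 \<and> cmod (y (Suc n) / y n - \<tau>) < e"
        using elim(1) s1 s2 im ne rec by blast
      moreover have "y n = Q n z" "y (Suc n) = Q (n - 1) z" using n1 by (auto simp: y_def mult_2)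
      ultimately show "Q n (zz n \<omega>) \<noteq> 0 \<and> cmod (Q (n - 1) (zz n \<omega>) / Q n (zz n \<omega>) - \<tau>) < e"
        by (simp add: z_def)
    qed
  qed
qed

lemma SS_tendsto:
  assumes e: "e > 0" and h: "h > 0"
  shows "\<forall>\<^sub>F n in sequentially. \<forall>\<omega>. cmod \<omega> \<le> R \<and> Im \<omega> \<ge> h \<longrightarrow>
    Q (n - 1) (zz n \<omega>) \<noteq> 0 \<and> cmod (SS n \<omega> - cnj \<tau>) < e"
proof -
  define d where "d = min (1/2) (e / 2)"
  have d: "d > 0" using e by (simp add: d_def)
  show ?thesis
    using SS_inverse_tendsto[OF d h, of R]
  proof eventually_elim
    case (elim n)
    show ?case
    proof (intro allI impI)
      fix \<omega> assume \<omega>: "cmod \<omega> \<le> R \<and> Im \<omega> \<ge> h"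
      define v where "v = Q (n - 1) (zz n \<omega>) / Q n (zz n \<omega>)"
      have v: "Q n (zz n \<omega>) \<noteq> 0" "cmod (v - \<tau>) < d" using elim \<omega> by (auto simp: v_def)
      have v2: "cmod v > 1 / 2" using norm_triangle_ineq2[of \<tau> "\<tau> - v"] v(2) cmod_\<tau> by (simp add: d_def norm_minus_commute)
      then have v0: "v \<noteq> 0" by auto
      then have Q0: "Q (n - 1) (zz n \<omega>) \<noteq> 0" by (auto simp: v_def)
      have t0: "\<tau> \<noteq> 0" using cmod_\<tau> by auto
      have "SS n \<omega> - cnj \<tau> = 1 / v - 1 / \<tau>" by (simp add: SS_def v_def cnj_\<tau>)
      also have "\<dots> = (\<tau> - v) / (v * \<tau>)" using v0 t0 by (simp add: field_simps)
      finally have "cmod (SS n \<omega> - cnj \<tau>) = cmod (v - \<tau>) / cmod v" using cmod_\<tau> by (simp add: norm_divide norm_mult norm_minus_commute)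
      also have "\<dots> \<le> cmod (v - \<tau>) / (1 / 2)" using v2 v0 by (intro divide_left_mono) auto
      also have "\<dots> < e" using v(2) by (simp add: d_def)
      finally show "Q (n - 1) (zz n \<omega>) \<noteq> 0 \<and> cmod (SS n \<omega> - cnj \<tau>) < e" using Q0 by simp
    qed
  qed
qed

section \<open>Comparison of the logarithmic trace with the logarithm of
  \<open>P (n - 1)\<close>\<close>

lemma zz_derivative: "(zz n has_field_derivative of_real (real n powr (-\<alpha>))) (at \<omega> within S)"
  unfolding zz_def by (auto intro!: derivative_eq_intros)

lemma ratio_derivative:
  assumes "Im z > 0"
  shows "((\<lambda>z. P n z / P (n - 1) z) has_field_derivative deriv (\<lambda>z. P n z / P (n - 1) z) z) (at z)"
proof -
  have "((\<lambda>z. P n z / P (n - 1) z) has_field_derivative ((deriv (P n) z * P (n - 1) z - P n z * deriv (P (n - 1)) z) / (P (n - 1) z * P (n - 1) z))) (at z)"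
    using assms P_nonzero[of z "n - 1"] by (intro DERIV_divide P_derivative) auto
  then show ?thesis by (metis DERIV_imp_deriv)
qed

lemma UU_derivative:
  assumes "n > 0" "Im \<omega> > 0"
  shows "(UU n has_field_derivative deriv (\<lambda>z. P n z / P (n - 1) z) (zz n \<omega>) * of_real (real n powr (-\<alpha>))) (at \<omega>)"
  unfolding UU_def[abs_def]
  by (rule DERIV_chain2[where f = "\<lambda>z. P n z / P (n - 1) z"]) (intro ratio_derivative Im_zz_pos assms zz_derivative)+

text \<open>Cauchy's inequality on a disc of radius \<open>h / 2\<close>, on which
  \<open>UU n\<close> is uniformly close to the constant \<tau>.\<close>

lemma UU_derivative_tendsto:
  assumes e: "e > 0" and h: "h > 0"
  shows "\<forall>\<^sub>F n in sequentially. \<forall>\<omega>. cmod \<omega> \<le> R \<and> Im \<omega> \<ge> h \<longrightarrow>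
    cmod (deriv (\<lambda>z. P n z / P (n - 1) z) (zz n \<omega>) * of_real (real n powr (-\<alpha>))) < e"
proof -
  define r where "r = h / 2"
  have r: "r > 0" using h by (simp add: r_def)
  define d where "d = e * r / 2"
  have d: "d > 0" using e r by (simp add: d_def)
  show ?thesis
    using UU_tendsto[OF d r, of "R + r"] eventually_gt_at_top[of 0]
  proof eventually_elim
    case (elim n)
    show ?case
    proof (intro allI impI, elim conjE)
      fix \<omega> assume \<omega>: "cmod \<omega> \<le> R" "Im \<omega> \<ge> h"
      have in_range: "cmod w \<le> R + r" "Im w \<ge> r" if "w \<in> cball \<omega> r" for w
      proof -
        have "cmod (w - \<omega>) \<le> r" using that by (simp add: dist_norm norm_minus_commute)
        then show "cmod w \<le> R + r" using \<omega> norm_triangle_sub[of w \<omega>] by linarith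
        show "Im w \<ge> r" using \<open>cmod (w - \<omega>) \<le> r\<close> abs_Im_le_cmod[of "w - \<omega>"] \<omega> by (simp add: r_def)
      qed
      have hol: "(\<lambda>w. UU n w - \<tau>) holomorphic_on cball \<omega> r"
      proof (rule holomorphic_on_diff)
        have "UU n field_differentiable at w within cball \<omega> r" if "w \<in> cball \<omega> r" for w
        proof -
          have "Im w > 0" using in_range(2)[OF that] r by linarith
          then have "UU n field_differentiable at w"
            using UU_derivative[OF elim(2)] unfolding field_differentiable_def by blast
          then show ?thesis by (rule field_differentiable_at_within)
        qed
        then show "UU n holomorphic_on cball \<omega> r" by (simp add: holomorphic_on_def)
      qed simp
      have "cmod ((deriv ^^ 1) (\<lambda>w. UU n w - \<tau>) \<omega>) \<le> fact 1 * d / r ^ 1"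
      proof (rule Cauchy_inequality)
        show "(\<lambda>w. UU n w - \<tau>) holomorphic_on ball \<omega> r" using hol by (rule holomorphic_on_subset) auto
        show "continuous_on (cball \<omega> r) (\<lambda>w. UU n w - \<tau>)" using hol by (rule holomorphic_on_imp_continuous_on)
        show "cmod (UU n x - \<tau>) \<le> d" if "cmod (\<omega> - x) = r" for x
        proof -
          have "x \<in> cball \<omega> r" using that by (simp add: dist_norm)
          then show ?thesis using elim(1) in_range[of x] by (meson less_imp_le)
        qed
      qed (use r in auto)
      moreover have "((\<lambda>w. UU n w - \<tau>) has_field_derivative deriv (\<lambda>z. P n z / P (n - 1) z) (zz n \<omega>) * of_real (real n powr (-\<alpha>)) - 0) (at \<omega>)"
        using \<omega> h elim by (intro DERIV_diff UU_derivative DERIV_const) auto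
      then have "deriv (\<lambda>w. UU n w - \<tau>) \<omega> = deriv (\<lambda>z. P n z / P (n - 1) z) (zz n \<omega>) * of_real (real n powr (-\<alpha>))"
        by (simp add: DERIV_imp_deriv)
      ultimately have "cmod (deriv (\<lambda>z. P n z / P (n - 1) z) (zz n \<omega>) * of_real (real n powr (-\<alpha>))) \<le> d / r" by simp
      also have "\<dots> < e" using e r by (simp add: d_def)
      finally show "cmod (deriv (\<lambda>z. P n z / P (n - 1) z) (zz n \<omega>) * of_real (real n powr (-\<alpha>))) < e" .
    qed
  qed
qed

text \<open>Both sides have logarithmic derivatives in \<open>\<omega>\<close> that differ by
  the derivative of \<open>UU\<close> over \<open>UU - SS\<close>, which tends to 0.\<close>

lemma log_trace_asymptotics:
  assumes e: "e > 0" and h: "h > 0"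
  shows "\<forall>\<^sub>F n in sequentially. \<forall>\<omega> \<omega>'. cmod \<omega> \<le> R \<and> Im \<omega> \<ge> h \<and> cmod \<omega>' \<le> R \<and> Im \<omega>' \<ge> h \<longrightarrow>
    (\<exists>\<delta>. cmod \<delta> \<le> e \<and> exp (log_trace n (zz n \<omega>) (zz n \<omega>')) = P (n - 1) (zz n \<omega>) / P (n - 1) (zz n \<omega>') * exp \<delta>)"
proof -
  define R' where "R' = \<bar>R\<bar> + 1"
  have R': "R' > 0" by (simp add: R'_def)
  \<comment> \<open>Chosen so that \<open>d / Im \<tau>\<close>, which bounds the derivative
    \<open>k\<close>, times the diameter bound \<open>2 * R'\<close> equals
    \<open>e\<close>.\<close>
  define d where "d = e * Im \<tau> / (2 * R')"
  have d: "d > 0" using e Im_\<tau> R' by (simp add: d_def)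
  have im2: "Im \<tau> / 2 > 0" using Im_\<tau> by simp
  show ?thesis
    using UU_derivative_tendsto[OF d h, of R] UU_tendsto[OF im2 h, of R] SS_tendsto[OF im2 h, of R] eventually_gt_at_top[of 0]
  proof eventually_elim
    case (elim n)
    show ?case
    proof (intro allI impI, elim conjE)
      fix \<omega> \<omega>' assume \<omega>: "cmod \<omega> \<le> R" "Im \<omega> \<ge> h" and \<omega>': "cmod \<omega>' \<le> R" "Im \<omega>' \<ge> h"
      define S where "S = {w. Im w \<ge> h} \<inter> cball 0 R"
      have cS: "convex S" unfolding S_def by (intro convex_Int convex_cball convex_Im_ge)
      have conv: "convex {z. Im z > 0}" by (rule convex_halfspace_Im_gt)
      have op: "open {z. Im z > 0}" by (rule open_halfspace_Im_gt)
      \<comment> \<open>\<open>P (n - 1)\<close> has no zeros in the upper half-plane, which is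
        simply connected, so it has a holomorphic logarithm there. The choice of branch disappears
        after exponentiation.\<close>
      obtain lp where lp: "lp holomorphic_on {z. Im z > 0}" "\<And>z. Im z > 0 \<Longrightarrow> P (n - 1) z = exp (lp z)"
      proof -
        have "simply_connected {z. Im z > 0}" using conv by (rule convex_imp_simply_connected)
        moreover have "P (n - 1) holomorphic_on {z. Im z > 0}" unfolding P_def by (rule holomorphic_cpoly)
        ultimately obtain g where "g holomorphic_on {z. Im z > 0}" "\<And>z. z \<in> {z. Im z > 0} \<Longrightarrow> P (n - 1) z = exp (g z)"
          using P_nonzero simply_connected_eq_holomorphic_log[OF op] by (metis (mono_tags, lifting) less_irrefl mem_Collect_eq)
        then show ?thesis using that by auto
      qed
      have lpd: "(lp has_field_derivative deriv (P (n - 1)) z / P (n - 1) z) (at z)" if z: "Im z > 0" for z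
      proof -
        have d1: "(lp has_field_derivative deriv lp z) (at z)"
          using lp(1) op z by (intro holomorphic_derivI) auto
        then have "((\<lambda>z. exp (lp z)) has_field_derivative exp (lp z) * deriv lp z) (at z)"
          by (intro DERIV_chain2[where f = exp] DERIV_exp)
        then have "(P (n - 1) has_field_derivative exp (lp z) * deriv lp z) (at z)"
          by (rule has_field_derivative_transform_within_open[OF _ op]) (use z lp(2) in auto)
        then have "deriv (P (n - 1)) z = P (n - 1) z * deriv lp z" using lp(2)[OF z] by (simp add: DERIV_imp_deriv)
        then show ?thesis using d1 lp(2)[OF z] by simp
      qed
      define F where "F = (\<lambda>w. log_trace n (zz n w) (zz n \<omega>') - lp (zz n w))"
      define k where "k = (\<lambda>w. deriv (\<lambda>z. P n z / P (n - 1) z) (zz n w) * of_real (real n powr (-\<alpha>)) / (UU n w - SS n w))"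
      have Sin: "cmod w \<le> R" "Im w \<ge> h" "Im w > 0" if "w \<in> S" for w using that h by (auto simp: S_def)
      have dF: "(F has_field_derivative k w) (at w within S)" if w: "w \<in> S" for w
      proof -
        have z: "Im (zz n w) > 0" using Sin[OF w] elim by (intro Im_zz_pos) auto
        have z': "Im (zz n \<omega>') > 0" using \<omega>' h elim by (intro Im_zz_pos) auto
        have Qz: "Q (n - 1) (zz n w) \<noteq> 0" using elim(3) Sin[OF w] by blast
        have "((\<lambda>z. log_trace n z (zz n \<omega>') - lp z) has_field_derivative
          of_real (ra n) * (deriv (P n) (zz n w) * Q (n - 1) (zz n w) - deriv (P (n - 1)) (zz n w) * Q n (zz n w)) - deriv (P (n - 1)) (zz n w) / P (n - 1) (zz n w)) (at (zz n w))"
          using elim by (intro DERIV_diff log_trace_derivative lpd z z') auto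
        then have "((\<lambda>z. log_trace n z (zz n \<omega>') - lp z) has_field_derivative
          deriv (\<lambda>w. P n w / P (n - 1) w) (zz n w) / (UU n w - SS n w)) (at (zz n w))"
          using elim by (subst (asm) log_trace_minus_log_P[OF z _ Qz]) (auto simp: UU_def SS_def)
        from DERIV_chain2[OF this zz_derivative[of n w S]] show ?thesis unfolding F_def k_def by simp
      qed
      have bk: "cmod (k w) \<le> e / (2 * R')" if w: "w \<in> S" for w
      proof -
        have u: "cmod (UU n w - \<tau>) < Im \<tau> / 2" and s: "cmod (SS n w - cnj \<tau>) < Im \<tau> / 2"
          using elim(2,3) Sin[OF w] by blast+
        \<comment> \<open>The limits \<tau> and \<open>cnj \<tau>\<close> differ by
          \<open>2 * Im \<tau>\<close> in the imaginary part, and each quantity is off by less than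
          \<open>Im \<tau> / 2\<close>.\<close>
        have "Im (UU n w - SS n w) \<ge> Im \<tau>"
          using abs_Im_le_cmod[of "UU n w - \<tau>"] abs_Im_le_cmod[of "SS n w - cnj \<tau>"] u s by simp
        then have us: "Im \<tau> \<le> cmod (UU n w - SS n w)" using abs_Im_le_cmod[of "UU n w - SS n w"] by linarith
        then have us0: "cmod (UU n w - SS n w) > 0" using Im_\<tau> by linarith
        have "cmod (k w) \<le> d / cmod (UU n w - SS n w)"
          unfolding k_def norm_divide using elim(1) Sin[OF w] by (intro divide_right_mono) (auto intro: less_imp_le)
        also have "\<dots> \<le> d / Im \<tau>" using us us0 d Im_\<tau> by (intro divide_left_mono) auto
        also have "\<dots> = e / (2 * R')" using Im_\<tau> by (simp add: d_def)
        finally show ?thesis .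
      qed
      have wS: "\<omega> \<in> S" "\<omega>' \<in> S" using \<omega> \<omega>' by (auto simp: S_def)
      have "cmod (F \<omega> - F \<omega>') \<le> e / (2 * R') * cmod (\<omega> - \<omega>')"
        by (rule field_differentiable_bound[OF cS dF bk wS])
      also have "\<dots> \<le> e / (2 * R') * (2 * R')"
        using \<omega> \<omega>' norm_triangle_ineq4[of \<omega> \<omega>'] e R' by (intro mult_left_mono) (auto simp: R'_def)
      also have "\<dots> = e" using R' by simp
      finally have F: "cmod (F \<omega> - F \<omega>') \<le> e" .
      have lt0: "log_trace n (zz n \<omega>') (zz n \<omega>') = 0" by (simp add: log_trace_def log_mean_def)
      have "log_trace n (zz n \<omega>) (zz n \<omega>') = lp (zz n \<omega>) - lp (zz n \<omega>') + (F \<omega> - F \<omega>')"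
        by (simp add: F_def lt0)
      then have "exp (log_trace n (zz n \<omega>) (zz n \<omega>')) = exp (lp (zz n \<omega>)) / exp (lp (zz n \<omega>')) * exp (F \<omega> - F \<omega>')"
        by (simp only: exp_add exp_diff)
      also have "\<dots> = P (n - 1) (zz n \<omega>) / P (n - 1) (zz n \<omega>') * exp (F \<omega> - F \<omega>')"
        using lp(2) Im_zz_pos \<omega> \<omega>' h elim by simp
      finally show "\<exists>\<delta>. cmod \<delta> \<le> e \<and> exp (log_trace n (zz n \<omega>) (zz n \<omega>')) = P (n - 1) (zz n \<omega>) / P (n - 1) (zz n \<omega>') * exp \<delta>"
        using F by blast
    qed
  qed
qed

end

subsection \<open>Determinantal formulas for the ensemble\<close>

definition dt :: "nat \<Rightarrow> (nat \<Rightarrow> nat \<Rightarrow> 'a::field) \<Rightarrow> 'a" where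
  "dt n f = Determinant.det (Matrix.mat n n (\<lambda>(i,j). f i j))"

lemma dt_cong: "(\<And>i j. i < n \<Longrightarrow> j < n \<Longrightarrow> f i j = g i j) \<Longrightarrow> dt n f = dt n g"
  unfolding dt_def by (intro arg_cong[of _ _ Determinant.det] eq_matI) auto

lemma dt_leibniz: "dt n f = (\<Sum>\<pi> | \<pi> permutes {..<n}. of_int (sign \<pi>) * (\<Prod>j<n. f (\<pi> j) j))"
proof -
  have "(\<Prod>j<n. Matrix.mat n n (\<lambda>(i,j). f i j) $$ (\<pi> j, j)) = (\<Prod>j<n. f (\<pi> j) j)" if "\<pi> permutes {0..<n}" for \<pi>
  proof (intro prod.cong refl)
    fix j assume "j \<in> {..<n}"
    then have "\<pi> j < n" using permutes_in_image[OF that, of j] by auto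
    then show "Matrix.mat n n (\<lambda>(i,j). f i j) $$ (\<pi> j, j) = f (\<pi> j) j" using \<open>j \<in> {..<n}\<close> by simp
  qed
  then show ?thesis unfolding dt_def by (subst det_col[of _ n]) (auto simp: lessThan_atLeast0 intro!: sum.cong)
qed

lemma dt_transpose: "dt n (\<lambda>i j. f j i) = dt n f"
proof -
  have "Matrix.mat n n (\<lambda>(i,j). f j i) = transpose_mat (Matrix.mat n n (\<lambda>(i,j). f i j))" by (intro eq_matI) auto
  then show ?thesis unfolding dt_def by (simp add: det_transpose[of _ n])
qed

lemma dt_permute_rows:
  assumes p: "\<pi> permutes {..<n}"
  shows "dt n (\<lambda>i j. f (\<pi> i) j) = of_int (sign \<pi>) * dt n f"
proof -
  have p': "\<pi> permutes {0..<n}" using p by (simp add: lessThan_atLeast0)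
  have "Matrix.mat n n (\<lambda>(i,j). f (\<pi> i) j) = Matrix.mat n n (\<lambda>(i,j). Matrix.mat n n (\<lambda>(i,j). f i j) $$ (\<pi> i, j))"
    using permutes_in_image[OF p'] by (intro eq_matI) auto
  then show ?thesis unfolding dt_def by (simp add: det_permute_rows[OF _ p'])
qed

lemma dt_permute_cols:
  assumes p: "\<pi> permutes {..<n}"
  shows "dt n (\<lambda>i j. f i (\<pi> j)) = of_int (sign \<pi>) * dt n f"
  using dt_permute_rows[OF p, of "\<lambda>i j. f j i"] dt_transpose[of n f] dt_transpose[of n "\<lambda>i j. f i (\<pi> j)"] by simp

lemma dt_scale_cols: "dt n (\<lambda>i j. f i j * d j) = dt n f * (\<Prod>j<n. d j)"
  unfolding dt_leibniz by (simp add: prod.distrib sum_distrib_right mult.assoc)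

lemma dt_scale_rows: "dt n (\<lambda>i j. c i * f i j) = (\<Prod>i<n. c i) * dt n f"
  using dt_scale_cols[of n "\<lambda>i j. f j i" c] dt_transpose[of n f] dt_transpose[of n "\<lambda>i j. f j i * c j"]
  by (simp add: mult.commute)

lemma dt_mult: "dt n (\<lambda>i j. \<Sum>k<n. f i k * g k j) = dt n f * dt n g"
proof -
  have "Matrix.mat n n (\<lambda>(i,j). \<Sum>k<n. f i k * g k j) = Matrix.mat n n (\<lambda>(i,j). f i j) * Matrix.mat n n (\<lambda>(i,j). g i j)"
    by (intro eq_matI) (auto simp: scalar_prod_def lessThan_atLeast0)
  then show ?thesis unfolding dt_def by (simp add: det_mult[of _ n])
qed

lemma dt_upper: "(\<And>i j. i < n \<Longrightarrow> j < i \<Longrightarrow> f i j = 0) \<Longrightarrow> dt n f = (\<Prod>i<n. f i i)"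
  unfolding dt_def
  by (subst det_upper_triangular[of _ n]) (auto simp: prod_list_diag_prod lessThan_atLeast0 upper_triangular_def)

lemma dt_lower: "(\<And>i j. j < n \<Longrightarrow> i < j \<Longrightarrow> f i j = 0) \<Longrightarrow> dt n f = (\<Prod>i<n. f i i)"
  using dt_upper[of n "\<lambda>i j. f j i"] dt_transpose[of n f] by auto

lemma dt_block_upper:
  assumes "\<And>i j. N \<le> i \<Longrightarrow> i < N + n \<Longrightarrow> j < N \<Longrightarrow> f i j = 0"
  shows "dt (N + n) f = dt N f * dt n (\<lambda>i j. f (N + i) (N + j))"
proof -
  have "Matrix.mat (N + n) (N + n) (\<lambda>(i,j). f i j) = four_block_mat (Matrix.mat N N (\<lambda>(i,j). f i j))
    (Matrix.mat N n (\<lambda>(i,j). f i (N + j))) (0\<^sub>m n N) (Matrix.mat n n (\<lambda>(i,j). f (N + i) (N + j)))"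
    by (intro eq_matI) (auto simp: four_block_mat_def assms)
  then show ?thesis unfolding dt_def by (simp add: det_four_block_mat_lower_left_zero[of _ N _ n])
qed

lemma sum_lessThan_add: "(\<Sum>j<N + n. g j) = (\<Sum>j<N. g j) + (\<Sum>k<n. g (N + k :: nat) :: 'a::comm_monoid_add)"
  by (induction n) (simp_all add: add.assoc)

lemma prod_lessThan_add: "(\<Prod>j<N + n. g j) = (\<Prod>j<N. g j) * (\<Prod>k<n. g (N + k :: nat) :: 'a::comm_monoid_mult)"
  by (induction n) (simp_all add: mult.assoc)

text \<open>Right multiplication by the unit lower triangular \<open>g\<close> clears the lower left
  block, because the lower right block is the identity; the Schur complement is what then stands in
  the upper left.\<close>

lemma dt_schur:
  assumes id: "\<And>i j. i < n \<Longrightarrow> j < n \<Longrightarrow> f (N + i) (N + j) = (if i = j then 1 else 0)"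
  shows "dt (N + n) f = dt N (\<lambda>k l. f k l - (\<Sum>j<n. f k (N + j) * f (N + j) l))"
proof -
  define g :: "nat \<Rightarrow> nat \<Rightarrow> 'a" where "g = (\<lambda>i j. if i = j then 1 else if N \<le> i \<and> j < N then - f i j else 0)"
  have "dt (N + n) g = (\<Prod>i<N + n. g i i)" by (rule dt_lower) (auto simp: g_def)
  then have g1: "dt (N + n) g = 1" by (simp add: g_def)
  define h where "h = (\<lambda>i j. \<Sum>k<N + n. f i k * g k j)"
  have hs: "h i j = (\<Sum>k<N. f i k * g k j) + (\<Sum>k<n. f i (N + k) * g (N + k) j)" for i j
    by (simp add: h_def sum_lessThan_add)
  have h1: "h i j = f i j - (\<Sum>k<n. f i (N + k) * f (N + k) j)" if "j < N" for i j
  proof -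
    have "(\<Sum>k<N. f i k * g k j) = (\<Sum>k<N. if k = j then f i k else 0)" by (intro sum.cong) (auto simp: g_def)
    moreover have "(\<Sum>k<n. f i (N + k) * g (N + k) j) = (\<Sum>k<n. - (f i (N + k) * f (N + k) j))"
      using that by (intro sum.cong) (auto simp: g_def)
    ultimately show ?thesis using that by (simp add: hs sum_negf)
  qed
  have h2: "h i (N + j) = f i (N + j)" if "j < n" for i j
  proof -
    have "(\<Sum>k<N. f i k * g k (N + j)) = 0" by (intro sum.neutral) (auto simp: g_def)
    moreover have "(\<Sum>k<n. f i (N + k) * g (N + k) (N + j)) = (\<Sum>k<n. if k = j then f i (N + k) else 0)"
      by (intro sum.cong) (auto simp: g_def)
    ultimately show ?thesis using that by (simp add: hs)
  qed
  have "dt (N + n) f = dt (N + n) h" unfolding h_def dt_mult g1 by simp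
  also have "\<dots> = dt N h * dt n (\<lambda>i j. h (N + i) (N + j))"
  proof (rule dt_block_upper)
    fix i j assume i: "N \<le> i" "i < N + n" and j: "j < N"
    define i' where "i' = i - N"
    have i': "i = N + i'" "i' < n" using i by (auto simp: i'_def)
    have "(\<Sum>k<n. f i (N + k) * f (N + k) j) = (\<Sum>k<n. if k = i' then f (N + k) j else 0)"
      using i' id by (intro sum.cong) auto
    then show "h i j = 0" using j i' by (simp add: h1)
  qed
  also have "dt n (\<lambda>i j. h (N + i) (N + j)) = dt n (\<lambda>i j. if i = j then 1 else 0)"
    by (intro dt_cong) (auto simp: h2 id)
  also have "\<dots> = 1" by (subst dt_upper) auto
  finally show ?thesis using h1 by (simp cong: dt_cong)
qed

section \<open>Vandermonde and Cauchy determinants\<close>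

definition vdm :: "nat \<Rightarrow> (nat \<Rightarrow> 'a::field) \<Rightarrow> 'a" where
  "vdm n t = (\<Prod>j<n. \<Prod>i<j. (t j - t i))"

lemma poly_eq_sum_lessThan: "degree q < n \<Longrightarrow> poly q (t::'a::field) = (\<Sum>c<n. coeff q c * t ^ c)"
proof -
  assume "degree q < n"
  then have "(\<Sum>c<n. coeff q c * t ^ c) = (\<Sum>c\<le>degree q. coeff q c * t ^ c)"
    by (intro sum.mono_neutral_right) (auto simp: coeff_eq_0)
  then show ?thesis by (simp add: poly_altdef)
qed

lemma dt_poly_factor:
  assumes "\<And>a. a < n \<Longrightarrow> degree (q a) < n"
  shows "dt n (\<lambda>a b. poly (q a) (t b)) = dt n (\<lambda>a c. coeff (q a) c) * dt n (\<lambda>c b. t b ^ c)"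
proof -
  have "dt n (\<lambda>a b. poly (q a) (t b)) = dt n (\<lambda>a b. \<Sum>c<n. coeff (q a) c * t b ^ c)"
    by (intro dt_cong poly_eq_sum_lessThan assms)
  then show ?thesis by (simp only: dt_mult)
qed

text \<open>The Newton basis \<open>q\<close> has a unit triangular coefficient matrix and a
  triangular matrix of values at the nodes, so \<open>dt_poly_factor\<close> yields the determinant
  without induction.\<close>

lemma dt_powers: "dt n (\<lambda>c b. t b ^ c) = vdm n t"
proof -
  define q where "q = (\<lambda>c. \<Prod>a<c. [:- t a, 1:])"
  have dq: "degree (q c) = c" for c unfolding q_def by (subst degree_prod_eq_sum_degree) auto
  have lq: "coeff (q c) c = 1" for c
  proof -
    have "lead_coeff (q c) = 1" unfolding q_def by (simp add: lead_coeff_prod)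
    then show ?thesis by (simp add: dq)
  qed
  have "dt n (\<lambda>a b. poly (q a) (t b)) = (\<Prod>i<n. poly (q i) (t i))"
    by (rule dt_upper) (auto simp: q_def poly_prod)
  moreover have "dt n (\<lambda>a c. coeff (q a) c) = (\<Prod>i<n. coeff (q i) i)"
    by (rule dt_lower) (auto simp: dq coeff_eq_0)
  ultimately show ?thesis
    using dt_poly_factor[of n q t] by (simp add: dq lq vdm_def) (simp add: q_def poly_prod)
qed

lemma dt_poly:
  assumes "\<And>a. a < n \<Longrightarrow> degree (q a) < n"
  shows "dt n (\<lambda>a b. poly (q a) (t b)) = dt n (\<lambda>a c. coeff (q a) c) * vdm n t"
  using dt_poly_factor[OF assms] by (simp add: dt_powers)

lemma vdm_add:
  "vdm (N + n) t = vdm N t * vdm n (\<lambda>j. t (N + j)) * (\<Prod>j<n. \<Prod>l<N. (t (N + j) - t l))"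
  unfolding vdm_def by (simp add: prod_lessThan_add prod.distrib mult_ac)

text \<open>Multiplying column \<open>b\<close> by the product of all \<open>z k - t b\<close> turns
  every row into values of a polynomial of degree below \<open>N + n\<close>, so the determinant is
  a constant times the Vandermonde product of the nodes, and the constant is found at special nodes.
  Both sides carry a factor \<open>R\<close>, so that the identity survives coinciding nodes;
  \<open>R\<^sup>2\<close> is the form in which the density of the ensemble will appear.\<close>

lemma cauchy_vandermonde:
  fixes z t :: "nat \<Rightarrow> 'a::field" and r :: "nat \<Rightarrow> 'a poly"
  assumes dr: "\<And>i. i < n \<Longrightarrow> degree (r i) < n"
    and zt: "\<And>k b. k < N \<Longrightarrow> b < N + n \<Longrightarrow> z k \<noteq> t b"
  defines "R \<equiv> dt n (\<lambda>i j. poly (r i) (t (N + j)))"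
  shows "dt (N + n) (\<lambda>a b. if a < N then 1 / (z a - t b) else poly (r (a - N)) (t b)) * R
      * (\<Prod>l<N. \<Prod>k<N. (z k - t l)) * vdm N z
    = (\<Prod>k<N. \<Prod>k'\<in>{..<N} - {k}. (z k' - z k)) * vdm N t * R\<^sup>2 * (\<Prod>j<n. \<Prod>k<N. (t (N + j) - t k) / (t (N + j) - z k))"
proof -
  define \<Psi> where "\<Psi> = (\<lambda>a b. if a < N then 1 / (z a - t b) else poly (r (a - N)) (t b))"
  define Wp where "Wp = (\<lambda>s. \<Prod>k<N. (z k - s))"
  define q where "q = (\<lambda>a. if a < N then \<Prod>k'\<in>{..<N} - {a}. [:z k', -1:] else r (a - N) * (\<Prod>k<N. [:z k, -1:]))"
  define E where "E = (\<Prod>k<N. \<Prod>k'\<in>{..<N} - {k}. (z k' - z k))"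
  define x where "x = (\<lambda>j. t (N + j))"
  have dq: "degree (q a) < N + n" if a: "a < N + n" for a
  proof (cases "a < N")
    case True
    have "degree (q a) \<le> N - 1"
      unfolding q_def using True degree_prod_sum_le[of "{..<N} - {a}" "\<lambda>k'. [:z k', -1:]"] by simp
    then show ?thesis using True by simp
  next
    case False
    have d: "degree (\<Prod>k<N. [:z k, -1:]) \<le> N"
      using degree_prod_sum_le[of "{..<N}" "\<lambda>k. [:z k, -1:]"] by simp
    have "degree (q a) \<le> degree (r (a - N)) + degree (\<Prod>k<N. [:z k, -1:])"
      unfolding q_def using False by (simp add: degree_mult_le)
    moreover have "degree (r (a - N)) < n" using a False by (intro dr) linarith
    ultimately show ?thesis using d by linarith
  qed
  have qv: "poly (q a) s = (if a < N then \<Prod>k'\<in>{..<N} - {a}. (z k' - s) else poly (r (a - N)) s * Wp s)" for a s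
    by (simp add: q_def Wp_def poly_prod)
  have A1: "dt (N + n) (\<lambda>a b. poly (q a) (t b)) = dt (N + n) \<Psi> * (\<Prod>b<N + n. Wp (t b))"
  proof -
    have "dt (N + n) (\<lambda>a b. poly (q a) (t b)) = dt (N + n) (\<lambda>a b. \<Psi> a b * Wp (t b))"
    proof (intro dt_cong)
      fix a b assume "a < N + n" and b: "b < N + n"
      show "poly (q a) (t b) = \<Psi> a b * Wp (t b)"
      proof (cases "a < N")
        case True
        then have "Wp (t b) = (z a - t b) * (\<Prod>k'\<in>{..<N} - {a}. (z k' - t b))"
          unfolding Wp_def by (subst prod.remove[of _ a]) auto
        then show ?thesis using True zt[OF True b] by (simp add: qv \<Psi>_def)
      qed (simp add: qv \<Psi>_def)
    qed
    then show ?thesis by (simp only: dt_scale_cols)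
  qed
  \<comment> \<open>With the poles as first \<open>N\<close> nodes the matrix of values becomes
    block triangular, since the rows \<open>a \<ge> N\<close> contain the factor \<open>Wp\<close>,
    which vanishes at every pole.\<close>
  define t' where "t' = (\<lambda>b. if b < N then z b else t b)"
  have t'x: "t' (N + j) = x j" for j by (simp add: t'_def x_def)
  have A2: "dt (N + n) (\<lambda>a b. poly (q a) (t' b)) = E * (R * (\<Prod>j<n. Wp (x j)))"
  proof -
    have "dt (N + n) (\<lambda>a b. poly (q a) (t' b)) = dt N (\<lambda>a b. poly (q a) (t' b)) * dt n (\<lambda>i j. poly (q (N + i)) (t' (N + j)))"
      by (rule dt_block_upper) (auto simp: qv t'_def Wp_def)
    also have "dt N (\<lambda>a b. poly (q a) (t' b)) = (\<Prod>a<N. poly (q a) (t' a))"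
      by (rule dt_upper) (auto simp: qv t'_def intro!: prod_zero)
    also have "\<dots> = E" by (simp add: qv t'_def E_def)
    also have "dt n (\<lambda>i j. poly (q (N + i)) (t' (N + j))) = dt n (\<lambda>i j. poly (r i) (x j) * Wp (x j))"
      by (intro dt_cong) (simp add: qv t'x)
    also have "\<dots> = R * (\<Prod>j<n. Wp (x j))" unfolding dt_scale_cols R_def x_def ..
    finally show ?thesis .
  qed
  have A3: "dt (N + n) (\<lambda>a b. poly (q a) (t b)) * vdm (N + n) t' = dt (N + n) (\<lambda>a b. poly (q a) (t' b)) * vdm (N + n) t"
    using dt_poly[where n = "N + n" and q = q and t = t, OF dq] dt_poly[where n = "N + n" and q = q and t = t', OF dq] by simp
  have V1: "vdm (N + n) t = vdm N t * vdm n x * (\<Prod>j<n. \<Prod>k<N. (x j - t k))"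
    unfolding vdm_add x_def ..
  have V2: "vdm (N + n) t' = vdm N z * vdm n x * (\<Prod>j<n. \<Prod>k<N. (x j - z k))"
  proof -
    have "vdm N t' = vdm N z" unfolding vdm_def by (intro prod.cong refl) (auto simp: t'_def)
    moreover have "(\<Prod>j<n. \<Prod>l<N. (t' (N + j) - t' l)) = (\<Prod>j<n. \<Prod>k<N. (x j - z k))"
      by (intro prod.cong refl) (auto simp: t'_def x_def)
    moreover have "(\<lambda>j. t' (N + j)) = x" by (simp add: t'x fun_eq_iff)
    ultimately show ?thesis unfolding vdm_add by simp
  qed
  have P1: "(\<Prod>b<N + n. Wp (t b)) = (\<Prod>l<N. \<Prod>k<N. (z k - t l)) * (\<Prod>j<n. Wp (x j))"
    unfolding prod_lessThan_add Wp_def x_def ..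
  have W0: "(\<Prod>j<n. Wp (x j)) \<noteq> 0" using zt by (auto simp: Wp_def x_def)
  have xz0: "(\<Prod>j<n. \<Prod>k<N. (x j - z k)) \<noteq> 0" using zt by (auto simp: x_def) (metis add_less_cancel_left)
  have R: "R = dt n (\<lambda>a c. coeff (r a) c) * vdm n x"
    unfolding R_def x_def by (rule dt_poly[OF dr])
  have fr: "(\<Prod>j<n. \<Prod>k<N. (x j - t k) / (x j - z k)) = (\<Prod>j<n. \<Prod>k<N. (x j - t k)) / (\<Prod>j<n. \<Prod>k<N. (x j - z k))"
    by (simp add: prod_dividef)
  show ?thesis
  \<comment> \<open>Coinciding nodes make \<open>R\<close> vanish and with it both sides; otherwise
    the common factor \<open>vdm n x\<close> can be cancelled.\<close>
  proof (cases "vdm n x = 0")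
    case True
    then have "R = 0" using R by simp
    then show ?thesis by simp
  next
    case False
    let ?X = "\<Prod>j<n. \<Prod>k<N. (x j - z k)" and ?Y = "\<Prod>j<n. \<Prod>k<N. (x j - t k)" and ?T = "\<Prod>l<N. \<Prod>k<N. (z k - t l)"
    have "(dt (N + n) \<Psi> * (?T * (\<Prod>j<n. Wp (x j)))) * (vdm N z * vdm n x * ?X)
      = (E * (R * (\<Prod>j<n. Wp (x j)))) * (vdm N t * vdm n x * ?Y)"
      using A3 unfolding A1 A2 V1 V2 P1 .
    then have "(dt (N + n) \<Psi> * ?T * vdm N z * ?X) * ((\<Prod>j<n. Wp (x j)) * vdm n x) = (E * R * vdm N t * ?Y) * ((\<Prod>j<n. Wp (x j)) * vdm n x)"
      by (simp only: mult_ac)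
    then have "dt (N + n) \<Psi> * ?T * vdm N z * ?X = E * R * vdm N t * ?Y" using False W0 by simp
    then have "dt (N + n) \<Psi> * ?T * vdm N z = E * R * vdm N t * (?Y / ?X)" using xz0 by (simp add: field_simps)
    then have "dt (N + n) \<Psi> * R * ?T * vdm N z = E * vdm N t * R\<^sup>2 * (?Y / ?X)"
      by (simp add: power2_eq_square mult_ac)
    then show ?thesis unfolding fr[unfolded x_def] \<Psi>_def E_def x_def .
  qed
qed

text \<open>The case of \<open>cauchy_vandermonde\<close> without polynomial rows.\<close>

lemma cauchy_det:
  fixes z w :: "nat \<Rightarrow> 'a::field"
  assumes "\<And>k l. k < N \<Longrightarrow> l < N \<Longrightarrow> z k \<noteq> w l"
  shows "dt N (\<lambda>k l. 1 / (z k - w l)) * (\<Prod>l<N. \<Prod>k<N. (z k - w l)) * vdm N z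
    = (\<Prod>k<N. \<Prod>k'\<in>{..<N} - {k}. (z k' - z k)) * vdm N w"
proof -
  have "dt 0 (\<lambda>i j. poly ((\<lambda>_. 0) i) (w (N + j))) = 1" by (simp add: dt_leibniz)
  moreover have "dt N (\<lambda>a b. if a < N then 1 / (z a - w b) else poly 0 (w b)) = dt N (\<lambda>k l. 1 / (z k - w l))"
    by (intro dt_cong) auto
  ultimately show ?thesis using cauchy_vandermonde[of 0 "\<lambda>_. 0" N z w] assms by simp
qed

text \<open>\<open>vandermonde\<close> takes each difference with the opposite sign, which the
  square does not see.\<close>

lemma vdm_square: "(vdm n x)\<^sup>2 = (vandermonde n x)\<^sup>2"
  unfolding vdm_def vandermonde_def by (simp add: prod_power_distrib power2_commute)

definition extend_perm :: "nat \<Rightarrow> (nat \<Rightarrow> nat) \<Rightarrow> nat \<Rightarrow> nat" where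
  "extend_perm N \<sigma> b = (if b < N then b else N + \<sigma> (b - N))"

lemma extend_perm_permutes:
  assumes s: "\<sigma> permutes {..<n}"
  shows "extend_perm N \<sigma> permutes {..<N + n}"
proof (rule bij_imp_permutes)
  have i: "Hilbert_Choice.inv \<sigma> permutes {..<n}" using s by (rule permutes_inv)
  show "bij_betw (extend_perm N \<sigma>) {..<N + n} {..<N + n}"
  proof (rule bij_betw_byWitness[where f' = "extend_perm N (Hilbert_Choice.inv \<sigma>)"])
    show "\<forall>b\<in>{..<N + n}. extend_perm N (Hilbert_Choice.inv \<sigma>) (extend_perm N \<sigma> b) = b"
      using permutes_inverses(2)[OF s] by (auto simp: extend_perm_def)
    show "\<forall>b\<in>{..<N + n}. extend_perm N \<sigma> (extend_perm N (Hilbert_Choice.inv \<sigma>) b) = b"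
      using permutes_inverses(1)[OF s] by (auto simp: extend_perm_def)
    have im: "\<pi> permutes {..<n} \<Longrightarrow> b < N + n \<Longrightarrow> \<not> b < N \<Longrightarrow> \<pi> (b - N) < n" for \<pi> b
      using permutes_in_image[of \<pi> "{..<n}" "b - N"] by auto
    show "extend_perm N \<sigma> ` {..<N + n} \<subseteq> {..<N + n}" using im[OF s] by (auto simp: extend_perm_def)
    show "extend_perm N (Hilbert_Choice.inv \<sigma>) ` {..<N + n} \<subseteq> {..<N + n}" using im[OF i] by (auto simp: extend_perm_def)
  qed
  show "extend_perm N \<sigma> b = b" if "b \<notin> {..<N + n}" for b
  proof -
    have "b - N \<notin> {..<n}" using that by auto
    then show ?thesis using permutes_not_in[OF s] that by (auto simp: extend_perm_def)
  qed
qed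

lemma dt_id: "dt n (\<lambda>i j. if i = j then 1 else 0) = 1"
  by (subst dt_upper) auto

text \<open>Both signs are determinants of permutation matrices, and the matrix of the extension is
  block diagonal with an identity block.\<close>

lemma sign_extend_perm:
  assumes s: "\<sigma> permutes {..<n}"
  shows "sign (extend_perm N \<sigma>) = sign \<sigma>"
proof -
  let ?\<delta> = "\<lambda>i j. if i = j then 1 else (0::real)"
  have "of_int (sign (extend_perm N \<sigma>)) = dt (N + n) (\<lambda>i j. ?\<delta> i (extend_perm N \<sigma> j))"
    using dt_permute_cols[OF extend_perm_permutes[OF s], where f = ?\<delta>] by (simp add: dt_id)
  also have "\<dots> = dt N (\<lambda>i j. ?\<delta> i (extend_perm N \<sigma> j)) * dt n (\<lambda>i j. ?\<delta> (N + i) (extend_perm N \<sigma> (N + j)))"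
    by (rule dt_block_upper) (auto simp: extend_perm_def)
  also have "dt N (\<lambda>i j. ?\<delta> i (extend_perm N \<sigma> j)) = dt N ?\<delta>"
    by (rule dt_cong) (auto simp: extend_perm_def)
  also have "dt n (\<lambda>i j. ?\<delta> (N + i) (extend_perm N \<sigma> (N + j))) = dt n (\<lambda>i j. ?\<delta> i (\<sigma> j))"
    by (rule dt_cong) (auto simp: extend_perm_def)
  also have "\<dots> = of_int (sign \<sigma>)" using dt_permute_cols[OF s, where f = ?\<delta>] by (simp add: dt_id)
  finally show ?thesis by (simp add: dt_id)
qed

lemma sign_mult_self: "of_int (sign \<sigma>) * (of_int (sign \<sigma>) * x) = (x :: 'a::ring_1)"
  by (cases "evenperm \<sigma>") (auto simp: sign_def)

text \<open>A column outside \<open>S\<close> is a unit vector, so a permutation that moves its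
  index contributes 0.\<close>

lemma dt_restrict_permutations:
  fixes M :: "nat \<Rightarrow> nat \<Rightarrow> 'a::field"
  assumes S: "S \<subseteq> {..<n}" and M: "\<And>i j. i < n \<Longrightarrow> j < n \<Longrightarrow> j \<notin> S \<Longrightarrow> M i j = (if i = j then 1 else 0)"
  shows "dt n M = (\<Sum>\<pi> | \<pi> permutes S. of_int (sign \<pi>) * (\<Prod>j\<in>S. M (\<pi> j) j))"
proof -
  have "dt n M = (\<Sum>\<pi> | \<pi> permutes S. of_int (sign \<pi>) * (\<Prod>j<n. M (\<pi> j) j))"
    unfolding dt_leibniz
  proof (rule sum.mono_neutral_right)
    show "finite {\<pi>. \<pi> permutes {..<n}}" by (rule finite_permutations) simp
    show "{\<pi>. \<pi> permutes S} \<subseteq> {\<pi>. \<pi> permutes {..<n}}" using S permutes_subset by blast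
    show "\<forall>\<pi>\<in>{\<pi>. \<pi> permutes {..<n}} - {\<pi>. \<pi> permutes S}. of_int (sign \<pi>) * (\<Prod>j<n. M (\<pi> j) j) = 0"
    proof
      fix \<pi> assume \<pi>: "\<pi> \<in> {\<pi>. \<pi> permutes {..<n}} - {\<pi>. \<pi> permutes S}"
      then obtain j where j: "j < n" "j \<notin> S" "\<pi> j \<noteq> j"
        using permutes_superset[of \<pi> "{..<n}" S] by auto
      have "\<pi> j < n" using permutes_in_image[of \<pi> "{..<n}" j] \<pi> j by auto
      then have "M (\<pi> j) j = 0" using M[of "\<pi> j" j] j by simp
      then have "(\<Prod>j<n. M (\<pi> j) j) = 0" using j by (intro prod_zero) auto
      then show "of_int (sign \<pi>) * (\<Prod>j<n. M (\<pi> j) j) = 0" by simp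
    qed
  qed
  also have "\<dots> = (\<Sum>\<pi> | \<pi> permutes S. of_int (sign \<pi>) * (\<Prod>j\<in>S. M (\<pi> j) j))"
  proof (intro sum.cong refl arg_cong2[of _ _ _ _ "(*)"])
    fix \<pi> assume "\<pi> \<in> {\<pi>. \<pi> permutes S}"
    then have "\<pi> j = j" if "j \<notin> S" for j using permutes_not_in that by fast
    then show "(\<Prod>j<n. M (\<pi> j) j) = (\<Prod>j\<in>S. M (\<pi> j) j)"
      using S M by (intro prod.mono_neutral_right) auto
  qed
  finally show ?thesis .
qed

section \<open>Integration of determinants against the ensemble\<close>

context orthonormal_system
begin

interpretation pm: product_sigma_finite "\<lambda>_::nat. \<mu>"
  by standard

abbreviation "PM n \<equiv> Pi\<^sub>M {..<n::nat} (\<lambda>_. \<mu>)"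

text \<open>Each Leibniz term is a product of functions of single particles, so it integrates to a
  product of integrals; the first \<open>N\<close> columns are constants.\<close>

lemma has_bochner_integral_dt:
  fixes f :: "nat \<Rightarrow> nat \<Rightarrow> real \<Rightarrow> 'a::{real_normed_field,banach,second_countable_topology}"
  assumes int: "\<And>i j. i < N + n \<Longrightarrow> j < n \<Longrightarrow> integrable \<mu> (f i j)"
  shows "has_bochner_integral (PM n) (\<lambda>x. dt (N + n) (\<lambda>i b. if b < N then c i b else f i (b - N) (x (b - N))))
     (dt (N + n) (\<lambda>i b. if b < N then c i b else integral\<^sup>L \<mu> (f i (b - N))))"
proof -
  have e1: "dt (N + n) (\<lambda>i b. if b < N then c i b else f i (b - N) (x (b - N))) =
    (\<Sum>\<pi> | \<pi> permutes {..<N + n}. (of_int (sign \<pi>) * (\<Prod>j<N. c (\<pi> j) j)) * (\<Prod>k<n. f (\<pi> (N + k)) k (x k)))" for x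
    unfolding dt_leibniz prod_lessThan_add by (simp add: mult.assoc)
  have e2: "dt (N + n) (\<lambda>i b. if b < N then c i b else integral\<^sup>L \<mu> (f i (b - N))) =
    (\<Sum>\<pi> | \<pi> permutes {..<N + n}. (of_int (sign \<pi>) * (\<Prod>j<N. c (\<pi> j) j)) * (\<Prod>k<n. integral\<^sup>L \<mu> (f (\<pi> (N + k)) k)))"
    unfolding dt_leibniz prod_lessThan_add by (simp add: mult.assoc)
  show ?thesis unfolding e1 e2
  proof (intro has_bochner_integral_sum has_bochner_integral_mult_right)
    fix \<pi> assume \<pi>: "\<pi> \<in> {\<pi>. \<pi> permutes {..<N + n}}"
    have I: "integrable \<mu> (f (\<pi> (N + k)) k)" if "k \<in> {..<n}" for k
      using permutes_in_image[of \<pi> "{..<N + n}" "N + k"] \<pi> that by (intro int) auto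
    show "has_bochner_integral (PM n) (\<lambda>x. \<Prod>k<n. f (\<pi> (N + k)) k (x k)) (\<Prod>k<n. integral\<^sup>L \<mu> (f (\<pi> (N + k)) k))"
      unfolding has_bochner_integral_iff
      by (intro conjI pm.product_integrable_prod[of "{..<n}" "\<lambda>k. f (\<pi> (N + k)) k"] pm.product_integral_prod[of "{..<n}" "\<lambda>k. f (\<pi> (N + k)) k"] I) auto
  qed
qed

text \<open>Andreief's identity with \<open>N\<close> additional columns that do not depend on the
  particles. Each Leibniz term of the second determinant is absorbed into the columns of the first;
  after integration the resulting permutation of columns cancels the sign, and all
  \<open>fact n\<close> terms agree.\<close>

lemma andreief:
  fixes \<phi> g :: "nat \<Rightarrow> real \<Rightarrow> 'a::{real_normed_field,banach,second_countable_topology}"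
  assumes int: "\<And>i j. i < N + n \<Longrightarrow> j < n \<Longrightarrow> integrable \<mu> (\<lambda>x. \<phi> i x * g j x)"
  shows "has_bochner_integral (PM n) (\<lambda>x. dt (N + n) (\<lambda>i b. if b < N then c i b else \<phi> i (x (b - N))) * dt n (\<lambda>i j. g i (x j)))
     (fact n * dt (N + n) (\<lambda>i b. if b < N then c i b else (\<integral>x. \<phi> i x * g (b - N) x \<partial>\<mu>)))"
proof -
  define A where "A = (\<lambda>i b. if b < N then c i b else (\<integral>x. \<phi> i x * g (b - N) x \<partial>\<mu>))"
  have e: "dt (N + n) (\<lambda>i b. if b < N then c i b else \<phi> i (x (b - N))) * dt n (\<lambda>i j. g i (x j)) =
    (\<Sum>\<sigma> | \<sigma> permutes {..<n}. of_int (sign \<sigma>) * dt (N + n) (\<lambda>i b. if b < N then c i b else \<phi> i (x (b - N)) * g (\<sigma> (b - N)) (x (b - N))))" for x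
  proof -
    have "dt (N + n) (\<lambda>i b. if b < N then c i b else \<phi> i (x (b - N))) * (\<Prod>j<n. g (\<sigma> j) (x j))
       = dt (N + n) (\<lambda>i b. if b < N then c i b else \<phi> i (x (b - N)) * g (\<sigma> (b - N)) (x (b - N)))" for \<sigma>
    proof -
      define d where "d = (\<lambda>b. if b < N then 1 else g (\<sigma> (b - N)) (x (b - N)))"
      have "(\<Prod>b<N + n. d b) = (\<Prod>j<n. g (\<sigma> j) (x j))" unfolding prod_lessThan_add by (simp add: d_def)
      moreover have "dt (N + n) (\<lambda>i b. if b < N then c i b else \<phi> i (x (b - N)) * g (\<sigma> (b - N)) (x (b - N)))
         = dt (N + n) (\<lambda>i b. (if b < N then c i b else \<phi> i (x (b - N))) * d b)"
        by (intro dt_cong) (auto simp: d_def)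
      ultimately show ?thesis by (simp only: dt_scale_cols)
    qed
    then show ?thesis unfolding dt_leibniz[of n] by (simp add: sum_distrib_left mult.left_commute)
  qed
  have perm: "of_int (sign \<sigma>) * dt (N + n) (\<lambda>i b. if b < N then c i b else (\<integral>x. \<phi> i x * g (\<sigma> (b - N)) x \<partial>\<mu>)) = dt (N + n) A"
    if \<sigma>: "\<sigma> permutes {..<n}" for \<sigma>
  proof -
    have "dt (N + n) (\<lambda>i b. if b < N then c i b else (\<integral>x. \<phi> i x * g (\<sigma> (b - N)) x \<partial>\<mu>)) = dt (N + n) (\<lambda>i b. A i (extend_perm N \<sigma> b))"
      by (intro dt_cong) (auto simp: A_def extend_perm_def)
    also have "\<dots> = of_int (sign \<sigma>) * dt (N + n) A"
      by (simp only: dt_permute_cols[OF extend_perm_permutes[OF \<sigma>]] sign_extend_perm[OF \<sigma>])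
    finally show ?thesis by (simp only: sign_mult_self)
  qed
  have "has_bochner_integral (PM n) (\<lambda>x. dt (N + n) (\<lambda>i b. if b < N then c i b else \<phi> i (x (b - N))) * dt n (\<lambda>i j. g i (x j)))
    (\<Sum>\<sigma> | \<sigma> permutes {..<n}. of_int (sign \<sigma>) * dt (N + n) (\<lambda>i b. if b < N then c i b else (\<integral>x. \<phi> i x * g (\<sigma> (b - N)) x \<partial>\<mu>)))"
    unfolding e
  proof (intro has_bochner_integral_sum has_bochner_integral_mult_right)
    fix \<sigma> assume "\<sigma> \<in> {\<sigma>. \<sigma> permutes {..<n}}"
    then have "\<sigma> j < n" if "j < n" for j using permutes_in_image[of \<sigma> "{..<n}" j] that by auto
    then show "has_bochner_integral (PM n)
       (\<lambda>x. dt (N + n) (\<lambda>i b. if b < N then c i b else \<phi> i (x (b - N)) * g (\<sigma> (b - N)) (x (b - N))))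
       (dt (N + n) (\<lambda>i b. if b < N then c i b else (\<integral>x. \<phi> i x * g (\<sigma> (b - N)) x \<partial>\<mu>)))"
      by (intro has_bochner_integral_dt[where f = "\<lambda>i j x. \<phi> i x * g (\<sigma> j) x"] int) auto
  qed
  also have "(\<Sum>\<sigma> | \<sigma> permutes {..<n}. of_int (sign \<sigma>) * dt (N + n) (\<lambda>i b. if b < N then c i b else (\<integral>x. \<phi> i x * g (\<sigma> (b - N)) x \<partial>\<mu>))) = (\<Sum>\<sigma> | \<sigma> permutes {..<n}. dt (N + n) A)"
    by (intro sum.cong refl perm) auto
  also have "\<dots> = fact n * dt (N + n) A" by (simp add: card_permutations[OF refl])
  finally show ?thesis by (simp add: A_def)
qed

text \<open>Passing from monomials to \<open>p\<close> multiplies the Vandermonde product only by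
  leading coefficients, so the square of this determinant is the density up to
  normalisation.\<close>

definition Dp :: "nat \<Rightarrow> (nat \<Rightarrow> real) \<Rightarrow> real" where
  "Dp n x = dt n (\<lambda>i j. poly (p i) (x j))"

lemma Dp_vandermonde: "(Dp n x)\<^sup>2 = (\<Prod>i<n. coeff (p i) i)\<^sup>2 * (vandermonde n x)\<^sup>2"
proof -
  have "Dp n x = dt n (\<lambda>a c. coeff (p a) c) * vdm n x" unfolding Dp_def by (rule dt_poly) simp
  also have "dt n (\<lambda>a c. coeff (p a) c) = (\<Prod>i<n. coeff (p i) i)" by (rule dt_lower) (simp add: coeff_eq_0)
  finally show ?thesis by (simp add: power_mult_distrib vdm_square)
qed

lemma has_bochner_integral_Dp: "has_bochner_integral (PM n) (\<lambda>x. (Dp n x)\<^sup>2) (fact n)"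
proof -
  have "has_bochner_integral (PM n) (\<lambda>x. dt (0 + n) (\<lambda>i b. if b < 0 then 0 else poly (p i) (x (b - 0))) * dt n (\<lambda>i j. poly (p i) (x j)))
     (fact n * dt (0 + n) (\<lambda>i b. if b < 0 then 0 else (\<integral>x. poly (p i) x * poly (p (b - 0)) x \<partial>\<mu>)))"
    by (rule andreief) simp
  then show ?thesis by (simp add: Dp_def power2_eq_square orthonormal dt_id)
qed

lemma Dp_measurable [measurable]: "Dp n \<in> borel_measurable (PM n)"
proof -
  have "(\<lambda>x. poly q (x j)) \<in> borel_measurable (PM n)" if "j < n" for q j
    using that by (intro borel_measurable_continuous_on[of "poly q"] continuous_intros) measurable
  then show ?thesis unfolding Dp_def[abs_def] dt_leibniz
    by (intro borel_measurable_sum borel_measurable_times borel_measurable_prod) auto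
qed

text \<open>The leading coefficients cancel against the normalising integral, which orthonormality
  reduces to \<open>fact n\<close>.\<close>

lemma OPE_density: "OPE \<mu> n = density (PM n) (\<lambda>x. ennreal ((Dp n x)\<^sup>2 / fact n))"
proof -
  define \<kappa> where "\<kappa> = (\<Prod>i<n. coeff (p i) i)"
  have k: "\<kappa> > 0" unfolding \<kappa>_def using lead_p by (intro prod_pos) auto
  have v: "(vandermonde n x)\<^sup>2 = (Dp n x)\<^sup>2 / \<kappa>\<^sup>2" for x using k by (simp add: Dp_vandermonde \<kappa>_def[symmetric])
  have "(\<integral>x. (vandermonde n x)\<^sup>2 \<partial>PM n) = fact n / \<kappa>\<^sup>2"
    unfolding v using has_bochner_integral_Dp[of n] by (simp add: has_bochner_integral_iff)
  then have "(vandermonde n x)\<^sup>2 / (\<integral>x. (vandermonde n x)\<^sup>2 \<partial>PM n) = (Dp n x)\<^sup>2 / fact n" for x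
    using k by (simp add: v)
  then show ?thesis unfolding OPE_def Let_def by simp
qed

lemma sets_OPE [measurable_cong, simp]: "sets (OPE \<mu> n) = sets (PM n)"
  unfolding OPE_density by simp

lemma prob_space_OPE: "prob_space (OPE \<mu> n)"
proof
  have "emeasure (OPE \<mu> n) (space (OPE \<mu> n)) = (\<integral>\<^sup>+x. ennreal ((Dp n x)\<^sup>2 / fact n) \<partial>PM n)"
    unfolding OPE_density by (subst emeasure_density) (auto intro!: nn_integral_cong)
  also have "\<dots> = ennreal (\<integral>x. (Dp n x)\<^sup>2 / fact n \<partial>PM n)"
    using has_bochner_integral_Dp[of n] by (intro nn_integral_eq_integral) (auto simp: has_bochner_integral_iff)
  also have "\<dots> = 1" using has_bochner_integral_Dp[of n] by (simp add: has_bochner_integral_iff)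
  finally show "emeasure (OPE \<mu> n) (space (OPE \<mu> n)) = 1" .
qed

lemma integral_OPE:
  fixes F :: "(nat \<Rightarrow> real) \<Rightarrow> 'a::{real_normed_field,banach,second_countable_topology}"
  assumes [measurable]: "F \<in> borel_measurable (PM n)"
  shows "integral\<^sup>L (OPE \<mu> n) F = (\<integral>x. of_real ((Dp n x)\<^sup>2) * F x \<partial>PM n) / fact n"
proof -
  have "integral\<^sup>L (OPE \<mu> n) F = (\<integral>x. ((Dp n x)\<^sup>2 / fact n) *\<^sub>R F x \<partial>PM n)"
    unfolding OPE_density by (intro integral_density) auto
  also have "\<dots> = (\<integral>x. (of_real ((Dp n x)\<^sup>2) * F x) / fact n \<partial>PM n)"
    by (intro Bochner_Integration.integral_cong) (auto simp: scaleR_conv_of_real)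
  finally show ?thesis by simp
qed

lemma dt_of_real: "of_real (dt n f) = (dt n (\<lambda>i j. of_real (f i j)) :: complex)"
  unfolding dt_leibniz by (auto intro!: sum.cong)

text \<open>The Cauchy-Vandermonde identity turns the integrand times the density into a product of two determinants, the
  integral of which is a determinant by Andreief; a Schur complement reduces its size from \<open>N + n\<close> to \<open>N\<close>, and the
  mixed Christoffel-Darboux formula evaluates the entries.\<close>

lemma rational_statistic_formula:
  fixes z w :: "nat \<Rightarrow> complex"
  assumes Imz: "\<And>k. k < N \<Longrightarrow> Im (z k) \<noteq> 0"
    and zw: "\<And>k l. k < N \<Longrightarrow> l < N \<Longrightarrow> z k \<noteq> w l" and zd: "vdm N z \<noteq> 0" and n: "n > 0"
  shows "dt N (\<lambda>k l. 1 / (z k - w l)) * (\<integral>x. (\<Prod>j<n. \<Prod>k<N. (of_real (x j) - w k) / (of_real (x j) - z k)) \<partial>OPE \<mu> n)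
    = dt N (\<lambda>k l. FF n (w l) (z k) / (z k - w l))"
proof -
  \<comment> \<open>Rows with index below \<open>N\<close> carry Cauchy kernels at the poles, the
    others the orthonormal polynomials; \<open>c\<close> is the same family evaluated at the zeros
    \<open>w\<close>.\<close>
  define \<phi> where "\<phi> = (\<lambda>i (x::real). if i < N then 1 / (z i - of_real x) else of_real (poly (p (i - N)) x))"
  define g where "g = (\<lambda>j (x::real). complex_of_real (poly (p j) x))"
  define c where "c = (\<lambda>i l. if i < N then 1 / (z i - w l) else P (i - N) (w l))"
  define A where "A = (\<lambda>i b. if b < N then c i b else (\<integral>x. \<phi> i x * g (b - N) x \<partial>\<mu>))"
  define H where "H = (\<lambda>x::nat\<Rightarrow>real. \<Prod>j<n. \<Prod>k<N. (of_real (x j) - w k) / (of_real (x j) - z k))"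
  define T where "T = (\<Prod>l<N. \<Prod>k<N. (z k - w l))"
  define E where "E = (\<Prod>k<N. \<Prod>k'\<in>{..<N} - {k}. (z k' - z k))"
  have int: "integrable \<mu> (\<lambda>x. \<phi> i x * g j x)" if "i < N + n" "j < n" for i j
  proof (cases "i < N")
    case True
    then show ?thesis using integrable_resolvent[OF Imz[OF True], of "p j"] by (simp add: \<phi>_def g_def)
  next
    case False
    then show ?thesis using integrable_of_real[OF integrable_poly_mult[of "p (i - N)" "p j"]] by (simp add: \<phi>_def g_def)
  qed
  have hb: "has_bochner_integral (PM n) (\<lambda>x. dt (N + n) (\<lambda>i b. if b < N then c i b else \<phi> i (x (b - N))) * dt n (\<lambda>i j. g i (x j))) (fact n * dt (N + n) A)"
    unfolding A_def by (rule andreief[OF int])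
  have pw: "dt (N + n) (\<lambda>i b. if b < N then c i b else \<phi> i (x (b - N))) * dt n (\<lambda>i j. g i (x j)) * T * vdm N z
      = E * vdm N w * (of_real ((Dp n x)\<^sup>2) * H x)" for x
  proof -
    \<comment> \<open>The nodes are the zeros \<open>w\<close> followed by the particles.\<close>
    define t where "t = (\<lambda>b. if b < N then w b else of_real (x (b - N)))"
    have "dt (N + n) (\<lambda>a b. if a < N then 1 / (z a - t b) else poly (map_poly of_real (p (a - N))) (t b)) * dt n (\<lambda>i j. poly (map_poly of_real (p i)) (t (N + j)))
      * (\<Prod>l<N. \<Prod>k<N. (z k - t l)) * vdm N z
     = (\<Prod>k<N. \<Prod>k'\<in>{..<N} - {k}. (z k' - z k)) * vdm N t * (dt n (\<lambda>i j. poly (map_poly of_real (p i)) (t (N + j))))\<^sup>2 * (\<Prod>j<n. \<Prod>k<N. (t (N + j) - t k) / (t (N + j) - z k))"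
    proof (rule cauchy_vandermonde)
      show "degree (map_poly complex_of_real (p i)) < n" if "i < n" for i
        using that by (simp add: degree_map_poly)
      show "z k \<noteq> t b" if "k < N" "b < N + n" for k b
        using zw[OF that(1)] Imz[OF that(1)] by (auto simp: t_def)
    qed
    moreover have "dt (N + n) (\<lambda>a b. if a < N then 1 / (z a - t b) else poly (map_poly of_real (p (a - N))) (t b))
       = dt (N + n) (\<lambda>i b. if b < N then c i b else \<phi> i (x (b - N)))"
      by (intro dt_cong) (auto simp: t_def c_def \<phi>_def P_def cpoly_def[symmetric] cpoly_of_real)
    moreover have "dt n (\<lambda>i j. poly (map_poly of_real (p i)) (t (N + j))) = dt n (\<lambda>i j. g i (x j))"
      by (intro dt_cong) (auto simp: t_def g_def cpoly_def[symmetric] cpoly_of_real)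
    moreover have "dt n (\<lambda>i j. g i (x j)) = of_real (Dp n x)" by (simp add: Dp_def dt_of_real g_def)
    moreover have "vdm N t = vdm N w" unfolding vdm_def by (intro prod.cong refl) (auto simp: t_def)
    moreover have "(\<Prod>l<N. \<Prod>k<N. (z k - t l)) = T" unfolding T_def by (intro prod.cong refl) (auto simp: t_def)
    moreover have "(\<Prod>j<n. \<Prod>k<N. (t (N + j) - t k) / (t (N + j) - z k)) = H x" unfolding H_def by (intro prod.cong refl) (auto simp: t_def)
    ultimately show ?thesis by (simp add: E_def mult_ac)
  qed
  have Hm: "H \<in> borel_measurable (PM n)" unfolding H_def by measurable
  have "(\<integral>x. dt (N + n) (\<lambda>i b. if b < N then c i b else \<phi> i (x (b - N))) * dt n (\<lambda>i j. g i (x j)) \<partial>PM n) = fact n * dt (N + n) A"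
    using hb by (simp add: has_bochner_integral_iff)
  then have "fact n * dt (N + n) A * T * vdm N z = (\<integral>x. dt (N + n) (\<lambda>i b. if b < N then c i b else \<phi> i (x (b - N))) * dt n (\<lambda>i j. g i (x j)) * T * vdm N z \<partial>PM n)"
    by (simp only: integral_mult_left_zero)
  also have "\<dots> = E * vdm N w * (\<integral>x. of_real ((Dp n x)\<^sup>2) * H x \<partial>PM n)"
    unfolding pw by (rule integral_mult_right_zero)
  also have "\<dots> = E * vdm N w * (fact n * integral\<^sup>L (OPE \<mu> n) H)"
    by (simp add: integral_OPE[OF Hm])
  finally have "fact n * (dt (N + n) A * T * vdm N z) = fact n * (E * vdm N w * integral\<^sup>L (OPE \<mu> n) H)" by (simp only: mult_ac)
  then have m1: "dt (N + n) A * T * vdm N z = E * vdm N w * integral\<^sup>L (OPE \<mu> n) H" by simp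
  have m2: "dt N (\<lambda>k l. 1 / (z k - w l)) * T * vdm N z = E * vdm N w"
    unfolding T_def E_def by (rule cauchy_det[OF zw])
  have T0: "T \<noteq> 0" using zw by (auto simp: T_def)
  have "dt (N + n) A * (T * vdm N z) = (dt N (\<lambda>k l. 1 / (z k - w l)) * integral\<^sup>L (OPE \<mu> n) H) * (T * vdm N z)"
    using m1 m2 by (simp only: mult_ac)
  then have m3: "dt (N + n) A = dt N (\<lambda>k l. 1 / (z k - w l)) * integral\<^sup>L (OPE \<mu> n) H" using T0 zd by simp
  have "dt (N + n) A = dt N (\<lambda>k l. A k l - (\<Sum>j<n. A k (N + j) * A (N + j) l))"
  proof (rule dt_schur)
    fix i j assume "i < n" "j < n"
    have "A (N + i) (N + j) = (\<integral>x. of_real (poly (p i) x * poly (p j) x) \<partial>\<mu>)"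
      by (simp add: A_def \<phi>_def g_def)
    also have "\<dots> = of_real (if i = j then 1 else 0)" unfolding integral_complex_of_real orthonormal ..
    finally show "A (N + i) (N + j) = (if i = j then 1 else 0)" by simp
  qed
  also have "\<dots> = dt N (\<lambda>k l. FF n (w l) (z k) / (z k - w l))"
  proof (rule dt_cong)
    fix k l assume k: "k < N" and l: "l < N"
    have "(\<Sum>j<n. A k (N + j) * A (N + j) l) = (\<Sum>j<n. P j (w l) * Q j (z k))"
      using k l by (intro sum.cong) (auto simp: A_def \<phi>_def g_def c_def Q_def mult.commute)
    moreover have "A k l = 1 / (z k - w l)" using k l by (simp add: A_def c_def)
    moreover have "(z k - w l) * (\<Sum>j<n. P j (w l) * Q j (z k)) = 1 - FF n (w l) (z k)"
      by (rule mixed_Christoffel_Darboux[OF Imz[OF k] n])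
    ultimately show "A k l - (\<Sum>j<n. A k (N + j) * A (N + j) l) = FF n (w l) (z k) / (z k - w l)"
      using zw[OF k l] by (simp add: field_simps)
  qed
  finally show ?thesis using m3 by (simp add: H_def)
qed

end

section \<open>Moments of linear statistics and a variance bound\<close>

context orthonormal_system
begin

interpretation pm: product_sigma_finite "\<lambda>_::nat. \<mu>"
  by standard

text \<open>The matrix of multiplication by \<open>f\<close> in the basis \<open>p\<close>.\<close>

definition FM :: "(real \<Rightarrow> real) \<Rightarrow> nat \<Rightarrow> nat \<Rightarrow> real" where
  "FM f i b = (\<integral>x. f x * (poly (p i) x * poly (p b) x) \<partial>\<mu>)"

lemma FM_one: "FM (\<lambda>_. 1) i b = (if i = b then 1 else 0)"
  by (simp add: FM_def orthonormal)

lemma FM_commute: "FM f i b = FM f b i"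
  by (simp add: FM_def mult.commute)

lemma integrable_FM:
  assumes "f \<in> borel_measurable borel" "\<And>x. \<bar>f x\<bar> \<le> C"
  shows "integrable \<mu> (\<lambda>x. f x * (poly q x * poly r x))"
  using integrable_bounded_poly[of f C "q * r"] assms by simp

text \<open>One factor \<open>Dp\<close> is expanded over permutations \<sigma>, and the columns are
  permuted back to absorb the sign. Then column \<open>b\<close> carries the weight of the particle
  that \<sigma> sends to \<open>b\<close>. Weight 1 gives a unit column, so weights on one or two
  particles leave minors of size one or two.\<close>

lemma expectation_weights:
  fixes h :: "nat \<Rightarrow> real \<Rightarrow> real"
  assumes hm: "\<And>j. h j \<in> borel_measurable borel" and hb: "\<And>j x. \<bar>h j x\<bar> \<le> C"
  shows "(\<integral>x. (\<Prod>j<n. h j (x j)) \<partial>OPE \<mu> n) =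
    (\<Sum>\<sigma> | \<sigma> permutes {..<n}. dt n (\<lambda>i b. FM (h (Hilbert_Choice.inv \<sigma> b)) i b)) / fact n"
proof -
  have e: "(Dp n x)\<^sup>2 * (\<Prod>j<n. h j (x j)) =
     (\<Sum>\<sigma> | \<sigma> permutes {..<n}. of_int (sign \<sigma>) * dt (0 + n) (\<lambda>i b. if b < 0 then 0 else h (b - 0) (x (b - 0)) * (poly (p i) (x (b - 0)) * poly (p (\<sigma> (b - 0))) (x (b - 0)))))" for x
  proof -
    have "Dp n x * ((\<Prod>j<n. poly (p (\<sigma> j)) (x j)) * (\<Prod>j<n. h j (x j))) =
       dt n (\<lambda>i b. h b (x b) * (poly (p i) (x b) * poly (p (\<sigma> b)) (x b)))" for \<sigma>
      unfolding Dp_def prod.distrib[symmetric] dt_scale_cols[symmetric] by (simp add: mult_ac)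
    note * = this
    have "(\<Sum>\<sigma> | \<sigma> permutes {..<n}. of_int (sign \<sigma>) * dt n (\<lambda>i b. h b (x b) * (poly (p i) (x b) * poly (p (\<sigma> b)) (x b))))
      = (\<Sum>\<sigma> | \<sigma> permutes {..<n}. of_int (sign \<sigma>) * (\<Prod>j<n. poly (p (\<sigma> j)) (x j))) * (Dp n x * (\<Prod>j<n. h j (x j)))"
      unfolding sum_distrib_right *[symmetric] by (intro sum.cong refl) (simp only: mult_ac)
    also have "\<dots> = Dp n x * (Dp n x * (\<Prod>j<n. h j (x j)))"
      by (subst (3) Dp_def) (simp add: dt_leibniz)
    finally show ?thesis by (simp add: power2_eq_square)
  qed
  have per: "of_int (sign \<sigma>) * dt (0 + n) (\<lambda>i b. if b < 0 then 0 else FM (h (b - 0)) i (\<sigma> (b - 0)))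
     = dt n (\<lambda>i b. FM (h (Hilbert_Choice.inv \<sigma> b)) i b)" if \<sigma>: "\<sigma> permutes {..<n}" for \<sigma>
  proof -
    have "dt (0 + n) (\<lambda>i b. if b < 0 then 0 else FM (h (b - 0)) i (\<sigma> (b - 0))) = dt n (\<lambda>i b. (\<lambda>i b. FM (h (Hilbert_Choice.inv \<sigma> b)) i b) i (\<sigma> b))"
      using permutes_inverses(2)[OF \<sigma>] by simp
    also have "\<dots> = of_int (sign \<sigma>) * dt n (\<lambda>i b. FM (h (Hilbert_Choice.inv \<sigma> b)) i b)"
      by (rule dt_permute_cols[OF \<sigma>])
    finally show ?thesis by (simp only: sign_mult_self)
  qed
  have "has_bochner_integral (PM n) (\<lambda>x. (Dp n x)\<^sup>2 * (\<Prod>j<n. h j (x j)))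
    (\<Sum>\<sigma> | \<sigma> permutes {..<n}. of_int (sign \<sigma>) * dt (0 + n) (\<lambda>i b. if b < 0 then 0 else FM (h (b - 0)) i (\<sigma> (b - 0))))"
    unfolding e FM_def
    by (intro has_bochner_integral_sum has_bochner_integral_mult_right
       has_bochner_integral_dt[where f = "\<lambda>i j x. h j x * (poly (p i) x * poly (p (_ j)) x)"] integrable_FM[OF hm hb])
  then have "(\<integral>x. (Dp n x)\<^sup>2 * (\<Prod>j<n. h j (x j)) \<partial>PM n) = (\<Sum>\<sigma> | \<sigma> permutes {..<n}. dt n (\<lambda>i b. FM (h (Hilbert_Choice.inv \<sigma> b)) i b))"
    using per by (simp add: has_bochner_integral_iff)
  moreover have "(\<lambda>x. \<Prod>j<n. h j (x j)) \<in> borel_measurable (PM n)"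
    using hm by (intro borel_measurable_prod) (auto intro!: measurable_compose[OF measurable_component_singleton])
  ultimately show ?thesis by (subst integral_OPE) auto
qed

lemma inv_perm_eq: "\<sigma> permutes S \<Longrightarrow> Hilbert_Choice.inv \<sigma> b = j \<longleftrightarrow> b = \<sigma> j"
  using permutes_inverses[of \<sigma> S] by metis

text \<open>For \<open>b \<noteq> c\<close> this is the minor of \<open>FM f\<close> on the indices
  \<open>b\<close> and \<open>c\<close>; the diagonal value belongs to a particle paired with
  itself.\<close>

definition FT :: "(real \<Rightarrow> real) \<Rightarrow> nat \<Rightarrow> nat \<Rightarrow> real" where
  "FT f b c = (if b = c then FM (\<lambda>x. (f x)\<^sup>2) b b else FM f b b * FM f c c - (FM f b c)\<^sup>2)"

lemma expectation_one_particle: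
  assumes fm: "f \<in> borel_measurable borel" and fb: "\<And>x. \<bar>f x\<bar> \<le> C" and j: "j < n"
  shows "(\<integral>x. f (x j) \<partial>OPE \<mu> n) = (\<Sum>\<sigma> | \<sigma> permutes {..<n}. FM f (\<sigma> j) (\<sigma> j)) / fact n"
proof -
  define h where "h = (\<lambda>k. if k = j then f else (\<lambda>_. 1))"
  have hm: "h k \<in> borel_measurable borel" for k using fm by (simp add: h_def)
  have hb: "\<bar>h k x\<bar> \<le> max C 1" for k x using fb[of x] by (auto simp: h_def)
  have "(\<Prod>k<n. h k (x k)) = f (x j)" for x :: "nat \<Rightarrow> real"
    using j by (subst prod.remove[of _ j]) (auto simp: h_def)
  then have "(\<integral>x. f (x j) \<partial>OPE \<mu> n) = (\<Sum>\<sigma> | \<sigma> permutes {..<n}. dt n (\<lambda>i b. FM (h (Hilbert_Choice.inv \<sigma> b)) i b)) / fact n"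
    using expectation_weights[of h "max C 1" n, OF hm hb] by simp
  also have "(\<Sum>\<sigma> | \<sigma> permutes {..<n}. dt n (\<lambda>i b. FM (h (Hilbert_Choice.inv \<sigma> b)) i b)) = (\<Sum>\<sigma> | \<sigma> permutes {..<n}. FM f (\<sigma> j) (\<sigma> j))"
  proof (intro sum.cong refl)
    fix \<sigma> assume "\<sigma> \<in> {\<sigma>. \<sigma> permutes {..<n}}"
    then have \<sigma>: "\<sigma> permutes {..<n}" by simp
    have \<sigma>j: "\<sigma> j < n" using permutes_in_image[OF \<sigma>, of j] j by auto
    have "dt n (\<lambda>i b. FM (h (Hilbert_Choice.inv \<sigma> b)) i b) = (\<Sum>\<pi> | \<pi> permutes {\<sigma> j}. of_int (sign \<pi>) * (\<Prod>b\<in>{\<sigma> j}. FM (h (Hilbert_Choice.inv \<sigma> b)) (\<pi> b) b))"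
      by (rule dt_restrict_permutations) (use \<sigma>j in \<open>auto simp: h_def inv_perm_eq[OF \<sigma>] FM_one\<close>)
    also have "\<dots> = FM f (\<sigma> j) (\<sigma> j)" by (simp add: permutes_sing h_def inv_perm_eq[OF \<sigma>])
    finally show "dt n (\<lambda>i b. FM (h (Hilbert_Choice.inv \<sigma> b)) i b) = FM f (\<sigma> j) (\<sigma> j)" .
  qed
  finally show ?thesis .
qed

lemma expectation_two_particles:
  assumes fm: "f \<in> borel_measurable borel" and fb: "\<And>x. \<bar>f x\<bar> \<le> C" and j: "j < n" and k: "k < n"
  shows "(\<integral>x. f (x j) * f (x k) \<partial>OPE \<mu> n) = (\<Sum>\<sigma> | \<sigma> permutes {..<n}. FT f (\<sigma> j) (\<sigma> k)) / fact n"
proof (cases "j = k")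
  case True
  have "(\<lambda>x. (f x)\<^sup>2) \<in> borel_measurable borel" using fm by measurable
  moreover have "\<bar>(f x)\<^sup>2\<bar> \<le> C\<^sup>2" for x using fb[of x] abs_le_square_iff[of "f x" C] by (simp add: order_trans[OF fb])
  ultimately show ?thesis using expectation_one_particle[of "\<lambda>x. (f x)\<^sup>2" "C\<^sup>2" j n] True j
    by (simp add: FT_def power2_eq_square)
next
  case jk: False
  define h where "h = (\<lambda>l. if l = j \<or> l = k then f else (\<lambda>_. 1))"
  have hm: "h l \<in> borel_measurable borel" for l using fm by (simp add: h_def)
  have hb: "\<bar>h l x\<bar> \<le> max C 1" for l x using fb[of x] by (auto simp: h_def)
  have "(\<Prod>l<n. h l (x l)) = f (x j) * f (x k)" for x :: "nat \<Rightarrow> real"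
  proof -
    have "(\<Prod>l<n. h l (x l)) = (\<Prod>l\<in>{j, k}. h l (x l))"
      using j k by (intro prod.mono_neutral_right) (auto simp: h_def)
    then show ?thesis using jk by (simp add: h_def)
  qed
  then have "(\<integral>x. f (x j) * f (x k) \<partial>OPE \<mu> n) = (\<Sum>\<sigma> | \<sigma> permutes {..<n}. dt n (\<lambda>i b. FM (h (Hilbert_Choice.inv \<sigma> b)) i b)) / fact n"
    using expectation_weights[of h "max C 1" n, OF hm hb] by simp
  also have "(\<Sum>\<sigma> | \<sigma> permutes {..<n}. dt n (\<lambda>i b. FM (h (Hilbert_Choice.inv \<sigma> b)) i b)) = (\<Sum>\<sigma> | \<sigma> permutes {..<n}. FT f (\<sigma> j) (\<sigma> k))"
  proof (intro sum.cong refl)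
    fix \<sigma> assume "\<sigma> \<in> {\<sigma>. \<sigma> permutes {..<n}}"
    then have \<sigma>: "\<sigma> permutes {..<n}" by simp
    define b where "b = \<sigma> j"
    define c where "c = \<sigma> k"
    have bc: "b < n" "c < n" "b \<noteq> c" using permutes_in_image[OF \<sigma>] j k jk permutes_inj[OF \<sigma>] by (auto simp: b_def c_def inj_eq)
    have hi: "h (Hilbert_Choice.inv \<sigma> d) = (if d = b \<or> d = c then f else (\<lambda>_. 1))" for d
      by (simp add: h_def inv_perm_eq[OF \<sigma>] b_def c_def)
    have "dt n (\<lambda>i d. FM (h (Hilbert_Choice.inv \<sigma> d)) i d) = (\<Sum>\<pi> | \<pi> permutes {b, c}. of_int (sign \<pi>) * (\<Prod>d\<in>{b, c}. FM (h (Hilbert_Choice.inv \<sigma> d)) (\<pi> d) d))"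
      by (rule dt_restrict_permutations) (use bc in \<open>auto simp: hi FM_one\<close>)
    also have "{\<pi>. \<pi> permutes {b, c}} = {id, Transposition.transpose b c}"
      using permutes_doubleton_iff[of _ b c] by auto
    also have "(\<Sum>\<pi>\<in>{id, Transposition.transpose b c}. of_int (sign \<pi>) * (\<Prod>d\<in>{b, c}. FM (h (Hilbert_Choice.inv \<sigma> d)) (\<pi> d) d)) = FM f b b * FM f c c - FM f c b * FM f b c"
    proof -
      have "id \<noteq> Transposition.transpose b c" using bc by (metis id_apply transpose_apply_first)
      then show ?thesis using bc by (simp add: hi sign_swap_id)
    qed
    also have "\<dots> = FT f b c" using bc FM_commute[of f c b] by (simp add: FT_def power2_eq_square)
    finally show "dt n (\<lambda>i b. FM (h (Hilbert_Choice.inv \<sigma> b)) i b) = FT f (\<sigma> j) (\<sigma> k)" by (simp add: b_def c_def)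
  qed
  finally show ?thesis .
qed

lemma bounded_integrable_OPE:
  fixes F :: "(nat \<Rightarrow> real) \<Rightarrow> 'b::{banach,second_countable_topology}"
  assumes "F \<in> borel_measurable (PM n)" "\<And>x. norm (F x) \<le> C"
  shows "integrable (OPE \<mu> n) F"
proof -
  interpret prob_space "OPE \<mu> n" by (rule prob_space_OPE)
  show ?thesis by (rule integrable_const_bound[where B = C]) (use assms in auto)
qed

lemma particle_measurable:
  assumes "f \<in> borel_measurable borel" "j < n"
  shows "(\<lambda>x. f (x j)) \<in> borel_measurable (PM n)"
  using assms by (auto intro!: measurable_compose[OF measurable_component_singleton])

lemma expectation_linear_statistic:
  assumes fm: "f \<in> borel_measurable borel" and fb: "\<And>x. \<bar>f x\<bar> \<le> C"
  shows "(\<integral>x. (\<Sum>j<n. f (x j)) \<partial>OPE \<mu> n) = (\<Sum>k<n. FM f k k)"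
proof -
  have "(\<integral>x. (\<Sum>j<n. f (x j)) \<partial>OPE \<mu> n) = (\<Sum>j<n. (\<Sum>\<sigma> | \<sigma> permutes {..<n}. FM f (\<sigma> j) (\<sigma> j)) / fact n)"
    using fb by (subst Bochner_Integration.integral_sum)
      (auto intro!: sum.cong expectation_one_particle[OF fm fb] bounded_integrable_OPE[where C = C] particle_measurable fm)
  also have "\<dots> = (\<Sum>\<sigma> | \<sigma> permutes {..<n}. (\<Sum>j<n. FM f (\<sigma> j) (\<sigma> j))) / fact n"
    unfolding sum_divide_distrib[symmetric] by (subst sum.swap) simp
  also have "(\<Sum>\<sigma> | \<sigma> permutes {..<n}. (\<Sum>j<n. FM f (\<sigma> j) (\<sigma> j))) = (\<Sum>\<sigma> | \<sigma> permutes {..<n}. (\<Sum>k<n. FM f k k))"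
  proof (rule sum.cong[OF refl])
    fix \<sigma> assume "\<sigma> \<in> {\<sigma>. \<sigma> permutes {..<n}}"
    then show "(\<Sum>j<n. FM f (\<sigma> j) (\<sigma> j)) = (\<Sum>k<n. FM f k k)"
      using sum.permute[of \<sigma> "{..<n}" "\<lambda>k. FM f k k"] by (simp add: o_def)
  qed
  finally show ?thesis by (simp add: card_permutations[OF refl])
qed

lemma second_moment_linear_statistic:
  assumes fm: "f \<in> borel_measurable borel" and fb: "\<And>x. \<bar>f x\<bar> \<le> C"
  shows "(\<integral>x. (\<Sum>j<n. f (x j))\<^sup>2 \<partial>OPE \<mu> n) = (\<Sum>b<n. \<Sum>c<n. FT f b c)"
proof -
  have fb': "\<bar>f x * f y\<bar> \<le> C * C" for x y unfolding abs_mult using fb by (intro mult_mono) (auto intro: order_trans[OF abs_ge_zero fb])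
  have m: "(\<lambda>x. f (x j) * f (x k)) \<in> borel_measurable (PM n)" if "j < n" "k < n" for j k
    using that fm by (intro borel_measurable_times particle_measurable)
  have int: "integrable (OPE \<mu> n) (\<lambda>x. f (x j) * f (x k))" if "j < n" "k < n" for j k
    using m[OF that] fb' by (intro bounded_integrable_OPE[where C = "C * C"]) auto
  have "(\<integral>x. (\<Sum>j<n. f (x j))\<^sup>2 \<partial>OPE \<mu> n) = (\<integral>x. (\<Sum>j<n. \<Sum>k<n. f (x j) * f (x k)) \<partial>OPE \<mu> n)"
    by (simp add: power2_eq_square sum_product)
  also have "\<dots> = (\<Sum>j<n. \<Sum>k<n. (\<Sum>\<sigma> | \<sigma> permutes {..<n}. FT f (\<sigma> j) (\<sigma> k)) / fact n)"
    by (subst Bochner_Integration.integral_sum, intro Bochner_Integration.integrable_sum int, simp, simp, intro sum.cong refl,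
        subst Bochner_Integration.integral_sum, intro int, simp, simp, intro sum.cong refl expectation_two_particles[OF fm fb]) auto
  also have "\<dots> = (\<Sum>\<sigma> | \<sigma> permutes {..<n}. (\<Sum>j<n. \<Sum>k<n. FT f (\<sigma> j) (\<sigma> k))) / fact n"
    unfolding sum_divide_distrib[symmetric]
    by (subst sum.swap[of _ "{..<n}" "{\<sigma>. \<sigma> permutes {..<n}}"], subst sum.swap[of _ "{..<n}" "{\<sigma>. \<sigma> permutes {..<n}}"]) simp
  also have "(\<Sum>\<sigma> | \<sigma> permutes {..<n}. (\<Sum>j<n. \<Sum>k<n. FT f (\<sigma> j) (\<sigma> k))) = (\<Sum>\<sigma> | \<sigma> permutes {..<n}. (\<Sum>b<n. \<Sum>c<n. FT f b c))"
  proof (rule sum.cong[OF refl])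
    fix \<sigma> assume "\<sigma> \<in> {\<sigma>. \<sigma> permutes {..<n}}"
    then have \<sigma>: "\<sigma> permutes {..<n}" by simp
    have "(\<Sum>b<n. \<Sum>c<n. FT f b c) = (\<Sum>j<n. \<Sum>c<n. FT f (\<sigma> j) c)"
      using sum.permute[OF \<sigma>, of "\<lambda>b. \<Sum>c<n. FT f b c"] by (simp add: o_def)
    also have "\<dots> = (\<Sum>j<n. \<Sum>k<n. FT f (\<sigma> j) (\<sigma> k))"
    proof (rule sum.cong[OF refl])
      show "(\<Sum>c<n. FT f (\<sigma> j) c) = (\<Sum>k<n. FT f (\<sigma> j) (\<sigma> k))" for j
        using sum.permute[OF \<sigma>, of "FT f (\<sigma> j)"] by (simp add: o_def)
    qed
    finally show "(\<Sum>j<n. \<Sum>k<n. FT f (\<sigma> j) (\<sigma> k)) = (\<Sum>b<n. \<Sum>c<n. FT f b c)" by simp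
  qed
  finally show ?thesis by (simp add: card_permutations[OF refl])
qed

lemma variance_linear_statistic:
  fixes n :: nat
  assumes fm: "f \<in> borel_measurable borel" and fb: "\<And>x. \<bar>f x\<bar> \<le> C"
  defines "X \<equiv> (\<lambda>x::nat\<Rightarrow>real. \<Sum>j<n. f (x j))"
  shows "(\<integral>x. (X x - (\<integral>y. X y \<partial>OPE \<mu> n))\<^sup>2 \<partial>OPE \<mu> n) = (\<Sum>b<n. FM (\<lambda>x. (f x)\<^sup>2) b b) - (\<Sum>b<n. \<Sum>c<n. (FM f b c)\<^sup>2)"
proof -
  interpret pr: prob_space "OPE \<mu> n" by (rule prob_space_OPE)
  define m where "m = (\<integral>y. X y \<partial>OPE \<mu> n)"
  have Xm: "X \<in> borel_measurable (PM n)" unfolding X_def by (intro borel_measurable_sum particle_measurable fm) auto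
  have Xb: "\<bar>X x\<bar> \<le> real n * C" for x
  proof -
    have "\<bar>X x\<bar> \<le> (\<Sum>j<n. C)" unfolding X_def by (rule order_trans[OF sum_abs]) (intro sum_mono fb)
    then show ?thesis by simp
  qed
  have X1: "integrable (OPE \<mu> n) X" by (rule bounded_integrable_OPE[OF Xm]) (use Xb in simp)
  have X2: "integrable (OPE \<mu> n) (\<lambda>x. (X x)\<^sup>2)"
    by (rule bounded_integrable_OPE[where C = "(real n * C)\<^sup>2"]) (use Xm Xb in \<open>auto simp: abs_le_square_iff[symmetric] intro: order_trans[OF Xb]\<close>)
  have "(\<integral>x. (X x - m)\<^sup>2 \<partial>OPE \<mu> n) = (\<integral>x. (X x)\<^sup>2 - 2 * m * X x + m\<^sup>2 \<partial>OPE \<mu> n)"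
    by (intro Bochner_Integration.integral_cong) (auto simp: power2_eq_square algebra_simps)
  also have "\<dots> = (\<integral>x. (X x)\<^sup>2 \<partial>OPE \<mu> n) - m\<^sup>2"
    using X1 X2 by (simp add: pr.prob_space m_def power2_eq_square)
  also have "(\<integral>x. (X x)\<^sup>2 \<partial>OPE \<mu> n) = (\<Sum>b<n. \<Sum>c<n. FT f b c)"
    unfolding X_def by (rule second_moment_linear_statistic[OF fm fb])
  \<comment> \<open>On the diagonal the added minor is zero, so the two cases of \<open>FT\<close>
    merge into one formula.\<close>
  also have "\<dots> = (\<Sum>b<n. \<Sum>c<n. (if b = c then FM (\<lambda>x. (f x)\<^sup>2) b b else 0) + (FM f b b * FM f c c - (FM f b c)\<^sup>2))"
    by (intro sum.cong refl) (auto simp: FT_def power2_eq_square)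
  also have "\<dots> = (\<Sum>b<n. FM (\<lambda>x. (f x)\<^sup>2) b b) + ((\<Sum>b<n. FM f b b) * (\<Sum>c<n. FM f c c) - (\<Sum>b<n. \<Sum>c<n. (FM f b c)\<^sup>2))"
    by (simp add: sum.distrib sum_subtractf sum_product)
  also have "(\<Sum>b<n. FM f b b) = m" unfolding m_def X_def by (rule expectation_linear_statistic[OF fm fb, symmetric])
  finally show ?thesis by (simp add: m_def power2_eq_square)
qed

text \<open>The variance is half the double integral of
  \<open>(f x - f y)\<^sup>2 * (K x y)\<^sup>2\<close>. The Lipschitz hypothesis supplies a factor
  \<open>(x - y)\<^sup>2\<close>, Christoffel-Darboux replaces \<open>(x - y) * K x y\<close> by two
  products of polynomials, and the product form of the weight splits the integral into
  one-dimensional ones.\<close>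

lemma variance_bound:
  fixes n :: nat
  assumes fm: "f \<in> borel_measurable borel" and fb: "\<And>x. \<bar>f x\<bar> \<le> C"
    and rm: "\<rho> \<in> borel_measurable borel" and r0: "\<And>x. 0 \<le> \<rho> x" and rb: "\<And>x. \<rho> x \<le> D"
    and lip: "\<And>x y. (f x - f y)\<^sup>2 \<le> L * (\<rho> x * \<rho> y * (x - y)\<^sup>2)" and L: "0 \<le> L" and n: "n > 0"
  defines "X \<equiv> (\<lambda>x::nat\<Rightarrow>real. \<Sum>j<n. f (x j))"
  shows "(\<integral>x. (X x - (\<integral>y. X y \<partial>OPE \<mu> n))\<^sup>2 \<partial>OPE \<mu> n) \<le> 2 * L * (ra n)\<^sup>2 * FM \<rho> n n * FM \<rho> (n - 1) (n - 1)"
proof -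
  define K where "K = (\<lambda>x y. \<Sum>k<n. poly (p k) x * poly (p k) y)"
  define q where "q = (\<lambda>b c. p b * p c)"
  note [measurable] = fm rm
  have rb': "\<bar>\<rho> x\<bar> \<le> D" for x using r0[of x] rb[of x] by simp
  have f2b: "\<bar>(f x)\<^sup>2\<bar> \<le> C\<^sup>2" for x using fb[of x] by (simp add: abs_le_square_iff[symmetric] order_trans[OF fb])
  have I1: "integrable \<mu> (\<lambda>x. f x * poly r x)" for r using integrable_bounded_poly[of f C r] fb by simp
  have I2: "integrable \<mu> (\<lambda>x. (f x)\<^sup>2 * poly r x)" for r using integrable_bounded_poly[of "\<lambda>x. (f x)\<^sup>2" "C\<^sup>2" r] f2b by simp
  have I3: "integrable \<mu> (\<lambda>x. \<rho> x * poly r x)" for r using integrable_bounded_poly[of \<rho> D r] rb' by simp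
  \<comment> \<open>Expanding the squared kernel keeps every integral one-dimensional: the double
    integral is an iterated one whose inner part is a finite sum.\<close>
  have K2: "(K x y)\<^sup>2 = (\<Sum>b<n. \<Sum>c<n. poly (q b c) x * poly (q b c) y)" for x y
    by (simp add: K_def q_def power2_eq_square sum_product mult_ac)
  have q1: "integral\<^sup>L \<mu> (poly (q b c)) = (if b = c then 1 else 0)" for b c
    using orthonormal[of b c] by (simp add: q_def poly_mult[abs_def])
  have FMq: "(\<integral>x. f x * poly (q b c) x \<partial>\<mu>) = FM f b c" "(\<integral>x. (f x)\<^sup>2 * poly (q b c) x \<partial>\<mu>) = FM (\<lambda>x. (f x)\<^sup>2) b c" for b c
    by (simp_all add: FM_def q_def)
  define IA where "IA = (\<lambda>x. \<integral>y. (f x - f y)\<^sup>2 * (K x y)\<^sup>2 \<partial>\<mu>)"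
  have A_eq: "(f x - f y)\<^sup>2 * (K x y)\<^sup>2 = (\<Sum>b<n. \<Sum>c<n. poly (q b c) x * ((f x)\<^sup>2 * poly (q b c) y - 2 * f x * (f y * poly (q b c) y) + (f y)\<^sup>2 * poly (q b c) y))" for x y
    unfolding K2 sum_distrib_left by (intro sum.cong refl) (simp add: power2_eq_square algebra_simps)
  have A_int: "integrable \<mu> (\<lambda>y. (f x - f y)\<^sup>2 * (K x y)\<^sup>2)" for x
    unfolding A_eq using I1 I2 integrable_poly
    by (intro Bochner_Integration.integrable_sum integrable_mult_right Bochner_Integration.integrable_add Bochner_Integration.integrable_diff) auto
  have IA_eq: "IA x = (\<Sum>b<n. \<Sum>c<n. (f x)\<^sup>2 * poly (q b c) x * (if b = c then 1 else 0) - 2 * (FM f b c) * (f x * poly (q b c) x) + FM (\<lambda>x. (f x)\<^sup>2) b c * poly (q b c) x)" for x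
  proof -
    have "IA x = (\<Sum>b<n. \<Sum>c<n. \<integral>y. poly (q b c) x * ((f x)\<^sup>2 * poly (q b c) y - 2 * f x * (f y * poly (q b c) y) + (f y)\<^sup>2 * poly (q b c) y) \<partial>\<mu>)"
      unfolding IA_def A_eq using I1 I2 integrable_poly
      by (subst Bochner_Integration.integral_sum; (intro Bochner_Integration.integrable_sum integrable_mult_right Bochner_Integration.integrable_add Bochner_Integration.integrable_diff)?; (simp; fail)?)
    also have "\<dots> = (\<Sum>b<n. \<Sum>c<n. (f x)\<^sup>2 * poly (q b c) x * (if b = c then 1 else 0) - 2 * (FM f b c) * (f x * poly (q b c) x) + FM (\<lambda>x. (f x)\<^sup>2) b c * poly (q b c) x)"
    proof (intro sum.cong refl)
      fix b c
      have "(\<integral>y. poly (q b c) x * ((f x)\<^sup>2 * poly (q b c) y - 2 * f x * (f y * poly (q b c) y) + (f y)\<^sup>2 * poly (q b c) y) \<partial>\<mu>)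
        = poly (q b c) x * ((f x)\<^sup>2 * integral\<^sup>L \<mu> (poly (q b c)) - 2 * f x * (\<integral>y. f y * poly (q b c) y \<partial>\<mu>) + (\<integral>y. (f y)\<^sup>2 * poly (q b c) y \<partial>\<mu>))"
        using I1[of "q b c"] I2[of "q b c"] integrable_poly[of "q b c"] by simp
      then show "(\<integral>y. poly (q b c) x * ((f x)\<^sup>2 * poly (q b c) y - 2 * f x * (f y * poly (q b c) y) + (f y)\<^sup>2 * poly (q b c) y) \<partial>\<mu>)
        = (f x)\<^sup>2 * poly (q b c) x * (if b = c then 1 else 0) - 2 * (FM f b c) * (f x * poly (q b c) x) + FM (\<lambda>x. (f x)\<^sup>2) b c * poly (q b c) x"
        unfolding q1 FMq by (simp add: algebra_simps)
    qed
    finally show ?thesis .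
  qed
  have IA_int: "integrable \<mu> IA"
    unfolding IA_eq[abs_def] using I1 I2 integrable_poly
    by (intro Bochner_Integration.integrable_sum integrable_mult_right Bochner_Integration.integrable_add Bochner_Integration.integrable_diff integrable_mult_left) auto
  have "integral\<^sup>L \<mu> IA = (\<Sum>b<n. \<Sum>c<n. FM (\<lambda>x. (f x)\<^sup>2) b c * (if b = c then 1 else 0) - 2 * (FM f b c) * FM f b c + FM (\<lambda>x. (f x)\<^sup>2) b c * (if b = c then 1 else 0))"
  proof -
    have e: "integrable \<mu> (\<lambda>x. (f x)\<^sup>2 * poly (q b c) x * (if b = c then 1 else 0) - 2 * (FM f b c) * (f x * poly (q b c) x) + FM (\<lambda>x. (f x)\<^sup>2) b c * poly (q b c) x)" for b c
      using I1 I2 integrable_poly by (intro Bochner_Integration.integrable_add Bochner_Integration.integrable_diff integrable_mult_right integrable_mult_left) auto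
    have v: "(\<integral>x. (f x)\<^sup>2 * poly (q b c) x * (if b = c then 1 else 0) - 2 * (FM f b c) * (f x * poly (q b c) x) + FM (\<lambda>x. (f x)\<^sup>2) b c * poly (q b c) x \<partial>\<mu>)
      = FM (\<lambda>x. (f x)\<^sup>2) b c * (if b = c then 1 else 0) - 2 * (FM f b c) * FM f b c + FM (\<lambda>x. (f x)\<^sup>2) b c * (if b = c then 1 else 0)" for b c
    proof -
      have "(\<integral>x. (f x)\<^sup>2 * poly (q b c) x * (if b = c then 1 else 0) - 2 * (FM f b c) * (f x * poly (q b c) x) + FM (\<lambda>x. (f x)\<^sup>2) b c * poly (q b c) x \<partial>\<mu>)
       = (\<integral>x. (f x)\<^sup>2 * poly (q b c) x \<partial>\<mu>) * (if b = c then 1 else 0) - 2 * (FM f b c) * (\<integral>x. f x * poly (q b c) x \<partial>\<mu>) + FM (\<lambda>x. (f x)\<^sup>2) b c * integral\<^sup>L \<mu> (poly (q b c))"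
        using I1[of "q b c"] I2[of "q b c"] integrable_poly[of "q b c"] by simp
      then show ?thesis unfolding q1 FMq .
    qed
    show ?thesis unfolding IA_eq[abs_def]
      by (subst Bochner_Integration.integral_sum, intro Bochner_Integration.integrable_sum e, intro sum.cong refl,
         subst Bochner_Integration.integral_sum, intro e, intro sum.cong refl v)
  qed
  also have "\<dots> = 2 * ((\<Sum>b<n. FM (\<lambda>x. (f x)\<^sup>2) b b) - (\<Sum>b<n. \<Sum>c<n. (FM f b c)\<^sup>2))"
  proof -
    have "(\<Sum>b<n. \<Sum>c<n. FM (\<lambda>x. (f x)\<^sup>2) b c * (if b = c then 1 else 0) - 2 * (FM f b c) * FM f b c + FM (\<lambda>x. (f x)\<^sup>2) b c * (if b = c then 1 else 0))
      = (\<Sum>b<n. \<Sum>c<n. 2 * ((if b = c then FM (\<lambda>x. (f x)\<^sup>2) b b else 0) - (FM f b c)\<^sup>2))"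
      by (intro sum.cong refl) (auto simp: power2_eq_square)
    also have "\<dots> = 2 * (\<Sum>b<n. (\<Sum>c<n. (if b = c then FM (\<lambda>x. (f x)\<^sup>2) b b else 0)) - (\<Sum>c<n. (FM f b c)\<^sup>2))"
      by (simp only: sum_distrib_left[symmetric] sum_subtractf)
    finally show ?thesis by (simp add: sum_subtractf)
  qed
  finally have var: "integral\<^sup>L \<mu> IA = 2 * (\<integral>x. (X x - (\<integral>y. X y \<partial>OPE \<mu> n))\<^sup>2 \<partial>OPE \<mu> n)"
    using variance_linear_statistic[OF fm fb, of n] by (simp add: X_def)
  define B where "B = (\<lambda>x y. 2 * L * (ra n)\<^sup>2 * (\<rho> x * poly (q n n) x * (\<rho> y * poly (q (n - 1) (n - 1)) y) + \<rho> x * poly (q (n - 1) (n - 1)) x * (\<rho> y * poly (q n n) y)))"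
  have AB: "(f x - f y)\<^sup>2 * (K x y)\<^sup>2 \<le> B x y" for x y
  proof -
    define u where "u = poly (p n) x * poly (p (n - 1)) y"
    define v where "v = poly (p (n - 1)) x * poly (p n) y"
    have "(f x - f y)\<^sup>2 * (K x y)\<^sup>2 \<le> L * (\<rho> x * \<rho> y * (x - y)\<^sup>2) * (K x y)\<^sup>2"
      by (intro mult_right_mono lip) auto
    also have "\<dots> = L * (\<rho> x * \<rho> y) * ((x - y) * K x y)\<^sup>2" by (simp add: power_mult_distrib)
    also have "(x - y) * K x y = ra n * (u - v)" unfolding K_def u_def v_def by (rule Christoffel_Darboux[OF n])
    also have "L * (\<rho> x * \<rho> y) * (ra n * (u - v))\<^sup>2 = L * (\<rho> x * \<rho> y) * (ra n)\<^sup>2 * (u - v)\<^sup>2" by (simp add: power_mult_distrib)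
    also have "\<dots> \<le> L * (\<rho> x * \<rho> y) * (ra n)\<^sup>2 * (2 * (u\<^sup>2 + v\<^sup>2))"
    proof (intro mult_left_mono)
      have "0 \<le> (u + v)\<^sup>2" by simp
      then show "(u - v)\<^sup>2 \<le> 2 * (u\<^sup>2 + v\<^sup>2)" by (simp add: power2_eq_square algebra_simps)
    qed (use L r0 in auto)
    also have "\<dots> = B x y" by (simp add: B_def u_def v_def q_def power2_eq_square algebra_simps)
    finally show ?thesis .
  qed
  define IB where "IB = (\<lambda>x. 2 * L * (ra n)\<^sup>2 * (\<rho> x * poly (q n n) x * FM \<rho> (n - 1) (n - 1) + \<rho> x * poly (q (n - 1) (n - 1)) x * FM \<rho> n n))"
  have FMr: "(\<integral>x. \<rho> x * poly (q b c) x \<partial>\<mu>) = FM \<rho> b c" for b c by (simp add: FM_def q_def)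
  have "IA x \<le> IB x" for x
  proof -
    have "integrable \<mu> (B x)" unfolding B_def using I3
      by (intro integrable_mult_right Bochner_Integration.integrable_add)
    then have "IA x \<le> integral\<^sup>L \<mu> (B x)" unfolding IA_def using AB A_int by (intro integral_mono) auto
    also have "\<dots> = IB x" unfolding B_def IB_def using I3 by (simp add: FMr)
    finally show ?thesis .
  qed
  moreover have "integrable \<mu> IB" unfolding IB_def using I3
    by (intro integrable_mult_right Bochner_Integration.integrable_add integrable_mult_left)
  ultimately have "integral\<^sup>L \<mu> IA \<le> integral\<^sup>L \<mu> IB" using IA_int by (intro integral_mono) auto
  also have "integral\<^sup>L \<mu> IB = 2 * L * (ra n)\<^sup>2 * (FM \<rho> n n * FM \<rho> (n - 1) (n - 1) + FM \<rho> (n - 1) (n - 1) * FM \<rho> n n)"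
    unfolding IB_def using I3 by (simp add: FMr)
  finally show ?thesis using var by (simp add: mult_ac)
qed

end

section \<open>Cauchy determinants with poles in both half-planes\<close>

lemma prod_ordered_pairs:
  fixes z :: "nat \<Rightarrow> 'a::field"
  shows "(\<Prod>k<N. \<Prod>k'\<in>{..<N} - {k}. (z k' - z k)) = vdm N (\<lambda>k. - z k) * vdm N z"
proof (induction N)
  case 0 show ?case by (simp add: vdm_def)
next
  case (Suc N)
  have "(\<Prod>k<Suc N. \<Prod>k'\<in>{..<Suc N} - {k}. (z k' - z k)) =
    (\<Prod>k<N. \<Prod>k'\<in>{..<Suc N} - {k}. (z k' - z k)) * (\<Prod>k'\<in>{..<Suc N} - {N}. (z k' - z N))" by simp
  also have "{..<Suc N} - {N} = {..<N}" by auto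
  also have "(\<Prod>k<N. \<Prod>k'\<in>{..<Suc N} - {k}. (z k' - z k)) = (\<Prod>k<N. (z N - z k) * (\<Prod>k'\<in>{..<N} - {k}. (z k' - z k)))"
  proof (intro prod.cong refl)
    fix k assume "k \<in> {..<N}"
    then have "{..<Suc N} - {k} = insert N ({..<N} - {k})" by auto
    then show "(\<Prod>k'\<in>{..<Suc N} - {k}. (z k' - z k)) = (z N - z k) * (\<Prod>k'\<in>{..<N} - {k}. (z k' - z k))" by simp
  qed
  also have "\<dots> = (\<Prod>k<N. z N - z k) * (vdm N (\<lambda>k. - z k) * vdm N z)" by (simp add: prod.distrib Suc)
  finally show ?case by (simp add: vdm_def mult_ac)
qed

lemma cauchy_det':
  fixes z w :: "nat \<Rightarrow> 'a::field"
  assumes "\<And>k l. k < N \<Longrightarrow> l < N \<Longrightarrow> z k \<noteq> w l" and "vdm N z \<noteq> 0"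
  shows "dt N (\<lambda>k l. 1 / (z k - w l)) = vdm N (\<lambda>k. - z k) * vdm N w / (\<Prod>l<N. \<Prod>k<N. (z k - w l))"
proof -
  have "(\<Prod>l<N. \<Prod>k<N. (z k - w l)) \<noteq> 0" using assms by auto
  moreover have "dt N (\<lambda>k l. 1 / (z k - w l)) * (\<Prod>l<N. \<Prod>k<N. (z k - w l)) * vdm N z = vdm N (\<lambda>k. - z k) * vdm N w * vdm N z"
    using cauchy_det[of N z w] assms(1) by (simp add: prod_ordered_pairs mult_ac)
  ultimately show ?thesis using assms(2) by (simp add: field_simps)
qed

lemma vdm_nonzero: "inj_on z {..<N} \<Longrightarrow> vdm N z \<noteq> (0::'a::field)"
  by (auto simp: vdm_def inj_on_def) (metis lessThan_iff less_trans nat_neq_iff)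

lemma vdm_cong: "(\<And>k. k < N \<Longrightarrow> z k = w k) \<Longrightarrow> vdm N z = vdm N w"
  unfolding vdm_def by (intro prod.cong refl) auto

text \<open>\<open>join m z w\<close> lists the poles and \<open>join m w z\<close> the zeros of the
  rational function that \<open>exp_phase_stat\<close> attaches to a phase statistic; conjugation
  exchanges the roles of \<open>z\<close> and \<open>w\<close>.\<close>

definition join :: "nat \<Rightarrow> (nat \<Rightarrow> complex) \<Rightarrow> (nat \<Rightarrow> complex) \<Rightarrow> nat \<Rightarrow> complex" where
  "join m z w k = (if k < m then z k else cnj (w (k - m)))"

lemma vdm_join: "vdm (m + m) (join m z w) = vdm m z * vdm m (\<lambda>k. cnj (w k)) * (\<Prod>s<m. \<Prod>r<m. (cnj (w s) - z r))"
proof -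
  have "vdm m (join m z w) = vdm m z" by (rule vdm_cong) (simp add: join_def)
  moreover have "(\<Prod>j<m. \<Prod>l<m. (join m z w (m + j) - join m z w l)) = (\<Prod>s<m. \<Prod>r<m. (cnj (w s) - z r))"
    by (intro prod.cong refl) (simp add: join_def)
  ultimately show ?thesis unfolding vdm_add by (simp add: join_def)
qed

lemma vdm_join_minus: "vdm (m + m) (\<lambda>k. - join m z w k) = vdm m (\<lambda>k. - z k) * vdm m (\<lambda>k. - cnj (w k)) * (\<Prod>s<m. \<Prod>r<m. (z r - cnj (w s)))"
proof -
  have e: "vdm (m + m) (\<lambda>k. - join m z w k) = vdm (m + m) (join m (\<lambda>k. - z k) (\<lambda>k. - w k))"
    by (rule vdm_cong) (auto simp: join_def)
  have "(\<Prod>s<m. \<Prod>r<m. (cnj (- w s) - (- z r))) = (\<Prod>s<m. \<Prod>r<m. (z r - cnj (w s)))"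
    by (intro prod.cong refl) simp
  then show ?thesis unfolding e vdm_join by simp
qed

text \<open>The eventual limit of the characteristic function: the Cauchy determinant with only the
  pairs in the same half-plane kept, divided by the full one.\<close>

definition gauss_product :: "nat \<Rightarrow> (nat \<Rightarrow> complex) \<Rightarrow> (nat \<Rightarrow> complex) \<Rightarrow> complex" where
  "gauss_product m z w = (\<Prod>s<m. \<Prod>r<m. ((z r - cnj (z s)) * (w r - cnj (w s))) / ((z r - cnj (w s)) * (w r - cnj (z s))))"

text \<open>Products over pairs inside one half-plane occur in both determinants and cancel. Only
  differences between a point and a conjugate survive, and these cannot vanish. The four conclusions
  share their preparation.\<close>

lemma block_cauchy_ratio:
  fixes z w :: "nat \<Rightarrow> complex"
  assumes Im: "\<And>r. r < m \<Longrightarrow> Im (z r) > 0" "\<And>r. r < m \<Longrightarrow> Im (w r) > 0"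
    and inj: "inj_on z {..<m}" "inj_on w {..<m}" and zw: "\<And>r s. r < m \<Longrightarrow> s < m \<Longrightarrow> z r \<noteq> w s"
  defines "Z \<equiv> join m z w" and "W \<equiv> join m w z"
  shows "dt (m + m) (\<lambda>k l. 1 / (Z k - W l)) \<noteq> 0"
    and "dt (m + m) (\<lambda>k l. if (k < m) = (l < m) then 1 / (Z k - W l) else 0) / dt (m + m) (\<lambda>k l. 1 / (Z k - W l)) = gauss_product m z w"
    and "\<And>k l. k < m + m \<Longrightarrow> l < m + m \<Longrightarrow> Z k \<noteq> W l" and "vdm (m + m) Z \<noteq> 0"
proof -
  have up: "z r \<noteq> cnj (z s)" "w r \<noteq> cnj (w s)" "z r \<noteq> cnj (w s)" "w r \<noteq> cnj (z s)" if "r < m" "s < m" for r s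
    using Im(1)[OF that(1)] Im(1)[OF that(2)] Im(2)[OF that(1)] Im(2)[OF that(2)] by (auto simp: complex_eq_iff)
  show ZW: "Z k \<noteq> W l" if "k < m + m" "l < m + m" for k l
  proof -
    have "k - m < m" if "\<not> k < m" using that \<open>k < m + m\<close> by linarith
    moreover have "l - m < m" if "\<not> l < m" using that \<open>l < m + m\<close> by linarith
    ultimately show ?thesis using up(1)[of k "l - m"] up(2)[of l "k - m"] zw[of k l] zw[of "l - m" "k - m"]
      by (cases "k < m"; cases "l < m") (auto simp: Z_def W_def join_def)
  qed
  have v: "vdm m z \<noteq> 0" "vdm m w \<noteq> 0" by (rule vdm_nonzero[OF inj(1)]) (rule vdm_nonzero[OF inj(2)])
  have vc: "vdm m (\<lambda>k. cnj (z k)) \<noteq> 0" "vdm m (\<lambda>k. cnj (w k)) \<noteq> 0" using inj by (auto intro!: vdm_nonzero simp: inj_on_def)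
  have vm: "vdm m (\<lambda>k. - z k) \<noteq> 0" "vdm m (\<lambda>k. - cnj (w k)) \<noteq> 0" using inj by (auto intro!: vdm_nonzero simp: inj_on_def)
  define A where "A = (\<Prod>s<m. \<Prod>r<m. (z r - cnj (z s)))"
  define B where "B = (\<Prod>s<m. \<Prod>r<m. (cnj (w s) - w r))"
  define C where "C = (\<Prod>s<m. \<Prod>r<m. (z r - cnj (w s)))"
  define D where "D = (\<Prod>s<m. \<Prod>r<m. (cnj (z s) - w r))"
  define T1 where "T1 = (\<Prod>l<m. \<Prod>k<m. (z k - w l))"
  define T2 where "T2 = (\<Prod>l<m. \<Prod>k<m. (cnj (w k) - cnj (z l)))"
  have nz: "A \<noteq> 0" "B \<noteq> 0" "C \<noteq> 0" "D \<noteq> 0" "T1 \<noteq> 0" "T2 \<noteq> 0"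
  proof -
    show "A \<noteq> 0" "C \<noteq> 0" "T1 \<noteq> 0" using up zw by (auto simp: A_def C_def T1_def)
    show "B \<noteq> 0" "D \<noteq> 0" "T2 \<noteq> 0" using up zw by (auto simp: B_def D_def T2_def) metis+
  qed
  have E: "(\<Prod>s<m. \<Prod>r<m. (cnj (w s) - z r)) \<noteq> 0" using up by (auto, metis)
  show vZ: "vdm (m + m) Z \<noteq> 0" unfolding Z_def vdm_join using v vc E by simp
  have T: "(\<Prod>l<m + m. \<Prod>k<m + m. (Z k - W l)) = (T1 * B) * (A * T2)"
  proof -
    have "(\<Prod>l<m. \<Prod>k<m. (Z k - W l)) = T1" "(\<Prod>l<m. \<Prod>k<m. (Z (m + k) - W l)) = (\<Prod>l<m. \<Prod>k<m. (cnj (w k) - w l))"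
      "(\<Prod>l<m. \<Prod>k<m. (Z k - W (m + l))) = A" "(\<Prod>l<m. \<Prod>k<m. (Z (m + k) - W (m + l))) = T2"
      unfolding T1_def A_def T2_def by (intro prod.cong refl; simp add: Z_def W_def join_def)+
    moreover have "(\<Prod>l<m. \<Prod>k<m. (cnj (w k) - w l)) = B" unfolding B_def by (rule prod.swap)
    ultimately show ?thesis unfolding prod_lessThan_add prod.distrib by (simp only: mult_ac)
  qed
  have c1: "dt (m + m) (\<lambda>k l. 1 / (Z k - W l)) = (vdm m (\<lambda>k. - z k) * vdm m (\<lambda>k. - cnj (w k)) * C) * (vdm m w * vdm m (\<lambda>k. cnj (z k)) * D) / ((T1 * B) * (A * T2))"
    by (subst cauchy_det'[OF ZW vZ]) (auto simp: T[symmetric], simp add: Z_def W_def vdm_join vdm_join_minus C_def D_def)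
  show nzC: "dt (m + m) (\<lambda>k l. 1 / (Z k - W l)) \<noteq> 0" unfolding c1 using nz v vc vm by simp
  have "dt (m + m) (\<lambda>k l. if (k < m) = (l < m) then 1 / (Z k - W l) else 0) =
    dt m (\<lambda>k l. if (k < m) = (l < m) then 1 / (Z k - W l) else 0) * dt m (\<lambda>k l. if (m + k < m) = (m + l < m) then 1 / (Z (m + k) - W (m + l)) else 0)"
    by (rule dt_block_upper) auto
  also have "dt m (\<lambda>k l. if (k < m) = (l < m) then 1 / (Z k - W l) else 0) = dt m (\<lambda>k l. 1 / (z k - w l))"
    by (rule dt_cong) (simp add: Z_def W_def join_def)
  also have "\<dots> = vdm m (\<lambda>k. - z k) * vdm m w / T1" unfolding T1_def by (rule cauchy_det'[OF zw v(1)])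
  also have "dt m (\<lambda>k l. if (m + k < m) = (m + l < m) then 1 / (Z (m + k) - W (m + l)) else 0) = dt m (\<lambda>k l. 1 / (cnj (w k) - cnj (z l)))"
    by (rule dt_cong) (simp add: Z_def W_def join_def)
  also have "\<dots> = vdm m (\<lambda>k. - cnj (w k)) * vdm m (\<lambda>k. cnj (z k)) / T2"
    unfolding T2_def by (rule cauchy_det'[OF _ vc(2)]) (metis complex_cnj_cancel_iff zw)
  finally have c2: "dt (m + m) (\<lambda>k l. if (k < m) = (l < m) then 1 / (Z k - W l) else 0) =
    vdm m (\<lambda>k. - z k) * vdm m w / T1 * (vdm m (\<lambda>k. - cnj (w k)) * vdm m (\<lambda>k. cnj (z k)) / T2)" .
  have "dt (m + m) (\<lambda>k l. if (k < m) = (l < m) then 1 / (Z k - W l) else 0) / dt (m + m) (\<lambda>k l. 1 / (Z k - W l)) = A * B / (C * D)"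
    unfolding c1 c2 using nz v vc vm by (simp add: field_simps)
  also have "\<dots> = gauss_product m z w"
  proof -
    have "A * B / (C * D) = (\<Prod>s<m. \<Prod>r<m. ((z r - cnj (z s)) * (cnj (w s) - w r)) / ((z r - cnj (w s)) * (cnj (z s) - w r)))"
      by (simp add: A_def B_def C_def D_def prod.distrib prod_dividef)
    also have "\<dots> = gauss_product m z w" unfolding gauss_product_def
    proof (intro prod.cong refl)
      fix s r
      have "cnj (w s) - w r = - (w r - cnj (w s))" "cnj (z s) - w r = - (w r - cnj (z s))" by simp_all
      then show "((z r - cnj (z s)) * (cnj (w s) - w r)) / ((z r - cnj (w s)) * (cnj (z s) - w r)) = ((z r - cnj (z s)) * (w r - cnj (w s))) / ((z r - cnj (w s)) * (w r - cnj (z s)))"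
        by (simp only: mult_minus_right minus_divide_divide)
    qed
    finally show ?thesis .
  qed
  finally show "dt (m + m) (\<lambda>k l. if (k < m) = (l < m) then 1 / (Z k - W l) else 0) / dt (m + m) (\<lambda>k l. 1 / (Z k - W l)) = gauss_product m z w" .
qed

lemma tendsto_dt:
  fixes f :: "nat \<Rightarrow> nat \<Rightarrow> nat \<Rightarrow> complex"
  assumes "\<And>i j. i < N \<Longrightarrow> j < N \<Longrightarrow> (\<lambda>n. f n i j) \<longlonglongrightarrow> g i j"
  shows "(\<lambda>n. dt N (f n)) \<longlonglongrightarrow> dt N g"
  unfolding dt_leibniz
proof (intro tendsto_sum tendsto_mult tendsto_const tendsto_prod assms)
  fix \<pi> j assume "\<pi> \<in> {\<pi>. \<pi> permutes {..<N}}" "j \<in> {..<N}"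
  then show "\<pi> j < N" "j < N" using permutes_in_image[of \<pi> "{..<N}" j] by auto
qed

text \<open>The factor 2 makes the exponential rational:
  \<open>exp (2 * \<i> * Im A) = exp A / cnj (exp A)\<close>, and for real \<open>u\<close> the
  conjugate of \<open>u - w\<close> is \<open>u - cnj w\<close>.\<close>

definition phase_stat :: "nat \<Rightarrow> (nat \<Rightarrow> complex) \<Rightarrow> (nat \<Rightarrow> complex) \<Rightarrow> real \<Rightarrow> real" where
  "phase_stat m z w u = 2 * (\<Sum>r<m. Im (Ln (of_real u - w r) - Ln (of_real u - z r)))"

lemma exp_2i_Im: "exp (\<i> * of_real (2 * Im A)) = exp A / cnj (exp A)"
proof -
  have "\<i> * of_real (2 * Im A) = A - cnj A" by (simp add: complex_eq_iff)
  then show ?thesis by (simp add: exp_diff exp_cnj)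
qed

lemma exp_phase_stat:
  assumes Im: "\<And>r. r < m \<Longrightarrow> Im (z r) > 0" "\<And>r. r < m \<Longrightarrow> Im (w r) > 0"
  shows "exp (\<i> * of_real (phase_stat m z w u)) = (\<Prod>k<m + m. (of_real u - join m w z k) / (of_real u - join m z w k))"
proof -
  have "exp (\<i> * of_real (phase_stat m z w u)) = (\<Prod>r<m. exp (\<i> * of_real (2 * Im (Ln (of_real u - w r) - Ln (of_real u - z r)))))"
    unfolding phase_stat_def by (simp add: exp_sum[symmetric] sum_distrib_left mult_ac)
  also have "\<dots> = (\<Prod>r<m. (of_real u - w r) / (of_real u - z r) * ((of_real u - cnj (z r)) / (of_real u - cnj (w r))))"
  proof (intro prod.cong refl)
    fix r assume "r \<in> {..<m}"
    then have nz: "of_real u - w r \<noteq> 0" "of_real u - z r \<noteq> 0" using Im[of r] by (auto simp: complex_eq_iff)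
    have "exp (Ln (of_real u - w r) - Ln (of_real u - z r)) = (of_real u - w r) / (of_real u - z r)"
      using nz by (simp add: exp_diff)
    then show "exp (\<i> * of_real (2 * Im (Ln (of_real u - w r) - Ln (of_real u - z r)))) =
       (of_real u - w r) / (of_real u - z r) * ((of_real u - cnj (z r)) / (of_real u - cnj (w r)))"
      unfolding exp_2i_Im by simp
  qed
  also have "\<dots> = (\<Prod>k<m + m. (of_real u - join m w z k) / (of_real u - join m z w k))"
    unfolding prod_lessThan_add prod.distrib by (simp add: join_def)
  finally show ?thesis .
qed

lemma phase_stat_measurable:
  assumes "\<And>r. r < m \<Longrightarrow> Im (z r) > 0" "\<And>r. r < m \<Longrightarrow> Im (w r) > 0"
  shows "phase_stat m z w \<in> borel_measurable borel"
proof -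
  have "(\<lambda>u::real. Ln (of_real u - z)) \<in> borel_measurable borel" if "Im z > 0" for z
    by (intro borel_measurable_continuous_onI continuous_intros) (use that in \<open>auto simp: complex_nonpos_Reals_iff\<close>)
  then show ?thesis unfolding phase_stat_def[abs_def] using assms
    by (intro borel_measurable_times borel_measurable_const borel_measurable_sum measurable_compose[OF _ borel_measurable_Im] borel_measurable_diff) auto
qed

lemma phase_stat_bounded:
  assumes Im: "\<And>r. r < m \<Longrightarrow> Im (z r) > 0" "\<And>r. r < m \<Longrightarrow> Im (w r) > 0"
  shows "\<exists>C. \<forall>u. \<bar>phase_stat m z w u\<bar> \<le> C"
proof -
  have "\<bar>phase_stat m z w u\<bar> \<le> 2 * (\<Sum>r<m. cmod (w r - z r) / min (Im (z r)) (Im (w r)))" for u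
  proof -
    have "\<bar>\<Sum>r<m. Im (Ln (of_real u - w r) - Ln (of_real u - z r))\<bar> \<le> (\<Sum>r<m. cmod (w r - z r) / min (Im (z r)) (Im (w r)))"
    proof (rule order_trans[OF sum_abs], intro sum_mono)
      fix r assume "r \<in> {..<m}"
      then show "\<bar>Im (Ln (of_real u - w r) - Ln (of_real u - z r))\<bar> \<le> cmod (w r - z r) / min (Im (z r)) (Im (w r))"
        using Im[of r] by (intro order_trans[OF abs_Im_le_cmod Ln_shift_lipschitz]) auto
    qed
    then show ?thesis unfolding phase_stat_def by (simp add: abs_mult)
  qed
  then show ?thesis by blast
qed

lemma Ln_scaled_difference:
  assumes "c > 0" "z \<noteq> 0" "w \<noteq> 0"
  shows "Ln (of_real c * z) - Ln (of_real c * w) = Ln z - Ln w"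
  using assms by (simp add: Ln_times_of_real)

lemma unimodular_quotient_split: "a \<noteq> 0 \<Longrightarrow> b \<noteq> 0 \<Longrightarrow> X / cnj X = a / b / cnj (a / b) * ((X * b / a) / cnj (X * b / a))"
  by simp

section \<open>Characteristic functions of phase statistics\<close>

context mesoscopic
begin

lemma rescale: "n > 0 \<Longrightarrow> of_real (real n powr \<alpha> * (x - x0)) - \<omega> = of_real (real n powr \<alpha>) * (of_real x - zz n \<omega>)"
  unfolding zz_def by (simp add: algebra_simps powr_minus of_real_inverse)

lemma UU_cnj: "UU n (cnj \<omega>) = cnj (UU n \<omega>)"
  by (simp add: UU_def zz_cnj P_cnj)

lemma SS_cnj: "n > 0 \<Longrightarrow> Im \<omega> \<noteq> 0 \<Longrightarrow> SS n (cnj \<omega>) = cnj (SS n \<omega>)"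
  by (simp add: SS_def zz_cnj Q_cnj Im_zz)

text \<open>The limit of \<open>UU n \<omega>\<close>, the root on the same side of the real axis as
  \<omega>; \<open>SS n \<omega>\<close> tends to the other root.\<close>

definition lU :: "complex \<Rightarrow> complex" where "lU \<omega> = (if Im \<omega> > 0 then \<tau> else cnj \<tau>)"

lemma UU_limit: assumes "Im \<omega> \<noteq> 0" shows "(\<lambda>n. UU n \<omega>) \<longlonglongrightarrow> lU \<omega>"
proof -
  have up: "(\<lambda>n. UU n \<omega>) \<longlonglongrightarrow> \<tau>" if "Im \<omega> > 0" for \<omega>
  proof (rule tendstoI)
    fix e :: real assume "e > 0"
    from UU_tendsto[OF this that, of "cmod \<omega>"] show "\<forall>\<^sub>F n in sequentially. dist (UU n \<omega>) \<tau> < e"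
      by eventually_elim (auto simp: dist_norm)
  qed
  show ?thesis
  proof (cases "Im \<omega> > 0")
    case True then show ?thesis using up by (simp add: lU_def)
  next
    case False
    then have "Im (cnj \<omega>) > 0" using assms by simp
    from tendsto_cnj[OF up[OF this]] show ?thesis using False by (simp add: UU_cnj lU_def)
  qed
qed

lemma SS_limit: assumes "Im \<omega> \<noteq> 0" shows "(\<lambda>n. SS n \<omega>) \<longlonglongrightarrow> cnj (lU \<omega>)" "\<forall>\<^sub>F n in sequentially. Q (n - 1) (zz n \<omega>) \<noteq> 0"
proof -
  have up: "(\<lambda>n. SS n \<omega>) \<longlonglongrightarrow> cnj \<tau>" "\<forall>\<^sub>F n in sequentially. Q (n - 1) (zz n \<omega>) \<noteq> 0" if "Im \<omega> > 0" for \<omega>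
  proof -
    show "(\<lambda>n. SS n \<omega>) \<longlonglongrightarrow> cnj \<tau>"
    proof (rule tendstoI)
      fix e :: real assume "e > 0"
      from SS_tendsto[OF this that, of "cmod \<omega>"] show "\<forall>\<^sub>F n in sequentially. dist (SS n \<omega>) (cnj \<tau>) < e"
        by eventually_elim (auto simp: dist_norm)
    qed
    show "\<forall>\<^sub>F n in sequentially. Q (n - 1) (zz n \<omega>) \<noteq> 0"
      using SS_tendsto[of 1 "Im \<omega>" "cmod \<omega>"] that by (auto elim: eventually_mono)
  qed
  show "(\<lambda>n. SS n \<omega>) \<longlonglongrightarrow> cnj (lU \<omega>)"
  proof (cases "Im \<omega> > 0")
    case True then show ?thesis using up by (simp add: lU_def)
  next
    case False
    then have pos: "Im (cnj \<omega>) > 0" using assms by simp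
    from tendsto_cnj[OF up(1)[OF this]] have "(\<lambda>n. cnj (SS n (cnj \<omega>))) \<longlonglongrightarrow> \<tau>" by simp
    moreover have "\<forall>\<^sub>F n in sequentially. cnj (SS n (cnj \<omega>)) = SS n \<omega>"
      using eventually_gt_at_top[of 0] by eventually_elim (simp add: SS_cnj assms)
    ultimately have "(\<lambda>n. SS n \<omega>) \<longlonglongrightarrow> \<tau>" by (rule Lim_transform_eventually)
    then show ?thesis using False by (simp add: lU_def)
  qed
  show "\<forall>\<^sub>F n in sequentially. Q (n - 1) (zz n \<omega>) \<noteq> 0"
  proof (cases "Im \<omega> > 0")
    case True then show ?thesis using up by simp
  next
    case False
    then have pos: "Im (cnj \<omega>) > 0" using assms by simp
    show ?thesis using up(2)[OF pos] eventually_gt_at_top[of 0]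
      by eventually_elim (use assms in \<open>auto simp: zz_cnj Q_cnj Im_zz\<close>)
  qed
qed

text \<open>Division by the diagonal value of \<open>FF\<close>, which is 1, eliminates
  \<open>ra n\<close> and \<open>Q\<close>. There remain a quotient of values of \<open>P\<close>,
  which can be pulled out of the rows and columns of a determinant, and an expression in ratios with
  known limits.\<close>

lemma FF_factor:
  assumes n: "n > 0" and \<omega>: "Im \<omega> \<noteq> 0" and \<zeta>: "Im \<zeta> \<noteq> 0" and Q0: "Q (n - 1) (zz n \<zeta>) \<noteq> 0"
  shows "FF n (zz n \<omega>) (zz n \<zeta>) = P (n - 1) (zz n \<omega>) / P (n - 1) (zz n \<zeta>) * ((UU n \<omega> - SS n \<zeta>) / (UU n \<zeta> - SS n \<zeta>))"
proof -
  have I: "Im (zz n \<omega>) \<noteq> 0" "Im (zz n \<zeta>) \<noteq> 0" using assms by (simp_all add: Im_zz)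
  have p: "P (n - 1) (zz n \<omega>) \<noteq> 0" "P (n - 1) (zz n \<zeta>) \<noteq> 0" using P_nonzero I by auto
  have f: "FF n (zz n x) (zz n \<zeta>) = of_real (ra n) * Q (n - 1) (zz n \<zeta>) * (P (n - 1) (zz n x) * (UU n x - SS n \<zeta>))"
    if "P (n - 1) (zz n x) \<noteq> 0" for x
    unfolding FF_def UU_def SS_def using that Q0 by (simp add: field_simps)
  have one: "of_real (ra n) * Q (n - 1) (zz n \<zeta>) * (P (n - 1) (zz n \<zeta>) * (UU n \<zeta> - SS n \<zeta>)) = 1"
    using FF_diag[OF I(2) n] f[OF p(2)] by simp
  then have "P (n - 1) (zz n \<zeta>) * (UU n \<zeta> - SS n \<zeta>) \<noteq> 0" by auto
  with one have r: "of_real (ra n) * Q (n - 1) (zz n \<zeta>) = 1 / (P (n - 1) (zz n \<zeta>) * (UU n \<zeta> - SS n \<zeta>))"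
    by (simp add: eq_divide_eq)
  show ?thesis unfolding f[OF p(1)] r by simp
qed

lemma log_trace_ratio_limit:
  assumes "Im \<omega> > 0" "Im \<omega>' > 0"
  shows "(\<lambda>n. exp (log_trace n (zz n \<omega>) (zz n \<omega>')) * P (n - 1) (zz n \<omega>') / P (n - 1) (zz n \<omega>)) \<longlonglongrightarrow> 1"
proof (rule tendstoI)
  fix e :: real assume e: "e > 0"
  have "isCont exp (0::complex)" by simp
  then obtain d where d: "d > 0" "\<And>\<delta>::complex. cmod \<delta> < d \<Longrightarrow> cmod (exp \<delta> - 1) < e"
    using e unfolding continuous_at_eps_delta by (auto simp: dist_norm)
  have d2: "d / 2 > 0" using d by simp
  define h where "h = min (Im \<omega>) (Im \<omega>')"
  have h: "h > 0" using assms by (simp add: h_def)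
  show "\<forall>\<^sub>F n in sequentially. dist (exp (log_trace n (zz n \<omega>) (zz n \<omega>')) * P (n - 1) (zz n \<omega>') / P (n - 1) (zz n \<omega>)) 1 < e"
    using log_trace_asymptotics[OF d2 h, of "max (cmod \<omega>) (cmod \<omega>')"] eventually_gt_at_top[of 0]
  proof eventually_elim
    case (elim n)
    then obtain \<delta> where \<delta>: "cmod \<delta> \<le> d / 2" "exp (log_trace n (zz n \<omega>) (zz n \<omega>')) = P (n - 1) (zz n \<omega>) / P (n - 1) (zz n \<omega>') * exp \<delta>"
      by (metis h_def max.cobounded1 max.cobounded2 min.cobounded1 min.cobounded2)
    have "P (n - 1) (zz n \<omega>) \<noteq> 0" "P (n - 1) (zz n \<omega>') \<noteq> 0" using assms elim by (auto intro!: P_nonzero simp: Im_zz)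
    then have "exp (log_trace n (zz n \<omega>) (zz n \<omega>')) * P (n - 1) (zz n \<omega>') / P (n - 1) (zz n \<omega>) = exp \<delta>"
      unfolding \<delta>(2) by simp
    then show ?case using d(2)[of \<delta>] \<delta>(1) d(1) by (simp add: dist_norm)
  qed
qed

text \<open>Rescaling by the positive number \<open>n powr \<alpha>\<close> adds the same real
  constant to both logarithms and cancels in the difference, so the mean is expressed by
  \<open>log_trace\<close> at the rescaled poles.\<close>

lemma FM_phase_stat:
  assumes Im: "\<And>r. r < m \<Longrightarrow> Im (z r) > 0" "\<And>r. r < m \<Longrightarrow> Im (w r) > 0" and n: "n > 0"
  shows "(\<Sum>k<n. FM (\<lambda>x. phase_stat m z w (real n powr \<alpha> * (x - x0))) k k) = 2 * (\<Sum>r<m. Im (log_trace n (zz n (w r)) (zz n (z r))))"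
proof -
  have "FM (\<lambda>x. phase_stat m z w (real n powr \<alpha> * (x - x0))) k k = 2 * (\<Sum>r<m. Im (log_mean (p k * p k) (zz n (w r)) (zz n (z r))))" for k
  proof -
    define q where "q = p k * p k"
    define Lk where "Lk = (\<lambda>r x. (Ln (of_real x - zz n (w r)) - Ln (of_real x - zz n (z r))) * complex_of_real (poly q x))"
    have Li: "integrable \<mu> (Lk r)" if "r < m" for r
      unfolding Lk_def using Im[OF that] n by (intro integrable_log_mean Im_zz_pos)
    have "FM (\<lambda>x. phase_stat m z w (real n powr \<alpha> * (x - x0))) k k = (\<integral>x. 2 * (\<Sum>r<m. Im (Lk r x)) \<partial>\<mu>)"
      unfolding FM_def
    proof (intro Bochner_Integration.integral_cong refl)
      fix x
      have "Im (Ln (of_real (real n powr \<alpha> * (x - x0)) - w r) - Ln (of_real (real n powr \<alpha> * (x - x0)) - z r)) * poly q x = Im (Lk r x)"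
        if "r < m" for r
      proof -
        have "Im (of_real x - zz n (w r)) \<noteq> 0" "Im (of_real x - zz n (z r)) \<noteq> 0"
          using Im[OF that] n by (auto simp: Im_zz)
        then have "of_real x - zz n (w r) \<noteq> 0" "of_real x - zz n (z r) \<noteq> 0" by (metis zero_complex.simps(2))+
        then have "Ln (of_real (real n powr \<alpha> * (x - x0)) - w r) - Ln (of_real (real n powr \<alpha> * (x - x0)) - z r)
           = Ln (of_real x - zz n (w r)) - Ln (of_real x - zz n (z r))"
          unfolding rescale[OF n] using n by (intro Ln_scaled_difference) auto
        then show ?thesis unfolding Lk_def by simp
      qed
      then show "phase_stat m z w (real n powr \<alpha> * (x - x0)) * (poly (p k) x * poly (p k) x) = 2 * (\<Sum>r<m. Im (Lk r x))"
        unfolding phase_stat_def by (simp add: q_def sum_distrib_right mult.assoc)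
    qed
    also have "\<dots> = 2 * (\<Sum>r<m. \<integral>x. Im (Lk r x) \<partial>\<mu>)"
      using Li by (subst integral_mult_right_zero, subst Bochner_Integration.integral_sum) (auto intro: integrable_Im)
    also have "(\<Sum>r<m. \<integral>x. Im (Lk r x) \<partial>\<mu>) = (\<Sum>r<m. Im (integral\<^sup>L \<mu> (Lk r)))"
      using Li by (intro sum.cong refl integral_Im) auto
    finally show ?thesis by (simp add: log_mean_def Lk_def q_def)
  qed
  then have "(\<Sum>k<n. FM (\<lambda>x. phase_stat m z w (real n powr \<alpha> * (x - x0))) k k) = 2 * (\<Sum>k<n. \<Sum>r<m. Im (log_mean (p k * p k) (zz n (w r)) (zz n (z r))))"
    by (simp add: sum_distrib_left)
  also have "\<dots> = 2 * (\<Sum>r<m. Im (log_trace n (zz n (w r)) (zz n (z r))))"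
    by (subst sum.swap) (simp add: log_trace_def)
  finally show ?thesis .
qed

text \<open>In the limit the entry for \<open>Z k\<close> and \<open>W l\<close> carries
  \<open>lU (W l) - cnj (lU (Z k))\<close>, which vanishes when the points lie in opposite
  half-planes: the determinant becomes block diagonal. The values of \<open>P (n - 1)\<close> pulled
  out of it need not have a limit, but the mean produces the same phase.\<close>

lemma phase_stat_limit:
  assumes Im: "\<And>r. r < m \<Longrightarrow> Im (z r) > 0" "\<And>r. r < m \<Longrightarrow> Im (w r) > 0"
    and inj: "inj_on z {..<m}" "inj_on w {..<m}" and zw: "\<And>r s. r < m \<Longrightarrow> s < m \<Longrightarrow> z r \<noteq> w s"
  defines "X \<equiv> lin_stat (phase_stat m z w) \<alpha> x0"
  shows "(\<lambda>n. \<integral>x. exp (\<i> * of_real (X n x - (\<integral>y. X n y \<partial>OPE \<mu> n))) \<partial>OPE \<mu> n) \<longlonglongrightarrow> gauss_product m z w"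
proof -
  define Z where "Z = join m z w"
  define W where "W = join m w z"
  define N where "N = m + m"
  have bc1: "dt N (\<lambda>k l. 1 / (Z k - W l)) \<noteq> 0"
    unfolding Z_def W_def N_def by (rule block_cauchy_ratio(1)) (use Im inj zw in auto)
  have bc2: "dt N (\<lambda>k l. if (k < m) = (l < m) then 1 / (Z k - W l) else 0) / dt N (\<lambda>k l. 1 / (Z k - W l)) = gauss_product m z w"
    unfolding Z_def W_def N_def by (rule block_cauchy_ratio(2)) (use Im inj zw in auto)
  have bc3: "Z k \<noteq> W l" if "k < N" "l < N" for k l
    unfolding Z_def W_def by (rule block_cauchy_ratio(3)) (use that Im inj zw in \<open>auto simp: N_def\<close>)
  have bc4: "vdm N Z \<noteq> 0"
    unfolding Z_def N_def by (rule block_cauchy_ratio(4)) (use Im inj zw in auto)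
  have ImZ: "Im (Z k) \<noteq> 0" "Im (W k) \<noteq> 0" if "k < N" for k
  proof -
    have "k - m < m" if "\<not> k < m" using that \<open>k < N\<close> by (simp add: N_def)
    then show "Im (Z k) \<noteq> 0" "Im (W k) \<noteq> 0"
      using Im[of k] Im[of "k - m"] by (cases "k < m"; force simp: Z_def W_def join_def)+
  qed
  have side: "lU (W l) = (if (k < m) = (l < m) then lU (Z k) else cnj (lU (Z k)))" if "k < N" "l < N" for k l
  proof -
    have "k - m < m" if "\<not> k < m" using that \<open>k < N\<close> by (simp add: N_def)
    moreover have "l - m < m" if "\<not> l < m" using that \<open>l < N\<close> by (simp add: N_def)
    ultimately have "Im (Z k) > 0 \<longleftrightarrow> k < m" "Im (W l) > 0 \<longleftrightarrow> l < m"
      using Im[of k] Im[of "k - m"] Im[of l] Im[of "l - m"] by (auto simp: Z_def W_def join_def)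
    then show ?thesis by (auto simp: lU_def)
  qed
  have lU0: "lU \<omega> - cnj (lU \<omega>) \<noteq> 0" for \<omega> using Im_\<tau> by (auto simp: lU_def complex_eq_iff)
  define \<rho> where "\<rho> = (\<lambda>n k l. (UU n (W l) - SS n (Z k)) / (UU n (Z k) - SS n (Z k)))"
  have \<rho>: "(\<lambda>n. \<rho> n k l / (Z k - W l)) \<longlonglongrightarrow> (if (k < m) = (l < m) then 1 / (Z k - W l) else 0)" if k: "k < N" and l: "l < N" for k l
  proof -
    have "(\<lambda>n. \<rho> n k l / (Z k - W l)) \<longlonglongrightarrow> (lU (W l) - cnj (lU (Z k))) / (lU (Z k) - cnj (lU (Z k))) / (Z k - W l)"
      unfolding \<rho>_def using bc3[OF k l] by (intro tendsto_divide tendsto_diff tendsto_const UU_limit SS_limit ImZ k l lU0) auto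
    then show ?thesis using side[OF k l] lU0[of "Z k"] by (auto split: if_splits)
  qed
  have dtl: "(\<lambda>n. dt N (\<lambda>k l. \<rho> n k l / (Z k - W l))) \<longlonglongrightarrow> dt N (\<lambda>k l. if (k < m) = (l < m) then 1 / (Z k - W l) else 0)"
    by (rule tendsto_dt[OF \<rho>])
  \<comment> \<open>The uncontrolled phase left by the values of \<open>P (n - 1)\<close>;
    \<open>q\<close> measures how far the contribution of the mean deviates from it.\<close>
  define \<Theta> where "\<Theta> = (\<lambda>n. \<Prod>r<m. (P (n - 1) (zz n (w r)) / P (n - 1) (zz n (z r))) / cnj (P (n - 1) (zz n (w r)) / P (n - 1) (zz n (z r))))"
  define q where "q = (\<lambda>n r. exp (log_trace n (zz n (w r)) (zz n (z r))) * P (n - 1) (zz n (z r)) / P (n - 1) (zz n (w r)))"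
  have ql: "(\<lambda>n. \<Prod>r<m. cnj (q n r) / q n r) \<longlonglongrightarrow> (\<Prod>r<m. cnj 1 / 1)"
    unfolding q_def using Im by (intro tendsto_prod tendsto_divide tendsto_cnj log_trace_ratio_limit) auto
  have evQ: "\<forall>\<^sub>F n in sequentially. \<forall>k\<in>{..<N}. Q (n - 1) (zz n (Z k)) \<noteq> 0"
    using ImZ SS_limit(2) by (intro eventually_ball_finite) auto
  \<comment> \<open>This identity is exact for large \<open>n\<close>; all limits are taken
    afterwards.\<close>
  have ev: "\<forall>\<^sub>F n in sequentially. dt N (\<lambda>k l. \<rho> n k l / (Z k - W l)) / dt N (\<lambda>k l. 1 / (Z k - W l)) * (\<Prod>r<m. cnj (q n r) / q n r)
     = (\<integral>x. exp (\<i> * of_real (X n x - (\<integral>y. X n y \<partial>OPE \<mu> n))) \<partial>OPE \<mu> n)"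
    using evQ eventually_gt_at_top[of 0]
  proof eventually_elim
    case (elim n)
    then have n: "n > 0" by simp
    \<comment> \<open>The scale enters both Cauchy determinants through the same power and
      cancels.\<close>
    define \<epsilon> where "\<epsilon> = complex_of_real (real n powr (-\<alpha>))"
    have \<epsilon>0: "\<epsilon> \<noteq> 0" using n by (simp add: \<epsilon>_def)
    have e0: "(1 / \<epsilon>) ^ N \<noteq> 0" using \<epsilon>0 by simp
    have dz: "zz n u - zz n v = \<epsilon> * (u - v)" for u v by (simp add: zz_def \<epsilon>_def algebra_simps)
    have pn: "P (n - 1) (zz n \<omega>) \<noteq> 0" if "Im \<omega> \<noteq> 0" for \<omega> using that n by (intro P_nonzero) (simp add: Im_zz)
    define pz where "pz = (\<Prod>k<N. P (n - 1) (zz n (Z k)))"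
    define pw where "pw = (\<Prod>l<N. P (n - 1) (zz n (W l)))"
    define I where "I = (\<integral>x. (\<Prod>j<n. \<Prod>k<N. (of_real (x j) - zz n (W k)) / (of_real (x j) - zz n (Z k))) \<partial>OPE \<mu> n)"
    have vz: "vdm N (\<lambda>k. zz n (Z k)) \<noteq> 0"
    proof -
      have "vdm N (\<lambda>k. zz n (Z k)) = (\<Prod>j<N. \<Prod>i<j. \<epsilon>) * vdm N Z" unfolding vdm_def by (simp add: dz prod.distrib)
      then show ?thesis using bc4 \<epsilon>0 by simp
    qed
    have "dt N (\<lambda>k l. 1 / (zz n (Z k) - zz n (W l))) * I = dt N (\<lambda>k l. FF n (zz n (W l)) (zz n (Z k)) / (zz n (Z k) - zz n (W l)))"
      unfolding I_def
    proof (rule rational_statistic_formula[OF _ _ vz n])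
      show "Im (zz n (Z k)) \<noteq> 0" if "k < N" for k
        using ImZ[OF that] n by (simp add: Im_zz)
      show "zz n (Z k) \<noteq> zz n (W l)" if "k < N" "l < N" for k l
      proof
        assume "zz n (Z k) = zz n (W l)"
        then have "\<epsilon> * (Z k - W l) = 0" using dz[of "Z k" "W l"] by simp
        then show False using \<epsilon>0 bc3[OF that] by simp
      qed
    qed
    also have "dt N (\<lambda>k l. FF n (zz n (W l)) (zz n (Z k)) / (zz n (Z k) - zz n (W l))) =
       dt N (\<lambda>k l. (1 / (\<epsilon> * P (n - 1) (zz n (Z k)))) * ((\<rho> n k l / (Z k - W l)) * P (n - 1) (zz n (W l))))"
    proof (rule dt_cong)
      fix k l assume k: "k < N" and l: "l < N"
      have "FF n (zz n (W l)) (zz n (Z k)) = P (n - 1) (zz n (W l)) / P (n - 1) (zz n (Z k)) * \<rho> n k l"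
        unfolding \<rho>_def using elim k l ImZ by (intro FF_factor) auto
      then show "FF n (zz n (W l)) (zz n (Z k)) / (zz n (Z k) - zz n (W l)) = (1 / (\<epsilon> * P (n - 1) (zz n (Z k)))) * ((\<rho> n k l / (Z k - W l)) * P (n - 1) (zz n (W l)))"
        unfolding dz by (simp add: mult_ac)
    qed
    also have "\<dots> = (\<Prod>k<N. 1 / (\<epsilon> * P (n - 1) (zz n (Z k)))) * (dt N (\<lambda>k l. \<rho> n k l / (Z k - W l)) * pw)"
      unfolding dt_scale_rows dt_scale_cols pw_def ..
    also have "(\<Prod>k<N. 1 / (\<epsilon> * P (n - 1) (zz n (Z k)))) = (1 / \<epsilon>) ^ N / pz"
      by (simp add: pz_def prod_dividef prod.distrib power_one_over)
    also have "dt N (\<lambda>k l. 1 / (zz n (Z k) - zz n (W l))) = (1 / \<epsilon>) ^ N * dt N (\<lambda>k l. 1 / (Z k - W l))"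
    proof -
      have "dt N (\<lambda>k l. 1 / (zz n (Z k) - zz n (W l))) = dt N (\<lambda>k l. (1 / \<epsilon>) * (1 / (Z k - W l)))"
        by (rule dt_cong) (simp add: dz)
      then show ?thesis by (simp only: dt_scale_rows) simp
    qed
    finally have "(1 / \<epsilon>) ^ N * (dt N (\<lambda>k l. 1 / (Z k - W l)) * I) = (1 / \<epsilon>) ^ N * (dt N (\<lambda>k l. \<rho> n k l / (Z k - W l)) * (pw / pz))"
      by (simp add: mult_ac)
    then have "dt N (\<lambda>k l. 1 / (Z k - W l)) * I = dt N (\<lambda>k l. \<rho> n k l / (Z k - W l)) * (pw / pz)" using e0 by (simp only: mult_cancel_left) simp
    note CI = this
    have I: "I = dt N (\<lambda>k l. \<rho> n k l / (Z k - W l)) / dt N (\<lambda>k l. 1 / (Z k - W l)) * (pw / pz)"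
    proof -
      have "I = dt N (\<lambda>k l. 1 / (Z k - W l)) * I / dt N (\<lambda>k l. 1 / (Z k - W l))" using bc1 by simp
      also have "\<dots> = dt N (\<lambda>k l. \<rho> n k l / (Z k - W l)) * (pw / pz) / dt N (\<lambda>k l. 1 / (Z k - W l))"
        by (simp only: CI)
      finally show ?thesis by simp
    qed
    \<comment> \<open>Conjugate points contribute conjugate values of \<open>P\<close>, so the
      quotient collapses to a product of terms \<open>X / cnj X\<close>.\<close>
    have pwz: "pw / pz = \<Theta> n"
    proof -
      have "pw = (\<Prod>r<m. P (n - 1) (zz n (w r))) * (\<Prod>r<m. cnj (P (n - 1) (zz n (z r))))"
        unfolding pw_def N_def prod_lessThan_add by (simp add: W_def join_def zz_cnj P_cnj)
      moreover have "pz = (\<Prod>r<m. P (n - 1) (zz n (z r))) * (\<Prod>r<m. cnj (P (n - 1) (zz n (w r))))"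
        unfolding pz_def N_def prod_lessThan_add by (simp add: Z_def join_def zz_cnj P_cnj)
      ultimately show ?thesis unfolding \<Theta>_def by (simp add: prod_dividef prod.distrib)
    qed
    obtain C where C: "\<And>u. \<bar>phase_stat m z w u\<bar> \<le> C" using phase_stat_bounded[of m z w] Im by blast
    have pm: "(\<lambda>x. phase_stat m z w (real n powr \<alpha> * (x - x0))) \<in> borel_measurable borel"
      by (rule measurable_compose[OF _ phase_stat_measurable]) (use Im in auto)
    have EX: "(\<integral>y. X n y \<partial>OPE \<mu> n) = 2 * (\<Sum>r<m. Im (log_trace n (zz n (w r)) (zz n (z r))))"
    proof -
      have "(\<Sum>k<n. FM (\<lambda>x. phase_stat m z w (real n powr \<alpha> * (x - x0))) k k) = 2 * (\<Sum>r<m. Im (log_trace n (zz n (w r)) (zz n (z r))))"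
        by (rule FM_phase_stat) (use Im n in auto)
      moreover have "(\<integral>y. X n y \<partial>OPE \<mu> n) = (\<Sum>k<n. FM (\<lambda>x. phase_stat m z w (real n powr \<alpha> * (x - x0))) k k)"
        unfolding X_def lin_stat_def using C by (intro expectation_linear_statistic pm)
      ultimately show ?thesis by simp
    qed
    have expEX: "exp (\<i> * of_real (- (\<integral>y. X n y \<partial>OPE \<mu> n))) = (\<Prod>r<m. cnj (q n r) / q n r) / \<Theta> n"
    proof -
      have "exp (\<i> * of_real (- (\<integral>y. X n y \<partial>OPE \<mu> n))) = inverse (exp (\<Sum>r<m. \<i> * of_real (2 * Im (log_trace n (zz n (w r)) (zz n (z r))))))"
        unfolding EX by (simp add: exp_minus[symmetric] sum_distrib_left mult_ac)
      also have "\<dots> = inverse (\<Prod>r<m. exp (log_trace n (zz n (w r)) (zz n (z r))) / cnj (exp (log_trace n (zz n (w r)) (zz n (z r)))))"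
        by (simp only: exp_sum[OF finite_lessThan] exp_2i_Im)
      also have "(\<Prod>r<m. exp (log_trace n (zz n (w r)) (zz n (z r))) / cnj (exp (log_trace n (zz n (w r)) (zz n (z r))))) = \<Theta> n * (\<Prod>r<m. q n r / cnj (q n r))"
        unfolding \<Theta>_def prod.distrib[symmetric]
      proof (intro prod.cong refl)
        fix r assume "r \<in> {..<m}"
        then have "P (n - 1) (zz n (z r)) \<noteq> 0" "P (n - 1) (zz n (w r)) \<noteq> 0" using Im[of r] pn[of "z r"] pn[of "w r"] by auto
        then show "exp (log_trace n (zz n (w r)) (zz n (z r))) / cnj (exp (log_trace n (zz n (w r)) (zz n (z r)))) =
           P (n - 1) (zz n (w r)) / P (n - 1) (zz n (z r)) / cnj (P (n - 1) (zz n (w r)) / P (n - 1) (zz n (z r))) * (q n r / cnj (q n r))"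
          unfolding q_def by (rule unimodular_quotient_split[rotated])
      qed
      finally show ?thesis by (simp add: divide_inverse prod_inversef[symmetric] mult_ac)
    qed
    have \<Theta>0: "\<Theta> n \<noteq> 0"
    proof -
      have "P (n - 1) (zz n (z r)) \<noteq> 0" "P (n - 1) (zz n (w r)) \<noteq> 0" if "r < m" for r using Im[OF that] pn[of "z r"] pn[of "w r"] by auto
      then show ?thesis unfolding \<Theta>_def by auto
    qed
    have EP: "exp (\<i> * of_real (phase_stat m z w u)) = (\<Prod>k<m + m. (of_real u - join m w z k) / (of_real u - join m z w k))" for u
      by (rule exp_phase_stat) (use Im in auto)
    have ex: "exp (\<i> * of_real (X n x)) = (\<Prod>j<n. \<Prod>k<N. (of_real (x j) - zz n (W k)) / (of_real (x j) - zz n (Z k)))" for x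
    proof -
      have "exp (\<i> * of_real (X n x)) = (\<Prod>j<n. exp (\<i> * of_real (phase_stat m z w (real n powr \<alpha> * (x j - x0)))))"
        unfolding X_def lin_stat_def by (simp add: exp_sum[symmetric] sum_distrib_left)
      also have "\<dots> = (\<Prod>j<n. \<Prod>k<N. (of_real (x j) - zz n (W k)) / (of_real (x j) - zz n (Z k)))"
        unfolding EP Z_def[symmetric] W_def[symmetric] N_def[symmetric] rescale[OF n] using n by simp
      finally show ?thesis .
    qed
    have "(\<integral>x. exp (\<i> * of_real (X n x - (\<integral>y. X n y \<partial>OPE \<mu> n))) \<partial>OPE \<mu> n)
      = (\<integral>x. exp (\<i> * of_real (X n x)) * exp (\<i> * of_real (- (\<integral>y. X n y \<partial>OPE \<mu> n))) \<partial>OPE \<mu> n)"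
      by (intro Bochner_Integration.integral_cong refl) (simp add: exp_add[symmetric] algebra_simps)
    also have "\<dots> = I * exp (\<i> * of_real (- (\<integral>y. X n y \<partial>OPE \<mu> n)))"
      unfolding ex I_def by (rule integral_mult_left_zero)
    also have "\<dots> = dt N (\<lambda>k l. \<rho> n k l / (Z k - W l)) / dt N (\<lambda>k l. 1 / (Z k - W l)) * (\<Prod>r<m. cnj (q n r) / q n r)"
      unfolding I pwz expEX using \<Theta>0 by simp
    finally show ?case by simp
  qed
  have "(\<lambda>n. dt N (\<lambda>k l. \<rho> n k l / (Z k - W l)) / dt N (\<lambda>k l. 1 / (Z k - W l)) * (\<Prod>r<m. cnj (q n r) / q n r))
    \<longlonglongrightarrow> dt N (\<lambda>k l. if (k < m) = (l < m) then 1 / (Z k - W l) else 0) / dt N (\<lambda>k l. 1 / (Z k - W l)) * (\<Prod>r<m. cnj 1 / 1)"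
    using bc1 by (intro tendsto_mult tendsto_divide dtl ql tendsto_const)
  then show ?thesis using Lim_transform_eventually[OF _ ev] by (simp add: bc2)
qed

end

subsection \<open>The weighted Lipschitz norm and the limiting variance\<close>

text \<open>The squared weight is \<open>(x - y)\<^sup>2\<close> times a product of Cauchy densities
  up to constants. The product form is exploited in \<open>variance_lin_stat_bound\<close> for
  finite \<open>n\<close> and in \<open>dq_mult_bound\<close> for the limiting variance.\<close>

definition wlip :: "real \<Rightarrow> (real \<Rightarrow> real) \<Rightarrow> bool" where
  "wlip L f \<longleftrightarrow> (\<forall>x y. \<bar>f x - f y\<bar> \<le> L * (\<bar>x - y\<bar> / (sqrt (1 + x\<^sup>2) * sqrt (1 + y\<^sup>2))))"

lemma wlipD: "wlip L f \<Longrightarrow> \<bar>f x - f y\<bar> \<le> L * (\<bar>x - y\<bar> / (sqrt (1 + x\<^sup>2) * sqrt (1 + y\<^sup>2)))"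
  by (simp add: wlip_def)

lemma wlip_mono: "wlip L f \<Longrightarrow> L \<le> L' \<Longrightarrow> wlip L' f"
  unfolding wlip_def by (meson abs_ge_zero divide_nonneg_nonneg mult_nonneg_nonneg mult_right_mono order_trans real_sqrt_ge_zero sum_power2_ge_zero zero_le_one zero_le_power2 add_nonneg_nonneg)

lemma wlip_add: "wlip L f \<Longrightarrow> wlip K g \<Longrightarrow> wlip (L + K) (\<lambda>x. f x + g x)"
  unfolding wlip_def
proof (intro allI)
  fix x y
  assume "\<forall>x y. \<bar>f x - f y\<bar> \<le> L * (\<bar>x - y\<bar> / (sqrt (1 + x\<^sup>2) * sqrt (1 + y\<^sup>2)))"
    "\<forall>x y. \<bar>g x - g y\<bar> \<le> K * (\<bar>x - y\<bar> / (sqrt (1 + x\<^sup>2) * sqrt (1 + y\<^sup>2)))"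
  then have "\<bar>f x - f y\<bar> \<le> L * (\<bar>x - y\<bar> / (sqrt (1 + x\<^sup>2) * sqrt (1 + y\<^sup>2)))"
    "\<bar>g x - g y\<bar> \<le> K * (\<bar>x - y\<bar> / (sqrt (1 + x\<^sup>2) * sqrt (1 + y\<^sup>2)))" by blast+
  then show "\<bar>f x + g x - (f y + g y)\<bar> \<le> (L + K) * (\<bar>x - y\<bar> / (sqrt (1 + x\<^sup>2) * sqrt (1 + y\<^sup>2)))"
    unfolding distrib_right by linarith
qed

lemma wlip_nonneg: assumes "wlip L f" shows "L \<ge> 0"
proof -
  have "0 \<le> L * (\<bar>1 - 0\<bar> / (sqrt (1 + 1\<^sup>2) * sqrt (1 + 0\<^sup>2)))"
    using wlipD[OF assms, of 1 0] abs_ge_zero order_trans by blast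
  then show ?thesis by (simp add: zero_le_divide_iff)
qed

lemma wlip_bounded: assumes "wlip L f" shows "\<bar>f x\<bar> \<le> \<bar>f 0\<bar> + L"
proof -
  have "\<bar>x\<bar> \<le> sqrt (1 + x\<^sup>2)" by (rule real_le_rsqrt) simp
  moreover have "0 < sqrt (1 + x\<^sup>2)" by (simp add: add_pos_nonneg)
  ultimately have "\<bar>x\<bar> / sqrt (1 + x\<^sup>2) \<le> 1" by simp
  then have "L * (\<bar>x\<bar> / sqrt (1 + x\<^sup>2)) \<le> L * 1" using wlip_nonneg[OF assms] by (rule mult_left_mono)
  then show ?thesis using wlipD[OF assms, of x 0] by simp
qed

text \<open>Jordan's inequality with a crude constant: up to \<open>pi / 3\<close> the derivative of
  \<open>sin\<close> is at least \<open>1 / 2\<close>, and beyond it \<open>sin A\<close> is at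
  least \<open>2 / 3\<close> while \<open>A\<close> is at most 2.\<close>

lemma sin_lower_bound:
  assumes "0 \<le> A" "A \<le> pi / 2" shows "A \<le> 3 * sin A"
proof (cases "A \<le> pi / 3")
  case True
  have "sin 0 - 0 / 2 \<le> sin A - A / 2"
  proof (rule DERIV_nonneg_imp_nondecreasing[OF assms(1)])
    fix x assume x: "0 \<le> x" "x \<le> A"
    have "cos (pi / 3) \<le> cos x" using x True by (intro cos_monotone_0_pi_le) auto
    then have "1 / 2 \<le> cos x" by (simp add: cos_60)
    then show "\<exists>y. ((\<lambda>a. sin a - a / 2) has_real_derivative y) (at x) \<and> 0 \<le> y"
      by (intro exI[of _ "cos x - 1 / 2"] conjI) (auto intro!: derivative_eq_intros)
  qed
  moreover have "0 \<le> sin A" using assms pi_gt_zero by (intro sin_ge_zero) linarith+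
  ultimately show ?thesis by simp
next
  case False
  have "sin (pi / 3) \<le> sin A" using False assms by (intro sin_monotone_2pi_le) auto
  moreover have "sin (pi / 3) \<ge> 2 / 3"
  proof -
    have "4 / 3 \<le> sqrt 3" by (rule real_le_rsqrt) (simp add: power2_eq_square)
    then show ?thesis by (simp add: sin_60)
  qed
  moreover have "A \<le> 2" using assms pi_less_4 by linarith
  ultimately show ?thesis by linarith
qed

lemma sin_arctan_diff: "sin (arctan x - arctan y) = (x - y) / (sqrt (1 + x\<^sup>2) * sqrt (1 + y\<^sup>2))"
  by (simp add: sin_diff sin_arctan cos_arctan diff_divide_distrib mult.commute)

text \<open>On the circle compactifying the line the weighted Lipschitz distance is the chord and
  \<open>arctan\<close> the angle, so the shorter of the two arcs between two points controls the difference.\<close>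

lemma wlip_derivative:
  assumes d: "\<And>x. (f has_real_derivative f' x) (at x)" and b: "\<And>x. \<bar>f' x\<bar> \<le> e / (1 + x\<^sup>2)"
    and top: "(f \<longlongrightarrow> 0) at_top" and bot: "(f \<longlongrightarrow> 0) at_bot"
  shows "wlip (3 * e) f"
proof -
  have e: "e \<ge> 0" using b[of 0] abs_ge_zero[of "f' 0"] by simp
  have da: "(arctan has_real_derivative 1 / (1 + x\<^sup>2)) (at x)" for x
    using DERIV_arctan[of x] by (simp add: divide_inverse)
  have arc: "\<bar>f x - f y\<bar> \<le> e * (arctan x - arctan y)" if "y \<le> x" for x y
  proof -
    have "e * arctan y - f y \<le> e * arctan x - f x"
    proof (rule DERIV_nonneg_imp_nondecreasing[OF that])
      fix u
      have "((\<lambda>u. e * arctan u - f u) has_real_derivative e * (1 / (1 + u\<^sup>2)) - f' u) (at u)"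
        by (intro DERIV_diff DERIV_cmult da d)
      moreover have "0 \<le> e * (1 / (1 + u\<^sup>2)) - f' u" using b[of u] by (simp add: abs_le_iff)
      ultimately show "\<exists>y. ((\<lambda>u. e * arctan u - f u) has_real_derivative y) (at u) \<and> 0 \<le> y" by blast
    qed
    moreover have "e * arctan y + f y \<le> e * arctan x + f x"
    proof (rule DERIV_nonneg_imp_nondecreasing[OF that])
      fix u
      have "((\<lambda>u. e * arctan u + f u) has_real_derivative e * (1 / (1 + u\<^sup>2)) + f' u) (at u)"
        by (intro DERIV_add DERIV_cmult da d)
      moreover have "0 \<le> e * (1 / (1 + u\<^sup>2)) + f' u" using b[of u] by (simp add: abs_le_iff)
      ultimately show "\<exists>y. ((\<lambda>u. e * arctan u + f u) has_real_derivative y) (at u) \<and> 0 \<le> y" by blast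
    qed
    ultimately show ?thesis by (simp add: abs_le_iff algebra_simps)
  qed
  \<comment> \<open>Comparison with the point at infinity, where \<open>f\<close> has the limit 0
    from both sides.\<close>
  have ft: "\<bar>f x\<bar> \<le> e * (pi / 2 - arctan x)" for x
  proof -
    have "((\<lambda>y. \<bar>f y - f x\<bar>) \<longlongrightarrow> \<bar>0 - f x\<bar>) at_top" by (intro tendsto_intros top)
    moreover have "\<forall>\<^sub>F y in at_top. \<bar>f y - f x\<bar> \<le> e * (pi / 2 - arctan x)"
      using eventually_ge_at_top[of x]
    proof eventually_elim
      case (elim y)
      have "e * (arctan y - arctan x) \<le> e * (pi / 2 - arctan x)"
        using e arctan_ubound[of y] by (intro mult_left_mono) auto
      then show ?case using arc[OF elim] by simp
    qed
    ultimately have "\<bar>0 - f x\<bar> \<le> e * (pi / 2 - arctan x)" by (intro tendsto_upperbound) auto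
    then show ?thesis by simp
  qed
  have fb: "\<bar>f x\<bar> \<le> e * (arctan x + pi / 2)" for x
  proof -
    have "((\<lambda>y. \<bar>f x - f y\<bar>) \<longlongrightarrow> \<bar>f x - 0\<bar>) at_bot" by (intro tendsto_intros bot)
    moreover have "\<forall>\<^sub>F y in at_bot. \<bar>f x - f y\<bar> \<le> e * (arctan x + pi / 2)"
      using eventually_le_at_bot[of x]
    proof eventually_elim
      case (elim y)
      have "e * (arctan x - arctan y) \<le> e * (arctan x + pi / 2)"
        using e arctan_lbound[of y] by (intro mult_left_mono) auto
      then show ?case using arc[OF elim] by simp
    qed
    ultimately have "\<bar>f x - 0\<bar> \<le> e * (arctan x + pi / 2)" by (intro tendsto_upperbound) auto
    then show ?thesis by simp
  qed
  have main: "\<bar>f x - f y\<bar> \<le> (3 * e) * ((x - y) / (sqrt (1 + x\<^sup>2) * sqrt (1 + y\<^sup>2)))" if "y \<le> x" for x y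
  proof -
    define A where "A = arctan x - arctan y"
    have A0: "0 \<le> A" using that by (simp add: A_def arctan_le_iff)
    have A1: "A \<le> pi" using arctan_ubound[of x] arctan_lbound[of y] by (simp add: A_def)
    have "\<bar>f x - f y\<bar> \<le> e * (3 * sin A)"
    proof (cases "A \<le> pi / 2")
      case True
      have "\<bar>f x - f y\<bar> \<le> e * A" using arc[OF that] by (simp add: A_def)
      also have "\<dots> \<le> e * (3 * sin A)" using e sin_lower_bound[OF A0 True] by (intro mult_left_mono)
      finally show ?thesis .
    next
      case False
      have "\<bar>f x - f y\<bar> \<le> \<bar>f x\<bar> + \<bar>f y\<bar>" by (rule abs_triangle_ineq4)
      also have "\<dots> \<le> e * (pi / 2 - arctan x) + e * (arctan y + pi / 2)" by (intro add_mono ft fb)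
      also have "\<dots> = e * (pi - A)" by (simp add: A_def algebra_simps)
      also have "\<dots> \<le> e * (3 * sin (pi - A))" using False A1 e sin_lower_bound[of "pi - A"] by (intro mult_left_mono) auto
      finally show ?thesis by simp
    qed
    then show ?thesis unfolding A_def sin_arctan_diff by (simp add: mult_ac)
  qed
  show ?thesis unfolding wlip_def
  proof (intro allI)
    fix x y
    show "\<bar>f x - f y\<bar> \<le> 3 * e * (\<bar>x - y\<bar> / (sqrt (1 + x\<^sup>2) * sqrt (1 + y\<^sup>2)))"
      using main[of y x] main[of x y] by (cases "y \<le> x") (auto simp: abs_minus_commute mult.commute)
  qed
qed

section \<open>The limiting variance as a double integral\<close>

definition dq :: "(real \<Rightarrow> real) \<Rightarrow> real \<Rightarrow> real \<Rightarrow> real" where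
  "dq f x y = (f x - f y) / (x - y)"

text \<open>On the diagonal the quotient is \<open>0 / 0 = 0\<close>, so the bound holds without
  exception.\<close>

lemma dq_bound:
  assumes "wlip L f" shows "\<bar>dq f x y\<bar> \<le> L * (1 / (sqrt (1 + x\<^sup>2) * sqrt (1 + y\<^sup>2)))"
proof (cases "x = y")
  case True
  then show ?thesis using wlip_nonneg[OF assms] by (simp add: dq_def)
next
  case False
  have "\<bar>dq f x y\<bar> = \<bar>f x - f y\<bar> / \<bar>x - y\<bar>" by (simp add: dq_def)
  also have "\<dots> \<le> L * (\<bar>x - y\<bar> / (sqrt (1 + x\<^sup>2) * sqrt (1 + y\<^sup>2))) / \<bar>x - y\<bar>"
    by (intro divide_right_mono wlipD assms) simp
  also have "\<dots> = L * (1 / (sqrt (1 + x\<^sup>2) * sqrt (1 + y\<^sup>2)))" using False by simp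
  finally show ?thesis .
qed

lemma dq_mult_bound:
  assumes "wlip L f" "wlip K g"
  shows "\<bar>dq f x y * dq g x y\<bar> \<le> L * K * (1 / (1 + x\<^sup>2) * (1 / (1 + y\<^sup>2)))"
proof -
  have "\<bar>dq f x y * dq g x y\<bar> \<le> (L * (1 / (sqrt (1 + x\<^sup>2) * sqrt (1 + y\<^sup>2)))) * (K * (1 / (sqrt (1 + x\<^sup>2) * sqrt (1 + y\<^sup>2))))"
    unfolding abs_mult using wlip_nonneg[OF assms(1)] by (intro mult_mono dq_bound assms) auto
  also have "\<dots> = L * K * (1 / ((sqrt (1 + x\<^sup>2) * sqrt (1 + x\<^sup>2)) * (sqrt (1 + y\<^sup>2) * sqrt (1 + y\<^sup>2))))"
  proof -
    have "(L * (1 / (a * b))) * (K * (1 / (a * b))) = L * K * (1 / ((a * a) * (b * b)))" for a b :: real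
      by (simp add: divide_inverse mult_ac)
    then show ?thesis .
  qed
  finally show ?thesis by simp
qed

lemma integrable_cauchy: "integrable lborel (\<lambda>x::real. 1 / (1 + x\<^sup>2))"
  and integral_cauchy: "(\<integral>x. 1 / (1 + x\<^sup>2) \<partial>lborel) = pi"
proof -
  have e: "einterval (-\<infinity>) \<infinity> = UNIV" by (auto simp: einterval_def)
  show "integrable lborel (\<lambda>x::real. 1 / (1 + x\<^sup>2))"
    using integrable_inverse_1_plus_square by (simp add: set_integrable_def e divide_inverse)
  show "(\<integral>x. 1 / (1 + x\<^sup>2) \<partial>lborel) = pi"
    using LBINT_inverse_1_plus_square
    by (simp add: interval_lebesgue_integral_def set_lebesgue_integral_def e divide_inverse)
qed

lemma integrable_cauchy_pair:
  "integrable (lborel \<Otimes>\<^sub>M lborel) (\<lambda>(x::real, y::real). 1 / (1 + x\<^sup>2) * (1 / (1 + y\<^sup>2)))" (is ?I)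
  and integral_cauchy_pair:
  "integral\<^sup>L (lborel \<Otimes>\<^sub>M lborel) (\<lambda>(x::real, y::real). 1 / (1 + x\<^sup>2) * (1 / (1 + y\<^sup>2))) = pi\<^sup>2"
proof -
  show i: ?I
  proof (rule lborel_pair.Fubini_integrable)
    show "(\<lambda>(x::real, y::real). 1 / (1 + x\<^sup>2) * (1 / (1 + y\<^sup>2))) \<in> borel_measurable (lborel \<Otimes>\<^sub>M lborel)" by measurable
    have "(\<integral>y. norm (case (x, y) of (x, y) \<Rightarrow> 1 / (1 + x\<^sup>2) * (1 / (1 + y\<^sup>2))) \<partial>lborel) = pi * (1 / (1 + x\<^sup>2))" for x :: real
    proof -
      have "(\<integral>y. norm (case (x, y) of (x, y) \<Rightarrow> 1 / (1 + x\<^sup>2) * (1 / (1 + y\<^sup>2))) \<partial>lborel) = (\<integral>y. 1 / (1 + x\<^sup>2) * (1 / (1 + y\<^sup>2)) \<partial>lborel)"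
        by (intro Bochner_Integration.integral_cong) auto
      also have "\<dots> = pi * (1 / (1 + x\<^sup>2))" unfolding integral_mult_right_zero integral_cauchy by simp
      finally show ?thesis .
    qed
    then show "integrable lborel (\<lambda>x::real. \<integral>y. norm (case (x, y) of (x, y) \<Rightarrow> 1 / (1 + x\<^sup>2) * (1 / (1 + y\<^sup>2))) \<partial>lborel)"
      using integrable_cauchy by (simp only: integrable_mult_right)
    show "AE x in lborel. integrable lborel (\<lambda>y::real. case (x::real, y) of (x, y) \<Rightarrow> 1 / (1 + x\<^sup>2) * (1 / (1 + y\<^sup>2)))"
      using integrable_cauchy by (auto simp del: times_divide_eq_left times_divide_eq_right mult_1_left)
  qed
  have "integral\<^sup>L (lborel \<Otimes>\<^sub>M lborel) (\<lambda>(x::real, y::real). 1 / (1 + x\<^sup>2) * (1 / (1 + y\<^sup>2))) =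
    (\<integral>x. (\<integral>y. 1 / (1 + x\<^sup>2) * (1 / (1 + y\<^sup>2)) \<partial>lborel) \<partial>lborel)"
    using lborel_pair.integral_fst'[OF i] by simp
  also have "\<dots> = (\<integral>x. pi * (1 / (1 + x\<^sup>2)) \<partial>lborel)"
    by (intro Bochner_Integration.integral_cong refl) (simp only: integral_mult_right_zero integral_cauchy mult.commute)
  also have "\<dots> = pi * (\<integral>x. 1 / (1 + x\<^sup>2) \<partial>lborel)" by (rule integral_mult_right_zero)
  also have "\<dots> = pi\<^sup>2" using integral_cauchy by (simp add: power2_eq_square)
  finally show "integral\<^sup>L (lborel \<Otimes>\<^sub>M lborel) (\<lambda>(x::real, y::real). 1 / (1 + x\<^sup>2) * (1 / (1 + y\<^sup>2))) = pi\<^sup>2" .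
qed

lemma dq_measurable:
  assumes [measurable]: "f \<in> borel_measurable borel"
  shows "(\<lambda>(x, y). dq f x y) \<in> borel_measurable (lborel \<Otimes>\<^sub>M lborel)"
  unfolding dq_def by measurable

lemma integrable_dq:
  assumes f: "f \<in> borel_measurable borel" "wlip L f" and g: "g \<in> borel_measurable borel" "wlip K g"
  shows "integrable (lborel \<Otimes>\<^sub>M lborel) (\<lambda>(x, y). dq f x y * dq g x y)"
proof (rule Bochner_Integration.integrable_bound)
  show "integrable (lborel \<Otimes>\<^sub>M lborel) (\<lambda>z::real\<times>real. L * K * (case z of (x, y) \<Rightarrow> 1 / (1 + x\<^sup>2) * (1 / (1 + y\<^sup>2))))"
    by (intro integrable_mult_right integrable_cauchy_pair)
  show "(\<lambda>(x, y). dq f x y * dq g x y) \<in> borel_measurable (lborel \<Otimes>\<^sub>M lborel)"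
    using borel_measurable_times[OF dq_measurable[OF f(1)] dq_measurable[OF g(1)]] by (simp add: case_prod_beta)
  show "AE z in lborel \<Otimes>\<^sub>M lborel. norm (case z of (x, y) \<Rightarrow> dq f x y * dq g x y) \<le> norm (L * K * (case z of (x, y) \<Rightarrow> 1 / (1 + x\<^sup>2) * (1 / (1 + y\<^sup>2))))"
    using dq_mult_bound[OF f(2) g(2)] by (intro AE_I2) (auto intro: order_trans[OF _ abs_ge_self])
qed

lemma sigma_sq_pair:
  assumes f: "f \<in> borel_measurable borel" "wlip L f"
  shows "sigma_sq f = 1 / (4 * pi\<^sup>2) * integral\<^sup>L (lborel \<Otimes>\<^sub>M lborel) (\<lambda>(x, y). dq f x y * dq f x y)"
  unfolding sigma_sq_def lborel_pair.integral_fst'[OF integrable_dq[OF f f], symmetric]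
  by (simp add: dq_def power2_eq_square)

text \<open>\<open>\<sigma>\<^sup>2\<close> is a quadratic form, so the difference is its polarisation at \<open>f + g\<close> and \<open>f - g\<close>.\<close>

lemma sigma_sq_diff:
  assumes f: "f \<in> borel_measurable borel" "wlip L f" and g: "g \<in> borel_measurable borel" "wlip K g"
    and d: "wlip D (\<lambda>x. f x - g x)"
  shows "\<bar>sigma_sq f - sigma_sq g\<bar> \<le> D * (L + K) / 4"
proof -
  let ?M = "lborel \<Otimes>\<^sub>M (lborel :: real measure)"
  define s where "s = (\<lambda>x. f x + g x)"
  define u where "u = (\<lambda>x. f x - g x)"
  have s: "s \<in> borel_measurable borel" "wlip (L + K) s" unfolding s_def using f g by (auto intro: wlip_add)
  have u: "u \<in> borel_measurable borel" "wlip D u" unfolding u_def using f g d by auto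
  have e: "dq f x y * dq f x y - dq g x y * dq g x y = dq u x y * dq s x y" for x y
  proof -
    have "dq u x y = dq f x y - dq g x y" "dq s x y = dq f x y + dq g x y"
      by (simp_all add: dq_def u_def s_def diff_divide_distrib[symmetric] add_divide_distrib[symmetric])
    note us = this
    show ?thesis unfolding us by (simp add: algebra_simps)
  qed
  have "sigma_sq f - sigma_sq g = 1 / (4 * pi\<^sup>2) * (integral\<^sup>L ?M (\<lambda>(x, y). dq f x y * dq f x y) - integral\<^sup>L ?M (\<lambda>(x, y). dq g x y * dq g x y))"
    by (simp add: sigma_sq_pair[OF f] sigma_sq_pair[OF g] right_diff_distrib)
  also have "integral\<^sup>L ?M (\<lambda>(x, y). dq f x y * dq f x y) - integral\<^sup>L ?M (\<lambda>(x, y). dq g x y * dq g x y) = integral\<^sup>L ?M (\<lambda>(x, y). dq u x y * dq s x y)"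
    by (subst Bochner_Integration.integral_diff[symmetric, OF integrable_dq[OF f f] integrable_dq[OF g g]]) (auto intro!: Bochner_Integration.integral_cong simp: e)
  finally have "\<bar>sigma_sq f - sigma_sq g\<bar> = 1 / (4 * pi\<^sup>2) * \<bar>integral\<^sup>L ?M (\<lambda>(x, y). dq u x y * dq s x y)\<bar>"
    by (simp add: abs_mult)
  also have "\<dots> \<le> 1 / (4 * pi\<^sup>2) * (D * (L + K) * pi\<^sup>2)"
  proof (intro mult_left_mono)
    have "\<bar>integral\<^sup>L ?M (\<lambda>(x, y). dq u x y * dq s x y)\<bar> \<le> integral\<^sup>L ?M (\<lambda>z. D * (L + K) * (case z of (x, y) \<Rightarrow> 1 / (1 + x\<^sup>2) * (1 / (1 + y\<^sup>2))))"
      unfolding real_norm_def[symmetric]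
    proof (rule Bochner_Integration.integral_norm_bound_integral[OF integrable_dq[OF u s]])
      show "integrable ?M (\<lambda>z. D * (L + K) * (case z of (x, y) \<Rightarrow> 1 / (1 + x\<^sup>2) * (1 / (1 + y\<^sup>2))))"
        by (intro integrable_mult_right integrable_cauchy_pair)
      show "norm (case z of (x, y) \<Rightarrow> dq u x y * dq s x y) \<le> D * (L + K) * (case z of (x, y) \<Rightarrow> 1 / (1 + x\<^sup>2) * (1 / (1 + y\<^sup>2)))" for z
        using dq_mult_bound[OF u(2) s(2), of "fst z" "snd z"] by (simp add: case_prod_beta)
    qed
    then show "\<bar>integral\<^sup>L ?M (\<lambda>(x, y). dq u x y * dq s x y)\<bar> \<le> D * (L + K) * pi\<^sup>2"
      by (simp only: integral_mult_right_zero integral_cauchy_pair)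
  qed simp
  also have "\<dots> = D * (L + K) / 4" by simp
  finally show ?thesis .
qed

section \<open>Resolvent estimates and resolvent integrals over the line\<close>

lemma integrable_lborel_cauchy_bound:
  fixes f :: "real \<Rightarrow> complex"
  assumes "f \<in> borel_measurable borel" and "\<And>x. cmod (f x) \<le> C * (1 / (1 + x\<^sup>2))"
  shows "integrable lborel f"
proof (rule Bochner_Integration.integrable_bound)
  show "integrable lborel (\<lambda>x::real. C * (1 / (1 + x\<^sup>2)))" by (intro integrable_mult_right integrable_cauchy)
  show "AE x in lborel. norm (f x) \<le> norm (C * (1 / (1 + x\<^sup>2)))"
    using assms(2) order_trans[OF _ abs_ge_self] unfolding real_norm_def by (intro AE_I2) blast
qed (use assms in simp)

text \<open>Split \<open>x\<close> as \<open>(x - Re z) + Re z\<close>; the leftover constant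
  \<open>1 + 2 * T\<^sup>2\<close> is paid for by \<open>(Im z)\<^sup>2 \<ge> e\<^sup>2\<close>. The
  factor reappears as \<open>kap\<close>.\<close>

lemma one_plus_square_bound:
  assumes "\<bar>Re z\<bar> \<le> T" and e: "e \<le> \<bar>Im z\<bar>" "e > 0"
  shows "1 + x\<^sup>2 \<le> (2 + (1 + 2 * T\<^sup>2) / e\<^sup>2) * (cmod (of_real x - z))\<^sup>2"
proof -
  have T: "(Re z)\<^sup>2 \<le> T\<^sup>2" using assms(1) by (simp add: abs_le_square_iff[symmetric] order_trans[OF assms(1)])
  have E: "e\<^sup>2 \<le> (Im z)\<^sup>2" using e by (simp add: abs_le_square_iff[symmetric])
  have c: "(cmod (of_real x - z))\<^sup>2 = (x - Re z)\<^sup>2 + (Im z)\<^sup>2" by (simp add: cmod_power2)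
  have "0 \<le> (x - 2 * Re z)\<^sup>2" by simp
  then have "x\<^sup>2 \<le> 2 * (x - Re z)\<^sup>2 + 2 * (Re z)\<^sup>2" by (simp add: power2_eq_square algebra_simps)
  then have "1 + x\<^sup>2 \<le> 2 * (x - Re z)\<^sup>2 + (1 + 2 * T\<^sup>2)" using T by linarith
  moreover have "2 * (x - Re z)\<^sup>2 \<le> 2 * (cmod (of_real x - z))\<^sup>2" by (simp add: c)
  moreover have "1 + 2 * T\<^sup>2 \<le> (1 + 2 * T\<^sup>2) / e\<^sup>2 * (cmod (of_real x - z))\<^sup>2"
  proof -
    have "(1 + 2 * T\<^sup>2) / e\<^sup>2 * e\<^sup>2 \<le> (1 + 2 * T\<^sup>2) / e\<^sup>2 * (cmod (of_real x - z))\<^sup>2"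
      using E by (intro mult_left_mono) (auto simp: c intro!: divide_nonneg_nonneg add_nonneg_nonneg order_trans[OF E])
    then show ?thesis using e by simp
  qed
  ultimately show ?thesis unfolding distrib_right by linarith
qed

lemma resolvent_cauchy_bound:
  assumes "Im z \<noteq> 0"
  obtains C where "C \<ge> 0" "\<And>x. 1 / cmod (of_real x - z) \<le> C * (1 / sqrt (1 + x\<^sup>2))"
proof -
  define K where "K = 2 + (1 + 2 * \<bar>Re z\<bar>\<^sup>2) / \<bar>Im z\<bar>\<^sup>2"
  have K: "K > 0" unfolding K_def by (intro add_pos_nonneg divide_nonneg_nonneg) auto
  show ?thesis
  proof (rule that[of "sqrt K"])
    show "sqrt K \<ge> 0" using K by simp
    fix x
    have nz: "cmod (of_real x - z) > 0" using assms by (auto simp: complex_eq_iff)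
    have "1 + x\<^sup>2 \<le> K * (cmod (of_real x - z))\<^sup>2"
      unfolding K_def using assms by (intro one_plus_square_bound) auto
    then have "sqrt (1 + x\<^sup>2) \<le> sqrt (K * (cmod (of_real x - z))\<^sup>2)" by (rule real_sqrt_le_mono)
    then have "sqrt (1 + x\<^sup>2) \<le> sqrt K * cmod (of_real x - z)" by (simp add: real_sqrt_mult)
    moreover have "0 < sqrt (1 + x\<^sup>2)" by (simp add: add_pos_nonneg)
    ultimately show "1 / cmod (of_real x - z) \<le> sqrt K * (1 / sqrt (1 + x\<^sup>2))"
      using nz by (simp add: field_simps)
  qed
qed

lemma integrable_resolvent_pair:
  assumes "Im z \<noteq> 0" "Im w \<noteq> 0"
  shows "integrable lborel (\<lambda>x. 1 / ((of_real x - z) * (complex_of_real x - w)))"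
proof -
  obtain C where C: "C \<ge> 0" "\<And>x. 1 / cmod (of_real x - z) \<le> C * (1 / sqrt (1 + x\<^sup>2))" using resolvent_cauchy_bound[OF assms(1)] by blast
  obtain D where D: "D \<ge> 0" "\<And>x. 1 / cmod (of_real x - w) \<le> D * (1 / sqrt (1 + x\<^sup>2))" using resolvent_cauchy_bound[OF assms(2)] by blast
  show ?thesis
  proof (rule integrable_lborel_cauchy_bound[where C = "C * D"])
    show "(\<lambda>x. 1 / ((of_real x - z) * (complex_of_real x - w))) \<in> borel_measurable borel" by measurable
    fix x
    have "cmod (1 / ((of_real x - z) * (complex_of_real x - w))) = (1 / cmod (of_real x - z)) * (1 / cmod (of_real x - w))"
      by (simp add: norm_divide norm_mult)
    also have "\<dots> \<le> (C * (1 / sqrt (1 + x\<^sup>2))) * (D * (1 / sqrt (1 + x\<^sup>2)))"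
      using C D by (intro mult_mono) auto
    also have "\<dots> = C * D * (1 / (sqrt (1 + x\<^sup>2) * sqrt (1 + x\<^sup>2)))" by simp
    finally show "cmod (1 / ((of_real x - z) * (complex_of_real x - w))) \<le> C * D * (1 / (1 + x\<^sup>2))" by simp
  qed
qed

lemma integral_lborel_FTC:
  fixes F f :: "real \<Rightarrow> complex"
  assumes F: "\<And>x. (F has_vector_derivative f x) (at x)" and f: "\<And>x. isCont f x" and i: "integrable lborel f"
    and A: "(F \<longlongrightarrow> A) at_bot" and B: "(F \<longlongrightarrow> B) at_top"
  shows "integral\<^sup>L lborel f = B - A"
proof -
  have e: "einterval (-\<infinity>) \<infinity> = UNIV" by (auto simp: einterval_def)
  have "(LBINT x=-\<infinity>..\<infinity>. f x) = B - A"
    by (rule interval_integral_FTC_integrable[where F = F])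
      (use assms in \<open>auto simp: ereal_tendsto_simps set_integrable_def e\<close>)
  then show ?thesis by (simp add: interval_lebesgue_integral_def set_lebesgue_integral_def e)
qed

lemma inverse_tendsto_0:
  fixes z :: complex
  shows "((\<lambda>x. 1 / (of_real x - z)) \<longlongrightarrow> 0) at_top" "((\<lambda>x. 1 / (of_real x - z)) \<longlongrightarrow> 0) at_bot"
proof -
  have t: "((\<lambda>x. 1 / (of_real x - z)) \<longlongrightarrow> 0) at_top" for z :: complex
    using tendsto_divide_0[OF tendsto_const tendsto_add_filterlim_at_infinity'[OF filterlim_of_real_at_infinity tendsto_const[of "- z"]]]
    by simp
  show "((\<lambda>x. 1 / (of_real x - z)) \<longlongrightarrow> 0) at_top" by (rule t)
  have "((\<lambda>x. - (1 / (of_real x - (- z)))) \<longlongrightarrow> - 0) at_top" by (intro tendsto_minus t)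
  moreover have "- (1 / (complex_of_real x - (- z))) = 1 / (of_real (- x) - z)" for x
    using minus_divide_right[of 1 "of_real x + z"] by simp
  ultimately show "((\<lambda>x. 1 / (of_real x - z)) \<longlongrightarrow> 0) at_bot" unfolding filterlim_at_bot_mirror by simp
qed

definition kap :: "real \<Rightarrow> real \<Rightarrow> real" where "kap T e = 2 + (1 + 2 * T\<^sup>2) / e\<^sup>2"

lemma kap_pos: "kap T e > 0"
  unfolding kap_def by (intro add_pos_nonneg divide_nonneg_nonneg) auto

lemma resolvent_uniform_bound:
  assumes "\<bar>Re z\<bar> \<le> T" "e \<le> Im z" "e > 0"
  shows "1 / cmod (of_real x - z) \<le> sqrt (kap T e) / sqrt (1 + x\<^sup>2)"
proof -
  have nz: "cmod (of_real x - z) > 0" using assms by (auto simp: complex_eq_iff)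
  have "1 + x\<^sup>2 \<le> kap T e * (cmod (of_real x - z))\<^sup>2"
    unfolding kap_def using assms by (intro one_plus_square_bound) auto
  then have "sqrt (1 + x\<^sup>2) \<le> sqrt (kap T e * (cmod (of_real x - z))\<^sup>2)" by (rule real_sqrt_le_mono)
  then have "sqrt (1 + x\<^sup>2) \<le> sqrt (kap T e) * cmod (of_real x - z)" by (simp add: real_sqrt_mult)
  moreover have "0 < sqrt (1 + x\<^sup>2)" by (simp add: add_pos_nonneg)
  ultimately show ?thesis using nz by (simp add: field_simps)
qed

lemma resolvent_pair_uniform_bound:
  assumes "\<bar>Re z\<bar> \<le> T" "e \<le> Im z" "\<bar>Re w\<bar> \<le> T" "e \<le> Im w" "e > 0"
  shows "1 / (cmod (of_real x - z) * cmod (of_real x - w)) \<le> kap T e / (1 + x\<^sup>2)"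
proof -
  have "1 / cmod (of_real x - z) * (1 / cmod (of_real x - w)) \<le> (sqrt (kap T e) / sqrt (1 + x\<^sup>2)) * (sqrt (kap T e) / sqrt (1 + x\<^sup>2))"
    using assms less_imp_le[OF kap_pos, of T e] by (intro mult_mono resolvent_uniform_bound) auto
  also have "\<dots> = kap T e / (1 + x\<^sup>2)" using kap_pos[of T e] by simp
  finally show ?thesis by simp
qed

text \<open>As a function of the pole \<open>u\<close> the logarithm has derivative
  \<open>1 / (u - x)\<close>, which is \<open>O(1 / sqrt (1 + x\<^sup>2))\<close> uniformly on a
  convex box containing \<open>z\<close> and \<open>w\<close>.\<close>

lemma Ln_difference_tendsto_0:
  assumes "Im z > 0" "Im w > 0"
  shows "((\<lambda>x. Ln (of_real x - w) - Ln (of_real x - z)) \<longlongrightarrow> 0) at_top"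
    and "((\<lambda>x. Ln (of_real x - w) - Ln (of_real x - z)) \<longlongrightarrow> 0) at_bot"
proof -
  define T where "T = max \<bar>Re z\<bar> \<bar>Re w\<bar>"
  define e where "e = min (Im z) (Im w)"
  have e: "e > 0" using assms by (simp add: e_def)
  define S where "S = {u. Im u \<ge> e} \<inter> ({u. Re u \<le> T} \<inter> {u. Re u \<ge> - T})"
  have cS: "convex S" unfolding S_def
    by (intro convex_Int convex_halfspace_Im_ge convex_halfspace_Re_le convex_halfspace_Re_ge)
  have b: "norm (Ln (of_real x - w) - Ln (of_real x - z)) \<le> sqrt (kap T e) * cmod (w - z) / sqrt (1 + x\<^sup>2)" for x
  proof -
    have "cmod (Ln (of_real x - w) - Ln (of_real x - z)) \<le> sqrt (kap T e) / sqrt (1 + x\<^sup>2) * cmod (w - z)"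
    proof (rule field_differentiable_bound[OF cS])
      fix u assume u: "u \<in> S"
      then show "((\<lambda>u. Ln (of_real x - u)) has_field_derivative 1 / (u - of_real x)) (at u within S)"
        using e by (intro Ln_shift_derivative) (auto simp: S_def)
      have "cmod (1 / (u - of_real x)) = 1 / cmod (of_real x - u)" by (simp add: norm_divide norm_minus_commute)
      also have "\<dots> \<le> sqrt (kap T e) / sqrt (1 + x\<^sup>2)"
        using u e by (intro resolvent_uniform_bound) (auto simp: S_def abs_le_iff)
      finally show "cmod (1 / (u - of_real x)) \<le> sqrt (kap T e) / sqrt (1 + x\<^sup>2)" .
    qed (auto simp: S_def T_def e_def)
    then show ?thesis by simp
  qed
  have "((\<lambda>x. sqrt (kap T e) * cmod (w - z) / sqrt (1 + x\<^sup>2)) \<longlongrightarrow> 0) at_top" by real_asymp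
  then show "((\<lambda>x. Ln (of_real x - w) - Ln (of_real x - z)) \<longlongrightarrow> 0) at_top"
    by (rule Lim_null_comparison[rotated]) (use b in auto)
  have "((\<lambda>x. sqrt (kap T e) * cmod (w - z) / sqrt (1 + x\<^sup>2)) \<longlongrightarrow> 0) at_bot" by real_asymp
  then show "((\<lambda>x. Ln (of_real x - w) - Ln (of_real x - z)) \<longlongrightarrow> 0) at_bot"
    by (rule Lim_null_comparison[rotated]) (use b in auto)
qed

text \<open>The point \<open>x - v\<close> moves along a horizontal line below the real axis, so its
  argument increases from \<open>- pi\<close> to 0. This jump is the source of
  \<open>2 * pi * \<i>\<close> in \<open>integral_resolvent_pair_opposite\<close>.\<close>

lemma Im_Ln_limits:
  assumes "Im v > 0"
  shows "((\<lambda>x. Im (Ln (of_real x - v))) \<longlongrightarrow> 0) at_top"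
    and "((\<lambda>x. Im (Ln (of_real x - v))) \<longlongrightarrow> - pi) at_bot"
proof -
  have "((\<lambda>x. arctan (- Im v / (x - Re v))) \<longlongrightarrow> arctan 0) at_top"
    by (intro tendsto_intros) real_asymp
  moreover have "\<forall>\<^sub>F x in at_top. arctan (- Im v / (x - Re v)) = Im (Ln (of_real x - v))"
    using eventually_gt_at_top[of "Re v"] by eventually_elim (subst Im_Ln_eq, auto simp: complex_eq_iff)
  ultimately show "((\<lambda>x. Im (Ln (of_real x - v))) \<longlongrightarrow> 0) at_top"
    using Lim_transform_eventually by fastforce
  have "((\<lambda>x. arctan (- Im v / (x - Re v)) - pi) \<longlongrightarrow> arctan 0 - pi) at_bot"
    by (intro tendsto_intros) real_asymp
  moreover have "\<forall>\<^sub>F x in at_bot. arctan (- Im v / (x - Re v)) - pi = Im (Ln (of_real x - v))"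
    using eventually_gt_at_bot[of "Re v"] by eventually_elim (use assms in \<open>subst Im_Ln_eq, auto simp: complex_eq_iff\<close>)
  ultimately show "((\<lambda>x. Im (Ln (of_real x - v))) \<longlongrightarrow> - pi) at_bot"
    using Lim_transform_eventually by fastforce
qed

lemma isCont_resolvent_pair:
  assumes "Im z \<noteq> 0" "Im w \<noteq> 0"
  shows "isCont (\<lambda>x. 1 / ((of_real x - z) * (complex_of_real x - w))) x"
proof -
  have "of_real x - z \<noteq> 0" "of_real x - w \<noteq> 0" using assms by (auto simp: complex_eq_iff)
  then show ?thesis by (intro continuous_intros) simp
qed

lemma partial_fraction:
  fixes x z w :: "'a::field"
  assumes "x - z \<noteq> 0" "x - w \<noteq> 0" "z \<noteq> w"
  shows "(1 / (x - z) - 1 / (x - w)) / (z - w) = 1 / ((x - z) * (x - w))"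
proof -
  have "1 / (x - z) - 1 / (x - w) = (z - w) / ((x - z) * (x - w))"
    using assms by (simp add: diff_frac_eq)
  then show ?thesis using assms by simp
qed

lemma Re_of_real_mult: "Re (of_real c * p) = c * Re p"
  and Im_of_real_mult: "Im (of_real c * p) = c * Im p"
  by simp_all

lemma Ln_real_derivative:
  assumes "Im z \<noteq> 0"
  shows "((\<lambda>x. Ln (of_real x - z)) has_vector_derivative 1 / (of_real x - z)) (at x)"
proof -
  have "of_real x - z \<notin> \<real>\<^sub>\<le>\<^sub>0" using assms by (auto simp: complex_nonpos_Reals_iff)
  then have "((\<lambda>u. Ln (u - z)) has_field_derivative inverse (of_real x - z) * (1 - 0)) (at (of_real x))"
    by (intro DERIV_chain2[where f = Ln] has_field_derivative_Ln DERIV_diff DERIV_const DERIV_ident)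
  from has_vector_derivative_real_field[OF this] show ?thesis by (simp add: divide_inverse)
qed

text \<open>Partial fractions give a logarithmic primitive, and with both poles on the same side the
  difference of logarithms tends to 0 at both ends. A double pole has the primitive
  \<open>- 1 / (x - z)\<close> instead.\<close>

lemma integral_resolvent_pair_same:
  assumes z: "Im z > 0" and w: "Im w > 0"
  shows "(\<integral>x. 1 / ((of_real x - z) * (complex_of_real x - w)) \<partial>lborel) = 0"
proof (cases "z = w")
  case True
  have "(\<integral>x. 1 / ((of_real x - z) * (complex_of_real x - z)) \<partial>lborel) = 0 - 0"
  proof (rule integral_lborel_FTC[where F = "\<lambda>x. - (1 / (of_real x - z))"])
    fix x
    have nz: "of_real x - z \<noteq> 0" using z by (auto simp: complex_eq_iff)
    have "((\<lambda>u. - (1 / (u - z))) has_field_derivative 1 / ((of_real x - z) * (of_real x - z))) (at (of_real x))"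
      using nz by (auto intro!: derivative_eq_intros)
    from has_vector_derivative_real_field[OF this]
    show "((\<lambda>x. - (1 / (of_real x - z))) has_vector_derivative 1 / ((of_real x - z) * (complex_of_real x - z))) (at x)" .
    show "isCont (\<lambda>x. 1 / ((of_real x - z) * (complex_of_real x - z))) x" using z by (intro isCont_resolvent_pair) auto
  next
    show "integrable lborel (\<lambda>x. 1 / ((of_real x - z) * (complex_of_real x - z)))" using z by (intro integrable_resolvent_pair) auto
    show "((\<lambda>x. - (1 / (of_real x - z))) \<longlongrightarrow> 0) at_bot" "((\<lambda>x. - (1 / (of_real x - z))) \<longlongrightarrow> 0) at_top"
      using tendsto_minus[OF inverse_tendsto_0(1)[of z]] tendsto_minus[OF inverse_tendsto_0(2)[of z]] by simp_all
  qed
  then show ?thesis using True by simp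
next
  case False
  have "(\<integral>x. 1 / ((of_real x - z) * (complex_of_real x - w)) \<partial>lborel) = 0 / (z - w) - 0 / (z - w)"
  proof (rule integral_lborel_FTC[where F = "\<lambda>x. (Ln (of_real x - z) - Ln (of_real x - w)) / (z - w)"])
    fix x
    have nz: "of_real x - z \<noteq> 0" "of_real x - w \<noteq> 0" using z w by (auto simp: complex_eq_iff)
    have "((\<lambda>x. (Ln (of_real x - z) - Ln (of_real x - w)) / (z - w)) has_vector_derivative (1 / (of_real x - z) - 1 / (of_real x - w)) / (z - w)) (at x)"
      using z w by (intro has_vector_derivative_divide has_vector_derivative_diff Ln_real_derivative) auto
    moreover have "(1 / (of_real x - z) - 1 / (of_real x - w)) / (z - w) = 1 / ((of_real x - z) * (of_real x - w))"
      using nz False by (intro partial_fraction) auto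
    ultimately show "((\<lambda>x. (Ln (of_real x - z) - Ln (of_real x - w)) / (z - w)) has_vector_derivative 1 / ((of_real x - z) * (complex_of_real x - w))) (at x)" by simp
    show "isCont (\<lambda>x. 1 / ((of_real x - z) * (complex_of_real x - w))) x" using z w by (intro isCont_resolvent_pair) auto
  next
    show "integrable lborel (\<lambda>x. 1 / ((of_real x - z) * (complex_of_real x - w)))" using z w by (intro integrable_resolvent_pair) auto
    show "((\<lambda>x. (Ln (of_real x - z) - Ln (of_real x - w)) / (z - w)) \<longlongrightarrow> 0 / (z - w)) at_bot"
      "((\<lambda>x. (Ln (of_real x - z) - Ln (of_real x - w)) / (z - w)) \<longlongrightarrow> 0 / (z - w)) at_top"
      using False by (intro tendsto_divide Ln_difference_tendsto_0 z w tendsto_const; simp)+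
  qed
  then show ?thesis by simp
qed

text \<open>The same primitive as for poles on one side, but the arguments of the two logarithms now
  move in opposite directions, which leaves a jump.\<close>

lemma integral_resolvent_pair_opposite:
  assumes z: "Im z > 0" and v: "Im v > 0"
  shows "(\<integral>x. 1 / ((of_real x - z) * (complex_of_real x - cnj v)) \<partial>lborel) = 2 * of_real pi * \<i> / (z - cnj v)"
proof -
  have zv: "z - cnj v \<noteq> 0" using z v by (auto simp: complex_eq_iff)
  \<comment> \<open>Trading \<open>cnj v\<close> for \<open>v\<close> reduces the matter to two
    poles in the same half-plane plus an explicit argument term.\<close>
  have dec: "Ln (of_real x - z) - Ln (of_real x - cnj v) = (Ln (of_real x - z) - Ln (of_real x - v)) + 2 * \<i> * of_real (Im (Ln (of_real x - v)))" for x
  proof -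
    have "of_real x - v \<notin> \<real>\<^sub>\<le>\<^sub>0" using v by (auto simp: complex_nonpos_Reals_iff)
    then have "Ln (of_real x - cnj v) = cnj (Ln (of_real x - v))" using cnj_Ln[of "of_real x - v"] by simp
    then show ?thesis by (simp add: complex_eq_iff)
  qed
  have lim: "((\<lambda>x. Ln (of_real x - z) - Ln (of_real x - cnj v)) \<longlongrightarrow> 0 + 2 * \<i> * of_real 0) at_top"
    "((\<lambda>x. Ln (of_real x - z) - Ln (of_real x - cnj v)) \<longlongrightarrow> 0 + 2 * \<i> * of_real (- pi)) at_bot"
    unfolding dec by (intro tendsto_intros Ln_difference_tendsto_0 Im_Ln_limits z v)+
  have "(\<integral>x. 1 / ((of_real x - z) * (complex_of_real x - cnj v)) \<partial>lborel) = (0 + 2 * \<i> * of_real 0) / (z - cnj v) - (0 + 2 * \<i> * of_real (- pi)) / (z - cnj v)"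
  proof (rule integral_lborel_FTC[where F = "\<lambda>x. (Ln (of_real x - z) - Ln (of_real x - cnj v)) / (z - cnj v)"])
    fix x
    have nz: "of_real x - z \<noteq> 0" "of_real x - cnj v \<noteq> 0" using z v by (auto simp: complex_eq_iff)
    have "((\<lambda>x. (Ln (of_real x - z) - Ln (of_real x - cnj v)) / (z - cnj v)) has_vector_derivative (1 / (of_real x - z) - 1 / (of_real x - cnj v)) / (z - cnj v)) (at x)"
      using z v by (intro has_vector_derivative_divide has_vector_derivative_diff Ln_real_derivative) auto
    moreover have "(1 / (of_real x - z) - 1 / (of_real x - cnj v)) / (z - cnj v) = 1 / ((of_real x - z) * (of_real x - cnj v))"
      using nz zv by (intro partial_fraction) auto
    ultimately show "((\<lambda>x. (Ln (of_real x - z) - Ln (of_real x - cnj v)) / (z - cnj v)) has_vector_derivative 1 / ((of_real x - z) * (complex_of_real x - cnj v))) (at x)" by simp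
    show "isCont (\<lambda>x. 1 / ((of_real x - z) * (complex_of_real x - cnj v))) x" using z v by (intro isCont_resolvent_pair) auto
  next
    show "integrable lborel (\<lambda>x. 1 / ((of_real x - z) * (complex_of_real x - cnj v)))" using z v by (intro integrable_resolvent_pair) auto
    show "((\<lambda>x. (Ln (of_real x - z) - Ln (of_real x - cnj v)) / (z - cnj v)) \<longlongrightarrow> (0 + 2 * \<i> * of_real (- pi)) / (z - cnj v)) at_bot"
      "((\<lambda>x. (Ln (of_real x - z) - Ln (of_real x - cnj v)) / (z - cnj v)) \<longlongrightarrow> (0 + 2 * \<i> * of_real 0) / (z - cnj v)) at_top"
      by (rule tendsto_divide[OF lim(2) tendsto_const zv], rule tendsto_divide[OF lim(1) tendsto_const zv])
  qed
  then show ?thesis by (simp add: mult_ac)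
qed

section \<open>Variance of sums of Poisson kernels\<close>

definition poisson_sum :: "nat \<Rightarrow> (nat \<Rightarrow> real) \<Rightarrow> (nat \<Rightarrow> complex) \<Rightarrow> real \<Rightarrow> real" where
  "poisson_sum m \<gamma> z x = (\<Sum>r<m. \<gamma> r * Im (1 / (of_real x - z r)))"

text \<open>The difference quotient of \<open>Im (1 / (x - z))\<close> is minus the imaginary part
  of \<open>1 / (x - z)\<close> times \<open>1 / (y - z)\<close>. By
  \<open>Im p * Im q = (Re (p * cnj q) - Re (p * q)) / 2\<close> its square becomes a sum of
  products separated in \<open>x\<close> and \<open>y\<close>. Poles on the same side then integrate
  to 0, and opposite ones give the square of
  \<open>2 * pi * \<i> / (z r - cnj (z s))\<close>.\<close>

lemma sigma_sq_poisson_sum: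
  assumes Im: "\<And>r. r < m \<Longrightarrow> Im (z r) > 0"
  shows "sigma_sq (poisson_sum m \<gamma> z) = - 1 / 2 * (\<Sum>r<m. \<Sum>s<m. \<gamma> r * \<gamma> s * Re (1 / (z r - cnj (z s))\<^sup>2))"
proof -
  define A where "A = (\<lambda>r x. 1 / (of_real x - z r))"
  define B where "B = (\<lambda>r s x. 1 / ((of_real x - z r) * (complex_of_real x - cnj (z s))))"
  define C where "C = (\<lambda>r s x. 1 / ((of_real x - z r) * (complex_of_real x - z s)))"
  define J where "J = (\<lambda>r s. 2 * of_real pi * \<i> / (z r - cnj (z s)))"
  define Hc where "Hc = (\<lambda>x y. \<Sum>r<m. \<Sum>s<m. of_real (\<gamma> r * \<gamma> s / 2) * (B r s x * B r s y - C r s x * C r s y))"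
  have Bi: "integrable lborel (B r s)" and BI: "integral\<^sup>L lborel (B r s) = J r s" if "r < m" "s < m" for r s
    unfolding B_def J_def using Im[OF that(1)] Im[OF that(2)] by (auto intro!: integrable_resolvent_pair integral_resolvent_pair_opposite)
  have Ci: "integrable lborel (C r s)" and CI: "integral\<^sup>L lborel (C r s) = 0" if "r < m" "s < m" for r s
    unfolding C_def using Im[OF that(1)] Im[OF that(2)] by (auto intro!: integrable_resolvent_pair integral_resolvent_pair_same)
  have Hi: "integrable lborel (Hc x)" for x
    unfolding Hc_def using Bi Ci by (intro Bochner_Integration.integrable_sum integrable_mult_right Bochner_Integration.integrable_diff) auto
  have HI: "integral\<^sup>L lborel (Hc x) = (\<Sum>r<m. \<Sum>s<m. of_real (\<gamma> r * \<gamma> s / 2) * (B r s x * J r s))" for x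
  proof -
    have "integral\<^sup>L lborel (Hc x) = (\<Sum>r<m. \<Sum>s<m. \<integral>y. of_real (\<gamma> r * \<gamma> s / 2) * (B r s x * B r s y - C r s x * C r s y) \<partial>lborel)"
      unfolding Hc_def using Bi Ci
      by (subst Bochner_Integration.integral_sum, intro Bochner_Integration.integrable_sum integrable_mult_right Bochner_Integration.integrable_diff, simp, simp)
         (intro sum.cong refl Bochner_Integration.integral_sum, intro integrable_mult_right Bochner_Integration.integrable_diff, auto)
    also have "\<dots> = (\<Sum>r<m. \<Sum>s<m. of_real (\<gamma> r * \<gamma> s / 2) * (B r s x * J r s))"
    proof (intro sum.cong refl)
      fix r s assume "r \<in> {..<m}" "s \<in> {..<m}"
      then have rs: "r < m" "s < m" by auto
      show "(\<integral>y. of_real (\<gamma> r * \<gamma> s / 2) * (B r s x * B r s y - C r s x * C r s y) \<partial>lborel) = of_real (\<gamma> r * \<gamma> s / 2) * (B r s x * J r s)"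
        unfolding integral_mult_right_zero
        by (subst Bochner_Integration.integral_diff) (auto intro!: integrable_mult_right Bi Ci rs simp: BI[OF rs] CI[OF rs])
    qed
    finally show ?thesis .
  qed
  have HR: "(poisson_sum m \<gamma> z x - poisson_sum m \<gamma> z y) / (x - y) * ((poisson_sum m \<gamma> z x - poisson_sum m \<gamma> z y) / (x - y)) = Re (Hc x y)" if xy: "x \<noteq> y" for x y
  proof -
    have "(poisson_sum m \<gamma> z x - poisson_sum m \<gamma> z y) / (x - y) = - (\<Sum>r<m. \<gamma> r * Im (A r x * A r y))"
    proof -
      have "(Im (A r x) - Im (A r y)) / (x - y) = - Im (A r x * A r y)" if "r < m" for r
      proof -
        have nz: "of_real x - z r \<noteq> 0" "of_real y - z r \<noteq> 0" using Im[OF that] by (auto simp: complex_eq_iff)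
        have "A r x - A r y = - of_real (x - y) * (A r x * A r y)"
          unfolding A_def using nz by (simp add: field_simps)
        then have "Im (A r x - A r y) = Im (of_real (- (x - y)) * (A r x * A r y))" by simp
        also have "\<dots> = - (x - y) * Im (A r x * A r y)" by (simp only: Im_of_real_mult minus_diff_eq)
        finally show ?thesis using xy by (simp add: field_simps)
      qed
      moreover have "(poisson_sum m \<gamma> z x - poisson_sum m \<gamma> z y) / (x - y) = (\<Sum>r<m. \<gamma> r * ((Im (A r x) - Im (A r y)) / (x - y)))"
        unfolding poisson_sum_def A_def by (simp add: sum_subtractf[symmetric] sum_divide_distrib right_diff_distrib diff_divide_distrib)
      moreover have "(\<Sum>r<m. \<gamma> r * ((Im (A r x) - Im (A r y)) / (x - y))) = (\<Sum>r<m. - (\<gamma> r * Im (A r x * A r y)))"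
        using calculation(1) by (intro sum.cong refl) (simp only: lessThan_iff mult_minus_right)
      ultimately show ?thesis by (simp only: sum_negf)
    qed
    then have "(poisson_sum m \<gamma> z x - poisson_sum m \<gamma> z y) / (x - y) * ((poisson_sum m \<gamma> z x - poisson_sum m \<gamma> z y) / (x - y))
       = (\<Sum>r<m. \<Sum>s<m. (\<gamma> r * Im (A r x * A r y)) * (\<gamma> s * Im (A s x * A s y)))"
      by (simp add: sum_product)
    also have "\<dots> = (\<Sum>r<m. \<Sum>s<m. \<gamma> r * \<gamma> s / 2 * Re (B r s x * B r s y - C r s x * C r s y))"
    proof (intro sum.cong refl)
      fix r s
      have im: "Im p * Im q = (Re (p * cnj q) - Re (p * q)) / 2" for p q :: complex by simp
      have b: "B r s x * B r s y = (A r x * A r y) * cnj (A s x * A s y)" "C r s x * C r s y = (A r x * A r y) * (A s x * A s y)"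
        unfolding A_def B_def C_def by simp_all
      show "(\<gamma> r * Im (A r x * A r y)) * (\<gamma> s * Im (A s x * A s y)) = \<gamma> r * \<gamma> s / 2 * Re (B r s x * B r s y - C r s x * C r s y)"
        unfolding b minus_complex.sel mult.assoc mult.left_commute[of "Im (A r x * A r y)" "\<gamma> s"] im by simp
    qed
    also have "\<dots> = Re (Hc x y)"
      unfolding Hc_def Re_sum by (simp only: Re_of_real_mult)
    finally show ?thesis .
  qed
  have meas: "poisson_sum m \<gamma> z \<in> borel_measurable borel" unfolding poisson_sum_def[abs_def] by measurable
  have inner: "(\<integral>y. ((poisson_sum m \<gamma> z x - poisson_sum m \<gamma> z y) / (x - y))\<^sup>2 \<partial>lborel) = Re (\<Sum>r<m. \<Sum>s<m. of_real (\<gamma> r * \<gamma> s / 2) * (B r s x * J r s))" for x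
  proof -
    have "(\<integral>y. ((poisson_sum m \<gamma> z x - poisson_sum m \<gamma> z y) / (x - y))\<^sup>2 \<partial>lborel) = (\<integral>y. Re (Hc x y) \<partial>lborel)"
    proof (rule integral_cong_AE)
      show "(\<lambda>y. ((poisson_sum m \<gamma> z x - poisson_sum m \<gamma> z y) / (x - y))\<^sup>2) \<in> borel_measurable lborel" using meas by measurable
      show "(\<lambda>y. Re (Hc x y)) \<in> borel_measurable lborel" using Hi[of x] by (intro borel_measurable_integrable) (auto intro: integrable_Re)
      \<comment> \<open>The diagonal, where the quotient is 0 by convention, is a null set.\<close>
      show "AE y in lborel. ((poisson_sum m \<gamma> z x - poisson_sum m \<gamma> z y) / (x - y))\<^sup>2 = Re (Hc x y)"
        using AE_lborel_singleton[of x] by eventually_elim (use HR in \<open>auto simp: power2_eq_square\<close>)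
    qed
    then show ?thesis using integral_Re[OF Hi[of x]] HI by simp
  qed
  have "(\<integral>x. (\<integral>y. ((poisson_sum m \<gamma> z x - poisson_sum m \<gamma> z y) / (x - y))\<^sup>2 \<partial>lborel) \<partial>lborel)
     = Re (\<integral>x. (\<Sum>r<m. \<Sum>s<m. of_real (\<gamma> r * \<gamma> s / 2) * (B r s x * J r s)) \<partial>lborel)"
    unfolding inner using Bi
    by (intro integral_Re Bochner_Integration.integrable_sum integrable_mult_right integrable_mult_left) auto
  also have "(\<integral>x. (\<Sum>r<m. \<Sum>s<m. of_real (\<gamma> r * \<gamma> s / 2) * (B r s x * J r s)) \<partial>lborel) = (\<Sum>r<m. \<Sum>s<m. of_real (\<gamma> r * \<gamma> s / 2) * (J r s * J r s))"
  proof -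
    have "(\<integral>x. (\<Sum>r<m. \<Sum>s<m. of_real (\<gamma> r * \<gamma> s / 2) * (B r s x * J r s)) \<partial>lborel) = (\<Sum>r<m. \<Sum>s<m. \<integral>x. of_real (\<gamma> r * \<gamma> s / 2) * (B r s x * J r s) \<partial>lborel)"
      using Bi
      by (subst Bochner_Integration.integral_sum, intro Bochner_Integration.integrable_sum integrable_mult_right integrable_mult_left, simp)
         (intro sum.cong refl Bochner_Integration.integral_sum, intro integrable_mult_right integrable_mult_left, auto)
    also have "\<dots> = (\<Sum>r<m. \<Sum>s<m. of_real (\<gamma> r * \<gamma> s / 2) * (J r s * J r s))"
      by (intro sum.cong refl) (simp only: integral_mult_right_zero integral_mult_left_zero BI lessThan_iff)
    finally show ?thesis .
  qed
  also have "Re \<dots> = (\<Sum>r<m. \<Sum>s<m. \<gamma> r * \<gamma> s / 2 * (- 4 * pi\<^sup>2 * Re (1 / (z r - cnj (z s))\<^sup>2)))"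
    unfolding Re_sum
  proof (intro sum.cong refl)
    fix r s
    have "J r s * J r s = of_real (- 4 * pi\<^sup>2) * (1 / (z r - cnj (z s))\<^sup>2)"
    proof -
      have c: "(2 * of_real pi * \<i>) * (2 * of_real pi * \<i>) = (of_real (- 4 * pi\<^sup>2) :: complex)"
        by (simp add: complex_eq_iff power2_eq_square)
      have "(c / u) * (c / u) = (c * c) * (1 / u\<^sup>2)" for c u :: complex by (simp add: power2_eq_square)
      from this[of "2 * of_real pi * \<i>" "z r - cnj (z s)"] show ?thesis unfolding J_def c .
    qed
    then have "Re (J r s * J r s) = - 4 * pi\<^sup>2 * Re (1 / (z r - cnj (z s))\<^sup>2)" by (simp only: Re_of_real_mult)
    then show "Re (of_real (\<gamma> r * \<gamma> s / 2) * (J r s * J r s)) = \<gamma> r * \<gamma> s / 2 * (- 4 * pi\<^sup>2 * Re (1 / (z r - cnj (z s))\<^sup>2))"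
      by (simp only: Re_of_real_mult)
  qed
  also have "\<dots> = 4 * pi\<^sup>2 * (- 1 / 2 * (\<Sum>r<m. \<Sum>s<m. \<gamma> r * \<gamma> s * Re (1 / (z r - cnj (z s))\<^sup>2)))"
    by (simp add: sum_distrib_left mult_ac)
  finally show ?thesis unfolding sigma_sq_def by simp
qed

subsection \<open>The Gaussian limit of the product over pairs\<close>

lemma riemann_sum_error:
  fixes k :: "real \<Rightarrow> real"
  assumes lip: "\<And>s t. a \<le> s \<Longrightarrow> s \<le> b \<Longrightarrow> a \<le> t \<Longrightarrow> t \<le> b \<Longrightarrow> \<bar>k s - k t\<bar> \<le> \<Lambda> * \<bar>s - t\<bar>"
    and h: "h \<ge> 0" and \<Lambda>: "\<Lambda> \<ge> 0" and n: "a + real n * h \<le> b"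
  shows "\<bar>(\<Sum>r<n. h * k (a + real r * h)) - integral {a..a + real n * h} k\<bar> \<le> real n * (\<Lambda> * h * h)"
  using n
proof (induction n)
  case 0 show ?case by simp
next
  case (Suc n)
  define c where "c = a + real n * h"
  have cb: "a \<le> c" "c \<le> c + h" "c + h \<le> b" using Suc.prems h by (auto simp: c_def algebra_simps)
  have e: "a + real (Suc n) * h = c + h" by (simp add: c_def algebra_simps)
  have cont: "continuous_on {a..b} k"
    by (rule lipschitz_on_continuous_on[of \<Lambda>]) (use lip \<Lambda> in \<open>auto simp: lipschitz_on_def dist_real_def\<close>)
  have int: "k integrable_on {u..v}" if "a \<le> u" "v \<le> b" for u v
    by (rule integrable_continuous_real, rule continuous_on_subset[OF cont]) (use that in auto)
  have "integral {a..c + h} k = integral {a..c} k + integral {c..c + h} k"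
    using cb by (intro Henstock_Kurzweil_Integration.integral_combine[symmetric] int) auto
  moreover have "\<bar>h * k c - integral {c..c + h} k\<bar> \<le> \<Lambda> * h * h"
  proof -
    have "integral {c..c + h} (\<lambda>t. k c - k t) = h * k c - integral {c..c + h} k"
      using cb int[of c "c + h"] h by (subst Henstock_Kurzweil_Integration.integral_diff) auto
    moreover have "norm (integral {c..c + h} (\<lambda>t. k c - k t)) \<le> \<Lambda> * h * (c + h - c)"
    proof (rule integral_bound)
      show "c \<le> c + h" using h by simp
      show "continuous_on {c..c + h} (\<lambda>t. k c - k t)"
        by (intro continuous_intros continuous_on_subset[OF cont]) (use cb in auto)
      show "norm (k c - k t) \<le> \<Lambda> * h" if "t \<in> {c..c + h}" for t
      proof -
        have "\<bar>k c - k t\<bar> \<le> \<Lambda> * \<bar>c - t\<bar>" using that cb by (intro lip) auto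
        also have "\<dots> \<le> \<Lambda> * h" using that \<Lambda> by (intro mult_left_mono) auto
        finally show ?thesis by simp
      qed
    qed
    ultimately show ?thesis by simp
  qed
  moreover have "\<bar>(\<Sum>r<n. h * k (a + real r * h)) - integral {a..c} k\<bar> \<le> real n * (\<Lambda> * h * h)"
    using Suc.IH cb unfolding c_def by simp
  moreover have "real (Suc n) * (\<Lambda> * h * h) = \<Lambda> * h * h + real n * (\<Lambda> * h * h)" by (simp add: distrib_right)
  ultimately show ?case unfolding e sum.lessThan_Suc c_def[symmetric] by linarith
qed

text \<open>Telescoping over the index set. The factors may slightly exceed 1 in modulus, hence the
  bound \<open>exp q\<close>; in the application \<open>q\<close> is of the order of the inverse
  cardinality, so the last exponential stays bounded.\<close>

lemma prod_difference_bound: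
  fixes u v :: "'i \<Rightarrow> complex"
  assumes "finite I" and "\<And>i. i \<in> I \<Longrightarrow> cmod (u i) \<le> exp q" "\<And>i. i \<in> I \<Longrightarrow> cmod (v i) \<le> exp q"
    and "\<And>i. i \<in> I \<Longrightarrow> cmod (u i - v i) \<le> \<delta>" and q: "q \<ge> 0" and \<delta>: "\<delta> \<ge> 0"
  shows "cmod ((\<Prod>i\<in>I. u i) - (\<Prod>i\<in>I. v i)) \<le> real (card I) * \<delta> * exp (real (card I) * q)"
  using assms(1-4)
proof (induction I rule: finite_induct)
  case empty show ?case by simp
next
  case (insert i I)
  define n where "n = card I"
  have U: "cmod (\<Prod>i\<in>I. u i) \<le> exp (real n * q)"
  proof -
    have "cmod (\<Prod>i\<in>I. u i) \<le> (\<Prod>i\<in>I. exp q)" unfolding prod_norm[symmetric] using insert by (intro prod_mono) auto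
    then show ?thesis by (simp add: n_def exp_of_nat_mult)
  qed
  have IH: "cmod ((\<Prod>i\<in>I. u i) - (\<Prod>i\<in>I. v i)) \<le> real n * \<delta> * exp (real n * q)" using insert by (simp add: n_def)
  have "u i * (\<Prod>i\<in>I. u i) - v i * (\<Prod>i\<in>I. v i) = (u i - v i) * (\<Prod>i\<in>I. u i) + v i * ((\<Prod>i\<in>I. u i) - (\<Prod>i\<in>I. v i))"
    by (simp add: algebra_simps)
  then have "cmod (u i * (\<Prod>i\<in>I. u i) - v i * (\<Prod>i\<in>I. v i)) \<le> cmod (u i - v i) * cmod (\<Prod>i\<in>I. u i) + cmod (v i) * cmod ((\<Prod>i\<in>I. u i) - (\<Prod>i\<in>I. v i))"
    by (metis norm_mult norm_triangle_ineq)
  also have "\<dots> \<le> \<delta> * exp (real n * q) + exp q * (real n * \<delta> * exp (real n * q))"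
    using insert.prems U IH \<delta> by (intro add_mono mult_mono) auto
  also have "\<dots> \<le> \<delta> * (exp q * exp (real n * q)) + exp q * (real n * \<delta> * exp (real n * q))"
  proof (intro add_right_mono mult_left_mono \<delta>)
    have "1 * exp (real n * q) \<le> exp q * exp (real n * q)" using q by (intro mult_right_mono) auto
    then show "exp (real n * q) \<le> exp q * exp (real n * q)" by simp
  qed
  also have "\<dots> = real (Suc n) * \<delta> * exp (real (Suc n) * q)" by (simp add: exp_add algebra_simps)
  finally show ?case using insert.hyps by (simp add: n_def)
qed

text \<open>For \<open>a = z r - cnj (z s)\<close>, \<open>d = w r - z r\<close> and
  \<open>e = cnj (w s - z s)\<close> this is the factor of one pair of dipoles: it deviates from 1
  only by a term bilinear in the two displacements, up to the shifts in the denominator.\<close>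

lemma gauss_factor:
  fixes a d e :: complex
  assumes "a - e \<noteq> 0" "a + d \<noteq> 0"
  shows "(a * (a + d - e)) / ((a - e) * (a + d)) = 1 + d * e / ((a - e) * (a + d))"
proof -
  have "(a * (a + d - e)) = (a - e) * (a + d) + d * e" by (simp add: algebra_simps)
  then show ?thesis using assms by (simp add: add_divide_distrib)
qed

text \<open>There are \<open>m\<^sup>2\<close> pairs, at most of the order of
  \<open>1 / h^2\<close>, and each factor \<open>1 + E\<close> differs from \<open>exp E'\<close> by
  \<open>O(h^3)\<close>, which leaves \<open>O(h)\<close>. \<open>Q * h\<^sup>2\<close> bounds
  \<open>E\<close> and \<open>E'\<close>, \<open>K * h^3\<close> bounds \<open>E - E'\<close>, and
  \<open>exp Q * Q\<^sup>2\<close> comes from the second-order remainder of the exponential.\<close>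

lemma gauss_product_approx:
  fixes z w :: "nat \<Rightarrow> complex" and c :: "nat \<Rightarrow> real"
  assumes Im: "\<And>r. r < m \<Longrightarrow> Im (z r) \<ge> \<epsilon>" "\<And>r. r < m \<Longrightarrow> Im (w r) \<ge> \<epsilon>" and \<epsilon>: "\<epsilon> > 0"
    and c: "\<And>r. r < m \<Longrightarrow> \<bar>c r\<bar> \<le> D * h" and d: "\<And>r. r < m \<Longrightarrow> cmod (w r - z r) \<le> D * h"
    and dc: "\<And>r. r < m \<Longrightarrow> cmod (w r - z r - of_real (c r)) \<le> h\<^sup>2" and h: "0 \<le> h" "h \<le> 1" and D: "D \<ge> 0"
    and mh: "real m * h \<le> T" and T: "T \<ge> 0"
  defines "Q \<equiv> D\<^sup>2 / \<epsilon>\<^sup>2" and "K \<equiv> 2 * D / \<epsilon>\<^sup>2 + D\<^sup>2 * (2 * D / \<epsilon>^3 + D\<^sup>2 / \<epsilon>^4)"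
  shows "cmod (gauss_product m z w - exp (\<Sum>s<m. \<Sum>r<m. of_real (c r * c s) / (z r - cnj (z s))\<^sup>2)) \<le> T\<^sup>2 * ((K + exp Q * Q\<^sup>2) * exp (T\<^sup>2 * Q)) * h"
proof -
  define I where "I = {..<m} \<times> {..<m}"
  define E where "E = (\<lambda>(s, r). (w r - z r) * cnj (w s - z s) / ((z r - cnj (w s)) * (w r - cnj (z s))))"
  define E' where "E' = (\<lambda>(s, r). complex_of_real (c r * c s) / (z r - cnj (z s))\<^sup>2)"
  have Q0: "Q \<ge> 0" by (simp add: Q_def)
  have K0: "K \<ge> 0" using D \<epsilon> by (simp add: K_def)
  have big: "cmod (z r - cnj (z s)) \<ge> \<epsilon>" "cmod (z r - cnj (w s)) \<ge> \<epsilon>" "cmod (w r - cnj (z s)) \<ge> \<epsilon>" if "r < m" "s < m" for r s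
    using that Im[of r] Im[of s] \<epsilon> abs_Im_le_cmod[of "z r - cnj (z s)"] abs_Im_le_cmod[of "z r - cnj (w s)"] abs_Im_le_cmod[of "w r - cnj (z s)"]
    by auto
  have g1: "gauss_product m z w = (\<Prod>i\<in>I. 1 + E i)"
  proof -
    have "gauss_product m z w = (\<Prod>s<m. \<Prod>r<m. 1 + E (s, r))" unfolding gauss_product_def
    proof (intro prod.cong refl)
      fix s r assume "s \<in> {..<m}" "r \<in> {..<m}"
      then have rs: "r < m" "s < m" by auto
      have nz: "z r - cnj (w s) \<noteq> 0" "w r - cnj (z s) \<noteq> 0" using big[OF rs] \<epsilon> by auto
      show "(z r - cnj (z s)) * (w r - cnj (w s)) / ((z r - cnj (w s)) * (w r - cnj (z s))) = 1 + E (s, r)"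
        using gauss_factor[of "z r - cnj (z s)" "cnj (w s - z s)" "w r - z r"] nz by (simp add: E_def algebra_simps)
    qed
    then show ?thesis unfolding I_def by (simp add: prod.cartesian_product)
  qed
  have g2: "exp (\<Sum>s<m. \<Sum>r<m. of_real (c r * c s) / (z r - cnj (z s))\<^sup>2) = (\<Prod>i\<in>I. exp (E' i))"
  proof -
    have "(\<Sum>s<m. \<Sum>r<m. of_real (c r * c s) / (z r - cnj (z s))\<^sup>2) = (\<Sum>i\<in>I. E' i)"
      unfolding I_def E'_def by (simp add: sum.cartesian_product)
    then show ?thesis by (simp add: exp_sum I_def)
  qed
  have bE: "cmod (E i) \<le> Q * h\<^sup>2" and bE': "cmod (E' i) \<le> Q * h\<^sup>2" and bd: "cmod (E i - E' i) \<le> K * h^3" if "i \<in> I" for i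
  proof -
    obtain s r where i: "i = (s, r)" by (cases i)
    then have rs: "r < m" "s < m" using that by (auto simp: I_def)
    define a where "a = z r - cnj (z s)"
    define A where "A = z r - cnj (w s)"
    define B where "B = w r - cnj (z s)"
    define p where "p = w r - z r"
    define q where "q = cnj (w s - z s)"
    have n: "cmod a \<ge> \<epsilon>" "cmod A \<ge> \<epsilon>" "cmod B \<ge> \<epsilon>" using big[OF rs] by (simp_all add: a_def A_def B_def)
    have nz: "a \<noteq> 0" "A \<noteq> 0" "B \<noteq> 0" using n \<epsilon> by auto
    have pq: "cmod p \<le> D * h" "cmod q \<le> D * h" using d[OF rs(1)] d[OF rs(2)] unfolding p_def q_def complex_mod_cnj by auto
    have pc: "cmod (p - of_real (c r)) \<le> h\<^sup>2" using dc[OF rs(1)] by (simp add: p_def)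
    have qc: "cmod (q - of_real (c s)) \<le> h\<^sup>2"
    proof -
      have "q - of_real (c s) = cnj (w s - z s - of_real (c s))" by (simp add: q_def)
      then show ?thesis using dc[OF rs(2)] by (simp only: complex_mod_cnj)
    qed
    have AB: "\<epsilon>\<^sup>2 \<le> cmod (A * B)" unfolding norm_mult power2_eq_square using n \<epsilon> by (intro mult_mono) auto
    have aa: "\<epsilon>\<^sup>2 \<le> cmod (a\<^sup>2)" unfolding norm_power using n \<epsilon> by (intro power_mono) auto
    have Ei: "E i = p * q / (A * B)" by (simp add: E_def i p_def q_def A_def B_def)
    have E'i: "E' i = of_real (c r) * of_real (c s) / a\<^sup>2" by (simp add: E'_def i a_def)
    have cc: "\<bar>c r\<bar> * \<bar>c s\<bar> \<le> (D * h) * (D * h)" using c rs D h by (intro mult_mono) auto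
    show "cmod (E i) \<le> Q * h\<^sup>2"
    proof -
      have "cmod (E i) \<le> (D * h) * (D * h) / \<epsilon>\<^sup>2"
        unfolding Ei norm_divide norm_mult[of p q] using AB \<epsilon> pq D h by (intro frac_le mult_mono) auto
      then show ?thesis by (simp add: Q_def power2_eq_square mult_ac)
    qed
    show "cmod (E' i) \<le> Q * h\<^sup>2"
    proof -
      have "cmod (E' i) \<le> (D * h) * (D * h) / \<epsilon>\<^sup>2"
        unfolding E'i norm_divide norm_mult norm_of_real using aa \<epsilon> cc D h by (intro frac_le) auto
      then show ?thesis by (simp add: Q_def power2_eq_square mult_ac)
    qed
    \<comment> \<open>Separates the error in the numerators from the error in the
      denominators.\<close>
    have "E i - E' i = (p * q - of_real (c r) * of_real (c s)) / (A * B) + of_real (c r) * of_real (c s) * (1 / (A * B) - 1 / a\<^sup>2)"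
      unfolding Ei E'i by (simp add: diff_divide_distrib right_diff_distrib)
    also have "1 / (A * B) - 1 / a\<^sup>2 = (q - p) / (a * (A * B)) + p * q / (a\<^sup>2 * (A * B))"
    proof -
      have Aq: "A = a - q" and Bp: "B = a + p" by (simp_all add: A_def B_def a_def p_def q_def)
      have "1 / (A * B) - 1 / a\<^sup>2 = (a\<^sup>2 - A * B) / (a\<^sup>2 * (A * B))" using nz by (simp add: diff_frac_eq mult.commute)
      also have "a\<^sup>2 - A * B = a * (q - p) + p * q" by (simp add: Aq Bp power2_eq_square algebra_simps)
      also have "(a * (q - p) + p * q) / (a\<^sup>2 * (A * B)) = (q - p) / (a * (A * B)) + p * q / (a\<^sup>2 * (A * B))"
        using nz by (simp add: add_divide_distrib power2_eq_square)
      finally show ?thesis .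
    qed
    finally have dec: "E i - E' i = (p * q - of_real (c r) * of_real (c s)) / (A * B) + of_real (c r) * of_real (c s) * ((q - p) / (a * (A * B)) + p * q / (a\<^sup>2 * (A * B)))" .
    have t1: "cmod ((p * q - of_real (c r) * of_real (c s)) / (A * B)) \<le> (2 * D * h^3) / \<epsilon>\<^sup>2"
    proof -
      have "p * q - of_real (c r) * of_real (c s) = (p - of_real (c r)) * q + of_real (c r) * (q - of_real (c s))" by (simp add: algebra_simps)
      then have "cmod (p * q - of_real (c r) * of_real (c s)) \<le> cmod (p - of_real (c r)) * cmod q + \<bar>c r\<bar> * cmod (q - of_real (c s))"
        by (metis norm_mult norm_of_real norm_triangle_ineq)
      also have "\<dots> \<le> h\<^sup>2 * (D * h) + (D * h) * h\<^sup>2" using pq pc qc c[OF rs(1)] D h by (intro add_mono mult_mono) auto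
      also have "\<dots> = 2 * D * h^3" by (simp add: power2_eq_square power3_eq_cube)
      finally show ?thesis unfolding norm_divide using AB \<epsilon> D h by (intro frac_le) auto
    qed
    have t2: "cmod ((q - p) / (a * (A * B))) \<le> 2 * D * h / \<epsilon>^3"
    proof -
      have "\<epsilon> * \<epsilon>\<^sup>2 \<le> cmod a * cmod (A * B)" using n AB \<epsilon> by (intro mult_mono) auto
      moreover have "cmod (q - p) \<le> 2 * D * h" using norm_triangle_ineq4[of q p] pq by linarith
      ultimately show ?thesis unfolding norm_divide norm_mult[of a] using \<epsilon> D h
        by (intro frac_le) (auto simp: power3_eq_cube power2_eq_square mult.assoc)
    qed
    have t3: "cmod (p * q / (a\<^sup>2 * (A * B))) \<le> D\<^sup>2 * h / \<epsilon>^4"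
    proof -
      have "\<epsilon>\<^sup>2 * \<epsilon>\<^sup>2 \<le> cmod (a\<^sup>2) * cmod (A * B)" using aa AB \<epsilon> by (intro mult_mono) auto
      moreover have "cmod (p * q) \<le> D\<^sup>2 * h"
      proof -
        have "cmod (p * q) \<le> (D * h) * (D * h)" unfolding norm_mult using pq D h by (intro mult_mono) auto
        also have "\<dots> = (D\<^sup>2 * h) * h" by (simp add: power2_eq_square)
        also have "\<dots> \<le> (D\<^sup>2 * h) * 1" using h by (intro mult_left_mono) auto
        finally show ?thesis by simp
      qed
      ultimately show ?thesis unfolding norm_divide norm_mult[of "a\<^sup>2"] using \<epsilon> D h
        by (intro frac_le) (auto simp: power4_eq_xxxx power2_eq_square mult.assoc)
    qed
    have "cmod (E i - E' i) \<le> (2 * D * h^3) / \<epsilon>\<^sup>2 + ((D * h) * (D * h)) * (2 * D * h / \<epsilon>^3 + D\<^sup>2 * h / \<epsilon>^4)"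
      unfolding dec
    proof (rule order_trans[OF norm_triangle_ineq], rule add_mono[OF t1])
      show "cmod (of_real (c r) * of_real (c s) * ((q - p) / (a * (A * B)) + p * q / (a\<^sup>2 * (A * B)))) \<le> ((D * h) * (D * h)) * (2 * D * h / \<epsilon>^3 + D\<^sup>2 * h / \<epsilon>^4)"
        unfolding norm_mult[of "of_real (c r) * of_real (c s)"]
      proof (rule mult_mono)
        show "cmod (of_real (c r) * of_real (c s)) \<le> D * h * (D * h)" using cc by (simp add: norm_mult)
        show "cmod ((q - p) / (a * (A * B)) + p * q / (a\<^sup>2 * (A * B))) \<le> 2 * D * h / \<epsilon> ^ 3 + D\<^sup>2 * h / \<epsilon> ^ 4"
          by (rule order_trans[OF norm_triangle_ineq add_mono[OF t2 t3]])
      qed (use D h in auto)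
    qed
    also have "\<dots> = K * h^3" by (simp add: K_def power2_eq_square power3_eq_cube algebra_simps)
    finally show "cmod (E i - E' i) \<le> K * h^3" .
  qed
  have Qh: "Q * h\<^sup>2 \<le> Q" using Q0 h by (intro mult_left_le) (auto simp: power_le_one)
  define \<delta> where "\<delta> = (K + exp Q * Q\<^sup>2) * h^3"
  have fin: "finite I" by (simp add: I_def)
  have cardI: "real (card I) = real m * real m" by (simp add: I_def)
  have "cmod (gauss_product m z w - exp (\<Sum>s<m. \<Sum>r<m. of_real (c r * c s) / (z r - cnj (z s))\<^sup>2)) \<le> real (card I) * \<delta> * exp (real (card I) * (Q * h\<^sup>2))"
    unfolding g1 g2
  proof (rule prod_difference_bound[OF fin])
    fix i assume i: "i \<in> I"
    have "cmod (1 + E i) \<le> 1 + Q * h\<^sup>2" using norm_triangle_ineq[of 1 "E i"] bE[OF i] by simp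
    also have "\<dots> \<le> exp (Q * h\<^sup>2)" by (rule exp_ge_add_one_self)
    finally show "cmod (1 + E i) \<le> exp (Q * h\<^sup>2)" .
    show "cmod (exp (E' i)) \<le> exp (Q * h\<^sup>2)"
      using bE'[OF i] complex_Re_le_cmod[of "E' i"] by simp
    have "cmod (exp (E' i) - (\<Sum>k\<le>1. E' i ^ k / fact k)) \<le> exp \<bar>Re (E' i)\<bar> * cmod (E' i) ^ (Suc 1) / fact 1"
      by (rule Taylor_exp)
    then have "cmod (exp (E' i) - 1 - E' i) \<le> exp \<bar>Re (E' i)\<bar> * (cmod (E' i))\<^sup>2" by (simp add: power2_eq_square algebra_simps)
    also have "\<dots> \<le> exp Q * (Q * h\<^sup>2)\<^sup>2"
      using bE'[OF i] Qh abs_Re_le_cmod[of "E' i"] by (intro mult_mono power_mono) auto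
    also have "\<dots> = exp Q * Q\<^sup>2 * h^3 * h" by (simp add: power2_eq_square power3_eq_cube)
    also have "\<dots> \<le> exp Q * Q\<^sup>2 * h^3 * 1" using h by (intro mult_left_mono) auto
    finally have "cmod (exp (E' i) - 1 - E' i) \<le> exp Q * Q\<^sup>2 * h^3" by simp
    then show "cmod (1 + E i - exp (E' i)) \<le> \<delta>"
      using bd[OF i] norm_triangle_ineq4[of "E i - E' i" "exp (E' i) - 1 - E' i"] by (simp add: \<delta>_def algebra_simps)
  qed (use Q0 K0 h in \<open>auto simp: \<delta>_def\<close>)
  also have "real (card I) * \<delta> = (real m * h)\<^sup>2 * (K + exp Q * Q\<^sup>2) * h"
    by (simp add: cardI \<delta>_def power2_eq_square power3_eq_cube)
  also have "real (card I) * (Q * h\<^sup>2) = (real m * h)\<^sup>2 * Q" by (simp add: cardI power2_eq_square)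
  also have "(real m * h)\<^sup>2 * (K + exp Q * Q\<^sup>2) * h * exp ((real m * h)\<^sup>2 * Q) \<le> T\<^sup>2 * (K + exp Q * Q\<^sup>2) * h * exp (T\<^sup>2 * Q)"
  proof -
    have "(real m * h)\<^sup>2 \<le> T\<^sup>2" using mh h by (intro power_mono) auto
    then show ?thesis using Q0 K0 h by (intro mult_mono mult_right_mono) (auto intro: mult_right_mono)
  qed
  finally show ?thesis by (simp add: mult_ac)
qed

subsection \<open>Approximation of test functions by phase statistics\<close>

lemma Complex_eq_real_add: "Complex t e = of_real t + \<i> * of_real e"
  by (simp add: complex_eq_iff)

lemma Complex_minus_nonzero: "e \<noteq> 0 \<Longrightarrow> of_real x - Complex t e \<noteq> 0"
  by (auto simp: complex_eq_iff)

lemma resolvent_derivative_node: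
  assumes e: "e \<noteq> 0"
  shows "((\<lambda>t. Im (1 / (of_real x - Complex t e))) has_real_derivative Im (1 / (of_real x - Complex t e)\<^sup>2)) (at t)"
    and "((\<lambda>t. Im (1 / (of_real x - Complex t e)\<^sup>2)) has_real_derivative Im (2 / (of_real x - Complex t e)^3)) (at t)"
proof -
  have nz: "of_real x - (of_real t + \<i> * of_real e) \<noteq> 0" using Complex_minus_nonzero[OF e, of x t] by (simp add: Complex_eq_real_add)
  have D: "((\<lambda>u. 1 / (of_real x - (u + \<i> * of_real e))) has_field_derivative 1 / (of_real x - (of_real t + \<i> * of_real e))\<^sup>2) (at (of_real t))"
    using nz by (auto intro!: derivative_eq_intros simp: power2_eq_square)
  from bounded_linear.has_vector_derivative[OF bounded_linear_Im has_vector_derivative_real_field[OF D]]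
  show "((\<lambda>t. Im (1 / (of_real x - Complex t e))) has_real_derivative Im (1 / (of_real x - Complex t e)\<^sup>2)) (at t)"
    by (simp add: Complex_eq_real_add has_real_derivative_iff_has_vector_derivative)
  have "((\<lambda>u. 1 / (of_real x - (u + \<i> * of_real e))\<^sup>2) has_field_derivative 2 / (of_real x - (of_real t + \<i> * of_real e))^3) (at (of_real t))"
    using DERIV_power[OF D, of 2] by (simp add: power_one_over power2_eq_square power3_eq_cube mult.assoc)
  from bounded_linear.has_vector_derivative[OF bounded_linear_Im has_vector_derivative_real_field[OF this]]
  show "((\<lambda>t. Im (1 / (of_real x - Complex t e)\<^sup>2)) has_real_derivative Im (2 / (of_real x - Complex t e)^3)) (at t)"
    by (simp add: Complex_eq_real_add has_real_derivative_iff_has_vector_derivative)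
qed

lemma resolvent_derivative_real:
  assumes "Im z \<noteq> 0"
  shows "((\<lambda>x. Im (1 / (of_real x - z))) has_real_derivative - Im (1 / (of_real x - z)\<^sup>2)) (at x)"
proof -
  have nz: "of_real x - z \<noteq> 0" using assms by (auto simp: complex_eq_iff)
  have "((\<lambda>u. 1 / (u - z)) has_field_derivative - (1 / (of_real x - z)\<^sup>2)) (at (of_real x))"
    using nz by (auto intro!: derivative_eq_intros simp: power2_eq_square)
  from bounded_linear.has_vector_derivative[OF bounded_linear_Im has_vector_derivative_real_field[OF this]]
  show ?thesis by (simp add: has_real_derivative_iff_has_vector_derivative)
qed

lemma poisson_kernel: "Im (1 / (of_real x - Complex t e)) = e / ((x - t)\<^sup>2 + e\<^sup>2)"
  by (simp add: Im_divide)

lemma poisson_kernel_derivative_bound: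
  assumes "e > 0" "x \<noteq> t"
  shows "\<bar>Im (1 / (of_real x - Complex t e)\<^sup>2)\<bar> \<le> 2 * e / \<bar>x - t\<bar>^3"
proof -
  define u where "u = x - t"
  have u: "u \<noteq> 0" using assms by (simp add: u_def)
  have "(of_real x - Complex t e)\<^sup>2 = Complex (u\<^sup>2 - e\<^sup>2) (- 2 * u * e)"
    by (simp add: complex_eq_iff u_def power2_eq_square algebra_simps)
  then have "Im (1 / (of_real x - Complex t e)\<^sup>2) = 2 * u * e / ((u\<^sup>2 - e\<^sup>2)\<^sup>2 + (2 * u * e)\<^sup>2)"
    by (simp add: Im_divide)
  also have "(u\<^sup>2 - e\<^sup>2)\<^sup>2 + (2 * u * e)\<^sup>2 = (u\<^sup>2 + e\<^sup>2)\<^sup>2" by (simp add: power2_eq_square algebra_simps)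
  finally have "\<bar>Im (1 / (of_real x - Complex t e)\<^sup>2)\<bar> = 2 * \<bar>u\<bar> * e / (u\<^sup>2 + e\<^sup>2)\<^sup>2"
    using assms by (simp add: abs_mult)
  also have "\<dots> \<le> 2 * \<bar>u\<bar> * e / (u\<^sup>2)\<^sup>2"
    using assms u by (intro divide_left_mono power_mono) auto
  also have "\<dots> = 2 * e / \<bar>u\<bar>^3"
  proof -
    have "(u\<^sup>2)\<^sup>2 = (\<bar>u\<bar>\<^sup>2)\<^sup>2" by simp
    also have "\<dots> = \<bar>u\<bar> * \<bar>u\<bar>^3" by (simp only: power2_eq_square power3_eq_cube mult.assoc)
    finally have "(u\<^sup>2)\<^sup>2 = \<bar>u\<bar> * \<bar>u\<bar>^3" .
    then show ?thesis using u by simp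
  qed
  finally show ?thesis by (simp add: u_def)
qed

lemma arctan_lower: "y > 0 \<Longrightarrow> pi / 2 - 1 / y \<le> arctan y"
proof -
  assume y: "y > 0"
  then have "arctan (1 / y) = pi / 2 - arctan y" using arctan_inverse[OF y] by (simp only: inverse_eq_divide)
  moreover have "arctan (1 / y) \<le> 1 / y" using y by (intro arctan_le_self) simp
  ultimately show ?thesis by linarith
qed

lemma exp_minus_lipschitz:
  fixes a b :: real
  assumes "a \<ge> 0" "b \<ge> 0" shows "\<bar>exp (- a) - exp (- b)\<bar> \<le> \<bar>a - b\<bar>"
proof -
  have *: "\<bar>exp (- a) - exp (- b)\<bar> \<le> b - a" if "0 \<le> a" "a \<le> b" for a b :: real
  proof -
    have "exp (- a) - exp (- b) = exp (- a) * (1 - exp (- (b - a)))" by (simp add: right_diff_distrib exp_add[symmetric])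
    also have "\<dots> \<le> 1 * (b - a)"
    proof (rule mult_mono)
      show "1 - exp (- (b - a)) \<le> b - a" using exp_ge_add_one_self[of "- (b - a)"] by linarith
    qed (use that in auto)
    finally show ?thesis using that by simp
  qed
  show ?thesis using *[of a b] *[of b a] assms by (cases "a \<le> b") (auto simp: abs_minus_commute)
qed

lemma sigma_sq_nonneg: "sigma_sq f \<ge> 0"
  unfolding sigma_sq_def by (intro mult_nonneg_nonneg Bochner_Integration.integral_nonneg) auto

lemma derivative_zero_outside:
  fixes f :: "real \<Rightarrow> real"
  assumes "\<And>x. (f has_real_derivative f' x) (at x)" "\<And>x. \<bar>x\<bar> \<ge> T0 \<Longrightarrow> f x = 0" "\<bar>x\<bar> > T0"
  shows "f' x = 0"
proof -
  have "open {x::real. \<bar>x\<bar> > T0}" by (intro open_Collect_less continuous_intros)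
  then have "((\<lambda>_. 0) has_real_derivative f' x) (at x)"
    using assms by (intro has_field_derivative_transform_within_open[OF assms(1)[of x]]) auto
  then show ?thesis using DERIV_unique DERIV_const by blast
qed

section \<open>Smoothing a test function by the Poisson kernel\<close>

locale test_function =
  fixes f f' :: "real \<Rightarrow> real" and F T0 :: real
  assumes d: "\<And>x. (f has_real_derivative f' x) (at x)" and cont: "continuous_on UNIV f'"
    and supp: "\<And>x. \<bar>x\<bar> \<ge> T0 \<Longrightarrow> f x = 0" and T0: "T0 \<ge> 1" and F: "F \<ge> 1"
    and fF: "\<And>x. \<bar>f x\<bar> \<le> F" and f'F: "\<And>x. \<bar>f' x\<bar> \<le> F"
begin

text \<open>Wide enough that for \<open>\<bar>x\<bar> \<le> 2 * T0\<close> both ends of the interval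
  are at distance at least 1 from \<open>x\<close>, so that little Poisson mass escapes.\<close>

definition T where "T = 3 * T0"

lemma T_ge: "T \<ge> 3" using T0 by (simp add: T_def)

lemma f'_zero: "\<bar>x\<bar> > T0 \<Longrightarrow> f' x = 0"
  using derivative_zero_outside[OF d supp] .

lemma f_cont: "continuous_on S f"
  using d by (meson DERIV_isCont continuous_at_imp_continuous_on)

lemma f_meas: "f \<in> borel_measurable borel"
  by (rule borel_measurable_continuous_onI[OF f_cont])

lemma f_lipschitz: "\<bar>f x - f y\<bar> \<le> F * \<bar>x - y\<bar>"
  using field_differentiable_bound[of UNIV f f' F x y] d f'F by (auto intro: has_field_derivative_at_within)

lemma f_tendsto_0: "(f \<longlongrightarrow> 0) at_top" "(f \<longlongrightarrow> 0) at_bot"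
  by (rule tendsto_eventually, rule eventually_mono[OF eventually_ge_at_top[of T0]], auto intro!: supp)
     (rule tendsto_eventually, rule eventually_mono[OF eventually_le_at_bot[of "- T0"]], auto intro!: supp)

lemma f_wlip: "wlip (3 * (F * (1 + T0\<^sup>2))) f"
proof (rule wlip_derivative[OF d])
  fix x
  show "\<bar>f' x\<bar> \<le> F * (1 + T0\<^sup>2) / (1 + x\<^sup>2)"
  proof (cases "\<bar>x\<bar> > T0")
    case True
    then show ?thesis using f'_zero F by (auto intro!: divide_nonneg_nonneg mult_nonneg_nonneg)
  next
    case False
    then have "x\<^sup>2 \<le> T0\<^sup>2" using T0 by (simp add: abs_le_square_iff[symmetric])
    then have "\<bar>f' x\<bar> * (1 + x\<^sup>2) \<le> F * (1 + T0\<^sup>2)" using f'F[of x] F by (intro mult_mono) auto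
    then show ?thesis by (simp add: pos_le_divide_eq add_pos_nonneg)
  qed
qed (rule f_tendsto_0)+

text \<open>The derivative in \<open>x\<close> of \<open>f t / pi\<close> times the Poisson kernel
  of height \<epsilon> centred at \<open>t\<close>; a Riemann sum of it over \<open>t\<close> is the
  derivative of a \<open>poisson_sum\<close>.\<close>

definition k :: "real \<Rightarrow> real \<Rightarrow> real \<Rightarrow> real" where
  "k \<epsilon> x t = f t / pi * (- Im (1 / (of_real x - Complex t \<epsilon>)\<^sup>2))"

text \<open>The Poisson smoothing of \<open>f'\<close>, hence close to \<open>f'\<close>.
  Integration by parts in \<open>integral_k\<close> identifies it with the integral of
  \<open>k\<close>, which involves only \<open>f\<close>.\<close>

definition G :: "real \<Rightarrow> real \<Rightarrow> real" where
  "G \<epsilon> x = integral {-T..T} (\<lambda>t. f' t / pi * Im (1 / (of_real x - Complex t \<epsilon>)))"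

lemma continuous_kernels:
  assumes "\<epsilon> \<noteq> 0"
  shows "continuous_on S (\<lambda>t. Im (1 / (of_real x - Complex t \<epsilon>)))" "continuous_on S (\<lambda>t. Im (1 / (of_real x - Complex t \<epsilon>)\<^sup>2))"
  using resolvent_derivative_node[OF assms] by (meson DERIV_isCont continuous_at_imp_continuous_on)+

lemma integral_k: assumes e: "\<epsilon> \<noteq> 0" shows "integral {-T..T} (k \<epsilon> x) = G \<epsilon> x"
proof -
  let ?R = "\<lambda>t. Im (1 / (of_real x - Complex t \<epsilon>))" and ?R2 = "\<lambda>t. Im (1 / (of_real x - Complex t \<epsilon>)\<^sup>2)"
  have T: "-T \<le> T" using T_ge by simp
  have fT: "f T = 0" "f (- T) = 0" using T0 by (auto intro!: supp simp: T_def)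
  have "((\<lambda>t. f' t / pi * ?R t + ?R2 t * (f t / pi)) has_integral (f T / pi * ?R T - f (- T) / pi * ?R (- T))) {-T..T}"
  proof (rule fundamental_theorem_of_calculus[OF T])
    fix t
    have "((\<lambda>t. f t / pi * ?R t) has_real_derivative f' t / pi * ?R t + ?R2 t * (f t / pi)) (at t)"
      by (intro DERIV_mult DERIV_cdivide d resolvent_derivative_node e)
    then show "((\<lambda>t. f t / pi * ?R t) has_vector_derivative f' t / pi * ?R t + ?R2 t * (f t / pi)) (at t within {-T..T})"
      by (simp only: has_real_derivative_iff_has_vector_derivative has_vector_derivative_at_within)
  qed
  then have 0: "integral {-T..T} (\<lambda>t. f' t / pi * ?R t + ?R2 t * (f t / pi)) = 0" using fT by (simp add: integral_unique)
  have i1: "(\<lambda>t. f' t / pi * ?R t) integrable_on {-T..T}"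
    by (intro integrable_continuous_real continuous_intros continuous_kernels e continuous_on_subset[OF cont]) auto
  have i2: "(\<lambda>t. ?R2 t * (f t / pi)) integrable_on {-T..T}"
    by (intro integrable_continuous_real continuous_intros continuous_kernels e f_cont) auto
  have "integral {-T..T} (k \<epsilon> x) = integral {-T..T} (\<lambda>t. - (?R2 t * (f t / pi)))"
    by (intro integral_cong) (simp add: k_def)
  also have "\<dots> = - integral {-T..T} (\<lambda>t. ?R2 t * (f t / pi))" by (rule Henstock_Kurzweil_Integration.integral_neg)
  also have "\<dots> = G \<epsilon> x" using 0 Henstock_Kurzweil_Integration.integral_add[OF i1 i2] by (simp add: G_def)
  finally show ?thesis .
qed

lemma k_integrable: "\<epsilon> \<noteq> 0 \<Longrightarrow> continuous_on S (k \<epsilon> x)"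
  unfolding k_def by (intro continuous_intros continuous_kernels f_cont) auto

text \<open>Far out \<open>f'\<close> is zero, and the derivative of the Poisson kernel decays like
  \<open>\<epsilon> / \<bar>x\<bar>^3\<close>, which is enough for the weight
  \<open>1 + x\<^sup>2\<close>.\<close>

lemma G_approx_far:
  assumes e: "0 < \<epsilon>" and x: "\<bar>x\<bar> > 2 * T0"
  shows "(1 + x\<^sup>2) * \<bar>G \<epsilon> x - f' x\<bar> \<le> 32 * T * F * \<epsilon>"
proof -
  have x2: "\<bar>x\<bar> \<ge> 2" using x T0 by linarith
  have b: "norm (k \<epsilon> x t) \<le> 16 * F * \<epsilon> / (1 + x\<^sup>2)" for t
  proof (cases "\<bar>t\<bar> \<ge> T0")
    case True
    then show ?thesis using supp F e by (simp add: k_def)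
  next
    case False
    have u: "\<bar>x - t\<bar> \<ge> \<bar>x\<bar> / 2" using False x by linarith
    then have xt: "x \<noteq> t" using x2 by auto
    have "\<bar>k \<epsilon> x t\<bar> = \<bar>f t\<bar> / pi * \<bar>Im (1 / (of_real x - Complex t \<epsilon>)\<^sup>2)\<bar>" by (simp only: k_def abs_mult abs_divide abs_minus_cancel) simp
    also have "\<dots> \<le> F / 1 * (2 * \<epsilon> / \<bar>x - t\<bar>^3)"
      using fF[of t] F pi_gt3 e by (intro mult_mono frac_le poisson_kernel_derivative_bound xt) auto
    also have "\<dots> \<le> F / 1 * (2 * \<epsilon> / (\<bar>x\<bar> / 2)^3)"
      using u x2 F e by (intro mult_left_mono divide_left_mono power_mono mult_pos_pos) auto
    also have "\<dots> = 16 * F * \<epsilon> / \<bar>x\<bar>^3" by (simp add: power_divide)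
    also have "\<dots> \<le> 16 * F * \<epsilon> / (1 + x\<^sup>2)"
    proof (intro divide_left_mono)
      have "1 + x\<^sup>2 \<le> 2 * \<bar>x\<bar>\<^sup>2" using power_mono[OF x2, of 2] by simp
      also have "\<dots> \<le> \<bar>x\<bar> * \<bar>x\<bar>\<^sup>2" using x2 by (intro mult_right_mono) auto
      finally show "1 + x\<^sup>2 \<le> \<bar>x\<bar>^3" by (simp add: power3_eq_cube power2_eq_square)
      show "0 < \<bar>x\<bar>^3 * (1 + x\<^sup>2)" using x2 by (intro mult_pos_pos add_pos_nonneg) auto
    qed (use F e in auto)
    finally show ?thesis by simp
  qed
  have "norm (integral {-T..T} (k \<epsilon> x)) \<le> 16 * F * \<epsilon> / (1 + x\<^sup>2) * (T - - T)"
    by (rule integral_bound) (use T_ge e b k_integrable in auto)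
  then have "\<bar>G \<epsilon> x\<bar> \<le> 32 * T * F * \<epsilon> / (1 + x\<^sup>2)" using integral_k[of \<epsilon> x] e by (simp add: mult_ac)
  then have "(1 + x\<^sup>2) * \<bar>G \<epsilon> x\<bar> \<le> 32 * T * F * \<epsilon>" by (simp add: pos_le_divide_eq add_pos_nonneg mult.commute)
  moreover have "f' x = 0" using x T0 by (intro f'_zero) auto
  ultimately show ?thesis by simp
qed

text \<open>The Poisson kernel is an approximate identity; the mass missing outside the interval
  costs \<open>2 * F * \<epsilon>\<close>.\<close>

lemma G_approx_near:
  assumes e: "0 < \<epsilon>" and x: "\<bar>x\<bar> \<le> 2 * T0" and \<delta>: "\<delta> > 0" and \<eta>: "\<eta> > 0"
    and uc: "\<And>s t. s \<in> {-T..T} \<Longrightarrow> t \<in> {-T..T} \<Longrightarrow> \<bar>s - t\<bar> < \<delta> \<Longrightarrow> \<bar>f' s - f' t\<bar> < \<eta>"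
  shows "\<bar>G \<epsilon> x - f' x\<bar> \<le> \<eta> + 4 * F * T / \<delta>\<^sup>2 * \<epsilon> + 2 * F * \<epsilon>"
proof -
  define P where "P = (\<lambda>t. Im (1 / (of_real x - Complex t \<epsilon>)))"
  have P: "P t = \<epsilon> / ((x - t)\<^sup>2 + \<epsilon>\<^sup>2)" for t unfolding P_def by (rule poisson_kernel)
  have P0: "P t \<ge> 0" for t using e by (simp add: P)
  have Pc: "continuous_on S P" for S unfolding P_def using e by (intro continuous_kernels) auto
  define pc where "pc = arctan ((T - x) / \<epsilon>) - arctan ((- T - x) / \<epsilon>)"
  have T: "-T \<le> T" using T_ge by simp
  have xT: "x \<in> {-T..T}" using x T0 by (auto simp: T_def)
  have hi: "(P has_integral pc) {-T..T}"
    unfolding pc_def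
  proof (rule fundamental_theorem_of_calculus[OF T])
    fix t
    have "((\<lambda>t. arctan ((t - x) / \<epsilon>)) has_real_derivative inverse (1 + ((t - x) / \<epsilon>)\<^sup>2) * (1 / \<epsilon>)) (at t)"
      using e by (auto intro!: derivative_eq_intros)
    moreover have "inverse (1 + ((t - x) / \<epsilon>)\<^sup>2) * (1 / \<epsilon>) = P t"
    proof -
      have "1 + ((t - x) / \<epsilon>)\<^sup>2 = ((x - t)\<^sup>2 + \<epsilon>\<^sup>2) / \<epsilon>\<^sup>2" using e by (simp add: power_divide add_divide_distrib power2_commute)
      then show ?thesis using e by (simp add: P power2_eq_square)
    qed
    ultimately show "((\<lambda>t. arctan ((t - x) / \<epsilon>)) has_vector_derivative P t) (at t within {-T..T})"
      by (simp add: has_real_derivative_iff_has_vector_derivative has_vector_derivative_at_within)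
  qed
  have PI: "integral {-T..T} P = pc" using hi by (rule integral_unique)
  have pc1: "pc \<le> pi" using arctan_ubound[of "(T - x) / \<epsilon>"] arctan_lbound[of "(- T - x) / \<epsilon>"] by (simp add: pc_def)
  have pc2: "pi - pc \<le> 2 * \<epsilon>"
  proof -
    have g: "T - x \<ge> 1" "T + x \<ge> 1" using x T0 by (auto simp: T_def)
    have "\<epsilon> / (T - x) \<le> \<epsilon>" "\<epsilon> / (T + x) \<le> \<epsilon>" using g e by (auto simp: divide_le_eq mult_le_cancel_left1)
    moreover have "pi / 2 - 1 / ((T - x) / \<epsilon>) \<le> arctan ((T - x) / \<epsilon>)" "pi / 2 - 1 / ((T + x) / \<epsilon>) \<le> arctan ((T + x) / \<epsilon>)"
      using g e by (intro arctan_lower divide_pos_pos; simp)+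
    moreover have "arctan ((- T - x) / \<epsilon>) = - arctan ((T + x) / \<epsilon>)"
      using arctan_minus[of "(T + x) / \<epsilon>"] by (simp add: minus_divide_left)
    ultimately show ?thesis by (simp add: pc_def)
  qed
  have c1: "continuous_on {-T..T} (\<lambda>t. (f' t - f' x) * P t)"
    by (intro continuous_intros Pc continuous_on_subset[OF cont]) auto
  have "G \<epsilon> x = integral {-T..T} (\<lambda>t. 1 / pi * ((f' t - f' x) * P t) + f' x / pi * P t)"
    unfolding G_def P_def by (intro integral_cong) (simp add: field_simps)
  also have "\<dots> = 1 / pi * integral {-T..T} (\<lambda>t. (f' t - f' x) * P t) + f' x / pi * pc"
  proof -
    have "(\<lambda>t. 1 / pi * ((f' t - f' x) * P t)) integrable_on {-T..T}" "(\<lambda>t. f' x / pi * P t) integrable_on {-T..T}"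
      by (intro integrable_continuous_real continuous_intros Pc continuous_on_subset[OF cont]; simp)+
    then show ?thesis
      by (subst Henstock_Kurzweil_Integration.integral_add) (auto simp: PI simp del: times_divide_eq_left)
  qed
  finally have Ge: "G \<epsilon> x - f' x = 1 / pi * integral {-T..T} (\<lambda>t. (f' t - f' x) * P t) - f' x * ((pi - pc) / pi)"
    by (simp add: field_simps)
  \<comment> \<open>For \<open>t\<close> away from \<open>x\<close> the variation of
    \<open>f'\<close> is dominated by a quadratic, and \<open>(x - t)\<^sup>2\<close> times the
    kernel is at most \<epsilon>, so one estimate covers the whole interval.\<close>
  have bnd: "\<bar>f' t - f' x\<bar> \<le> \<eta> + 2 * F / \<delta>\<^sup>2 * (x - t)\<^sup>2" if "t \<in> {-T..T}" for t
  proof (cases "\<bar>t - x\<bar> < \<delta>")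
    case True
    then have "\<bar>f' t - f' x\<bar> \<le> \<eta>" using uc[OF that xT] by simp
    moreover have "0 \<le> 2 * F / \<delta>\<^sup>2 * (x - t)\<^sup>2" using F by simp
    ultimately show ?thesis by linarith
  next
    case False
    then have "\<delta>\<^sup>2 \<le> (x - t)\<^sup>2" using \<delta> by (simp add: abs_le_square_iff[symmetric] abs_minus_commute)
    then have "2 * F / \<delta>\<^sup>2 * \<delta>\<^sup>2 \<le> 2 * F / \<delta>\<^sup>2 * (x - t)\<^sup>2" using F by (intro mult_left_mono) auto
    then have "2 * F \<le> 2 * F / \<delta>\<^sup>2 * (x - t)\<^sup>2" using \<delta> by simp
    moreover have "\<bar>f' t - f' x\<bar> \<le> 2 * F" using f'F[of t] f'F[of x] by linarith
    ultimately show ?thesis using \<eta> by linarith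
  qed
  have "norm (integral {-T..T} (\<lambda>t. (f' t - f' x) * P t)) \<le> integral {-T..T} (\<lambda>t. \<eta> * P t + 2 * F / \<delta>\<^sup>2 * \<epsilon>)"
  proof (rule integral_norm_bound_integral)
    show "(\<lambda>t. (f' t - f' x) * P t) integrable_on {-T..T}" by (rule integrable_continuous_real[OF c1])
    show "(\<lambda>t. \<eta> * P t + 2 * F / \<delta>\<^sup>2 * \<epsilon>) integrable_on {-T..T}"
      by (intro integrable_continuous_real continuous_intros Pc)
    fix t assume t: "t \<in> {-T..T}"
    have "(x - t)\<^sup>2 * P t \<le> \<epsilon>"
    proof -
      have "(x - t)\<^sup>2 / ((x - t)\<^sup>2 + \<epsilon>\<^sup>2) \<le> 1" using e by (simp add: divide_le_eq_1 add_nonneg_pos)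
      then have "\<epsilon> * ((x - t)\<^sup>2 / ((x - t)\<^sup>2 + \<epsilon>\<^sup>2)) \<le> \<epsilon> * 1" using e by (intro mult_left_mono) auto
      then show ?thesis by (simp add: P mult.commute)
    qed
    then have q: "2 * F / \<delta>\<^sup>2 * ((x - t)\<^sup>2 * P t) \<le> 2 * F / \<delta>\<^sup>2 * \<epsilon>" using F by (intro mult_left_mono) auto
    have "norm ((f' t - f' x) * P t) = \<bar>f' t - f' x\<bar> * P t" using P0[of t] by (simp add: abs_mult)
    also have "\<dots> \<le> (\<eta> + 2 * F / \<delta>\<^sup>2 * (x - t)\<^sup>2) * P t" using bnd[OF t] P0[of t] by (intro mult_right_mono) auto
    also have "\<dots> = \<eta> * P t + 2 * F / \<delta>\<^sup>2 * ((x - t)\<^sup>2 * P t)" by (simp only: distrib_right mult.assoc)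
    also have "\<dots> \<le> \<eta> * P t + 2 * F / \<delta>\<^sup>2 * \<epsilon>" using q by simp
    finally show "norm ((f' t - f' x) * P t) \<le> \<eta> * P t + 2 * F / \<delta>\<^sup>2 * \<epsilon>" .
  qed
  also have "\<dots> = \<eta> * pc + 2 * F / \<delta>\<^sup>2 * \<epsilon> * (2 * T)"
  proof -
    have "(\<lambda>t. \<eta> * P t) integrable_on {-T..T}" by (intro integrable_continuous_real continuous_intros Pc)
    then show ?thesis using T by (subst Henstock_Kurzweil_Integration.integral_add) (auto simp: PI)
  qed
  finally have I: "\<bar>integral {-T..T} (\<lambda>t. (f' t - f' x) * P t)\<bar> \<le> \<eta> * pc + 4 * F * T / \<delta>\<^sup>2 * \<epsilon>" by (simp add: mult_ac)
  have "\<bar>G \<epsilon> x - f' x\<bar> \<le> 1 / pi * \<bar>integral {-T..T} (\<lambda>t. (f' t - f' x) * P t)\<bar> + \<bar>f' x\<bar> * ((pi - pc) / pi)"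
    unfolding Ge using pc1 by (intro order_trans[OF abs_triangle_ineq4]) (simp add: abs_mult)
  also have "\<dots> \<le> 1 / pi * (\<eta> * pi + 4 * F * T / \<delta>\<^sup>2 * \<epsilon>) + F * (2 * \<epsilon> / 1)"
  proof (intro add_mono mult_left_mono mult_mono)
    have "\<eta> * pc \<le> \<eta> * pi" using pc1 \<eta> by simp
    then show "\<bar>integral {-T..T} (\<lambda>t. (f' t - f' x) * P t)\<bar> \<le> \<eta> * pi + 4 * F * T / \<delta>\<^sup>2 * \<epsilon>" using I by linarith
    show "(pi - pc) / pi \<le> 2 * \<epsilon> / 1" using pc1 pc2 pi_gt3 e by (intro frac_le) auto
    show "0 \<le> (pi - pc) / pi" using pc1 by simp
  qed (use f'F F e in auto)
  also have "1 / pi * (\<eta> * pi + 4 * F * T / \<delta>\<^sup>2 * \<epsilon>) \<le> \<eta> + 4 * F * T / \<delta>\<^sup>2 * \<epsilon>"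
  proof -
    have "0 \<le> 4 * F * T / \<delta>\<^sup>2 * \<epsilon>" using F T_ge e by simp
    then have "1 / pi * (4 * F * T / \<delta>\<^sup>2 * \<epsilon>) \<le> 1 * (4 * F * T / \<delta>\<^sup>2 * \<epsilon>)" using pi_gt3 by (intro mult_right_mono) auto
    then show ?thesis by (simp add: distrib_left)
  qed
  finally show ?thesis by simp
qed

lemma G_approx:
  assumes e: "e > 0"
  obtains \<epsilon> where "0 < \<epsilon>" "\<epsilon> \<le> 1" "\<And>x. (1 + x\<^sup>2) * \<bar>G \<epsilon> x - f' x\<bar> \<le> e"
proof -
  \<comment> \<open>For \<open>\<bar>x\<bar> \<le> 2 * T0\<close> the weight is at most
    \<open>1 + 4 * T0\<^sup>2\<close>, and each of the three error terms is allotted \<eta>.\<close>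
  define \<eta> where "\<eta> = e / (3 * (1 + 4 * T0\<^sup>2))"
  have t0: "1 + 4 * T0\<^sup>2 > 0" by (intro add_pos_nonneg) auto
  have \<eta>: "\<eta> > 0" using e t0 by (simp add: \<eta>_def)
  have "uniformly_continuous_on {-T..T} f'"
    by (intro compact_uniformly_continuous continuous_on_subset[OF cont]) auto
  then obtain \<delta> where \<delta>: "\<delta> > 0" "\<And>s t. s \<in> {-T..T} \<Longrightarrow> t \<in> {-T..T} \<Longrightarrow> \<bar>s - t\<bar> < \<delta> \<Longrightarrow> \<bar>f' s - f' t\<bar> < \<eta>"
    using \<eta> unfolding uniformly_continuous_on_def dist_real_def by (metis abs_minus_commute)
  define B where "B = 4 * F * T / \<delta>\<^sup>2"
  have B: "B \<ge> 0" using F T_ge by (simp add: B_def)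
  define \<epsilon> where "\<epsilon> = min (min 1 (\<eta> / (B + 1))) (min (\<eta> / (2 * F)) (e / (32 * T * F)))"
  have \<epsilon>: "0 < \<epsilon>" "\<epsilon> \<le> 1" using \<eta> B F T_ge e by (auto simp: \<epsilon>_def)
  have "\<epsilon> \<le> \<eta> / (B + 1)" "\<epsilon> \<le> \<eta> / (2 * F)" "\<epsilon> \<le> e / (32 * T * F)" by (auto simp: \<epsilon>_def)
  then have b: "(B + 1) * \<epsilon> \<le> \<eta>" "2 * F * \<epsilon> \<le> \<eta>" "32 * T * F * \<epsilon> \<le> e"
    using B F T_ge by (auto simp: pos_le_divide_eq mult.commute)
  have "(1 + x\<^sup>2) * \<bar>G \<epsilon> x - f' x\<bar> \<le> e" for x
  proof (cases "\<bar>x\<bar> > 2 * T0")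
    case True
    then show ?thesis using G_approx_far[OF \<epsilon>(1) True] b by linarith
  next
    case False
    then have x: "\<bar>x\<bar> \<le> 2 * T0" by simp
    have "\<bar>G \<epsilon> x - f' x\<bar> \<le> \<eta> + B * \<epsilon> + 2 * F * \<epsilon>"
      unfolding B_def by (rule G_approx_near[OF \<epsilon>(1) x \<delta>(1) \<eta> \<delta>(2)])
    also have "\<dots> \<le> 3 * \<eta>" using b \<epsilon> by (simp add: distrib_right)
    finally have g: "\<bar>G \<epsilon> x - f' x\<bar> \<le> 3 * \<eta>" .
    have "x\<^sup>2 \<le> (2 * T0)\<^sup>2" using power_mono[OF x, of 2] by simp
    then have "(1 + x\<^sup>2) * \<bar>G \<epsilon> x - f' x\<bar> \<le> (1 + 4 * T0\<^sup>2) * (3 * \<eta>)"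
      using g by (intro mult_mono) (auto simp: power_mult_distrib)
    also have "\<dots> = e" using t0 by (simp add: \<eta>_def field_simps)
    finally show ?thesis .
  qed
  then show ?thesis using that \<epsilon> by blast
qed

end

section \<open>From Poisson sums to phase statistics\<close>

lemma poisson_sum_derivative:
  assumes "\<And>r. r < m \<Longrightarrow> Im (z r) > 0"
  shows "(poisson_sum m \<gamma> z has_real_derivative (\<Sum>r<m. \<gamma> r * (- Im (1 / (of_real x - z r)\<^sup>2)))) (at x)"
  unfolding poisson_sum_def[abs_def]
proof (rule DERIV_sum)
  fix r assume "r \<in> {..<m}"
  then have "Im (z r) \<noteq> 0" using assms[of r] by simp
  then show "((\<lambda>x. \<gamma> r * Im (1 / (of_real x - z r))) has_real_derivative \<gamma> r * (- Im (1 / (of_real x - z r)\<^sup>2))) (at x)"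
    by (intro DERIV_cmult resolvent_derivative_real)
qed

lemma poisson_sum_tendsto_0: "(poisson_sum m \<gamma> z \<longlongrightarrow> 0) at_top" "(poisson_sum m \<gamma> z \<longlongrightarrow> 0) at_bot"
proof -
  have "((\<lambda>x. \<Sum>r<m. \<gamma> r * Im (1 / (of_real x - z r))) \<longlongrightarrow> (\<Sum>r<m. \<gamma> r * Im 0)) F"
    if "\<And>r. ((\<lambda>x. 1 / (of_real x - z r)) \<longlongrightarrow> 0) F" for F
    by (intro tendsto_sum tendsto_mult tendsto_const tendsto_Im that)
  from this[OF inverse_tendsto_0(1)] this[OF inverse_tendsto_0(2)]
  show "(poisson_sum m \<gamma> z \<longlongrightarrow> 0) at_top" "(poisson_sum m \<gamma> z \<longlongrightarrow> 0) at_bot"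
    by (simp_all add: poisson_sum_def[abs_def])
qed

lemma phase_stat_derivative:
  assumes "\<And>r. r < m \<Longrightarrow> Im (z r) > 0" "\<And>r. r < m \<Longrightarrow> Im (w r) > 0"
  shows "(phase_stat m z w has_real_derivative (\<Sum>r<m. 2 * Im (1 / (of_real x - w r) - 1 / (of_real x - z r)))) (at x)"
proof -
  have "((\<lambda>x. \<Sum>r<m. Im (Ln (of_real x - w r) - Ln (of_real x - z r))) has_real_derivative (\<Sum>r<m. Im (1 / (of_real x - w r) - 1 / (of_real x - z r)))) (at x)"
  proof (rule DERIV_sum)
    fix r assume "r \<in> {..<m}"
    then have "Im (z r) \<noteq> 0" "Im (w r) \<noteq> 0" using assms[of r] by auto
    from bounded_linear.has_vector_derivative[OF bounded_linear_Im has_vector_derivative_diff[OF Ln_real_derivative[OF this(2)] Ln_real_derivative[OF this(1)]]]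
    show "((\<lambda>x. Im (Ln (of_real x - w r) - Ln (of_real x - z r))) has_real_derivative Im (1 / (of_real x - w r) - 1 / (of_real x - z r))) (at x)"
      by (simp only: has_real_derivative_iff_has_vector_derivative)
  qed
  from DERIV_cmult[OF this, of 2] show ?thesis by (simp only: phase_stat_def[abs_def] sum_distrib_left)
qed

lemma phase_stat_tendsto_0:
  assumes "\<And>r. r < m \<Longrightarrow> Im (z r) > 0" "\<And>r. r < m \<Longrightarrow> Im (w r) > 0"
  shows "(phase_stat m z w \<longlongrightarrow> 0) at_top" "(phase_stat m z w \<longlongrightarrow> 0) at_bot"
proof -
  have "((\<lambda>x. 2 * (\<Sum>r<m. Im (Ln (of_real x - w r) - Ln (of_real x - z r)))) \<longlongrightarrow> 2 * (\<Sum>r<m. Im 0)) F"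
    if "\<And>r. r < m \<Longrightarrow> ((\<lambda>x. Ln (of_real x - w r) - Ln (of_real x - z r)) \<longlongrightarrow> 0) F" for F
    by (intro tendsto_sum tendsto_mult tendsto_const tendsto_Im that) auto
  from this[OF Ln_difference_tendsto_0(1)[OF assms]] this[OF Ln_difference_tendsto_0(2)[OF assms]]
  show "(phase_stat m z w \<longlongrightarrow> 0) at_top" "(phase_stat m z w \<longlongrightarrow> 0) at_bot"
    by (simp_all add: phase_stat_def[abs_def])
qed

text \<open>A dipole acts like the derivative of the resolvent in its pole. The error consists of
  the part of the displacement not captured by \<open>c\<close>, at most \<open>h\<^sup>2\<close>,
  and of the second-order term; both keep the factor \<open>1 / (1 + x\<^sup>2)\<close> that
  \<open>wlip_derivative\<close> demands.\<close>

lemma resolvent_shift_bound: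
  assumes z: "\<bar>Re z\<bar> \<le> T" "\<epsilon> \<le> Im z" and w: "\<bar>Re w\<bar> \<le> T" "\<epsilon> \<le> Im w" and \<epsilon>: "\<epsilon> > 0"
    and c: "\<bar>c\<bar> \<le> D * h" and d: "cmod (w - z) \<le> D * h" and dc: "cmod (w - z - of_real c) \<le> h\<^sup>2"
  shows "\<bar>2 * Im (1 / (of_real x - w) - 1 / (of_real x - z)) - 2 * c * Im (1 / (of_real x - z)\<^sup>2)\<bar>
    \<le> 2 * (kap T \<epsilon> / (1 + x\<^sup>2)) * (h\<^sup>2 * (1 + D\<^sup>2 / \<epsilon>))"
proof -
  define A where "A = of_real x - z"
  define B where "B = of_real x - w"
  have nz: "A \<noteq> 0" "B \<noteq> 0" using z w \<epsilon> by (auto simp: A_def B_def complex_eq_iff)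
  have wz: "w - z = A - B" by (simp add: A_def B_def)
  have Ae: "cmod A \<ge> \<epsilon>" using abs_Im_le_cmod[of A] z \<epsilon> by (simp add: A_def)
  have AB: "1 / (cmod A * cmod B) \<le> kap T \<epsilon> / (1 + x\<^sup>2)"
    unfolding A_def B_def by (rule resolvent_pair_uniform_bound[OF z w \<epsilon>])
  have Dh: "D * h \<ge> 0" using c by linarith
  have K0: "0 \<le> kap T \<epsilon> / (1 + x\<^sup>2)" using kap_pos[of T \<epsilon>] by (intro divide_nonneg_nonneg add_nonneg_nonneg) auto
  have A1: "1 / cmod A \<le> 1 / \<epsilon>" using Ae \<epsilon> by (intro frac_le) auto
  have eq: "1 / B - 1 / A - of_real c * (1 / A\<^sup>2) = (w - z - of_real c) / (A * B) + of_real c * (w - z) / (A * B) / A"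
    unfolding wz using nz by (simp add: field_simps power2_eq_square)
  have "cmod (1 / B - 1 / A - of_real c * (1 / A\<^sup>2)) \<le> cmod (w - z - of_real c) * (1 / (cmod A * cmod B)) + \<bar>c\<bar> * cmod (w - z) * (1 / (cmod A * cmod B)) * (1 / cmod A)"
    unfolding eq by (rule order_trans[OF norm_triangle_ineq]) (simp add: norm_mult norm_divide)
  also have "\<dots> \<le> h\<^sup>2 * (kap T \<epsilon> / (1 + x\<^sup>2)) + (D * h) * (D * h) * (kap T \<epsilon> / (1 + x\<^sup>2)) * (1 / \<epsilon>)"
    by (intro add_mono mult_mono c d dc AB A1 mult_nonneg_nonneg K0 Dh) auto
  also have "\<dots> = kap T \<epsilon> / (1 + x\<^sup>2) * (h\<^sup>2 * (1 + D\<^sup>2 / \<epsilon>))"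
    by (simp add: algebra_simps power2_eq_square add_divide_distrib)
  finally have b: "cmod (1 / B - 1 / A - of_real c * (1 / A\<^sup>2)) \<le> kap T \<epsilon> / (1 + x\<^sup>2) * (h\<^sup>2 * (1 + D\<^sup>2 / \<epsilon>))" .
  have "Im (1 / B - 1 / A - of_real c * (1 / A\<^sup>2)) = Im (1 / B - 1 / A) - c * Im (1 / A\<^sup>2)"
    by (simp only: minus_complex.simps Im_of_real_mult)
  then have "\<bar>Im (1 / B - 1 / A) - c * Im (1 / A\<^sup>2)\<bar> \<le> kap T \<epsilon> / (1 + x\<^sup>2) * (h\<^sup>2 * (1 + D\<^sup>2 / \<epsilon>))"
    using order_trans[OF abs_Im_le_cmod b] by (simp only:)
  moreover have "2 * Im (1 / B - 1 / A) - 2 * c * Im (1 / A\<^sup>2) = 2 * (Im (1 / B - 1 / A) - c * Im (1 / A\<^sup>2))"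
    by (simp only: right_diff_distrib mult.assoc)
  ultimately show ?thesis unfolding A_def[symmetric] B_def[symmetric] by (simp only: abs_mult abs_numeral mult.assoc)
qed

text \<open>Exchanging \<open>r\<close> and \<open>s\<close> conjugates each term, so the sum is
  real, and \<open>sigma_sq_poisson_sum\<close> identifies it. The weights \<open>- 2 * c r\<close>
  are those that dipoles of displacement \<open>c r\<close> imitate.\<close>

lemma exp_gauss_sum:
  assumes "\<And>r. r < m \<Longrightarrow> Im (z r) > 0"
  shows "exp (\<Sum>s<m. \<Sum>r<m. of_real (c r * c s) / (z r - cnj (z s))\<^sup>2) = of_real (exp (- sigma_sq (poisson_sum m (\<lambda>r. - 2 * c r) z) / 2))"
proof -
  define S where "S = (\<Sum>s<m. \<Sum>r<m. of_real (c r * c s) / (z r - cnj (z s))\<^sup>2)"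
  have "cnj S = (\<Sum>s<m. \<Sum>r<m. of_real (c s * c r) / (z s - cnj (z r))\<^sup>2)"
    unfolding S_def cnj_sum by (intro sum.cong refl) (simp add: power2_commute mult.commute)
  also have "\<dots> = S" unfolding S_def by (rule sum.swap)
  finally have S: "S = of_real (Re S)" by (metis complex_cnj_cancel_iff complex_eq_iff cnj.simps(2) Re_complex_of_real Im_complex_of_real neg_equal_0_iff_equal equal_neg_zero)
  have "sigma_sq (poisson_sum m (\<lambda>r. - 2 * c r) z) = - 1 / 2 * (\<Sum>r<m. \<Sum>s<m. - 2 * c r * (- 2 * c s) * Re (1 / (z r - cnj (z s))\<^sup>2))"
    by (rule sigma_sq_poisson_sum) (rule assms)
  also have "\<dots> = - 1 / 2 * (\<Sum>s<m. \<Sum>r<m. - 2 * c r * (- 2 * c s) * Re (1 / (z r - cnj (z s))\<^sup>2))"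
    by (rule arg_cong[OF sum.swap])
  also have "\<dots> = - 2 * (\<Sum>s<m. \<Sum>r<m. c r * c s * Re (1 / (z r - cnj (z s))\<^sup>2))"
    by (simp add: sum_distrib_left mult_ac)
  also have "(\<Sum>s<m. \<Sum>r<m. c r * c s * Re (1 / (z r - cnj (z s))\<^sup>2)) = Re S"
  proof -
    have "u * Re (1 / q) = Re (of_real u / q)" for u :: real and q
    proof -
      have "of_real u / q = of_real u * (1 / q)" by simp
      then show ?thesis by (simp only: Re_of_real_mult)
    qed
    then show ?thesis unfolding S_def Re_sum by (simp only:)
  qed
  finally have "- sigma_sq (poisson_sum m (\<lambda>r. - 2 * c r) z) / 2 = Re S" by simp
  then show ?thesis using S unfolding S_def[symmetric] by (metis exp_of_real)
qed

context test_function
begin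

text \<open>The factor \<open>1 / (1 + x\<^sup>2)\<close> in the Lipschitz constant passes into the
  error of the Riemann sum.\<close>

lemma k_lipschitz:
  assumes \<epsilon>: "0 < \<epsilon>" and st: "-T \<le> s" "s \<le> T" "-T \<le> t" "t \<le> T"
  shows "\<bar>k \<epsilon> x s - k \<epsilon> x t\<bar> \<le> F * kap T \<epsilon> * (1 + 2 / \<epsilon>) / (1 + x\<^sup>2) * \<bar>s - t\<bar>"
proof -
  let ?K = "kap T \<epsilon> / (1 + x\<^sup>2)"
  define k' where "k' = (\<lambda>t. f' t / pi * (- Im (1 / (of_real x - Complex t \<epsilon>)\<^sup>2)) + (- Im (2 / (of_real x - Complex t \<epsilon>)^3)) * (f t / pi))"
  have D: "((k \<epsilon> x) has_real_derivative k' u) (at u)" for u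
    unfolding k_def[abs_def] k'_def using \<epsilon>
    by (intro DERIV_mult DERIV_cdivide d DERIV_minus resolvent_derivative_node) auto
  have K0: "?K \<ge> 0" using kap_pos[of T \<epsilon>] by (intro divide_nonneg_nonneg add_nonneg_nonneg) auto
  have "norm (k' u) \<le> F * kap T \<epsilon> * (1 + 2 / \<epsilon>) / (1 + x\<^sup>2)" if u: "u \<in> {-T..T}" for u
  proof -
    define A where "A = of_real x - Complex u \<epsilon>"
    have Ae: "cmod A \<ge> \<epsilon>" using abs_Im_le_cmod[of A] \<epsilon> by (simp add: A_def)
    have A2: "1 / (cmod A * cmod A) \<le> ?K"
      unfolding A_def by (rule resolvent_pair_uniform_bound) (use u \<epsilon> in auto)
    have i2: "\<bar>Im (1 / A\<^sup>2)\<bar> \<le> ?K"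
      by (rule order_trans[OF abs_Im_le_cmod]) (use A2 in \<open>simp add: norm_divide norm_power power2_eq_square norm_mult\<close>)
    have "cmod (2 / A^3) = 2 * (1 / (cmod A * cmod A)) * (1 / cmod A)"
      by (simp add: norm_divide norm_power norm_mult power3_eq_cube)
    also have "\<dots> \<le> 2 * ?K * (1 / \<epsilon>)"
    proof (intro mult_mono A2 order_refl)
      show "1 / cmod A \<le> 1 / \<epsilon>" using Ae \<epsilon> by (intro frac_le) auto
    qed (use K0 \<epsilon> in auto)
    finally have i3: "\<bar>Im (2 / A^3)\<bar> \<le> 2 * ?K * (1 / \<epsilon>)" using abs_Im_le_cmod order_trans by blast
    have p: "\<bar>y / pi\<bar> \<le> F" if "\<bar>y\<bar> \<le> F" for y
    proof -
      have "\<bar>y\<bar> / pi \<le> F / 1" using that pi_gt3 F by (intro frac_le) auto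
      then show ?thesis by simp
    qed
    have "norm (k' u) \<le> \<bar>f' u / pi\<bar> * \<bar>Im (1 / A\<^sup>2)\<bar> + \<bar>Im (2 / A^3)\<bar> * \<bar>f u / pi\<bar>"
      unfolding k'_def A_def[symmetric] real_norm_def
      by (rule order_trans[OF abs_triangle_ineq]) (simp only: abs_mult abs_minus_cancel)
    also have "\<dots> \<le> F * ?K + (2 * ?K * (1 / \<epsilon>)) * F"
      using p[OF f'F[of u]] p[OF fF[of u]] i2 i3 K0 F \<epsilon> by (intro add_mono mult_mono) auto
    also have "\<dots> = F * kap T \<epsilon> * (1 + 2 / \<epsilon>) / (1 + x\<^sup>2)"
      by (simp add: distrib_left add_divide_distrib mult_ac)
    finally show ?thesis .
  qed
  from field_differentiable_bound[of "{-T..T}" "k \<epsilon> x" k', OF _ has_field_derivative_at_within[OF D] this, of s t]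
  show ?thesis using st by auto
qed

text \<open>The derivative of \<open>f\<close> is compared with \<open>G\<close> (smoothing),
  \<open>G\<close> with the derivative of the Poisson sum \<open>g\<close> (discretisation), and
  that with the derivative of the phase statistic (dipoles), each time up to
  \<open>e1 / (1 + x\<^sup>2)\<close>. The product over pairs is compared with the explicit variance
  of \<open>g\<close>, and this with the variance of \<open>f\<close> through
  \<open>sigma_sq_diff\<close>.\<close>

lemma phase_stat_approximation:
  assumes e: "e > 0"
  obtains m z w where "\<And>r. r < m \<Longrightarrow> Im (z r) > 0" "\<And>r. r < m \<Longrightarrow> Im (w r) > 0"
    "inj_on z {..<m}" "inj_on w {..<m}" "\<And>r s. r < m \<Longrightarrow> s < m \<Longrightarrow> z r \<noteq> w s"
    "wlip e (\<lambda>x. f x - phase_stat m z w x)" "cmod (gauss_product m z w - of_real (exp (- sigma_sq f / 2))) \<le> e"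
proof -
  define L where "L = 3 * (F * (1 + T0\<^sup>2))"
  have L0: "L \<ge> 0" using F by (simp add: L_def)
  have fL: "wlip L f" unfolding L_def by (rule f_wlip)
  \<comment> \<open>\<open>9 * e1\<close> will bound the weighted distance from \<open>f\<close> to
    the phase statistic, and \<open>e1 * (3 * L + 9 * e1)\<close> the difference of the variances of
    \<open>f\<close> and \<open>g\<close>; both are at most
    \<open>e1 * (4 * L + 19)\<close>.\<close>
  define e1 where "e1 = min 1 (e / (4 * L + 19))"
  have e1: "e1 > 0" "e1 \<le> 1" "e1 * (4 * L + 19) \<le> e"
  proof -
    have "e1 \<le> e / (4 * L + 19)" by (simp add: e1_def)
    then show "e1 * (4 * L + 19) \<le> e" using L0 by (simp add: pos_le_divide_eq)
  qed (use e L0 in \<open>auto simp: e1_def\<close>)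
  obtain \<epsilon> where \<epsilon>: "0 < \<epsilon>" "\<epsilon> \<le> 1" and Ga: "\<And>x. (1 + x\<^sup>2) * \<bar>G \<epsilon> x - f' x\<bar> \<le> e1"
    using G_approx[OF e1(1)] by blast
  \<comment> \<open>A displacement is at most \<open>F * h\<close> in the real and
    \<open>h\<^sup>2 \<le> h\<close> in the imaginary direction.\<close>
  define D where "D = F + 1"
  have D: "D \<ge> 0" using F by (simp add: D_def)
  define \<Lambda> where "\<Lambda> = F * kap T \<epsilon> * (1 + 2 / \<epsilon>)"
  define C1 where "C1 = 2 * T * \<Lambda>"
  define C2 where "C2 = 2 * T * (2 * kap (T + F) \<epsilon> * (1 + D\<^sup>2 / \<epsilon>))"
  define Q where "Q = D\<^sup>2 / \<epsilon>\<^sup>2"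
  define K where "K = 2 * D / \<epsilon>\<^sup>2 + D\<^sup>2 * (2 * D / \<epsilon>^3 + D\<^sup>2 / \<epsilon>^4)"
  define C3 where "C3 = (2 * T)\<^sup>2 * ((K + exp Q * Q\<^sup>2) * exp ((2 * T)\<^sup>2 * Q))"
  have \<Lambda>0: "\<Lambda> \<ge> 0" using F \<epsilon> kap_pos[of T \<epsilon>] by (auto simp: \<Lambda>_def intro!: mult_nonneg_nonneg)
  have C: "C1 \<ge> 0" "C2 \<ge> 0" "C3 \<ge> 0"
    using T_ge \<Lambda>0 \<epsilon> kap_pos[of "T + F" \<epsilon>] D by (auto simp: C1_def C2_def C3_def K_def intro!: mult_nonneg_nonneg add_nonneg_nonneg)
  \<comment> \<open>Collects the requirements on the mesh: \<open>h \<le> 1\<close>,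
    \<open>F * h \<le> 1 / 2\<close> to keep the zeros distinct, and one bound for each of the
    errors governed by \<open>C1\<close>, \<open>C2\<close> and \<open>C3\<close>.\<close>
  define h0 where "h0 = min (min 1 (1 / (2 * F))) (min (e1 / (C1 + 1)) (min (e1 / (C2 + 1)) ((e / 2) / (C3 + 1))))"
  have h0: "h0 > 0" using F e1 C e by (auto simp: h0_def)
  obtain M :: nat where M: "2 * T / h0 < real M" using reals_Archimedean2 by blast
  have M0: "real M > 0" using M h0 T_ge by (smt (verit) divide_nonneg_pos)
  define h where "h = 2 * T / real M"
  have h: "0 < h" using M0 T_ge by (simp add: h_def)
  have Mh: "real M * h = 2 * T" using M0 by (simp add: h_def)
  have "h \<le> h0" using M M0 h0 by (simp add: h_def field_simps)
  then have hb: "h \<le> 1" "h \<le> 1 / (2 * F)" "h \<le> e1 / (C1 + 1)" "h \<le> e1 / (C2 + 1)" "h \<le> (e / 2) / (C3 + 1)"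
    by (auto simp: h0_def)
  have small: "C * h \<le> x" if "C \<ge> 0" "h \<le> x / (C + 1)" for C x
  proof -
    have "(C + 1) * h \<le> x" using that by (simp add: pos_le_divide_eq mult.commute)
    then show ?thesis using h by (simp add: distrib_right)
  qed
  have C1h: "C1 * h \<le> e1" and C2h: "C2 * h \<le> e1" and C3h: "C3 * h \<le> e / 2"
    by (rule small[OF C(1) hb(3)], rule small[OF C(2) hb(4)], rule small[OF C(3) hb(5)])
  have Fh: "F * h \<le> 1 / 2" using hb(2) F by (simp add: pos_le_divide_eq mult_ac)
  define t where "t = (\<lambda>r. - T + real r * h)"
  \<comment> \<open>With this displacement \<open>- 2 * c r\<close> equals
    \<open>f (t r) * h / pi\<close>, the Riemann weight of the Poisson integral.\<close>
  define c where "c = (\<lambda>r. - f (t r) * h / (2 * pi))"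
  define z where "z = (\<lambda>r. Complex (t r) \<epsilon>)"
  \<comment> \<open>The shift by \<open>h\<^sup>2\<close> only serves to keep the two families of poles disjoint.\<close>
  define w where "w = (\<lambda>r. Complex (t r + c r) (\<epsilon> + h\<^sup>2))"
  define g where "g = poisson_sum M (\<lambda>r. - 2 * c r) z"
  define \<phi> where "\<phi> = phase_stat M z w"
  have tT: "\<bar>t r\<bar> \<le> T" if "r < M" for r
  proof -
    have "real r * h \<le> real M * h" using that h by (intro mult_right_mono) auto
    moreover have "0 \<le> real r * h" using h by simp
    ultimately show ?thesis using Mh by (auto simp: t_def)
  qed
  have cF: "\<bar>c r\<bar> \<le> F * h" for r
  proof -
    have "\<bar>c r\<bar> = \<bar>f (t r)\<bar> * h / (2 * pi)" using h by (simp add: c_def abs_mult)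
    also have "\<dots> \<le> F * h / 1" using fF[of "t r"] F h pi_gt3 by (intro frac_le mult_right_mono mult_nonneg_nonneg) auto
    finally show ?thesis by simp
  qed
  have h2: "h\<^sup>2 \<le> h" using h hb(1) by (simp add: power2_eq_square mult_left_le)
  have cD: "\<bar>c r\<bar> \<le> D * h" for r using cF[of r] h by (simp add: D_def distrib_right)
  have wzc: "w r - z r - of_real (c r) = Complex 0 (h\<^sup>2)" for r by (simp add: w_def z_def complex_eq_iff)
  have i: "cmod (Complex 0 (h\<^sup>2)) = h\<^sup>2" by (simp only: complex_norm zero_power2 add_0 real_sqrt_abs abs_power2)
  have dc: "cmod (w r - z r - of_real (c r)) \<le> h\<^sup>2" for r unfolding wzc i ..
  have wzD: "cmod (w r - z r) \<le> D * h" for r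
  proof -
    have "w r - z r = Complex 0 (h\<^sup>2) + of_real (c r)" using wzc[of r] by (simp add: algebra_simps)
    then have "cmod (w r - z r) \<le> h\<^sup>2 + \<bar>c r\<bar>" using norm_triangle_ineq[of "Complex 0 (h\<^sup>2)" "of_real (c r)"] i by simp
    then show ?thesis using cF[of r] h2 by (simp add: D_def distrib_right)
  qed
  have cF1: "\<bar>c r\<bar> \<le> F" for r
    using order_trans[OF cF[of r] mult_left_le[OF hb(1)]] F by simp
  have Imz: "\<epsilon> \<le> Im (z r)" "Im (z r) > 0" and Imw: "\<epsilon> \<le> Im (w r)" "Im (w r) > 0" for r
    using \<epsilon> by (auto simp: z_def w_def add_pos_nonneg)
  have injz: "inj_on z {..<M}" using h by (auto simp: inj_on_def z_def t_def)
  \<comment> \<open>Since \<open>F * h \<le> 1 / 2\<close>, the displacement \<open>c\<close> is a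
    contraction as a function of the node, so displaced nodes cannot collide.\<close>
  have injw: "inj_on w {..<M}"
  proof (rule inj_onI)
    fix r s assume "w r = w s"
    then have eq: "t r - t s = c s - c r" by (simp add: w_def)
    have "c s - c r = (f (t r) - f (t s)) * h / (2 * pi)" by (simp add: c_def field_simps)
    then have "\<bar>t r - t s\<bar> = \<bar>f (t r) - f (t s)\<bar> * h / (2 * pi)" using eq h by (simp add: abs_mult)
    also have "\<dots> \<le> F * \<bar>t r - t s\<bar> * h / 1"
      using f_lipschitz[of "t r" "t s"] F h pi_gt3 by (intro frac_le mult_right_mono mult_nonneg_nonneg) auto
    also have "\<dots> = F * h * \<bar>t r - t s\<bar>" by simp
    also have "\<dots> \<le> 1 / 2 * \<bar>t r - t s\<bar>" using Fh by (intro mult_right_mono) auto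
    finally have "t r = t s" by simp
    then show "r = s" using h by (simp add: t_def)
  qed
  have zw: "z r \<noteq> w s" for r s using h by (auto simp: z_def w_def)
  define g' where "g' = (\<lambda>x. \<Sum>r<M. - 2 * c r * (- Im (1 / (of_real x - z r)\<^sup>2)))"
  define \<phi>' where "\<phi>' = (\<lambda>x. \<Sum>r<M. 2 * Im (1 / (of_real x - w r) - 1 / (of_real x - z r)))"
  have gd: "(g has_real_derivative g' x) (at x)" for x unfolding g_def g'_def by (rule poisson_sum_derivative) (rule Imz)
  have \<phi>d: "(\<phi> has_real_derivative \<phi>' x) (at x)" for x unfolding \<phi>_def \<phi>'_def by (rule phase_stat_derivative) (rule Imz Imw)+
  have x0: "1 + x\<^sup>2 > 0" for x :: real by (intro add_pos_nonneg) auto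
  have g1: "\<bar>g' x - G \<epsilon> x\<bar> \<le> e1 / (1 + x\<^sup>2)" for x
  proof -
    have "g' x = (\<Sum>r<M. h * k \<epsilon> x (- T + real r * h))"
      unfolding g'_def by (intro sum.cong refl) (simp add: c_def k_def t_def z_def)
    moreover have "\<bar>(\<Sum>r<M. h * k \<epsilon> x (- T + real r * h)) - integral {-T..- T + real M * h} (k \<epsilon> x)\<bar> \<le> real M * (\<Lambda> / (1 + x\<^sup>2) * h * h)"
      by (rule riemann_sum_error[where b = T])
         (use k_lipschitz[OF \<epsilon>(1)] h \<Lambda>0 x0[of x] Mh in \<open>auto simp: \<Lambda>_def[symmetric]\<close>)
    moreover have "- T + real M * h = T" using Mh by simp
    moreover have "real M * (\<Lambda> / (1 + x\<^sup>2) * h * h) = C1 * h / (1 + x\<^sup>2)"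
    proof -
      have "real M * (\<Lambda> / (1 + x\<^sup>2) * h * h) = (real M * h) * \<Lambda> * h / (1 + x\<^sup>2)" by simp
      then show ?thesis unfolding Mh C1_def by simp
    qed
    moreover have "C1 * h / (1 + x\<^sup>2) \<le> e1 / (1 + x\<^sup>2)" using C1h x0[of x] by (intro divide_right_mono) auto
    moreover have "integral {-T..T} (k \<epsilon> x) = G \<epsilon> x" using \<epsilon> by (intro integral_k) simp
    ultimately show ?thesis by (simp only:)
  qed
  have g2: "\<bar>\<phi>' x - g' x\<bar> \<le> e1 / (1 + x\<^sup>2)" for x
  proof -
    have "\<phi>' x - g' x = (\<Sum>r<M. 2 * Im (1 / (of_real x - w r) - 1 / (of_real x - z r)) - 2 * c r * Im (1 / (of_real x - z r)\<^sup>2))"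
      unfolding \<phi>'_def g'_def by (simp add: sum_subtractf)
    also have "\<bar>\<dots>\<bar> \<le> (\<Sum>r<M. 2 * (kap (T + F) \<epsilon> / (1 + x\<^sup>2)) * (h\<^sup>2 * (1 + D\<^sup>2 / \<epsilon>)))"
    proof (rule order_trans[OF sum_abs], intro sum_mono)
      fix r assume "r \<in> {..<M}"
      then have r: "\<bar>t r\<bar> \<le> T" using tT by simp
      have "\<bar>Re (z r)\<bar> \<le> T + F" "\<bar>Re (w r)\<bar> \<le> T + F" using r cF1[of r] F by (auto simp: z_def w_def)
      then show "\<bar>2 * Im (1 / (of_real x - w r) - 1 / (of_real x - z r)) - 2 * c r * Im (1 / (of_real x - z r)\<^sup>2)\<bar>
        \<le> 2 * (kap (T + F) \<epsilon> / (1 + x\<^sup>2)) * (h\<^sup>2 * (1 + D\<^sup>2 / \<epsilon>))"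
        by (intro resolvent_shift_bound Imz Imw \<epsilon> cD wzD dc)
    qed
    also have "\<dots> = (real M * h) * (2 * kap (T + F) \<epsilon> * (1 + D\<^sup>2 / \<epsilon>)) * h / (1 + x\<^sup>2)"
      by (simp only: sum_constant card_lessThan power2_eq_square[of h] times_divide_eq_right times_divide_eq_left mult_ac)
    also have "\<dots> = C2 * h / (1 + x\<^sup>2)" unfolding Mh C2_def ..
    also have "\<dots> \<le> e1 / (1 + x\<^sup>2)" using C2h x0[of x] by (intro divide_right_mono) auto
    finally show ?thesis .
  qed
  have g3: "\<bar>G \<epsilon> x - f' x\<bar> \<le> e1 / (1 + x\<^sup>2)" for x
    using Ga[of x] x0[of x] by (simp add: pos_le_divide_eq mult.commute)
  have fg: "wlip (3 * (2 * e1)) (\<lambda>x. f x - g x)"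
  proof (rule wlip_derivative[OF DERIV_diff[OF d gd]])
    fix x show "\<bar>f' x - g' x\<bar> \<le> 2 * e1 / (1 + x\<^sup>2)" using g1[of x] g3[of x] by (simp add: abs_le_iff)
    show "((\<lambda>x. f x - g x) \<longlongrightarrow> 0) at_top" "((\<lambda>x. f x - g x) \<longlongrightarrow> 0) at_bot"
      using tendsto_diff[OF f_tendsto_0(1) poisson_sum_tendsto_0(1)] tendsto_diff[OF f_tendsto_0(2) poisson_sum_tendsto_0(2)] by (simp_all add: g_def)
  qed
  have "wlip (3 * (3 * e1)) (\<lambda>x. f x - \<phi> x)"
  proof (rule wlip_derivative[OF DERIV_diff[OF d \<phi>d]])
    fix x show "\<bar>f' x - \<phi>' x\<bar> \<le> 3 * e1 / (1 + x\<^sup>2)" using g1[of x] g2[of x] g3[of x] by (simp add: abs_le_iff)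
    have "(\<phi> \<longlongrightarrow> 0) at_top" "(\<phi> \<longlongrightarrow> 0) at_bot" unfolding \<phi>_def by (intro phase_stat_tendsto_0 Imz Imw)+
    then show "((\<lambda>x. f x - \<phi> x) \<longlongrightarrow> 0) at_top" "((\<lambda>x. f x - \<phi> x) \<longlongrightarrow> 0) at_bot"
      using tendsto_diff[OF f_tendsto_0(1), of \<phi> 0] tendsto_diff[OF f_tendsto_0(2), of \<phi> 0] by simp_all
  qed
  moreover have "3 * (3 * e1) \<le> e"
  proof -
    have "e1 * 9 \<le> e1 * (4 * L + 19)" using e1 L0 by (intro mult_left_mono) auto
    then show ?thesis using e1(3) by linarith
  qed
  ultimately have f\<phi>: "wlip e (\<lambda>x. f x - phase_stat M z w x)" unfolding \<phi>_def by (rule wlip_mono)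
  have gK: "wlip (L + 6 * e1) g"
  proof -
    have "\<bar>- (f x - g x) - - (f y - g y)\<bar> = \<bar>f x - g x - (f y - g y)\<bar>" for x y by linarith
    then have "wlip (3 * (2 * e1)) (\<lambda>x. - (f x - g x))" using wlipD[OF fg] unfolding wlip_def by metis
    from wlip_add[OF fL this] show ?thesis by simp
  qed
  have gm: "g \<in> borel_measurable borel"
    by (rule borel_measurable_continuous_onI) (meson gd DERIV_isCont continuous_at_imp_continuous_on)
  have "\<bar>sigma_sq f - sigma_sq g\<bar> \<le> 3 * (2 * e1) * (L + (L + 6 * e1)) / 4"
    by (rule sigma_sq_diff[OF f_meas fL gm gK fg])
  also have "\<dots> \<le> e1 * (4 * L + 19)"
  proof -
    have "3 * (2 * e1) * (L + (L + 6 * e1)) / 4 = e1 * (3 * L + 9 * e1)" by (simp add: field_simps)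
    also have "\<dots> \<le> e1 * (4 * L + 19)" using e1 L0 by (intro mult_left_mono) auto
    finally show ?thesis .
  qed
  also have "\<dots> \<le> e" by (rule e1)
  finally have s: "\<bar>sigma_sq f - sigma_sq g\<bar> \<le> e" .
  have "\<bar>exp (- (sigma_sq g / 2)) - exp (- (sigma_sq f / 2))\<bar> \<le> \<bar>sigma_sq g / 2 - sigma_sq f / 2\<bar>"
    by (intro exp_minus_lipschitz) (simp_all add: sigma_sq_nonneg)
  also have "\<dots> \<le> e / 2" using s by linarith
  finally have x1: "\<bar>exp (- sigma_sq g / 2) - exp (- sigma_sq f / 2)\<bar> \<le> e / 2" by simp
  have "cmod (gauss_product M z w - exp (\<Sum>s<M. \<Sum>r<M. of_real (c r * c s) / (z r - cnj (z s))\<^sup>2)) \<le> C3 * h"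
    unfolding C3_def K_def Q_def
    by (rule gauss_product_approx) (use Imz Imw \<epsilon> cD wzD dc h hb(1) D Mh T_ge in auto)
  then have x2: "cmod (gauss_product M z w - of_real (exp (- sigma_sq g / 2))) \<le> e / 2"
    using C3h unfolding g_def exp_gauss_sum[OF Imz(2)] by linarith
  have "cmod (gauss_product M z w - of_real (exp (- sigma_sq f / 2))) \<le> cmod (gauss_product M z w - of_real (exp (- sigma_sq g / 2))) + cmod (of_real (exp (- sigma_sq g / 2)) - of_real (exp (- sigma_sq f / 2)))"
    using norm_triangle_ineq[of "gauss_product M z w - of_real (exp (- sigma_sq g / 2))" "of_real (exp (- sigma_sq g / 2)) - of_real (exp (- sigma_sq f / 2))"]
    by (simp only: diff_add_cancel add_diff_eq)
  also have "\<dots> \<le> e / 2 + e / 2"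
    using x1 x2 by (intro add_mono) (simp_all only: of_real_diff[symmetric] norm_of_real)
  finally have gp: "cmod (gauss_product M z w - of_real (exp (- sigma_sq f / 2))) \<le> e" by simp
  show ?thesis using that[of M z w] Imz Imw injz injw zw f\<phi> gp by blast
qed

end

subsection \<open>The central limit theorem\<close>

text \<open>The exponentials differ by at most the distance of their arguments, and
  \<open>\<bar>d\<bar> \<le> d\<^sup>2 / (2 * c) + c / 2\<close> passes from the first to the second
  moment. The bound \<open>B\<close> provides integrability.\<close>

lemma (in prob_space) characteristic_difference_bound:
  fixes X Y :: "'a \<Rightarrow> real"
  assumes m: "X \<in> borel_measurable M" "Y \<in> borel_measurable M" and b: "\<And>x. \<bar>X x\<bar> \<le> B" "\<And>x. \<bar>Y x\<bar> \<le> B"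
    and v: "(\<integral>x. (X x - Y x)\<^sup>2 \<partial>M) \<le> c\<^sup>2" and c: "c > 0"
  shows "cmod ((\<integral>x. exp (\<i> * of_real (X x)) \<partial>M) - (\<integral>x. exp (\<i> * of_real (Y x)) \<partial>M)) \<le> c"
proof -
  have e: "cmod (exp (\<i> * of_real u) - exp (\<i> * of_real v)) \<le> \<bar>u - v\<bar>" for u v :: real
  proof -
    have "exp (\<i> * of_real u) - exp (\<i> * of_real v) = exp (\<i> * of_real v) * (exp (\<i> * of_real (u - v)) - 1)"
      by (simp add: right_diff_distrib exp_add[symmetric])
    then have "cmod (exp (\<i> * of_real u) - exp (\<i> * of_real v)) = cmod (exp (\<i> * of_real (u - v)) - 1)"
      by (simp add: norm_mult)
    also have "\<dots> \<le> \<bar>u - v\<bar>" using iexp_approx1[of "u - v" 0] by simp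
    finally show ?thesis .
  qed
  have i: "integrable M (\<lambda>x. exp (\<i> * of_real (Z x)))" if "Z \<in> borel_measurable M" for Z :: "'a \<Rightarrow> real"
    using that by (intro integrable_const_bound[where B = 1]) auto
  have B: "\<bar>X x - Y x\<bar> \<le> 2 * B" for x using b[of x] by linarith
  have B2: "(X x - Y x)\<^sup>2 \<le> (2 * B)\<^sup>2" for x using power_mono[OF B[of x], of 2] by simp
  have i1: "integrable M (\<lambda>x. \<bar>X x - Y x\<bar>)" using m B by (intro integrable_const_bound[where B = "2 * B"]) auto
  have i2: "integrable M (\<lambda>x. (X x - Y x)\<^sup>2)" using m B2 by (intro integrable_const_bound[where B = "(2 * B)\<^sup>2"]) auto
  have "cmod ((\<integral>x. exp (\<i> * of_real (X x)) \<partial>M) - (\<integral>x. exp (\<i> * of_real (Y x)) \<partial>M)) = cmod (\<integral>x. exp (\<i> * of_real (X x)) - exp (\<i> * of_real (Y x)) \<partial>M)"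
    using m by (simp add: i Bochner_Integration.integral_diff)
  also have "\<dots> \<le> (\<integral>x. \<bar>X x - Y x\<bar> \<partial>M)"
    by (rule order_trans[OF integral_norm_bound integral_mono]) (use m i1 e in \<open>auto intro!: integrable_norm Bochner_Integration.integrable_diff i\<close>)
  also have "\<dots> \<le> (\<integral>x. (X x - Y x)\<^sup>2 / (2 * c) + c / 2 \<partial>M)"
  proof (rule integral_mono[OF i1])
    show "integrable M (\<lambda>x. (X x - Y x)\<^sup>2 / (2 * c) + c / 2)" using i2 by simp
    fix x
    have "0 \<le> (\<bar>X x - Y x\<bar> - c)\<^sup>2" by simp
    then have "2 * c * \<bar>X x - Y x\<bar> \<le> (X x - Y x)\<^sup>2 + c\<^sup>2" by (simp add: power2_diff mult_ac)
    then show "\<bar>X x - Y x\<bar> \<le> (X x - Y x)\<^sup>2 / (2 * c) + c / 2" using c by (simp add: field_simps power2_eq_square)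
  qed
  also have "\<dots> = (\<integral>x. (X x - Y x)\<^sup>2 \<partial>M) / (2 * c) + c / 2" using i2 by (simp add: prob_space)
  also have "\<dots> \<le> c\<^sup>2 / (2 * c) + c / 2" using v c by (intro add_right_mono divide_right_mono) auto
  also have "\<dots> = c" using c by (simp add: power2_eq_square)
  finally show ?thesis .
qed

section \<open>Gaussian laws and elementary properties of linear statistics\<close>

lemma char_gaussian:
  assumes "v \<ge> 0"
  shows "real_distribution (gaussian v)" "char (gaussian v) t = of_real (exp (- (v * t\<^sup>2) / 2))"
proof -
  have "real_distribution (gaussian v) \<and> char (gaussian v) t = of_real (exp (- (v * t\<^sup>2) / 2))"
  proof (cases "v = 0")
    case True
    interpret prob_space "return borel (0::real)" by (rule prob_space_return) simp
    have "char (return borel 0) t = 1" unfolding char_def by (subst integral_return) auto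
    then show ?thesis using True by (auto simp: gaussian_def intro!: real_distribution.intro real_distribution_axioms.intro prob_space_axioms)
  next
    case False
    then have v: "sqrt v > 0" "(sqrt v)\<^sup>2 = v" using assms by auto
    interpret N: real_distribution std_normal_distribution by (rule real_dist_normal_dist)
    have "distributed std_normal_distribution lborel (\<lambda>x. x) std_normal_density"
      by (auto simp: distributed_def distr_id2 sets_lborel intro!: distr_id2)
    from N.normal_density_affine[OF this, of "sqrt v" 0] v
    have "distributed std_normal_distribution lborel (\<lambda>x. sqrt v * x) (normal_density 0 (sqrt v))" by simp
    then have g: "gaussian v = distr std_normal_distribution lborel (\<lambda>x. sqrt v * x)"
      using False by (simp add: gaussian_def distributed_distr_eq_density)
    also have "\<dots> = distr std_normal_distribution borel (\<lambda>x. sqrt v * x)" by (intro distr_cong) auto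
    finally have g: "gaussian v = distr std_normal_distribution borel (\<lambda>x. sqrt v * x)" .
    have "char (gaussian v) t = char std_normal_distribution (sqrt v * t)"
      unfolding g char_def by (subst integral_distr) (auto simp: mult_ac)
    also have "\<dots> = of_real (exp (- (v * t\<^sup>2) / 2))"
      unfolding char_std_normal_distribution using v by (simp add: power_mult_distrib)
    finally show ?thesis unfolding g using N.real_distribution_distr[of "\<lambda>x. sqrt v * x"] by simp
  qed
  then show "real_distribution (gaussian v)" "char (gaussian v) t = of_real (exp (- (v * t\<^sup>2) / 2))" by auto
qed

lemma lin_stat_cmult: "lin_stat (\<lambda>x. t * f x) \<alpha> x0 n x = t * lin_stat f \<alpha> x0 n x"
  by (simp add: lin_stat_def sum_distrib_left)

lemma lin_stat_diff: "lin_stat (\<lambda>x. f x - g x) \<alpha> x0 n x = lin_stat f \<alpha> x0 n x - lin_stat g \<alpha> x0 n x"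
  by (simp add: lin_stat_def sum_subtractf)

lemma lin_stat_bounded: "(\<And>x. \<bar>f x\<bar> \<le> C) \<Longrightarrow> \<bar>lin_stat f \<alpha> x0 n x\<bar> \<le> real n * C"
  unfolding lin_stat_def using sum_bounded_above[of "{..<n}" "\<lambda>j. \<bar>f (real n powr \<alpha> * (x j - x0))\<bar>" C]
  by (intro order_trans[OF sum_abs]) auto

lemma sigma_sq_cmult: "sigma_sq (\<lambda>x. t * f x) = t\<^sup>2 * sigma_sq f"
proof -
  have "((t * f x - t * f y) / (x - y))\<^sup>2 = t\<^sup>2 * ((f x - f y) / (x - y))\<^sup>2" for x y
    by (simp add: right_diff_distrib[symmetric] power_mult_distrib[symmetric])
  then show ?thesis by (simp add: sigma_sq_def)
qed

lemma test_function_exists: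
  assumes "f C1_differentiable_on UNIV" "compact (closure {x. f x \<noteq> (0::real)})"
  obtains f' F T0 where "test_function f f' F T0"
proof -
  obtain f' where f': "\<And>x. (f has_real_derivative f' x) (at x)" "continuous_on UNIV f'"
    using assms(1) by (auto simp: C1_differentiable_on_def has_real_derivative_iff_has_vector_derivative)
  have "bounded {x. f x \<noteq> 0}" using assms(2) compact_imp_bounded bounded_subset closure_subset by blast
  then obtain B where B: "\<And>x. f x \<noteq> 0 \<Longrightarrow> \<bar>x\<bar> \<le> B" by (auto simp: bounded_iff)
  define T0 where "T0 = \<bar>B\<bar> + 1"
  have s: "f x = 0" if "\<bar>x\<bar> \<ge> T0" for x
  proof (rule ccontr)
    assume "f x \<noteq> 0"
    from B[OF this] that show False unfolding T0_def by linarith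
  qed
  have s': "f' x = 0" if "\<bar>x\<bar> > T0" for x using derivative_zero_outside[OF f'(1) s that] .
  have fc: "continuous_on {-T0..T0} f" using f'(1) by (meson DERIV_isCont continuous_at_imp_continuous_on)
  have "bounded (f ` {-T0..T0})" "bounded (f' ` {-T0..T0})"
    by (intro compact_imp_bounded compact_continuous_image fc continuous_on_subset[OF f'(2)]; simp)+
  then obtain F1 F2 where F: "\<And>x. x \<in> {-T0..T0} \<Longrightarrow> \<bar>f x\<bar> \<le> F1" "\<And>x. x \<in> {-T0..T0} \<Longrightarrow> \<bar>f' x\<bar> \<le> F2"
    unfolding bounded_iff by (metis image_eqI real_norm_def)
  have "test_function f f' (max 1 (max F1 F2)) T0"
  proof
    fix x
    have "\<bar>f x\<bar> \<le> max 1 (max F1 F2) \<and> \<bar>f' x\<bar> \<le> max 1 (max F1 F2)"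
    proof (cases "\<bar>x\<bar> > T0")
      case True
      then show ?thesis using s[of x] s'[of x] by simp
    next
      case False
      then have "x \<in> {-T0..T0}" by auto
      from F[OF this] show ?thesis by linarith
    qed
    then show "\<bar>f x\<bar> \<le> max 1 (max F1 F2)" "\<bar>f' x\<bar> \<le> max 1 (max F1 F2)" by auto
  qed (use f' s in \<open>auto simp: T0_def\<close>)
  then show ?thesis by (rule that)
qed

text \<open>The characteristic function at \<open>t\<close> of the statistic of \<open>f\<close> is
  that at 1 of the statistic of \<open>t * f\<close>, so the limit theorem is applied to multiples
  of \<open>f\<close>.\<close>

lemma (in test_function) test_function_cmult: "test_function (\<lambda>x. t * f x) (\<lambda>x. t * f' x) (F * (1 + \<bar>t\<bar>)) T0"
proof
  show "((\<lambda>x. t * f x) has_real_derivative t * f' x) (at x)" for x by (intro DERIV_cmult d)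
  show "continuous_on UNIV (\<lambda>x. t * f' x)" by (intro continuous_intros cont)
  have "1 * 1 \<le> F * (1 + \<bar>t\<bar>)" using F by (intro mult_mono) auto
  then show "1 \<le> F * (1 + \<bar>t\<bar>)" by simp
  have "\<bar>t * y\<bar> \<le> F * (1 + \<bar>t\<bar>)" if "\<bar>y\<bar> \<le> F" for y
  proof -
    have "\<bar>t * y\<bar> \<le> (1 + \<bar>t\<bar>) * F" unfolding abs_mult using that by (intro mult_mono) auto
    then show ?thesis by (simp add: mult.commute)
  qed
  then show "\<bar>t * f x\<bar> \<le> F * (1 + \<bar>t\<bar>)" "\<bar>t * f' x\<bar> \<le> F * (1 + \<bar>t\<bar>)" for x using fF f'F by auto
qed (use supp T0 in auto)

section \<open>Uniform variance bound and passage to general test functions\<close>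

context mesoscopic
begin

lemma lin_stat_measurable:
  assumes "f \<in> borel_measurable borel"
  shows "lin_stat f \<alpha> x0 n \<in> borel_measurable (PM n)"
proof -
  have "(\<lambda>y. f (real n powr \<alpha> * (y - x0))) \<in> borel_measurable borel" using assms by measurable
  then show ?thesis unfolding lin_stat_def[abs_def] by (intro borel_measurable_sum particle_measurable) auto
qed

lemma ra_tendsto: "ra \<longlonglongrightarrow> a"
proof -
  obtain C where C: "\<forall>\<^sub>F n in sequentially. \<forall>k. real n / 2 \<le> real k \<longrightarrow>
     \<bar>ra k - a\<bar> \<le> C * real n powr (-\<beta>) \<and> \<bar>rb k - b\<bar> \<le> C * real n powr (-\<beta>) \<and> C * real n powr (-\<beta>) \<le> a / 2"
    by (rule coefficient_bounds)
  have "(\<lambda>n. real n powr (- \<beta>)) \<longlonglongrightarrow> 0" using \<alpha> by (intro tendsto_neg_powr filterlim_real_sequentially) auto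
  then have "(\<lambda>n. C * real n powr (- \<beta>)) \<longlonglongrightarrow> 0" using tendsto_mult_right_zero by blast
  moreover have "\<forall>\<^sub>F n in sequentially. norm (ra n - a) \<le> C * real n powr (- \<beta>)"
    using C by eventually_elim auto
  ultimately have "(\<lambda>n. ra n - a) \<longlonglongrightarrow> 0" by (rule Lim_null_comparison[rotated])
  then show ?thesis by (rule LIM_zero_cancel)
qed

definition \<rho> :: "nat \<Rightarrow> real \<Rightarrow> real" where "\<rho> n x = 1 / (1 + (real n powr \<alpha> * (x - x0))\<^sup>2)"

lemma \<rho>_measurable: "\<rho> n \<in> borel_measurable borel" unfolding \<rho>_def[abs_def] by measurable

lemma \<rho>_bounds: "0 \<le> \<rho> n x" "\<rho> n x \<le> 1"
  by (auto simp: \<rho>_def divide_le_eq_1 add_pos_nonneg)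

text \<open>\<open>- n\<^sup>\<alpha> \<rho>\<close> is the imaginary part of the resolvent at \<open>x\<^sub>0 + i n\<^bsup>-\<alpha>\<^esup>\<close>.\<close>

lemma FM_\<rho>_bound:
  assumes n: "n > 0"
  shows "\<bar>real n powr \<alpha> * FM (\<rho> n) k k\<bar> \<le> cmod (P k (zz n \<i>) * Q k (zz n \<i>))"
proof -
  define \<theta> where "\<theta> = real n powr \<alpha>"
  have \<theta>: "\<theta> > 0" using n by (simp add: \<theta>_def)
  have "real n powr (- \<alpha>) = 1 / \<theta>" by (simp add: \<theta>_def powr_minus_divide)
  then have z: "zz n \<i> = Complex x0 (1 / \<theta>)" by (simp add: zz_def complex_eq_iff)
  have Im: "Im (zz n \<i>) \<noteq> 0" using \<theta> by (simp add: z)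
  have "Im (1 / (zz n \<i> - of_real x)) = - (\<theta> * \<rho> n x)" for x
  proof -
    have "Im (1 / (zz n \<i> - of_real x)) = - ((1 / \<theta>) / ((x0 - x)\<^sup>2 + (1 / \<theta>)\<^sup>2))"
      unfolding z by (simp add: Im_divide)
    also have "(x0 - x)\<^sup>2 + (1 / \<theta>)\<^sup>2 = (1 + (\<theta> * (x - x0))\<^sup>2) / \<theta>\<^sup>2"
      using \<theta> by (simp add: power_mult_distrib power_divide add_divide_distrib power2_commute)
    also have "(1 / \<theta>) / \<dots> = \<theta> * \<rho> n x" using \<theta> unfolding \<rho>_def \<theta>_def[symmetric] by (simp add: power2_eq_square)
    finally show ?thesis .
  qed
  note R = this
  have eq: "Im (1 / (zz n \<i> - of_real x) * of_real (poly (p k * p k) x)) = - \<theta> * (\<rho> n x * (poly (p k) x * poly (p k) x))" for x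
  proof -
    have "Im (R * of_real y) = Im R * y" for R y by simp
    with R show ?thesis by (simp only: poly_mult mult.assoc mult_minus_left)
  qed
  have "Im (G k k (zz n \<i>)) = (\<integral>x. Im (1 / (zz n \<i> - of_real x) * of_real (poly (p k * p k) x)) \<partial>\<mu>)"
    unfolding G_def by (rule integral_Im[symmetric]) (rule integrable_resolvent[OF Im])
  also have "\<dots> = - \<theta> * FM (\<rho> n) k k" unfolding eq FM_def by simp
  finally have "\<bar>\<theta> * FM (\<rho> n) k k\<bar> = \<bar>Im (G k k (zz n \<i>))\<bar>" by simp
  also have "\<dots> \<le> cmod (G k k (zz n \<i>))" by (rule abs_Im_le_cmod)
  also have "G k k (zz n \<i>) = P k (zz n \<i>) * Q k (zz n \<i>)" by (rule G_eq_PQ[OF Im order_refl])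
  finally show ?thesis by (simp only: \<theta>_def)
qed

text \<open>At the point \<open>zz n \<i>\<close> the identity \<open>FF n z z = 1\<close> says that
  \<open>ra n * (UU - SS)\<close> is the reciprocal of \<open>P (n - 1) * Q (n - 1)\<close>.
  Multiplication by \<open>UU * SS\<close> raises the index by one.\<close>

lemma diagonal_resolvent_limits:
  "(\<lambda>n. P (n - 1) (zz n \<i>) * Q (n - 1) (zz n \<i>)) \<longlonglongrightarrow> 1 / (of_real a * (\<tau> - cnj \<tau>))"
  "(\<lambda>n. P n (zz n \<i>) * Q n (zz n \<i>)) \<longlonglongrightarrow> 1 / (of_real a * (\<tau> - cnj \<tau>)) * (\<tau> * cnj \<tau>)"
proof -
  have lU: "lU \<i> = \<tau>" by (simp add: lU_def)
  have U: "(\<lambda>n. UU n \<i>) \<longlonglongrightarrow> \<tau>" and S: "(\<lambda>n. SS n \<i>) \<longlonglongrightarrow> cnj \<tau>"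
    using UU_limit[of \<i>] SS_limit(1)[of \<i>] by (simp_all add: lU)
  have nz: "of_real a * (\<tau> - cnj \<tau>) \<noteq> 0" using a Im_\<tau> by (auto simp: complex_eq_iff)
  have "(\<lambda>n. 1 / (of_real (ra n) * (UU n \<i> - SS n \<i>))) \<longlonglongrightarrow> 1 / (of_real a * (\<tau> - cnj \<tau>))"
    by (intro tendsto_intros ra_tendsto U S nz)
  moreover have ev: "\<forall>\<^sub>F n in sequentially. n > 0 \<and> Q (n - 1) (zz n \<i>) \<noteq> 0"
    by (intro eventually_conj eventually_gt_at_top SS_limit(2)) simp
  then have "\<forall>\<^sub>F n in sequentially. 1 / (of_real (ra n) * (UU n \<i> - SS n \<i>)) = P (n - 1) (zz n \<i>) * Q (n - 1) (zz n \<i>)"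
  proof eventually_elim
    case (elim n)
    then have Im: "Im (zz n \<i>) \<noteq> 0" by (simp add: Im_zz)
    have P0: "P (n - 1) (zz n \<i>) \<noteq> 0" by (rule P_nonzero[OF Im])
    have "of_real (ra n) * (UU n \<i> - SS n \<i>) * (P (n - 1) (zz n \<i>) * Q (n - 1) (zz n \<i>)) = FF n (zz n \<i>) (zz n \<i>)"
      using elim P0 by (simp add: FF_def UU_def SS_def field_simps)
    also have "\<dots> = 1" using FF_diag[OF Im] elim by simp
    finally have one: "of_real (ra n) * (UU n \<i> - SS n \<i>) * (P (n - 1) (zz n \<i>) * Q (n - 1) (zz n \<i>)) = 1" .
    then have nz: "of_real (ra n) * (UU n \<i> - SS n \<i>) \<noteq> 0" by (metis mult_zero_left zero_neq_one)
    show ?case by (rule eq_divide_imp[OF nz, symmetric], subst mult.commute, rule one)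
  qed
  ultimately show L: "(\<lambda>n. P (n - 1) (zz n \<i>) * Q (n - 1) (zz n \<i>)) \<longlonglongrightarrow> 1 / (of_real a * (\<tau> - cnj \<tau>))"
    by (rule Lim_transform_eventually)
  have "(\<lambda>n. P (n - 1) (zz n \<i>) * Q (n - 1) (zz n \<i>) * (UU n \<i> * SS n \<i>)) \<longlonglongrightarrow> 1 / (of_real a * (\<tau> - cnj \<tau>)) * (\<tau> * cnj \<tau>)"
    by (intro tendsto_mult L U S)
  moreover have "\<forall>\<^sub>F n in sequentially. P (n - 1) (zz n \<i>) * Q (n - 1) (zz n \<i>) * (UU n \<i> * SS n \<i>) = P n (zz n \<i>) * Q n (zz n \<i>)"
    using ev
  proof eventually_elim
    case (elim n)
    then have "P (n - 1) (zz n \<i>) \<noteq> 0" by (intro P_nonzero) (simp add: Im_zz)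
    then show ?case using elim by (simp add: UU_def SS_def)
  qed
  ultimately show "(\<lambda>n. P n (zz n \<i>) * Q n (zz n \<i>)) \<longlonglongrightarrow> 1 / (of_real a * (\<tau> - cnj \<tau>)) * (\<tau> * cnj \<tau>)"
    by (rule Lim_transform_eventually)
qed

text \<open>After rescaling, \<open>wlip\<close> is the hypothesis of \<open>variance_bound\<close>
  with weight \<open>\<rho> n\<close> and constant \<open>(L * n powr \<alpha>)\<^sup>2\<close>. One
  power \<open>n powr \<alpha>\<close> goes to each of the two diagonal entries, which are then
  bounded by convergent resolvent entries. \<open>K\<close> depends neither on \<open>f\<close> nor
  on \<open>L\<close>.\<close>

lemma variance_lin_stat_bound:
  obtains K where "K > 0" "\<forall>\<^sub>F n in sequentially. \<forall>f L. f \<in> borel_measurable borel \<longrightarrow> wlip L f \<longrightarrow>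
    (\<integral>x. (lin_stat f \<alpha> x0 n x - (\<integral>y. lin_stat f \<alpha> x0 n y \<partial>OPE \<mu> n))\<^sup>2 \<partial>OPE \<mu> n) \<le> (K * L)\<^sup>2"
proof -
  define V where "V = (\<lambda>n. 2 * (ra n)\<^sup>2 * (cmod (P n (zz n \<i>) * Q n (zz n \<i>)) * cmod (P (n - 1) (zz n \<i>) * Q (n - 1) (zz n \<i>))))"
  obtain v where "V \<longlonglongrightarrow> v"
    unfolding V_def using tendsto_mult[OF tendsto_mult[OF tendsto_const[of 2] tendsto_power[OF ra_tendsto, of 2]]
      tendsto_mult[OF tendsto_norm[OF diagonal_resolvent_limits(2)] tendsto_norm[OF diagonal_resolvent_limits(1)]]] by blast
  then have ev: "\<forall>\<^sub>F n in sequentially. V n < \<bar>v\<bar> + 1" by (rule order_tendstoD) simp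
  \<comment> \<open>At least 1, so that \<open>V n < K\<close> implies
    \<open>V n \<le> K\<^sup>2\<close>, which combines with \<open>L\<^sup>2\<close> to
    \<open>(K * L)\<^sup>2\<close>.\<close>
  define K where "K = \<bar>v\<bar> + 1"
  have K: "K > 0" "K \<le> K\<^sup>2" by (auto simp: K_def power2_eq_square mult_le_cancel_left1 add_nonneg_pos)
  have "\<forall>\<^sub>F n in sequentially. \<forall>f L. f \<in> borel_measurable borel \<longrightarrow> wlip L f \<longrightarrow>
    (\<integral>x. (lin_stat f \<alpha> x0 n x - (\<integral>y. lin_stat f \<alpha> x0 n y \<partial>OPE \<mu> n))\<^sup>2 \<partial>OPE \<mu> n) \<le> (K * L)\<^sup>2"
    using ev eventually_gt_at_top[of 0]
  proof eventually_elim
    case (elim n)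
    show ?case
    proof (intro allI impI)
      fix f L assume fm: "f \<in> borel_measurable borel" and fL: "wlip L f"
      define \<theta> where "\<theta> = real n powr \<alpha>"
      define g where "g = (\<lambda>x. f (\<theta> * (x - x0)))"
      have gm: "g \<in> borel_measurable borel" unfolding g_def using fm by measurable
      have gb: "\<bar>g x\<bar> \<le> \<bar>f 0\<bar> + L" for x unfolding g_def by (rule wlip_bounded[OF fL])
      have gl: "(g x - g y)\<^sup>2 \<le> (L * \<theta>)\<^sup>2 * (\<rho> n x * \<rho> n y * (x - y)\<^sup>2)" for x y
      proof -
        let ?u = "\<theta> * (x - x0)" and ?v = "\<theta> * (y - x0)"
        have "\<bar>g x - g y\<bar>\<^sup>2 \<le> (L * (\<bar>?u - ?v\<bar> / (sqrt (1 + ?u\<^sup>2) * sqrt (1 + ?v\<^sup>2))))\<^sup>2"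
          unfolding g_def by (rule power_mono[OF wlipD[OF fL]]) simp
        also have "\<dots> = L\<^sup>2 * ((?u - ?v)\<^sup>2 / ((1 + ?u\<^sup>2) * (1 + ?v\<^sup>2)))"
          by (simp add: power_mult_distrib power_divide)
        also have "?u - ?v = \<theta> * (x - y)" by (simp add: algebra_simps)
        finally show ?thesis by (simp add: \<rho>_def \<theta>_def[symmetric] power_mult_distrib)
      qed
      have X: "lin_stat f \<alpha> x0 n = (\<lambda>x. \<Sum>j<n. g (x j))" by (simp add: lin_stat_def[abs_def] g_def \<theta>_def)
      have "(\<integral>x. (lin_stat f \<alpha> x0 n x - (\<integral>y. lin_stat f \<alpha> x0 n y \<partial>OPE \<mu> n))\<^sup>2 \<partial>OPE \<mu> n)
        \<le> 2 * (L * \<theta>)\<^sup>2 * (ra n)\<^sup>2 * FM (\<rho> n) n n * FM (\<rho> n) (n - 1) (n - 1)"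
        unfolding X by (rule variance_bound[OF gm gb \<rho>_measurable \<rho>_bounds gl]) (use elim in auto)
      also have "\<dots> = L\<^sup>2 * (2 * (ra n)\<^sup>2 * ((\<theta> * FM (\<rho> n) n n) * (\<theta> * FM (\<rho> n) (n - 1) (n - 1))))"
        by (simp add: power_mult_distrib power2_eq_square mult_ac)
      also have "\<dots> \<le> L\<^sup>2 * V n"
      proof -
        have "(\<theta> * FM (\<rho> n) n n) * (\<theta> * FM (\<rho> n) (n - 1) (n - 1)) \<le> \<bar>\<theta> * FM (\<rho> n) n n\<bar> * \<bar>\<theta> * FM (\<rho> n) (n - 1) (n - 1)\<bar>"
          by (rule order_trans[OF abs_ge_self]) (simp only: abs_mult order_refl)
        also have "\<dots> \<le> cmod (P n (zz n \<i>) * Q n (zz n \<i>)) * cmod (P (n - 1) (zz n \<i>) * Q (n - 1) (zz n \<i>))"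
          unfolding \<theta>_def using elim by (intro mult_mono FM_\<rho>_bound) auto
        finally show ?thesis unfolding V_def by (intro mult_left_mono) auto
      qed
      also have "\<dots> \<le> L\<^sup>2 * K\<^sup>2" using elim K(2) by (intro mult_left_mono) (auto simp: K_def)
      finally show "(\<integral>x. (lin_stat f \<alpha> x0 n x - (\<integral>y. lin_stat f \<alpha> x0 n y \<partial>OPE \<mu> n))\<^sup>2 \<partial>OPE \<mu> n) \<le> (K * L)\<^sup>2"
        by (simp add: power_mult_distrib mult.commute)
    qed
  qed
  then show ?thesis using that K by blast
qed

text \<open>The variance bound controls the exchange of \<open>f\<close> for a phase statistic by
  \<open>K * e\<close>, uniformly for large \<open>n\<close>; the limit of the latter is within
  \<open>e\<close> of the Gaussian value. This allows fixing the phase statistic before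
  \<open>n\<close> grows.\<close>

lemma test_function_limit:
  assumes "test_function f f' F T0"
  shows "(\<lambda>n. \<integral>x. exp (\<i> * of_real (lin_stat f \<alpha> x0 n x - (\<integral>y. lin_stat f \<alpha> x0 n y \<partial>OPE \<mu> n))) \<partial>OPE \<mu> n) \<longlonglongrightarrow> of_real (exp (- sigma_sq f / 2))"
proof (rule tendstoI)
  interpret f: test_function f f' F T0 by fact
  define E where "E = (\<lambda>g n. \<integral>x. exp (\<i> * complex_of_real (lin_stat g \<alpha> x0 n x - (\<integral>y. lin_stat g \<alpha> x0 n y \<partial>OPE \<mu> n))) \<partial>OPE \<mu> n)"
  obtain K where K: "K > 0" and var: "\<forall>\<^sub>F n in sequentially. \<forall>f L. f \<in> borel_measurable borel \<longrightarrow> wlip L f \<longrightarrow>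
    (\<integral>x. (lin_stat f \<alpha> x0 n x - (\<integral>y. lin_stat f \<alpha> x0 n y \<partial>OPE \<mu> n))\<^sup>2 \<partial>OPE \<mu> n) \<le> (K * L)\<^sup>2"
    by (rule variance_lin_stat_bound)
  fix \<eta> :: real assume \<eta>: "\<eta> > 0"
  \<comment> \<open>The errors are \<open>K * e\<close>, \<open>e\<close> and \<open>e\<close>; the
    third unit in \<open>K + 3\<close> makes their sum strictly less than \<eta>.\<close>
  define e where "e = \<eta> / (K + 3)"
  have "e * (K + 3) = \<eta>" "e > 0" using \<eta> K by (simp_all add: e_def)
  then have e: "e > 0" "K * e + e + e < \<eta>" by (auto simp: algebra_simps)
  obtain m z w where Im: "\<And>r. r < m \<Longrightarrow> Im (z r) > 0" "\<And>r. r < m \<Longrightarrow> Im (w r) > 0"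
    and inj: "inj_on z {..<m}" "inj_on w {..<m}" and zw: "\<And>r s. r < m \<Longrightarrow> s < m \<Longrightarrow> z r \<noteq> w s"
    and wl: "wlip e (\<lambda>x. f x - phase_stat m z w x)" and gp: "cmod (gauss_product m z w - of_real (exp (- sigma_sq f / 2))) \<le> e"
    using f.phase_stat_approximation[OF e(1)] by blast
  define \<phi> where "\<phi> = phase_stat m z w"
  have \<phi>m: "\<phi> \<in> borel_measurable borel" unfolding \<phi>_def by (rule phase_stat_measurable[OF Im])
  obtain B where B: "\<And>u. \<bar>\<phi> u\<bar> \<le> B" unfolding \<phi>_def using phase_stat_bounded[of m z w] Im by blast
  have "(\<lambda>n. E \<phi> n) \<longlonglongrightarrow> gauss_product m z w"
    unfolding E_def \<phi>_def by (rule phase_stat_limit[OF Im inj zw])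
  then have "\<forall>\<^sub>F n in sequentially. dist (E \<phi> n) (gauss_product m z w) < e" using e(1) by (rule tendstoD)
  then have "\<forall>\<^sub>F n in sequentially. dist (E f n) (of_real (exp (- sigma_sq f / 2))) < \<eta>"
    using var
  proof eventually_elim
    case (elim n)
    interpret prob_space "OPE \<mu> n" by (rule prob_space_OPE)
    define c where "c = (\<lambda>g. \<integral>y. lin_stat g \<alpha> x0 n y \<partial>OPE \<mu> n)"
    have c: "(\<integral>y. lin_stat g \<alpha> x0 n y \<partial>OPE \<mu> n) = c g" for g by (simp only: c_def)
    have m: "lin_stat g \<alpha> x0 n \<in> borel_measurable (OPE \<mu> n)" if "g \<in> borel_measurable borel" for g
      using lin_stat_measurable[OF that] by simp
    define D where "D = real n * F + real n * B + \<bar>c f\<bar> + \<bar>c \<phi>\<bar>"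
    have "\<bar>lin_stat f \<alpha> x0 n x\<bar> \<le> real n * F" "\<bar>lin_stat \<phi> \<alpha> x0 n x\<bar> \<le> real n * B" for x
      by (intro lin_stat_bounded f.fF B)+
    note lb = this
    have i: "integrable (OPE \<mu> n) (lin_stat f \<alpha> x0 n)" "integrable (OPE \<mu> n) (lin_stat \<phi> \<alpha> x0 n)"
      by (rule integrable_const_bound[where B = "real n * F"]; use m[OF f.f_meas] lb in simp)
         (rule integrable_const_bound[where B = "real n * B"]; use m[OF \<phi>m] lb in simp)
    have cd: "c (\<lambda>x. f x - \<phi> x) = c f - c \<phi>" unfolding c_def lin_stat_diff using i by (rule Bochner_Integration.integral_diff)
    have "(\<lambda>x. f x - \<phi> x) \<in> borel_measurable borel" using f.f_meas \<phi>m by measurable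
    then have "(\<integral>x. (lin_stat (\<lambda>x. f x - \<phi> x) \<alpha> x0 n x - c (\<lambda>x. f x - \<phi> x))\<^sup>2 \<partial>OPE \<mu> n) \<le> (K * e)\<^sup>2"
      using elim(2) wl unfolding c_def \<phi>_def by blast
    moreover have shift: "u - v - (c f - c \<phi>) = (u - c f) - (v - c \<phi>)" for u v by simp
    ultimately have v: "(\<integral>x. ((lin_stat f \<alpha> x0 n x - c f) - (lin_stat \<phi> \<alpha> x0 n x - c \<phi>))\<^sup>2 \<partial>OPE \<mu> n) \<le> (K * e)\<^sup>2"
      unfolding cd lin_stat_diff by (simp only: shift)
    have "cmod (E f n - E \<phi> n) \<le> K * e"
      unfolding E_def c
    proof (rule characteristic_difference_bound[OF _ _ _ _ v])
      have "real n * F \<ge> 0" "real n * B \<ge> 0" using order_trans[OF abs_ge_zero lb(1)] order_trans[OF abs_ge_zero lb(2)] by auto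
      then show "\<bar>lin_stat f \<alpha> x0 n x - c f\<bar> \<le> D" "\<bar>lin_stat \<phi> \<alpha> x0 n x - c \<phi>\<bar> \<le> D" for x
        using lb[of x] unfolding D_def by linarith+
    qed (use m[OF f.f_meas] m[OF \<phi>m] K e in simp_all)
    moreover have "cmod (E \<phi> n - gauss_product m z w) < e" using elim(1) by (simp add: dist_norm)
    ultimately have "cmod ((E f n - E \<phi> n) + (E \<phi> n - gauss_product m z w) + (gauss_product m z w - of_real (exp (- sigma_sq f / 2)))) < \<eta>"
      using gp e(2) norm_triangle_ineq[of "E f n - E \<phi> n" "E \<phi> n - gauss_product m z w"]
        norm_triangle_ineq[of "(E f n - E \<phi> n) + (E \<phi> n - gauss_product m z w)" "gauss_product m z w - of_real (exp (- sigma_sq f / 2))"]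
      by linarith
    then show ?case by (simp add: dist_norm)
  qed
  then show "\<forall>\<^sub>F n in sequentially. dist (\<integral>x. exp (\<i> * of_real (lin_stat f \<alpha> x0 n x - (\<integral>y. lin_stat f \<alpha> x0 n y \<partial>OPE \<mu> n))) \<partial>OPE \<mu> n) (of_real (exp (- sigma_sq f / 2))) < \<eta>"
    unfolding E_def .
qed

lemma lin_stat_weak_conv:
  assumes "test_function f f' F T0"
  shows "weak_conv_m (\<lambda>n. distr (OPE \<mu> n) borel
      (\<lambda>x. lin_stat f \<alpha> x0 n x - (\<integral>y. lin_stat f \<alpha> x0 n y \<partial>OPE \<mu> n))) (gaussian (sigma_sq f))"
proof (rule levy_continuity)
  interpret f: test_function f f' F T0 by fact
  have m: "(\<lambda>x. lin_stat f \<alpha> x0 n x - c) \<in> borel_measurable (OPE \<mu> n)" for n c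
    using lin_stat_measurable[OF f.f_meas, of n] by simp
  show "real_distribution (distr (OPE \<mu> n) borel (\<lambda>x. lin_stat f \<alpha> x0 n x - (\<integral>y. lin_stat f \<alpha> x0 n y \<partial>OPE \<mu> n)))" for n
  proof -
    interpret prob_space "OPE \<mu> n" by (rule prob_space_OPE)
    show ?thesis by (rule real_distribution_distr[OF m])
  qed
  show "real_distribution (gaussian (sigma_sq f))" by (rule char_gaussian(1)[OF sigma_sq_nonneg])
  fix t
  have "char (distr (OPE \<mu> n) borel (\<lambda>x. lin_stat f \<alpha> x0 n x - (\<integral>y. lin_stat f \<alpha> x0 n y \<partial>OPE \<mu> n))) t
    = (\<integral>x. exp (\<i> * of_real (lin_stat (\<lambda>x. t * f x) \<alpha> x0 n x - (\<integral>y. lin_stat (\<lambda>x. t * f x) \<alpha> x0 n y \<partial>OPE \<mu> n))) \<partial>OPE \<mu> n)" for n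
    unfolding char_def lin_stat_cmult using m by (subst integral_distr) (auto simp: right_diff_distrib)
  moreover have "char (gaussian (sigma_sq f)) t = of_real (exp (- sigma_sq (\<lambda>x. t * f x) / 2))"
    unfolding char_gaussian(2)[OF sigma_sq_nonneg] sigma_sq_cmult by (simp add: mult.commute)
  ultimately show "(\<lambda>n. char (distr (OPE \<mu> n) borel (\<lambda>x. lin_stat f \<alpha> x0 n x - (\<integral>y. lin_stat f \<alpha> x0 n y \<partial>OPE \<mu> n))) t) \<longlonglongrightarrow> char (gaussian (sigma_sq f)) t"
    using test_function_limit[OF f.test_function_cmult[of t]] by (simp only:)
qed

end

theorem theorem1p3:
  fixes \<mu> :: "real measure" and p :: "nat \<Rightarrow> real poly"
    and a b \<beta> :: real
  assumes "finite_moments \<mu>"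
    and "orthonormal_polys \<mu> p"
    and "a > 0" and "0 < \<beta>" and "\<beta> < 1"
    and "(\<lambda>n. rec_a \<mu> p n - a) \<in> O(\<lambda>n. real n powr (-\<beta>))"
    and "(\<lambda>n. rec_b \<mu> p n - b) \<in> O(\<lambda>n. real n powr (-\<beta>))"
  shows "\<forall>(f::real \<Rightarrow> real) x0 \<alpha>.
           f C1_differentiable_on UNIV \<and> compact (closure {x. f x \<noteq> 0}) \<and>
           x0 \<in> {b - 2 * a <..< b + 2 * a} \<and> 0 < \<alpha> \<and> \<alpha> < \<beta> \<longrightarrow>
           weak_conv_m
             (\<lambda>n. distr (OPE \<mu> n) borel
                (\<lambda>x. lin_stat f \<alpha> x0 n x - (\<integral>y. lin_stat f \<alpha> x0 n y \<partial>OPE \<mu> n)))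
             (gaussian (sigma_sq f))"
proof (intro allI impI, elim conjE)
  fix f :: "real \<Rightarrow> real" and x0 \<alpha>
  assume f: "f C1_differentiable_on UNIV" "compact (closure {x. f x \<noteq> 0})"
    and x0: "x0 \<in> {b - 2 * a <..< b + 2 * a}" and \<alpha>: "0 < \<alpha>" "\<alpha> < \<beta>"
  interpret mesoscopic \<mu> p a b \<beta> \<alpha> x0
    using assms x0 \<alpha> by unfold_locales auto
  obtain f' F T0 where "test_function f f' F T0" using f by (rule test_function_exists)
  then show "weak_conv_m (\<lambda>n. distr (OPE \<mu> n) borel
      (\<lambda>x. lin_stat f \<alpha> x0 n x - (\<integral>y. lin_stat f \<alpha> x0 n y \<partial>OPE \<mu> n))) (gaussian (sigma_sq f))"
    by (rule lin_stat_weak_conv)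
qed

end
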